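(* There exists a positive constant $R_0$ (not depending on $\beta$) such that, for every $\beta>0$, with $B = R_0l_0(\beta)$ in the definition of $\Xi_0$, the following hold: (i) There exist constants $C^*_1, C^*_2 >0$ that do not depend on $\beta$ such that for all $y \ge 4B$, \[ \mathbb{P}_{(0, 2B)}\left(\tau_2(y) \le \Xi_0 \right) \le C^*_1 \mathrm{e}^{-C^*_2 \beta (y-\beta)/2}. \] (ii) For all $y \ge 2B$, \[ \mathbb{P}_{(0,2B)}\left(\tau_2(y) \le \Xi_0\right) \ge (1-\mathrm{e}^{-\beta R_0l_0(\beta)})\mathrm{e}^{-\beta(y-2R_0l_0(\beta))}. \] (iii) There exists a constant $C^*(\beta)>0$ depending on $\beta$ such that for any $x \ge 18B$, \[ \mathbb{P}_{(0,2B)}\left(\tau_1(-x) \le \Xi_0\right) \le C^*(\beta) \mathrm{e}^{-(x-2\beta)^2/8}. \] (iv) There exists a constant $C^{**}(\beta) >0$ depending on $\beta$ such that for any $x \ge \beta$, \[ \mathbb{P}_{(0,2B)}\left(\inf_{t \le \Xi_0} Q_1(t) < -x\right) \ge C^{**}(\beta) \mathrm{e}^{-x^2}. \]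
   Context: Fix $\beta>0$. For an initial state $(x,y)$ with $x\le 0$, $y\ge 0$, let $(Q_1,Q_2)$ be the continuous process on $[0,\infty)$ solving \[ Q_1(t) = x + \sqrt{2}W(t) - \beta t + \int_0^t(-Q_1(s)+Q_2(s))\,ds - L(t),\qquad Q_2(t) = y + L(t) - \int_0^t Q_2(s)\,ds, \] where $W$ is a standard Brownian motion and $L$ is the unique nondecreasing nonnegative càdlàg process with $L(0)=0$ such that $Q_1(t)\le 0$ for all $t$ and $\int_0^\infty \mathbf{1}_{[Q_1(t)<0]}\,dL(t)=0$. $\mathbb{P}_{(x,y)}$ denotes probability when $(Q_1(0),Q_2(0))=(x,y)$; $\tau_i(z)=\inf\{t\ge0: Q_i(t)=z\}$ for $i=1,2$. For $B>0$, define $\alpha_0=0$, $\alpha_1=\inf\{t\ge 0: Q_2(t)=B\}$, $\alpha_2=\inf\{t>\alpha_1: Q_2(t)=2B\}$, and $\Xi_0=\alpha_2$. Let $l_0(\beta)=\max\{\beta,\beta^{-1},\beta^{-1}\log(1/\beta)\}$. *)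

theory Defs
  imports "HOL-Probability.Probability"
begin

definition std_BM :: "'a measure \<Rightarrow> (real \<Rightarrow> 'a \<Rightarrow> real) \<Rightarrow> bool" where
  "std_BM M W \<longleftrightarrow> prob_space M
     \<and> (\<forall>t. W t \<in> borel_measurable M)
     \<and> (\<forall>\<omega>\<in>space M. W 0 \<omega> = 0 \<and> continuous_on {0..} (\<lambda>t. W t \<omega>))
     \<and> (\<forall>s t. 0 \<le> s \<and> s < t \<longrightarrow>
          distributed M lborel (\<lambda>\<omega>. W t \<omega> - W s \<omega>)
             (\<lambda>z. ennreal (normal_density 0 (sqrt (t - s)) z)))
     \<and> (\<forall>(ts :: nat \<Rightarrow> real) n. 0 \<le> ts 0 \<and> (\<forall>i<n. ts i < ts (Suc i)) \<longrightarrow>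
          prob_space.indep_vars M (\<lambda>_. borel)
             (\<lambda>i \<omega>. W (ts (Suc i)) \<omega> - W (ts i) \<omega>) {..<n})"

text \<open>The reflected system: for every sample point, (Q1,Q2,L) solve the
  equations on [0,oo) with initial state (x,y); L is nondecreasing, nonnegative,
  L(0)=0, Q1 \<le> 0, and L increases only when Q1 = 0, i.e. the Lebesgue--Stieltjes
  integral of the indicator of [Q1 < 0] with respect to dL over [0,oo) vanishes.\<close>
definition reflected_system ::
  "'a measure \<Rightarrow> (real \<Rightarrow> 'a \<Rightarrow> real) \<Rightarrow> real \<Rightarrow> real \<Rightarrow> real \<Rightarrow>
   (real \<Rightarrow> 'a \<Rightarrow> real) \<Rightarrow> (real \<Rightarrow> 'a \<Rightarrow> real) \<Rightarrow> (real \<Rightarrow> 'a \<Rightarrow> real) \<Rightarrow> bool" where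
  "reflected_system M W \<beta> x y Q1 Q2 L \<longleftrightarrow>
     (\<forall>\<omega>\<in>space M.
        continuous_on {0..} (\<lambda>t. Q1 t \<omega>) \<and> continuous_on {0..} (\<lambda>t. Q2 t \<omega>)
      \<and> L 0 \<omega> = 0 \<and> mono_on {0..} (\<lambda>t. L t \<omega>) \<and> (\<forall>t\<ge>0. L t \<omega> \<ge> 0)
      \<and> (\<forall>t\<ge>0. Q1 t \<omega> \<le> 0)
      \<and> (\<forall>t\<ge>0. Q1 t \<omega> = x + sqrt 2 * W t \<omega> - \<beta> * t
               + integral {0..t} (\<lambda>s. - Q1 s \<omega> + Q2 s \<omega>) - L t \<omega>)
      \<and> (\<forall>t\<ge>0. Q2 t \<omega> = y + L t \<omega> - integral {0..t} (\<lambda>s. Q2 s \<omega>))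
      \<and> (\<integral>\<^sup>+ t. indicator {t. 0 \<le> t \<and> Q1 t \<omega> < 0} t
            \<partial>interval_measure (\<lambda>t. L (max t 0) \<omega>)) = 0)"

text \<open>Hitting time tau(z) = inf{t \<ge> 0 : f t = z}, with inf of the empty set = oo.\<close>
definition hit :: "(real \<Rightarrow> real) \<Rightarrow> real \<Rightarrow> ereal" where
  "hit f z = Inf {ereal t | t. 0 \<le> t \<and> f t = z}"

definition Xi0 :: "(real \<Rightarrow> real) \<Rightarrow> real \<Rightarrow> ereal" where
  "Xi0 q2 B = Inf {ereal t | t. hit q2 B < ereal t \<and> q2 t = 2 * B}"

definition l0 :: "real \<Rightarrow> real" where
  "l0 \<beta> = max \<beta> (max (1 / \<beta>) (ln (1 / \<beta>) / \<beta>))"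

end

theory Submission
  imports Defs "HOL-Real_Asymp.Real_Asymp"
begin

text \<open>Write \<open>w = \<surd>2 W\<close>, \<open>D = - Q\<^sub>1 \<ge> 0\<close>, \<open>Q = Q\<^sub>2\<close>. Then \<open>Q - D = 2 B + w(t) - \<beta> t + \<integral>D\<close>, and \<open>L\<close> is constant on
  the excursions of \<open>D\<close> from \<open>0\<close>, which makes all four bounds pathwise comparisons with functionals of \<open>w\<close>.

  Lower bounds: \<open>Q \<ge> 2 B + w(t) - \<beta> t\<close>, and the exit probabilities of a Brownian motion with drift give (ii). If
  \<open>w\<close> follows a line of slope \<open>-a\<close> up to time \<open>1/2\<close>, then \<open>Q\<close> stays bounded and \<open>D\<close> grows linearly in \<open>a\<close>; the
  Cameron-Martin formula bounds the probability of such a tube from below, which is (iv).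

  Upper bounds: time is cut into blocks of length \<open>1/16\<close>. While \<open>Q \<ge> B\<close>, an excursion of \<open>D\<close> is dominated by a
  drawdown of \<open>w\<close> with drift \<open>B - \<beta>\<close>, of order \<open>1/B\<close>, so over a block \<open>Q\<close> grows by at most an increment of \<open>w\<close>
  minus \<open>\<beta>/16\<close> plus small errors; these bounds are independent and identically distributed, and Chernoff's bound
  gives (i) and an exponential tail of the hitting time of \<open>B\<close>. The return to \<open>2 B\<close> is a sequence of trials whose
  success depends on the size of \<open>D\<close>, which is controlled by mean reversion and a Lyapunov function. Hence the
  cycle length has an exponential tail, and the Gaussian tail of \<open>D\<close> in a single block yields (iii).\<close>

section \<open>Pathwise analysis of the reflected system\<close>

text \<open>No strong Markov property enters: the probabilistic estimates use only deterministic
  block ends and functionals of single blocks of \<open>w\<close>, which are independent. Constants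
  in (i) must be uniform in \<beta>, while the trials for the return to \<open>2 B\<close> succeed
  at a rate that depends on \<beta>. The two are separated by the fact that within a cycle a level
  above \<open>2 B\<close> is first reached before the queue has fallen below \<open>B\<close>; the
  return phase then enters (i) only through the probability that the cycle outlasts a horizon, and
  the horizon is sent to infinity. Summing over blocks costs a factor of order
  \<open>1 / min 1 (\<beta>\<^sup>2)\<close>, which a surplus in the exponent has to absorb. A
  second obstacle is measurability. The solution is given sample point by sample point, and
  \<open>measure\<close> is 0 on nonmeasurable sets, so that lower bounds are meaningless until the
  events are shown measurable; Picard iterates of the Brownian path provide this.\<close>

lemma continuous_on_atLeast_integrable:
  fixes f :: "real \<Rightarrow> real"
  assumes "continuous_on {0..} f" "0 \<le> a"
  shows "f integrable_on {a..b}"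
  using assms by (intro integrable_continuous_real continuous_on_subset[OF assms(1)]) auto

lemma integral_diff_eq:
  fixes f :: "real \<Rightarrow> real"
  assumes "continuous_on {0..} f" "0 \<le> a" "a \<le> b"
  shows "integral {0..b} f - integral {0..a} f = integral {a..b} f"
  using Henstock_Kurzweil_Integration.integral_combine[OF assms(2,3) continuous_on_atLeast_integrable[OF assms(1) order_refl]]
  by simp

lemma integral_has_derivative_at:
  fixes f :: "real \<Rightarrow> real"
  assumes "continuous_on {0..} f" "0 < t"
  shows "((\<lambda>t. integral {0..t} f) has_real_derivative f t) (at t)"
proof -
  have "((\<lambda>t. integral {0..t} f) has_vector_derivative f t) (at t within {0..t+1})"
    using assms by (intro integral_has_vector_derivative continuous_on_subset[OF assms(1)]) auto
  moreover have "at t within {0..t+1} = at t"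
    using assms(2) by (intro at_within_interior) auto
  ultimately show ?thesis
    by (simp add: has_real_derivative_iff_has_vector_derivative)
qed

lemma continuous_on_integral_atLeast:
  fixes f :: "real \<Rightarrow> real"
  assumes "continuous_on {0..} f"
  shows "continuous_on {0..} (\<lambda>t. integral {0..t} f)"
proof -
  have "continuous (at t within {0..}) (\<lambda>t. integral {0..t} f)" if "0 \<le> t" for t
  proof -
    have "continuous_on {0..t+1} (\<lambda>t. integral {0..t} f)"
      using assms by (intro indefinite_integral_continuous_1 continuous_on_atLeast_integrable) auto
    then have "continuous (at t within {0..t+1}) (\<lambda>t. integral {0..t} f)"
      using that by (auto simp: continuous_on_eq_continuous_within)
    moreover have "at t within {0..t+1} = at t within {0..}"
      by (rule at_within_nhd[of _ "{..<t+1}"]) auto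
    ultimately show ?thesis by simp
  qed
  then show ?thesis by (auto simp: continuous_on_eq_continuous_within)
qed

text \<open>Integrating factor: \<open>exp s * (\<phi> s - c)\<close> is nonincreasing. The
  derivative is asked for only inside the interval, because the functions it serves are
  differentiated only between zeros of \<open>D\<close> or to the right of 0.\<close>

lemma exp_relaxation:
  fixes \<phi> :: "real \<Rightarrow> real"
  assumes ab: "a \<le> b" and cont: "continuous_on {a..b} \<phi>"
    and der: "\<And>s. a < s \<Longrightarrow> s < b \<Longrightarrow> \<exists>d. (\<phi> has_real_derivative d) (at s) \<and> d \<le> c - \<phi> s"
  shows "\<phi> b \<le> exp (-(b - a)) * \<phi> a + c * (1 - exp (-(b - a)))"
proof -
  have "exp b * (\<phi> b - c) \<le> exp a * (\<phi> a - c)"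
  proof (rule DERIV_nonpos_imp_decreasing_open[OF ab])
    fix s assume s: "a < s" "s < b"
    then obtain d where d: "(\<phi> has_real_derivative d) (at s)" "d \<le> c - \<phi> s"
      using der by blast
    have "((\<lambda>s. exp s * (\<phi> s - c)) has_real_derivative (exp s * (\<phi> s - c) + exp s * d)) (at s)"
      by (auto intro!: derivative_eq_intros d(1))
    moreover have "exp s * (\<phi> s - c) + exp s * d \<le> 0"
      using d(2) by (simp add: distrib_left[symmetric] mult_le_0_iff)
    ultimately show "\<exists>y. ((\<lambda>s. exp s * (\<phi> s - c)) has_real_derivative y) (at s) \<and> y \<le> 0"
      by blast
  qed (intro continuous_intros cont)
  then have "exp (-b) * (exp b * (\<phi> b - c)) \<le> exp (-b) * (exp a * (\<phi> a - c))"
    by (intro mult_left_mono) auto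
  then have "\<phi> b - c \<le> exp (a - b) * (\<phi> a - c)"
    by (simp add: mult.assoc[symmetric] exp_add[symmetric])
  then show ?thesis by (simp add: algebra_simps)
qed

text \<open>A single sample path, without probability; \<open>D\<close> starts at 0.
  \<open>L_flat\<close> is stated for half-open intervals because the Stieltjes measure of
  \<open>L\<close> gives mass \<open>L b - L a\<close> to \<open>{a<..b}\<close>.\<close>

locale reflected_path =
  fixes w D Q L :: "real \<Rightarrow> real" and \<beta> y0 :: real
  assumes w_cont: "continuous_on {0..} w" and w_0: "w 0 = 0"
    and D_cont: "continuous_on {0..} D" and Q_cont: "continuous_on {0..} Q"
    and D_nonneg: "0 \<le> t \<Longrightarrow> 0 \<le> D t"
    and L_0: "L 0 = 0" and L_mono: "mono_on {0..} L"
    and D_eq: "0 \<le> t \<Longrightarrow> D t = - w t + \<beta> * t - integral {0..t} (\<lambda>s. D s + Q s) + L t"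
    and Q_eq: "0 \<le> t \<Longrightarrow> Q t = y0 + L t - integral {0..t} Q"
    and L_flat: "0 \<le> a \<Longrightarrow> a \<le> b \<Longrightarrow> (\<And>t. a < t \<Longrightarrow> t \<le> b \<Longrightarrow> 0 < D t) \<Longrightarrow> L b = L a"
    and y0_nonneg: "0 \<le> y0" and beta_pos: "0 < \<beta>"
begin

lemma D_0: "D 0 = 0"
  using D_eq[of 0] by (simp add: w_0 L_0)

lemma Q_0: "Q 0 = y0"
  using Q_eq[of 0] by (simp add: L_0)

lemma DQ_cont: "continuous_on {0..} (\<lambda>s. D s + Q s)"
  by (intro continuous_intros D_cont Q_cont)

lemma L_cont: "continuous_on {0..} L"
proof -
  have "continuous_on {0..} (\<lambda>t. Q t - y0 + integral {0..t} Q)"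
    by (intro continuous_intros Q_cont continuous_on_integral_atLeast)
  then show ?thesis by (rule continuous_on_eq) (use Q_eq in auto)
qed

text \<open>Left continuity of \<open>L\<close> at \<open>b\<close> removes the requirement
  \<open>0 < D b\<close>. Excursions that end at a zero of \<open>D\<close> need this form.\<close>

lemma L_flat': 
  assumes "0 \<le> a" "a \<le> b" "\<And>t. a < t \<Longrightarrow> t < b \<Longrightarrow> 0 < D t"
  shows "L b = L a"
proof (cases "a = b")
  case False
  then have ab: "a < b" using assms by simp
  have "continuous_on {a..b} L"
    using assms by (intro continuous_on_subset[OF L_cont]) auto
  then have lim: "(L \<longlongrightarrow> L b) (at_left b)"
    using ab by (rule continuous_on_Icc_at_leftD)
  have "eventually (\<lambda>t. L t = L a) (at_left b)"
    using eventually_at_left_real[OF ab]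
  proof eventually_elim
    case (elim t)
    then show ?case using assms(1,3) by (intro L_flat) auto
  qed
  with lim have "((\<lambda>t. L a) \<longlongrightarrow> L b) (at_left b)"
    by (rule Lim_transform_eventually)
  then show ?thesis
    by (intro tendsto_unique[OF _ _ tendsto_const]) auto
qed simp

lemma Q_diff:
  assumes "0 \<le> a" "a \<le> b"
  shows "Q b - Q a = L b - L a - integral {a..b} Q"
  using Q_eq[of a] Q_eq[of b] integral_diff_eq[OF Q_cont assms] assms by simp

lemma D_diff:
  assumes "0 \<le> a" "a \<le> b"
  shows "D b - D a = - (w b - w a) + \<beta> * (b - a) - integral {a..b} (\<lambda>s. D s + Q s) + (L b - L a)"
  using D_eq[of a] D_eq[of b] integral_diff_eq[OF DQ_cont assms] assms by (simp add: algebra_simps)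

lemma S_diff:
  assumes "0 \<le> a" "a \<le> b"
  shows "(Q b - D b) - (Q a - D a) = w b - w a - \<beta> * (b - a) + integral {a..b} D"
proof -
  have "integral {a..b} (\<lambda>s. D s + Q s) = integral {a..b} D + integral {a..b} Q"
    using assms by (intro integral_add continuous_on_atLeast_integrable D_cont Q_cont)
  then show ?thesis using Q_diff[OF assms] D_diff[OF assms] by simp
qed

lemma integral_D_nonneg: "0 \<le> a \<Longrightarrow> 0 \<le> integral {a..b} D"
  by (intro integral_nonneg continuous_on_atLeast_integrable D_cont) (auto intro: D_nonneg)

lemma Q_ge_drift: 
  assumes "0 \<le> t" shows "y0 + w t - \<beta> * t \<le> Q t"
  using S_diff[of 0 t] integral_D_nonneg[of 0 t] D_nonneg[OF assms] assms
  by (simp add: D_0 Q_0 w_0)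

lemma L_nonneg: "0 \<le> t \<Longrightarrow> 0 \<le> L t"
  using L_mono L_0 by (metis atLeast_iff mono_onD order_refl)

text \<open>Reflection only adds to the queue, so it decays no faster than \<open>exp (-t)\<close>.
  Besides nonnegativity this shows that the queue cannot halve before time \<open>ln 2\<close>,
  which keeps the cycle alive in the lower bound for \<open>D\<close>.\<close>

lemma Q_ge_exp:
  assumes t: "0 \<le> t" shows "y0 * exp (-t) \<le> Q t"
proof -
  let ?I = "\<lambda>t. integral {0..t} Q"
  \<comment> \<open>\<open>L\<close> is frozen at its final value \<open>L t\<close>, an upper bound
    on the whole interval; the derivative \<open>Q\<close> of the integral is then at most
    \<open>y0 + L t\<close> minus the integral.\<close>
  have "?I t \<le> exp (-(t - 0)) * ?I 0 + (y0 + L t) * (1 - exp (-(t - 0)))"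
  proof (rule exp_relaxation)
    show "continuous_on {0..t} ?I"
      by (intro continuous_on_subset[OF continuous_on_integral_atLeast[OF Q_cont]]) auto
    fix s assume s: "0 < s" "s < t"
    then have "L s \<le> L t" using L_mono by (auto intro: mono_onD)
    then show "\<exists>d. (?I has_real_derivative d) (at s) \<and> d \<le> y0 + L t - ?I s"
      using integral_has_derivative_at[OF Q_cont s(1)] Q_eq[of s] s by (intro exI[of _ "Q s"]) auto
  qed fact
  then have "?I t \<le> (y0 + L t) * (1 - exp (-t))" by simp
  then have "(y0 + L t) * exp (-t) \<le> Q t"
    using Q_eq[OF t] by (simp add: algebra_simps)
  moreover have "y0 * exp (-t) \<le> (y0 + L t) * exp (-t)"
    using L_nonneg[OF t] by (intro mult_right_mono) auto
  ultimately show ?thesis by linarith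
qed

lemma Q_nonneg: "0 \<le> t \<Longrightarrow> 0 \<le> Q t"
  using Q_ge_exp[of t] y0_nonneg by (smt (verit) exp_gt_zero mult_nonneg_nonneg)

text \<open>The zero set of \<open>D\<close> is closed. If \<open>t\<close> is itself a zero, then
  \<open>g = t\<close> and the positivity clause is vacuous.\<close>

lemma last_zero:
  assumes "0 \<le> a" "z \<in> {a..t}" "D z = 0"
  obtains g where "a \<le> g" "g \<le> t" "D g = 0" "\<And>s. g < s \<Longrightarrow> s \<le> t \<Longrightarrow> 0 < D s"
proof -
  let ?Z = "{s \<in> {a..t}. D s = 0}"
  have "closed ?Z"
    using assms by (intro continuous_closed_preimage_constant continuous_on_subset[OF D_cont]) auto
  then have "compact ?Z"
    by (auto simp: compact_eq_bounded_closed intro: bounded_subset[of "{a..t}"])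
  moreover have "?Z \<noteq> {}" using assms by auto
  ultimately obtain g where g: "g \<in> ?Z" "\<And>s. s \<in> ?Z \<Longrightarrow> s \<le> g"
    using compact_attains_sup[of ?Z] by blast
  show ?thesis
  proof (rule that[of g])
    fix s assume s: "g < s" "s \<le> t"
    then have "D s \<noteq> 0" using g(1) g(2)[of s] by auto
    moreover have "0 \<le> D s" using s g(1) assms by (intro D_nonneg) auto
    ultimately show "0 < D s" by simp
  qed (use g in auto)
qed

lemma first_zero:
  assumes "0 \<le> a" "z \<in> {a..t}" "D z = 0"
  obtains g where "a \<le> g" "g \<le> t" "D g = 0" "\<And>s. a \<le> s \<Longrightarrow> s < g \<Longrightarrow> 0 < D s"
proof -
  let ?Z = "{s \<in> {a..t}. D s = 0}"
  have "closed ?Z"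
    using assms by (intro continuous_closed_preimage_constant continuous_on_subset[OF D_cont]) auto
  then have "compact ?Z"
    by (auto simp: compact_eq_bounded_closed intro: bounded_subset[of "{a..t}"])
  moreover have "?Z \<noteq> {}" using assms by auto
  ultimately obtain g where g: "g \<in> ?Z" "\<And>s. s \<in> ?Z \<Longrightarrow> g \<le> s"
    using compact_attains_inf[of ?Z] by blast
  show ?thesis
  proof (rule that[of g])
    fix s assume s: "a \<le> s" "s < g"
    then have "D s \<noteq> 0" using g(1) g(2)[of s] by auto
    moreover have "0 \<le> D s" using s g(1) assms by (intro D_nonneg) auto
    ultimately show "0 < D s" by simp
  qed (use g in auto)
qed

text \<open>\<open>L\<close> is constant during the excursion, so nothing refills the queue and its
  outflow is at least \<open>B\<close> per unit of time.\<close>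

lemma Q_decay:
  assumes "0 \<le> a" "a \<le> b" "\<And>t. a < t \<Longrightarrow> t < b \<Longrightarrow> 0 < D t"
    and B: "\<And>s. a \<le> s \<Longrightarrow> s \<le> b \<Longrightarrow> B \<le> Q s"
  shows "Q b \<le> Q a - B * (b - a)"
proof -
  have "integral {a..b} (\<lambda>_. B) \<le> integral {a..b} Q"
    using assms by (intro integral_le continuous_on_atLeast_integrable Q_cont) auto
  then show ?thesis
    using Q_diff[of a b] L_flat'[of a b] assms by (simp add: mult.commute)
qed

text \<open>After the last zero \<open>g\<close> reflection is inactive and \<open>D\<close> starts
  from 0; apart from \<open>- w\<close> its drift is at most \<open>\<beta> - B\<close>. The witness
  is \<open>u = g\<close>.\<close>

lemma D_le_drawdown:
  assumes "0 \<le> a" "z \<in> {a..t}" "D z = 0"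
    and B: "\<And>s. a \<le> s \<Longrightarrow> s \<le> t \<Longrightarrow> B \<le> Q s"
  shows "\<exists>u\<in>{a..t}. D t \<le> w u - w t - (B - \<beta>) * (t - u)"
proof -
  obtain g where g: "a \<le> g" "g \<le> t" "D g = 0" "\<And>s. g < s \<Longrightarrow> s \<le> t \<Longrightarrow> 0 < D s"
    using last_zero[OF assms(1-3)] by blast
  have "integral {g..t} (\<lambda>_. B) \<le> integral {g..t} (\<lambda>s. D s + Q s)"
    using assms g
    by (intro integral_le continuous_on_atLeast_integrable DQ_cont) (auto intro!: add_increasing D_nonneg)
  then have "D t \<le> w g - w t - (B - \<beta>) * (t - g)"
    using D_diff[of g t] L_flat[of g t] g assms by (simp add: algebra_simps)
  then show ?thesis using g by auto
qed

text \<open>Over an excursion of \<open>D\<close> the reflection term is constant, hence \<open>D s + w s - w t\<close> is differentiable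
  in \<open>s\<close> and mean reverting.\<close>

lemma D_mean_reversion:
  assumes "0 \<le> a" "a \<le> t" and m: "\<And>u. a \<le> u \<Longrightarrow> u \<le> t \<Longrightarrow> w u - w t \<le> m"
  shows "D t \<le> exp (-(t - a)) * D a + \<beta> + m"
proof -
  \<comment> \<open>A bound over one stretch without zeros. Below, \<open>g\<close> is the last zero
    of \<open>D\<close>, or \<open>a\<close> itself when there is none, so \<open>D g\<close> need
    not vanish.\<close>
  have ex: "D t \<le> exp (-(t - g)) * D g + \<beta> + m"
    if g: "a \<le> g" "g \<le> t" "\<And>s. g < s \<Longrightarrow> s \<le> t \<Longrightarrow> 0 < D s" for g
  proof -
    let ?\<phi> = "\<lambda>s. D s + w s - w t"
    have 0: "0 \<le> g" using g assms by simp
    have eq: "?\<phi> s = D g + w g - w t + \<beta> * (s - g) - (integral {0..s} (\<lambda>s. D s + Q s) - integral {0..g} (\<lambda>s. D s + Q s))"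
      if "g \<le> s" "s \<le> t" for s
      using D_diff[of g s] L_flat[of g s] that g 0 integral_diff_eq[OF DQ_cont 0 that(1)] by (simp add: algebra_simps)
    have "?\<phi> t \<le> exp (-(t - g)) * ?\<phi> g + (\<beta> + m) * (1 - exp (-(t - g)))"
    proof (rule exp_relaxation)
      show "continuous_on {g..t} ?\<phi>"
        using 0 by (intro continuous_intros continuous_on_subset[OF D_cont] continuous_on_subset[OF w_cont]) auto
      fix s assume s: "g < s" "s < t"
      \<comment> \<open>\<open>D\<close> and \<open>w\<close> need not be differentiable separately.
        On the excursion their sum equals \<open>?\<psi>\<close>, in which \<open>w\<close> occurs
        only at the fixed times \<open>g\<close> and \<open>t\<close>.\<close>
      let ?\<psi> = "\<lambda>s. D g + w g - w t + \<beta> * (s - g) - (integral {0..s} (\<lambda>s. D s + Q s) - integral {0..g} (\<lambda>s. D s + Q s))"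
      have "(?\<psi> has_real_derivative \<beta> - (D s + Q s)) (at s)"
        using s 0 by (auto intro!: derivative_eq_intros integral_has_derivative_at DQ_cont)
      then have "(?\<phi> has_real_derivative \<beta> - (D s + Q s)) (at s)"
      proof (rule has_field_derivative_transform_within_open[where S = "{g<..<t}"])
        show "open {g<..<t}" "s \<in> {g<..<t}" using s by auto
        fix x assume "x \<in> {g<..<t}"
        then show "?\<psi> x = ?\<phi> x" by (intro eq[symmetric]) auto
      qed
      moreover have "\<beta> - (D s + Q s) \<le> \<beta> + m - ?\<phi> s"
        using m[of s] Q_nonneg[of s] s g 0 by simp
      ultimately show "\<exists>d. (?\<phi> has_real_derivative d) (at s) \<and> d \<le> \<beta> + m - ?\<phi> s" by blast
    qed fact
    also have "\<dots> \<le> exp (-(t - g)) * (D g + m) + (\<beta> + m) * (1 - exp (-(t - g)))"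
      using m[of g] g by (intro add_right_mono mult_left_mono) auto
    also have "\<dots> = exp (-(t - g)) * D g + \<beta> * (1 - exp (-(t - g))) + m"
      by (simp add: algebra_simps)
    also have "\<dots> \<le> exp (-(t - g)) * D g + \<beta> + m"
      using beta_pos by (simp add: mult_le_cancel_left1)
    finally show ?thesis by simp
  qed
  show ?thesis
  proof (cases "\<exists>z\<in>{a..t}. D z = 0")
    case True
    then obtain z where z: "z \<in> {a..t}" "D z = 0" by blast
    obtain g where "a \<le> g" "g \<le> t" "D g = 0" "\<And>s. g < s \<Longrightarrow> s \<le> t \<Longrightarrow> 0 < D s"
      using last_zero[OF assms(1) z] by blast
    then show ?thesis
      using ex[of g] mult_nonneg_nonneg[OF exp_ge_zero D_nonneg[OF assms(1)], of "-(t - a)"] by simp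
  next
    case False
    then have "0 < D s" if "a \<le> s" "s \<le> t" for s
      using that D_nonneg[of s] assms by force
    then show ?thesis using ex[of a] assms by auto
  qed
qed

text \<open>Here \<open>\<sigma>\<close> and \<open>g\<close> are the first and the last zero of \<open>D\<close> in the interval; before \<open>\<sigma>\<close> and after \<open>g\<close> the
  queue decays at rate at least \<open>B\<close>, and in between \<open>D\<close> is dominated by drawdowns of \<open>w\<close>.\<close>

lemma Q_growth:
  assumes a: "0 \<le> a" "a \<le> e" and z: "z \<in> {a..e}" "D z = 0"
    and B: "\<And>s. a \<le> s \<Longrightarrow> s \<le> e \<Longrightarrow> B \<le> Q s"
    and R: "\<And>t u. a \<le> u \<Longrightarrow> u \<le> t \<Longrightarrow> t \<le> e \<Longrightarrow> w u - w t - (B - \<beta>) * (t - u) \<le> R t"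
    and R_cont: "continuous_on {a..e} R"
  shows "\<exists>\<sigma> g. a \<le> \<sigma> \<and> \<sigma> \<le> g \<and> g \<le> e \<and>
    Q e - Q a \<le> w g - w \<sigma> - \<beta> * (g - \<sigma>) - B * (e - g) - B * (\<sigma> - a) + integral {a..e} R"
proof -
  obtain g where g: "a \<le> g" "g \<le> e" "D g = 0" "\<And>s. g < s \<Longrightarrow> s \<le> e \<Longrightarrow> 0 < D s"
    using last_zero[OF a(1) z] by blast
  have "g \<in> {a..g}" using g by simp
  then obtain \<sigma> where s: "a \<le> \<sigma>" "\<sigma> \<le> g" "D \<sigma> = 0" "\<And>s. a \<le> s \<Longrightarrow> s < \<sigma> \<Longrightarrow> 0 < D s"
    using first_zero[OF a(1) _ g(3)] by blast
  have 1: "Q e \<le> Q g - B * (e - g)"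
    using g a by (intro Q_decay B) auto
  have 2: "Q \<sigma> \<le> Q a - B * (\<sigma> - a)"
    using s g a by (intro Q_decay B) auto
  have 3: "Q g - Q \<sigma> = w g - w \<sigma> - \<beta> * (g - \<sigma>) + integral {\<sigma>..g} D"
    using S_diff[of \<sigma> g] g s a by simp
  have R_nonneg: "0 \<le> R t" if "a \<le> t" "t \<le> e" for t
    using R[of t t] that by simp
  have Rint: "R integrable_on {c..d}" if "a \<le> c" "d \<le> e" for c d
    using that by (intro integrable_continuous_real continuous_on_subset[OF R_cont]) auto
  have "integral {\<sigma>..g} D \<le> integral {\<sigma>..g} R"
  proof (rule integral_le)
    show "D integrable_on {\<sigma>..g}" using s a by (intro continuous_on_atLeast_integrable D_cont) auto
    show "R integrable_on {\<sigma>..g}" using s g by (intro Rint)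
    fix t assume t: "t \<in> {\<sigma>..g}"
    have "\<exists>u\<in>{\<sigma>..t}. D t \<le> w u - w t - (B - \<beta>) * (t - u)"
      using t s g a by (intro D_le_drawdown[of \<sigma> \<sigma>] B) auto
    then obtain u where "u \<in> {\<sigma>..t}" "D t \<le> w u - w t - (B - \<beta>) * (t - u)" by blast
    then show "D t \<le> R t" using R[of u t] t s g by auto
  qed
  also have "\<dots> \<le> integral {a..e} R"
    using s g by (intro integral_subset_le Rint) (auto intro: R_nonneg)
  finally show ?thesis using 1 2 3 s g by (intro exI[of _ \<sigma>] exI[of _ g]) auto
qed

lemma Q_le_no_zero:
  assumes a: "0 \<le> a" "a \<le> e" and z: "\<And>z. z \<in> {a..e} \<Longrightarrow> D z \<noteq> 0"
    and B: "\<And>s. a \<le> s \<Longrightarrow> s \<le> e \<Longrightarrow> B \<le> Q s"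
  shows "Q e \<le> Q a - B * (e - a)"
proof (rule Q_decay)
  fix t assume "a < t" "t < e"
  then show "0 < D t" using z[of t] D_nonneg[of t] a by auto
qed (use a B in auto)

text \<open>The maximum of \<open>Q\<close> is attained at a zero of \<open>D\<close>, where \<open>Q\<close> equals \<open>Q - D\<close>; this bounds \<open>Q\<close> first, and then
  \<open>Q - D\<close> relaxes towards \<open>-a\<close>.\<close>

lemma D_ge_of_tube:
  assumes tube: "\<And>s. 0 \<le> s \<Longrightarrow> s \<le> 1/2 \<Longrightarrow> \<bar>w s + a * s\<bar> \<le> m" and a: "0 \<le> a"
  shows "38/100 * a - 3 * y0 - 7 * m \<le> D (1/2)"
proof -
  have m: "0 \<le> m" using tube[of 0] w_0 by simp
  \<comment> \<open>Numerical bounds \<open>1/2 \<le> exp (-1/2) \<le> 62/100\<close>; the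
    complement 38/100 becomes the coefficient of \<open>a\<close> in the conclusion.\<close>
  have e0: "1 + 1/2 + (1/2)^2/2 \<le> exp (1/2::real)"
    by (rule exp_lower_Taylor_quadratic) simp
  have e1: "exp (-(1/2)::real) \<le> 62/100"
  proof -
    have "exp (-(1/2)::real) = inverse (exp (1/2))" by (simp add: exp_minus)
    also have "\<dots> \<le> inverse (1 + 1/2 + (1/2)^2/2)"
      using e0 by (intro le_imp_inverse_le) (auto simp: power2_eq_square)
    also have "\<dots> \<le> 62/100" by (simp add: power2_eq_square)
    finally show ?thesis .
  qed
  have e2: "1/2 \<le> exp (-(1/2)::real)"
    using exp_ge_add_one_self[of "-(1/2)::real"] by simp
  \<comment> \<open>Subtracting \<open>w s + a * s\<close> leaves a differentiable function: by
    \<open>S_diff\<close> it is \<open>y0 - (a + \<beta>) * s\<close> plus the integral of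
    \<open>D\<close>.\<close>
  let ?S = "\<lambda>s. Q s - D s - (w s + a * s)"
  have eq: "?S s = y0 - (a + \<beta>) * s + integral {0..s} D" if "0 \<le> s" for s
    using S_diff[of 0 s] that by (simp add: D_0 Q_0 w_0 algebra_simps)
  \<comment> \<open>Since \<open>D s = Q s - ?S s - (w s + a * s)\<close>, the bounds
    \<open>q\<close> on \<open>Q\<close> and \<open>m\<close> on the tube turn the derivative
    \<open>- (a + \<beta>) + D s\<close> into at most \<open>q + m - a - ?S s\<close>.\<close>
  have bound: "?S t \<le> exp (-t) * y0 + (q + m - a) * (1 - exp (-t))"
    if t: "0 \<le> t" "t \<le> 1/2" and q: "\<And>s. 0 \<le> s \<Longrightarrow> s \<le> 1/2 \<Longrightarrow> Q s \<le> q" for t q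
  proof -
    have "?S t \<le> exp (-(t - 0)) * ?S 0 + (q + m - a) * (1 - exp (-(t - 0)))"
    proof (rule exp_relaxation)
      show "continuous_on {0..t} ?S"
        by (intro continuous_intros continuous_on_subset[OF D_cont] continuous_on_subset[OF Q_cont]
            continuous_on_subset[OF w_cont]) auto
      fix s assume s: "0 < s" "s < t"
      let ?\<psi> = "\<lambda>s. y0 - (a + \<beta>) * s + integral {0..s} D"
      have "(?\<psi> has_real_derivative - (a + \<beta>) + D s) (at s)"
        using s by (auto intro!: derivative_eq_intros integral_has_derivative_at D_cont)
      then have "(?S has_real_derivative - (a + \<beta>) + D s) (at s)"
      proof (rule has_field_derivative_transform_within_open[where S = "{0<..<t}"])
        show "open {0<..<t}" "s \<in> {0<..<t}" using s by auto
        fix x assume "x \<in> {0<..<t}"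
        then show "?\<psi> x = ?S x" by (intro eq[symmetric]) auto
      qed
      moreover have "- (a + \<beta>) + D s \<le> q + m - a - ?S s"
        using tube[of s] q[of s] s t beta_pos by auto
      ultimately show "\<exists>d. (?S has_real_derivative d) (at s) \<and> d \<le> q + m - a - ?S s" by blast
    qed fact
    then show ?thesis by (simp add: D_0 Q_0 w_0)
  qed
  obtain t1 where t1: "t1 \<in> {0..1/2}" "\<And>s. s \<in> {0..1/2} \<Longrightarrow> Q s \<le> Q t1"
    using continuous_attains_sup[of "{0..1/2}" Q] continuous_on_subset[OF Q_cont, of "{0..1/2}"] by auto
  obtain g where g: "0 \<le> g" "g \<le> t1" "D g = 0" "\<And>s. g < s \<Longrightarrow> s \<le> t1 \<Longrightarrow> 0 < D s"
    using last_zero[of 0 0 t1] D_0 t1 by auto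
  have "Q t1 \<le> Q g - 0 * (t1 - g)"
    using g t1 by (intro Q_decay Q_nonneg) auto
  then have "Q t1 \<le> ?S g + m"
    using tube[of g] g t1 by auto
  also have "?S g \<le> exp (-g) * y0 + (Q t1 + m - a) * (1 - exp (-g))"
    using g t1 by (intro bound) auto
  finally have *: "Q t1 \<le> exp (-g) * y0 + (Q t1 + m - a) * (1 - exp (-g)) + m" by simp
  have "exp (-(1/2)) \<le> exp (-g)" using g t1 by simp
  with e2 have g1: "exp (-g) \<le> 1" "1/2 \<le> exp (-g)"
    using g(1) by (simp, linarith)
  have "exp (-g) * y0 \<le> 1 * y0" using g1 y0_nonneg by (intro mult_right_mono) auto
  moreover have "(m - a) * (1 - exp (-g)) \<le> m * 1"
    using g1 m a by (intro order_trans[OF mult_right_mono[of "m - a" m] mult_left_mono]) auto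
  \<comment> \<open>The term \<open>Q t1 * (1 - exp (-g))\<close> on the right is absorbed on the
    left. As \<open>exp (-g) \<ge> 1/2\<close>, the maximum of \<open>Q\<close> is bounded
    independently of the slope \<open>a\<close>.\<close>
  ultimately have "Q t1 * exp (-g) \<le> y0 + 2 * m" using * by (simp add: algebra_simps)
  moreover have "Q t1 * (1/2) \<le> Q t1 * exp (-g)"
    using g1 t1 by (intro mult_left_mono Q_nonneg) auto
  ultimately have q: "Q t1 \<le> 2 * y0 + 4 * m" by simp
  have "?S (1/2) \<le> exp (-(1/2)) * y0 + (2 * y0 + 4 * m + m - a) * (1 - exp (-(1/2)))"
    using t1 q by (intro bound) (auto intro: order_trans)
  also have "exp (-(1/2)) * y0 \<le> 62/100 * y0" using e1 y0_nonneg by (intro mult_right_mono) auto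
  also have "(2 * y0 + 4 * m + m - a) * (1 - exp (-(1/2))) \<le> (2 * y0 + 5 * m) * (1/2) - a * (38/100)"
  proof -
    have "(2 * y0 + 5 * m) * (1 - exp (-(1/2))) \<le> (2 * y0 + 5 * m) * (1/2)"
      using e2 m y0_nonneg by (intro mult_left_mono) auto
    moreover have "a * (38/100) \<le> a * (1 - exp (-(1/2)))"
      using e1 a by (intro mult_left_mono) auto
    ultimately show ?thesis by (simp add: algebra_simps)
  qed
  finally have "?S (1/2) \<le> 62/100 * y0 + ((2 * y0 + 5 * m) * (1/2) - a * (38/100))" by simp
  moreover have "- D (1/2) - m \<le> ?S (1/2)" using tube[of "1/2"] Q_nonneg[of "1/2"] by auto
  ultimately show ?thesis using m y0_nonneg by argo
qed

end

section \<open>Dyadic grids and running suprema\<close>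

text \<open>Dyadic rather than arbitrary subdivisions, so that consecutive levels are nested: events
  on grids become monotone in \<open>n\<close> and block algebras increase with
  \<open>n\<close>.\<close>

definition grid :: "real \<Rightarrow> real \<Rightarrow> nat \<Rightarrow> nat \<Rightarrow> real" where
  "grid a b n i = a + real i * ((b - a) / 2 ^ n)"

lemma grid_0 [simp]: "grid a b n 0 = a" and grid_end [simp]: "grid a b n (2 ^ n) = b"
  by (simp_all add: grid_def)

lemma grid_Suc: "grid a b n (Suc i) = grid a b n i + (b - a) / 2 ^ n"
  by (simp add: grid_def field_simps)

lemma grid_ge: "a \<le> b \<Longrightarrow> a \<le> grid a b n i"
  by (simp add: grid_def)

lemma grid_mono: "a \<le> b \<Longrightarrow> i \<le> j \<Longrightarrow> grid a b n i \<le> grid a b n j"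
  unfolding grid_def by (intro add_left_mono mult_right_mono) auto

lemma grid_le: "a \<le> b \<Longrightarrow> i \<le> 2 ^ n \<Longrightarrow> grid a b n i \<le> b"
  using grid_mono[of a b i "2 ^ n" n] by simp

lemma grid_in: "a \<le> b \<Longrightarrow> i \<le> 2 ^ n \<Longrightarrow> grid a b n i \<in> {a..b}"
  using grid_ge grid_le by auto

lemma grid_refine: "grid a b (Suc n) (2 * i) = grid a b n i"
  by (simp add: grid_def)

lemma grid_below:
  assumes "a \<le> b" "t \<in> {a..b}"
  obtains i where "i \<le> 2 ^ n" "grid a b n i \<le> t" "t \<le> grid a b n i + (b - a) / 2 ^ n"
proof (cases "a = b")
  case True
  then show ?thesis using assms by (intro that[of 0]) auto
next
  case False
  then have ab: "a < b" using assms by simp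
  define d where "d = (b - a) / 2 ^ n"
  have d: "0 < d" using ab by (simp add: d_def)
  define i where "i = nat \<lfloor>(t - a) / d\<rfloor>"
  have i: "real i \<le> (t - a) / d" "(t - a) / d \<le> real i + 1"
    unfolding i_def using assms d by auto
  have "(t - a) / d \<le> (b - a) / d" using assms d by (intro divide_right_mono) auto
  also have "\<dots> = 2 ^ n" using ab by (simp add: d_def)
  finally have "real i \<le> 2 ^ n" using i by linarith
  then have "i \<le> 2 ^ n" by (metis of_nat_le_iff of_nat_numeral of_nat_power)
  moreover have "grid a b n i \<le> t" "t \<le> grid a b n i + (b - a) / 2 ^ n"
    using i d unfolding grid_def d_def[symmetric] by (auto simp: field_simps)
  ultimately show ?thesis by (rule that)
qed

lemma grid_mesh_tendsto_0: "(\<lambda>n. (b - a) / 2 ^ n) \<longlonglongrightarrow> (0::real)"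
  using tendsto_mult_right_zero[OF LIMSEQ_power_zero[of "1/2::real"], of "b - a"] by (simp add: power_divide)

text \<open>The approximation is from below. This matters for barrier events: all grid times up to
  the approximating one also precede \<open>t\<close>.\<close>

lemma grid_dense:
  assumes "a \<le> b" "t \<in> {a..b}"
  obtains i where "\<And>n. i n \<le> 2 ^ n" "\<And>n. grid a b n (i n) \<le> t" "(\<lambda>n. grid a b n (i n)) \<longlonglongrightarrow> t"
proof -
  have "\<exists>i. \<forall>n. i n \<le> 2 ^ n \<and> grid a b n (i n) \<le> t \<and> t \<le> grid a b n (i n) + (b - a) / 2 ^ n"
    using grid_below[OF assms] by (intro choice) metis
  then obtain i where i: "\<And>n. i n \<le> 2 ^ n" "\<And>n. grid a b n (i n) \<le> t"
    "\<And>n. t \<le> grid a b n (i n) + (b - a) / 2 ^ n" by blast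
  have "(\<lambda>n. grid a b n (i n)) \<longlonglongrightarrow> t"
  proof (rule tendsto_sandwich[of "\<lambda>n. t - (b - a) / 2 ^ n" _ _ "\<lambda>_. t"])
    show "(\<lambda>n. t - (b - a) / 2 ^ n) \<longlonglongrightarrow> t"
      using tendsto_diff[OF tendsto_const grid_mesh_tendsto_0] by simp
  qed (use i in \<open>auto simp: algebra_simps\<close>)
  with i show ?thesis by (intro that)
qed

text \<open>Presents time integrals of continuous processes as limits of finite sums, from which
  their measurability and exponential moments are inherited.\<close>

lemma riemann_sum_tendsto:
  fixes f :: "real \<Rightarrow> real"
  assumes ab: "a \<le> b" and cont: "continuous_on {a..b} f"
  shows "(\<lambda>n. (\<Sum>i<2 ^ n. f (grid a b n i) * ((b - a) / 2 ^ n))) \<longlonglongrightarrow> integral {a..b} f"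
proof (rule metric_LIMSEQ_I)
  fix e :: real assume e: "0 < e"
  \<comment> \<open>The summand 1 keeps the denominator positive when \<open>a = b\<close>.\<close>
  define e' where "e' = e / (2 * (b - a + 1))"
  have e': "0 < e'" using e ab by (simp add: e'_def)
  have "uniformly_continuous_on {a..b} f"
    using cont by (intro compact_uniformly_continuous) auto
  then obtain d where d: "0 < d" "\<And>x y. x \<in> {a..b} \<Longrightarrow> y \<in> {a..b} \<Longrightarrow> dist y x < d \<Longrightarrow> dist (f y) (f x) < e'"
    using e' unfolding uniformly_continuous_on_def by blast
  obtain N where N: "\<And>n. N \<le> n \<Longrightarrow> \<bar>(b - a) / 2 ^ n\<bar> < d"
    using metric_LIMSEQ_D[OF grid_mesh_tendsto_0[of b a] d(1)] by (auto simp: dist_real_def)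
  show "\<exists>N. \<forall>n\<ge>N. dist (\<Sum>i<2 ^ n. f (grid a b n i) * ((b - a) / 2 ^ n)) (integral {a..b} f) < e"
  proof (intro exI[of _ N] allI impI)
    fix n assume n: "N \<le> n"
    let ?g = "grid a b n"
    have int: "f integrable_on {c..d}" if "a \<le> c" "d \<le> b" for c d
      using that by (intro integrable_continuous_real continuous_on_subset[OF cont]) auto
    have split: "integral {a..?g k} f = (\<Sum>i<k. integral {?g i..?g (Suc i)} f)" if "k \<le> 2 ^ n" for k
      using that
    proof (induction k)
      case (Suc k)
      have "integral {a..?g (Suc k)} f = integral {a..?g k} f + integral {?g k..?g (Suc k)} f"
        using Suc.prems ab
        by (intro Henstock_Kurzweil_Integration.integral_combine[symmetric] int grid_ge grid_mono grid_le) auto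
      then show ?case using Suc by simp
    qed simp
    have "\<bar>f (?g i) * ((b - a) / 2 ^ n) - integral {?g i..?g (Suc i)} f\<bar> \<le> e' * ((b - a) / 2 ^ n)"
      if i: "i < 2 ^ n" for i
    proof -
      have len: "?g (Suc i) - ?g i = (b - a) / 2 ^ n" by (simp add: grid_Suc)
      have sub: "a \<le> ?g i" "?g i \<le> ?g (Suc i)" "?g (Suc i) \<le> b"
        using i ab by (auto intro!: grid_ge grid_mono grid_le)
      have I: "f integrable_on {?g i..?g (Suc i)}" using sub by (intro int) auto
      have "norm (integral {?g i..?g (Suc i)} (\<lambda>t. f (?g i) - f t)) \<le> e' * (?g (Suc i) - ?g i)"
      proof (rule integral_bound)
        show "continuous_on {?g i..?g (Suc i)} (\<lambda>t. f (?g i) - f t)"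
          using sub by (intro continuous_intros continuous_on_subset[OF cont]) auto
        fix t assume t: "t \<in> {?g i..?g (Suc i)}"
        have "dist (?g i) t < d" using t N[OF n] len unfolding dist_real_def atLeastAtMost_iff by linarith
        then show "norm (f (?g i) - f t) \<le> e'"
          using d(2)[of t "?g i"] t sub by (auto simp: dist_real_def)
      qed (use sub in auto)
      moreover have "integral {?g i..?g (Suc i)} (\<lambda>t. f (?g i) - f t) =
          f (?g i) * ((b - a) / 2 ^ n) - integral {?g i..?g (Suc i)} f"
        using I sub len by (subst Henstock_Kurzweil_Integration.integral_diff) (auto simp: mult.commute)
      ultimately show ?thesis by (simp add: len)
    qed
    then have "\<bar>\<Sum>i<2 ^ n. f (?g i) * ((b - a) / 2 ^ n) - integral {?g i..?g (Suc i)} f\<bar>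
        \<le> (\<Sum>i<(2::nat) ^ n. e' * ((b - a) / 2 ^ n))"
      by (intro order_trans[OF sum_abs] sum_mono) auto
    also have "\<dots> = e' * (b - a)" by simp
    also have "\<dots> \<le> e' * (b - a + 1)" using e' by (intro mult_left_mono) auto
    also have "\<dots> = e / 2" using ab by (simp add: e'_def field_simps)
    finally have "\<bar>\<Sum>i<2 ^ n. f (?g i) * ((b - a) / 2 ^ n) - integral {?g i..?g (Suc i)} f\<bar> < e"
      using e by simp
    then show "dist (\<Sum>i<2 ^ n. f (?g i) * ((b - a) / 2 ^ n)) (integral {a..b} f) < e"
      using split[of "2 ^ n"] by (simp add: dist_real_def sum_subtractf)
  qed
qed

definition run_sup :: "(real \<Rightarrow> real) \<Rightarrow> real \<Rightarrow> real \<Rightarrow> real" where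
  "run_sup f a b = (SUP t\<in>{a..b}. f t)"

lemma run_sup_bdd:
  fixes f :: "real \<Rightarrow> real"
  assumes "continuous_on {a..b} f"
  shows "bdd_above (f ` {a..b})"
  using assms by (intro bounded_imp_bdd_above compact_imp_bounded compact_continuous_image) auto

lemma run_sup_ge:
  assumes "continuous_on {a..b} f" "t \<in> {a..b}"
  shows "f t \<le> run_sup f a b"
  unfolding run_sup_def using assms by (intro cSUP_upper run_sup_bdd)

lemma run_sup_le:
  assumes "a \<le> b" "\<And>t. t \<in> {a..b} \<Longrightarrow> f t \<le> c"
  shows "run_sup f a b \<le> c"
  unfolding run_sup_def using assms by (intro cSUP_least) auto

lemma run_sup_attained:
  assumes "continuous_on {a..b} f" "a \<le> b"
  obtains t where "t \<in> {a..b}" "run_sup f a b = f t"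
proof -
  obtain t where t: "t \<in> {a..b}" "\<And>s. s \<in> {a..b} \<Longrightarrow> f s \<le> f t"
    using continuous_attains_sup[of "{a..b}" f] assms by auto
  then have "run_sup f a b = f t"
    using assms by (intro antisym run_sup_le run_sup_ge) auto
  with t show ?thesis by (intro that)
qed

lemma run_sup_mono:
  assumes "continuous_on {a..c} f" "a \<le> b" "b \<le> c"
  shows "run_sup f a b \<le> run_sup f a c"
  using assms by (intro run_sup_le run_sup_ge) auto

lemma continuous_on_run_sup:
  assumes cont: "continuous_on {a..b} f"
  shows "continuous_on {a..b} (\<lambda>t. run_sup f a t)"
  unfolding continuous_on_iff
proof (intro ballI allI impI)
  fix x e :: real assume x: "x \<in> {a..b}" and e: "0 < e"
  obtain d where d: "0 < d" "\<And>y. y \<in> {a..b} \<Longrightarrow> dist y x < d \<Longrightarrow> dist (f y) (f x) < e / 3"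
    using cont x e unfolding continuous_on_iff by (metis zero_less_divide_iff zero_less_numeral)
  have c: "continuous_on {a..t} f" if "t \<le> b" for t
    using that by (intro continuous_on_subset[OF cont]) auto
  \<comment> \<open>Between \<open>s\<close> and \<open>t\<close> the function stays within
    \<open>e / 3\<close> of \<open>f x\<close>, hence within \<open>2 * (e / 3)\<close> of
    \<open>f s\<close>, and the earlier supremum dominates \<open>f s\<close>.\<close>
  have up: "run_sup f a t \<le> run_sup f a s + 2 * (e / 3)"
    if st: "s \<in> {a..b}" "t \<in> {a..b}" "dist t x < d" "dist s x < d" "s \<le> t" "s = x \<or> t = x" for s t
  proof (rule run_sup_le)
    fix u assume u: "u \<in> {a..t}"
    show "f u \<le> run_sup f a s + 2 * (e / 3)"
    proof (cases "u \<le> s")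
      case True
      then have "f u \<le> run_sup f a s" using u st by (intro run_sup_ge c) auto
      then show ?thesis using e by simp
    next
      case False
      have "f s \<le> run_sup f a s" using st by (intro run_sup_ge c) auto
      moreover have "dist (f u) (f x) < e / 3" "dist (f s) (f x) < e / 3"
        using d(2)[of u] d(2)[of s] st u False by (auto simp: dist_real_def)
      ultimately show ?thesis unfolding dist_real_def by linarith
    qed
  qed (use st in auto)
  show "\<exists>d>0. \<forall>x'\<in>{a..b}. dist x' x < d \<longrightarrow> dist (run_sup f a x') (run_sup f a x) < e"
  proof (intro exI[of _ d] conjI ballI impI)
    fix t assume t: "t \<in> {a..b}" "dist t x < d"
    show "dist (run_sup f a t) (run_sup f a x) < e"
    proof (cases "t \<le> x")
      case True
      have "run_sup f a x \<le> run_sup f a t + 2 * (e / 3)" using t x d True by (intro up) auto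
      moreover have "run_sup f a t \<le> run_sup f a x" using t x True by (intro run_sup_mono c) auto
      ultimately show ?thesis using e unfolding dist_real_def by linarith
    next
      case False
      have "run_sup f a t \<le> run_sup f a x + 2 * (e / 3)" using t x d False by (intro up) auto
      moreover have "run_sup f a x \<le> run_sup f a t" using t x False by (intro run_sup_mono c) auto
      ultimately show ?thesis using e unfolding dist_real_def by linarith
    qed
  qed (use d in auto)
qed

definition grid_sup :: "(real \<Rightarrow> real) \<Rightarrow> real \<Rightarrow> real \<Rightarrow> nat \<Rightarrow> real" where
  "grid_sup f a b n = Max ((\<lambda>i. f (grid a b n i)) ` {..2 ^ n})"

text \<open>Grid maxima never exceed the supremum, and along grid points approaching a maximiser
  they reach it in the limit.\<close>

lemma grid_sup_tendsto:
  assumes cont: "continuous_on {a..b} f" and ab: "a \<le> b"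
  shows "(\<lambda>n. grid_sup f a b n) \<longlonglongrightarrow> run_sup f a b"
proof -
  obtain t where t: "t \<in> {a..b}" "run_sup f a b = f t"
    using run_sup_attained[OF cont ab] by blast
  obtain i where i: "\<And>n. i n \<le> 2 ^ n" "\<And>n. grid a b n (i n) \<le> t" "(\<lambda>n. grid a b n (i n)) \<longlonglongrightarrow> t"
    using grid_dense[OF ab t(1)] by blast
  have lim: "(\<lambda>n. f (grid a b n (i n))) \<longlonglongrightarrow> f t"
    by (rule continuous_on_tendsto_compose[OF cont i(3) t(1)]) (use grid_in[OF ab i(1)] in auto)
  show ?thesis
  proof (rule tendsto_sandwich[OF _ _ lim[folded t(2)] tendsto_const])
    show "\<forall>\<^sub>F n in sequentially. f (grid a b n (i n)) \<le> grid_sup f a b n"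
      unfolding grid_sup_def using i(1) by (intro always_eventually allI Max_ge) auto
    show "\<forall>\<^sub>F n in sequentially. grid_sup f a b n \<le> run_sup f a b"
      unfolding grid_sup_def
      by (intro always_eventually allI Max.boundedI) (auto intro!: run_sup_ge cont grid_in ab)
  qed
qed

lemma borel_measurable_run_sup:
  assumes "a \<le> b" "\<And>\<omega>. \<omega> \<in> space N \<Longrightarrow> continuous_on {a..b} (\<lambda>t. f t \<omega>)"
    and "\<And>t. t \<in> {a..b} \<Longrightarrow> f t \<in> borel_measurable N"
  shows "(\<lambda>\<omega>. run_sup (\<lambda>t. f t \<omega>) a b) \<in> borel_measurable N"
proof (rule borel_measurable_LIMSEQ_real)
  show "(\<lambda>n. grid_sup (\<lambda>t. f t \<omega>) a b n) \<longlonglongrightarrow> run_sup (\<lambda>t. f t \<omega>) a b" if "\<omega> \<in> space N" for \<omega>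
    using assms that by (intro grid_sup_tendsto) auto
  show "(\<lambda>\<omega>. grid_sup (\<lambda>t. f t \<omega>) a b n) \<in> borel_measurable N" for n
    unfolding grid_sup_def
    by (intro borel_measurable_Max) (auto intro!: assms(3) grid_in[OF assms(1), unfolded atLeastAtMost_iff])
qed

lemma borel_measurable_integral_cont:
  fixes f :: "real \<Rightarrow> 'a \<Rightarrow> real"
  assumes "a \<le> b" "\<And>\<omega>. \<omega> \<in> space N \<Longrightarrow> continuous_on {a..b} (\<lambda>t. f t \<omega>)"
    and "\<And>t. t \<in> {a..b} \<Longrightarrow> f t \<in> borel_measurable N"
  shows "(\<lambda>\<omega>. integral {a..b} (\<lambda>t. f t \<omega>)) \<in> borel_measurable N"
proof (rule borel_measurable_LIMSEQ_real)
  show "(\<lambda>n. (\<Sum>i<2 ^ n. f (grid a b n i) \<omega> * ((b - a) / 2 ^ n))) \<longlonglongrightarrow> integral {a..b} (\<lambda>t. f t \<omega>)"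
    if "\<omega> \<in> space N" for \<omega>
    using assms that by (intro riemann_sum_tendsto) auto
  show "(\<lambda>\<omega>. \<Sum>i<2 ^ n. f (grid a b n i) \<omega> * ((b - a) / 2 ^ n)) \<in> borel_measurable N" for n
    by (intro borel_measurable_sum borel_measurable_times assms(3) grid_in assms(1)) auto
qed

section \<open>Random walks\<close>

text \<open>The sigma-algebra generated by the variables with index strictly below \<open>k\<close>,
  encoded as the preimage algebra of the restricted tuple so that independence of disjoint index
  groups applies directly.\<close>

definition past :: "'a measure \<Rightarrow> 'b measure \<Rightarrow> (nat \<Rightarrow> 'a \<Rightarrow> 'b) \<Rightarrow> nat \<Rightarrow> 'a measure" where
  "past M N X k = vimage_algebra (space M) (\<lambda>\<omega>. \<lambda>i\<in>{..<k}. X i \<omega>) (PiM {..<k} (\<lambda>_. N))"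

lemma space_past [simp]: "space (past M N X k) = space M"
  by (simp add: past_def)

lemma measurable_past:
  assumes "\<And>i. i < k \<Longrightarrow> X i \<in> measurable M N" "i < k"
  shows "X i \<in> measurable (past M N X k) N"
proof -
  have "(\<lambda>\<omega>. \<lambda>i\<in>{..<k}. X i \<omega>) \<in> measurable (past M N X k) (PiM {..<k} (\<lambda>_. N))"
    unfolding past_def
    by (rule measurable_vimage_algebra1) (auto simp: space_PiM PiE_iff extensional_def intro!: measurable_space[OF assms(1)] split: if_splits)
  from measurable_compose[OF this measurable_component_singleton[of i]] assms(2)
  show ?thesis by simp
qed

lemma (in prob_space) nn_integral_past_mult:
  assumes ind: "indep_vars (\<lambda>_. N) X {..<n}" and k: "k < n"
    and P: "P \<in> borel_measurable (past M N X k)" and g: "g \<in> borel_measurable N"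
  shows "(\<integral>\<^sup>+\<omega>. P \<omega> * g (X k \<omega>) \<partial>M) = (\<integral>\<^sup>+\<omega>. P \<omega> \<partial>M) * (\<integral>\<^sup>+\<omega>. (g (X k \<omega>) :: ennreal) \<partial>M)"
proof -
  let ?R = "\<lambda>\<omega>. \<lambda>i\<in>{..<k}. X i \<omega>" and ?R' = "\<lambda>\<omega>. \<lambda>i\<in>{k}. X i \<omega>"
  have X: "random_variable N (X i)" if "i < n" for i
    using ind that by (auto simp: indep_vars_def)
  have R: "random_variable (PiM {..<k} (\<lambda>_. N)) ?R"
    using k by (intro measurable_restrict X) auto
  have R': "random_variable (PiM {k} (\<lambda>_. N)) ?R'"
    using k by (intro measurable_restrict X) auto
  have iv: "indep_var (PiM {..<k} (\<lambda>_. N)) ?R (PiM {k} (\<lambda>_. N)) ?R'"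
    using k by (intro indep_var_restrict[OF ind]) auto
  have Gsets: "(\<lambda>\<omega>. g (X k \<omega>)) -` A \<inter> space M \<in> {?R' -` A \<inter> space M | A. A \<in> sets (PiM {k} (\<lambda>_. N))}"
    if "A \<in> sets borel" for A
  proof (intro CollectI exI conjI)
    have "(\<lambda>x. g (x k)) \<in> borel_measurable (PiM {k} (\<lambda>_. N))"
      by (rule measurable_compose[OF measurable_component_singleton[where I = "{k}" and M = "\<lambda>_. N"] g]) simp
    from measurable_sets[OF this that]
    show "(\<lambda>x. g (x k)) -` A \<inter> space (PiM {k} (\<lambda>_. N)) \<in> sets (PiM {k} (\<lambda>_. N))" .
    show "(\<lambda>\<omega>. g (X k \<omega>)) -` A \<inter> space M =
      ?R' -` ((\<lambda>x. g (x k)) -` A \<inter> space (PiM {k} (\<lambda>_. N))) \<inter> space M"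
      using measurable_space[OF R'] by auto
  qed
  have Psets: "P -` A \<inter> space M \<in> {?R -` A \<inter> space M | A. A \<in> sets (PiM {..<k} (\<lambda>_. N))}"
    if "A \<in> sets borel" for A
    using measurable_sets[OF P that] unfolding space_past unfolding past_def
    by (subst (asm) sets_vimage_algebra2) (use measurable_space[OF R] in auto)
  have P': "random_variable borel P"
  proof (rule measurableI)
    fix A :: "ennreal set" assume "A \<in> sets borel"
    from Psets[OF this] obtain A' where "A' \<in> sets (PiM {..<k} (\<lambda>_. N))" "P -` A \<inter> space M = ?R -` A' \<inter> space M"
      by auto
    then show "P -` A \<inter> space M \<in> sets M" using measurable_sets[OF R] by simp
  qed simp
  have "indep_var borel P borel (\<lambda>\<omega>. g (X k \<omega>))"
    unfolding indep_var_eq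
  proof (intro conjI P')
    show "random_variable borel (\<lambda>\<omega>. g (X k \<omega>))"
      using X[OF k] g by measurable
    have "indep_set (sigma_sets (space M) {?R -` A \<inter> space M | A. A \<in> sets (PiM {..<k} (\<lambda>_. N))})
      (sigma_sets (space M) {?R' -` A \<inter> space M |A. A \<in> sets (PiM {k} (\<lambda>_. N))})"
      using iv unfolding indep_var_eq by blast
    then show "indep_set (sigma_sets (space M) {P -` A \<inter> space M |A. A \<in> sets borel})
      (sigma_sets (space M) {(\<lambda>\<omega>. g (X k \<omega>)) -` A \<inter> space M |A. A \<in> sets borel})"
      unfolding indep_set_def
    proof (rule indep_sets_mono_sets)
      fix i :: bool
      have "sigma_sets (space M) {P -` A \<inter> space M |A. A \<in> sets borel} \<subseteq>
        sigma_sets (space M) {?R -` A \<inter> space M | A. A \<in> sets (PiM {..<k} (\<lambda>_. N))}"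
        by (intro sigma_sets_mono') (use Psets in blast)
      moreover have "sigma_sets (space M) {(\<lambda>\<omega>. g (X k \<omega>)) -` A \<inter> space M |A. A \<in> sets borel} \<subseteq>
        sigma_sets (space M) {?R' -` A \<inter> space M | A. A \<in> sets (PiM {k} (\<lambda>_. N))}"
        by (intro sigma_sets_mono') (use Gsets in blast)
      ultimately show "case_bool (sigma_sets (space M) {P -` A \<inter> space M |A. A \<in> sets borel})
        (sigma_sets (space M) {(\<lambda>\<omega>. g (X k \<omega>)) -` A \<inter> space M |A. A \<in> sets borel}) i \<subseteq>
        case_bool (sigma_sets (space M) {?R -` A \<inter> space M | A. A \<in> sets (PiM {..<k} (\<lambda>_. N))})
        (sigma_sets (space M) {?R' -` A \<inter> space M |A. A \<in> sets (PiM {k} (\<lambda>_. N))}) i"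
        by (cases i) auto
    qed
  qed
  then have "indep_vars (\<lambda>_. borel) (case_bool P (\<lambda>\<omega>. g (X k \<omega>))) UNIV"
    unfolding indep_var_def by (rule indep_vars_cong[THEN iffD1, rotated -1]) (auto split: bool.split)
  from indep_vars_nn_integral[OF _ this] show ?thesis
    by (simp add: UNIV_bool mult.commute)
qed

text \<open>The concavity of \<open>z powr p\<close> in exponential form; it is the inequality that
  makes the potential below decrease when the walk sets a new maximum.\<close>

lemma exp_convex_comb:
  assumes "0 \<le> p" "p \<le> (1::real)"
  shows "exp (p * u) \<le> 1 - p + p * exp u"
  using convex_onD[OF exp_convex assms, of 0 u] by simp

text \<open>For a walk \<open>S\<close> with running maximum \<open>m\<close>, the function \<open>(1 - p) exp (\<kappa> m) + p exp (\<kappa> m - b (m - S))\<close> with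
  \<open>p = \<kappa> / b\<close> is the Azema-Yor supermartingale of \<open>exp (b S)\<close> for the concave function \<open>z \<mapsto> z powr p\<close>.\<close>

lemma (in prob_space) nn_integral_exp_max_le:
  fixes X :: "nat \<Rightarrow> 'a \<Rightarrow> real"
  assumes ind: "indep_vars (\<lambda>_. borel) X {..<n}"
    and mgf: "\<And>i. i < n \<Longrightarrow> (\<integral>\<^sup>+\<omega>. ennreal (exp (b * X i \<omega>)) \<partial>M) \<le> 1"
    and \<kappa>: "0 < \<kappa>" "\<kappa> < b"
  shows "(\<integral>\<^sup>+\<omega>. ennreal (exp (\<kappa> * Max ((\<lambda>k. \<Sum>i<k. X i \<omega>) ` {..n}))) \<partial>M) \<le> ennreal (b / (b - \<kappa>))"
proof -
  define p where "p = \<kappa> / b"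
  have p: "0 < p" "p < 1" "p * b = \<kappa>" using \<kappa> by (auto simp: p_def)
  define S where "S k \<omega> = (\<Sum>i<k. X i \<omega>)" for k \<omega>
  define Mx where "Mx k \<omega> = Max ((\<lambda>j. S j \<omega>) ` {..k})" for k \<omega>
  have X: "random_variable borel (X i)" if "i < n" for i
    using ind that by (auto simp: indep_vars_def)
  have Mx_0: "Mx 0 \<omega> = 0" for \<omega> by (simp add: Mx_def S_def)
  have Mx_Suc: "Mx (Suc k) \<omega> = max (Mx k \<omega>) (S k \<omega> + X k \<omega>)" for k \<omega>
    by (simp add: Mx_def atMost_Suc max.commute) (simp add: S_def)
  have S_le: "S k \<omega> \<le> Mx k \<omega>" for k \<omega> unfolding Mx_def by (intro Max_ge) auto
  have meas_S: "S k \<in> borel_measurable (past M borel X m)" if "k \<le> m" "m \<le> n" for k m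
    unfolding S_def using that by (intro borel_measurable_sum measurable_past X) auto
  have meas_Mx: "Mx k \<in> borel_measurable (past M borel X m)" if "k \<le> m" "m \<le> n" for k m
    unfolding Mx_def using that by (intro borel_measurable_Max meas_S) auto
  have meas_S': "S k \<in> borel_measurable M" if "k \<le> n" for k
    unfolding S_def using that by (intro borel_measurable_sum X) auto
  have meas_Mx': "Mx k \<in> borel_measurable M" if "k \<le> n" for k
    unfolding Mx_def using that by (intro borel_measurable_Max meas_S') auto
  define \<Phi>1 where "\<Phi>1 k \<omega> = (1 - p) * exp (\<kappa> * Mx k \<omega>)" for k \<omega>
  define \<Phi>2 where "\<Phi>2 k \<omega> = p * exp ((\<kappa> - b) * Mx k \<omega> + b * S k \<omega>)" for k \<omega>
  have pos: "0 \<le> \<Phi>1 k \<omega>" "0 \<le> \<Phi>2 k \<omega>" for k \<omega> using p by (auto simp: \<Phi>1_def \<Phi>2_def)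
  \<comment> \<open>While the maximum stays put, \<Phi>1 is unchanged and \<Phi>2 is multiplied by
    \<open>exp (b * X k)\<close>, with equality. At a new maximum the inequality is
    \<open>exp_convex_comb\<close> for the excess \<Delta> over the old one. The two parts are kept
    apart because only \<Phi>2 meets the new increment.\<close>
  have step: "\<Phi>1 (Suc k) \<omega> + \<Phi>2 (Suc k) \<omega> \<le> \<Phi>1 k \<omega> + \<Phi>2 k \<omega> * exp (b * X k \<omega>)" for k \<omega>
  proof (cases "S k \<omega> + X k \<omega> \<le> Mx k \<omega>")
    case True
    then show ?thesis
      by (simp add: \<Phi>1_def \<Phi>2_def Mx_Suc max_def S_def[of "Suc k"] S_def[of k, symmetric] exp_add[symmetric] algebra_simps)
  next
    case False
    define \<Delta> where "\<Delta> = S k \<omega> + X k \<omega> - Mx k \<omega>"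
    have M1: "Mx (Suc k) \<omega> = Mx k \<omega> + \<Delta>" "S (Suc k) \<omega> = Mx k \<omega> + \<Delta>" "S k \<omega> = Mx k \<omega> + \<Delta> - X k \<omega>"
      using False by (auto simp: Mx_Suc \<Delta>_def S_def)
    have "exp (\<kappa> * \<Delta>) \<le> 1 - p + p * exp (b * \<Delta>)"
      using exp_convex_comb[of p "b * \<Delta>"] p by (simp add: mult.assoc[symmetric])
    then have "exp (\<kappa> * Mx k \<omega>) * exp (\<kappa> * \<Delta>) \<le> exp (\<kappa> * Mx k \<omega>) * (1 - p + p * exp (b * \<Delta>))"
      by (intro mult_left_mono) auto
    moreover have "\<Phi>1 (Suc k) \<omega> + \<Phi>2 (Suc k) \<omega> = exp (\<kappa> * Mx k \<omega>) * exp (\<kappa> * \<Delta>)"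
      unfolding \<Phi>1_def \<Phi>2_def M1 by (simp add: algebra_simps exp_add[symmetric])
    moreover have "\<Phi>1 k \<omega> + \<Phi>2 k \<omega> * exp (b * X k \<omega>) = exp (\<kappa> * Mx k \<omega>) * (1 - p + p * exp (b * \<Delta>))"
      unfolding \<Phi>1_def \<Phi>2_def M1(3) by (simp add: algebra_simps exp_add[symmetric])
    ultimately show ?thesis by simp
  qed
  have main: "(\<integral>\<^sup>+\<omega>. ennreal (\<Phi>1 k \<omega>) + ennreal (\<Phi>2 k \<omega>) \<partial>M) \<le> 1" if "k \<le> n" for k
    using that
  proof (induction k)
    case 0
    have "ennreal (\<Phi>1 0 \<omega>) + ennreal (\<Phi>2 0 \<omega>) = 1" for \<omega>
      using pos by (simp add: ennreal_plus[symmetric] del: ennreal_plus) (simp add: \<Phi>1_def \<Phi>2_def Mx_0 S_def)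
    then show ?case by (simp add: emeasure_space_1)
  next
    case (Suc k)
    then have k: "k < n" "k \<le> n" by auto
    have [measurable]: "S k \<in> borel_measurable M" "Mx k \<in> borel_measurable M" "X k \<in> borel_measurable M"
      using k by (auto intro!: meas_S' meas_Mx' X)
    have 1: "(\<lambda>\<omega>. ennreal (\<Phi>2 k \<omega>)) \<in> borel_measurable (past M borel X k)"
      unfolding \<Phi>2_def using meas_S[of k k] meas_Mx[of k k] k by measurable
    have "(\<integral>\<^sup>+\<omega>. ennreal (\<Phi>1 (Suc k) \<omega>) + ennreal (\<Phi>2 (Suc k) \<omega>) \<partial>M) \<le>
       (\<integral>\<^sup>+\<omega>. ennreal (\<Phi>1 k \<omega>) + ennreal (\<Phi>2 k \<omega>) * ennreal (exp (b * X k \<omega>)) \<partial>M)"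
      using step pos by (intro nn_integral_mono)
        (simp add: ennreal_plus[symmetric] ennreal_mult[symmetric] ennreal_leI del: ennreal_plus)
    also have "\<dots> = (\<integral>\<^sup>+\<omega>. ennreal (\<Phi>1 k \<omega>) \<partial>M) + (\<integral>\<^sup>+\<omega>. ennreal (\<Phi>2 k \<omega>) * ennreal (exp (b * X k \<omega>)) \<partial>M)"
      unfolding \<Phi>1_def \<Phi>2_def by (intro nn_integral_add) auto
    also have "(\<integral>\<^sup>+\<omega>. ennreal (\<Phi>2 k \<omega>) * ennreal (exp (b * X k \<omega>)) \<partial>M) =
       (\<integral>\<^sup>+\<omega>. ennreal (\<Phi>2 k \<omega>) \<partial>M) * (\<integral>\<^sup>+\<omega>. ennreal (exp (b * X k \<omega>)) \<partial>M)"
      by (rule nn_integral_past_mult[OF ind k(1) 1, of "\<lambda>x. ennreal (exp (b * x))"]) measurable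
    also have "\<dots> \<le> (\<integral>\<^sup>+\<omega>. ennreal (\<Phi>2 k \<omega>) \<partial>M) * 1"
      using mgf[OF k(1)] by (intro mult_left_mono) auto
    finally have "(\<integral>\<^sup>+\<omega>. ennreal (\<Phi>1 (Suc k) \<omega>) + ennreal (\<Phi>2 (Suc k) \<omega>) \<partial>M) \<le>
      (\<integral>\<^sup>+\<omega>. ennreal (\<Phi>1 k \<omega>) \<partial>M) + (\<integral>\<^sup>+\<omega>. ennreal (\<Phi>2 k \<omega>) \<partial>M)"
      by (simp add: add_left_mono)
    also have "\<dots> = (\<integral>\<^sup>+\<omega>. ennreal (\<Phi>1 k \<omega>) + ennreal (\<Phi>2 k \<omega>) \<partial>M)"
      unfolding \<Phi>1_def \<Phi>2_def by (intro nn_integral_add[symmetric]) auto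
    also have "\<dots> \<le> 1" using Suc k by simp
    finally show ?case .
  qed
  have [measurable]: "Mx n \<in> borel_measurable M" by (rule meas_Mx') simp
  \<comment> \<open>Dropping \<Phi>2 leaves the exponential of the maximum with weight
    \<open>1 - p\<close>, whose inverse is the constant \<open>b / (b - \<kappa>)\<close>.\<close>
  have "ennreal (1 - p) * (\<integral>\<^sup>+\<omega>. ennreal (exp (\<kappa> * Mx n \<omega>)) \<partial>M) = (\<integral>\<^sup>+\<omega>. ennreal (\<Phi>1 n \<omega>) \<partial>M)"
    unfolding \<Phi>1_def using p by (subst nn_integral_cmult[symmetric]) (auto simp: ennreal_mult)
  also have "\<dots> \<le> (\<integral>\<^sup>+\<omega>. ennreal (\<Phi>1 n \<omega>) + ennreal (\<Phi>2 n \<omega>) \<partial>M)"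
    by (intro nn_integral_mono) auto
  also have "\<dots> \<le> 1" by (rule main) simp
  finally have "ennreal (1 - p) * (\<integral>\<^sup>+\<omega>. ennreal (exp (\<kappa> * Mx n \<omega>)) \<partial>M) \<le> 1" .
  then have "ennreal (1 / (1 - p)) * (ennreal (1 - p) * (\<integral>\<^sup>+\<omega>. ennreal (exp (\<kappa> * Mx n \<omega>)) \<partial>M)) \<le> ennreal (1 / (1 - p)) * 1"
    by (intro mult_left_mono) auto
  moreover have "ennreal (1 / (1 - p)) * ennreal (1 - p) = 1"
    using p by (subst ennreal_mult[symmetric]) auto
  ultimately have "(\<integral>\<^sup>+\<omega>. ennreal (exp (\<kappa> * Mx n \<omega>)) \<partial>M) \<le> ennreal (1 / (1 - p))"
    by (simp add: mult.assoc[symmetric])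
  also have "1 / (1 - p) = b / (b - \<kappa>)" using \<kappa> by (simp add: p_def field_simps)
  finally show ?thesis by (simp add: Mx_def S_def)
qed

text \<open>Completing the square: exponential tilting by \<open>b\<close> moves the mean to
  \<open>b * \<sigma>\<^sup>2\<close>.\<close>

lemma exp_mult_normal_density:
  assumes "0 < \<sigma>"
  shows "exp (b * x) * normal_density 0 \<sigma> x = exp (b\<^sup>2 * \<sigma>\<^sup>2 / 2) * normal_density (b * \<sigma>\<^sup>2) \<sigma> x"
proof -
  have "b * x + - (x - 0)\<^sup>2 / (2 * \<sigma>\<^sup>2) = b\<^sup>2 * \<sigma>\<^sup>2 / 2 + - (x - b * \<sigma>\<^sup>2)\<^sup>2 / (2 * \<sigma>\<^sup>2)"
    using assms by (simp add: field_simps power2_eq_square)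
  then show ?thesis
    unfolding normal_density_def by (simp add: exp_add[symmetric] mult.left_commute)
qed

lemma nn_integral_normal_density: "0 < \<sigma> \<Longrightarrow> (\<integral>\<^sup>+x. ennreal (normal_density \<mu> \<sigma> x) \<partial>lborel) = 1"
  using prob_space.emeasure_space_1[OF prob_space_normal_density[of \<sigma> \<mu>]] by (simp add: emeasure_density)

lemma (in prob_space) nn_integral_exp_normal:
  assumes "distributed M lborel X (\<lambda>z. ennreal (normal_density 0 \<sigma> z))" "0 < \<sigma>"
  shows "(\<integral>\<^sup>+\<omega>. ennreal (exp (b * X \<omega>)) \<partial>M) = ennreal (exp (b\<^sup>2 * \<sigma>\<^sup>2 / 2))"
proof -
  have "(\<integral>\<^sup>+\<omega>. ennreal (exp (b * X \<omega>)) \<partial>M) = (\<integral>\<^sup>+x. ennreal (normal_density 0 \<sigma> x) * ennreal (exp (b * x)) \<partial>lborel)"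
    using distributed_nn_integral[OF assms(1), of "\<lambda>x. ennreal (exp (b * x))"] by simp
  also have "\<dots> = (\<integral>\<^sup>+x. ennreal (exp (b\<^sup>2 * \<sigma>\<^sup>2 / 2)) * ennreal (normal_density (b * \<sigma>\<^sup>2) \<sigma> x) \<partial>lborel)"
    using assms(2)
    by (intro nn_integral_cong)
      (simp add: ennreal_mult[symmetric] exp_mult_normal_density[symmetric] mult.commute[of "normal_density 0 \<sigma> _"])
  also have "\<dots> = ennreal (exp (b\<^sup>2 * \<sigma>\<^sup>2 / 2))"
    using assms(2) by (simp add: nn_integral_cmult nn_integral_normal_density)
  finally show ?thesis .
qed

text \<open>Change of variables one coordinate at a time, by Fubini and induction on the index set.
  It serves twice: for a translation, where \<rho> is the Girsanov density of a single step, and for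
  the sign change, where \<rho> is 1.\<close>

lemma nn_integral_PiM_transform:
  fixes N :: "real measure"
  assumes N: "sigma_finite_measure N" "sets N = sets borel"
    and T[measurable]: "T \<in> borel_measurable borel" and \<rho>[measurable]: "\<rho> \<in> borel_measurable borel"
    and tr: "\<And>g. g \<in> borel_measurable borel \<Longrightarrow> (\<integral>\<^sup>+x. g (T x) \<partial>N) = (\<integral>\<^sup>+x. g x * \<rho> x \<partial>N)"
    and I: "finite I"
    and f: "f \<in> borel_measurable (PiM I (\<lambda>_. borel))"
  shows "(\<integral>\<^sup>+x. f (\<lambda>i\<in>I. T (x i)) \<partial>PiM I (\<lambda>_. N)) = (\<integral>\<^sup>+x. f x * (\<Prod>i\<in>I. \<rho> (x i)) \<partial>PiM I (\<lambda>_. N))"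
  using I f
proof (induction I arbitrary: f)
  case empty
  show ?case by (intro nn_integral_cong) (simp add: space_PiM)
next
  case (insert i I)
  interpret product_sigma_finite "\<lambda>_. N" using N(1) by (simp add: product_sigma_finite_def)
  have setsP: "sets (PiM J (\<lambda>_. N)) = sets (PiM J (\<lambda>_. borel :: real measure))" for J :: "'a set"
    by (intro sets_PiM_cong refl N(2))
  note [measurable_cong] = setsP N(2)
  note [measurable] = insert.prems
  have upd: "(\<lambda>j\<in>insert i I. T ((x(i := y)) j)) = (\<lambda>j\<in>I. T (x j))(i := T y)" for x y
    using insert.hyps by (auto simp: fun_eq_iff)
  have prd: "(\<Prod>j\<in>insert i I. \<rho> ((x(i := y)) j)) = \<rho> y * (\<Prod>j\<in>I. \<rho> (x j))" for x y
  proof -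
    have "(\<Prod>j\<in>I. \<rho> ((x(i := y)) j)) = (\<Prod>j\<in>I. \<rho> (x j))"
      using insert.hyps by (intro prod.cong) auto
    then show ?thesis using insert.hyps by (subst prod.insert) auto
  qed
  define F where "F x = (\<integral>\<^sup>+y. f (x(i := y)) * \<rho> y \<partial>N)" for x
  interpret sigma_finite_measure N by fact
  have F[measurable]: "F \<in> borel_measurable (PiM I (\<lambda>_. borel))"
  proof -
    have "F \<in> borel_measurable (PiM I (\<lambda>_. N))" unfolding F_def by measurable
    then show ?thesis by (simp cong: measurable_cong_sets add: setsP)
  qed
  have "(\<integral>\<^sup>+x. f (\<lambda>j\<in>insert i I. T (x j)) \<partial>PiM (insert i I) (\<lambda>_. N)) =
      (\<integral>\<^sup>+x. (\<integral>\<^sup>+y. f (\<lambda>j\<in>insert i I. T ((x(i := y)) j)) \<partial>N) \<partial>PiM I (\<lambda>_. N))"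
    by (rule product_nn_integral_insert[OF insert.hyps]) measurable
  also have "\<dots> = (\<integral>\<^sup>+x. (\<integral>\<^sup>+y. f ((\<lambda>j\<in>I. T (x j))(i := T y)) \<partial>N) \<partial>PiM I (\<lambda>_. N))"
    unfolding upd ..
  also have "\<dots> = (\<integral>\<^sup>+x. F (\<lambda>j\<in>I. T (x j)) \<partial>PiM I (\<lambda>_. N))"
    unfolding F_def
  proof (rule nn_integral_cong)
    fix x assume x: "x \<in> space (PiM I (\<lambda>_. N))"
    have "(\<lambda>j\<in>I. T (x j)) \<in> space (PiM I (\<lambda>_. borel))" by (auto simp: space_PiM)
    then have "(\<lambda>y. f ((\<lambda>j\<in>I. T (x j))(i := y))) \<in> borel_measurable borel"
      by measurable
    from tr[OF this] show "(\<integral>\<^sup>+y. f ((\<lambda>j\<in>I. T (x j))(i := T y)) \<partial>N) = (\<integral>\<^sup>+y. f ((\<lambda>j\<in>I. T (x j))(i := y)) * \<rho> y \<partial>N)" .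
  qed
  also have "\<dots> = (\<integral>\<^sup>+x. F x * (\<Prod>j\<in>I. \<rho> (x j)) \<partial>PiM I (\<lambda>_. N))"
    by (rule insert.IH) measurable
  also have "\<dots> = (\<integral>\<^sup>+x. (\<integral>\<^sup>+y. f (x(i := y)) * (\<rho> y * (\<Prod>j\<in>I. \<rho> (x j))) \<partial>N) \<partial>PiM I (\<lambda>_. N))"
  proof (rule nn_integral_cong)
    fix x assume "x \<in> space (PiM I (\<lambda>_. N))"
    then have "x \<in> space (PiM I (\<lambda>_. borel))" using sets_eq_imp_space_eq[OF setsP, of I] by simp
    then have "(\<lambda>y. f (x(i := y))) \<in> borel_measurable borel" by measurable
    then have [measurable]: "(\<lambda>y. f (x(i := y))) \<in> borel_measurable N"
      by (simp cong: measurable_cong_sets add: N(2))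
    show "F x * (\<Prod>j\<in>I. \<rho> (x j)) = (\<integral>\<^sup>+y. f (x(i := y)) * (\<rho> y * (\<Prod>j\<in>I. \<rho> (x j))) \<partial>N)"
      unfolding F_def by (subst nn_integral_multc[symmetric]) (simp_all add: mult.assoc)
  qed
  also have "\<dots> = (\<integral>\<^sup>+x. f x * (\<Prod>j\<in>insert i I. \<rho> (x j)) \<partial>PiM (insert i I) (\<lambda>_. N))"
    unfolding prd[symmetric] by (rule product_nn_integral_insert[OF insert.hyps, symmetric]) measurable
  finally show ?case .
qed

lemma (in prob_space) nn_integral_indep_normal:
  fixes X :: "nat \<Rightarrow> 'a \<Rightarrow> real"
  assumes ind: "indep_vars (\<lambda>_. borel) X {..<n}" and n: "0 < n"
    and X: "\<And>i. i < n \<Longrightarrow> distributed M lborel (X i) (\<lambda>z. ennreal (normal_density 0 \<sigma> z))"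
    and f[measurable]: "f \<in> borel_measurable (PiM {..<n} (\<lambda>_. borel))"
  shows "(\<integral>\<^sup>+\<omega>. f (\<lambda>i\<in>{..<n}. X i \<omega>) \<partial>M) =
    (\<integral>\<^sup>+x. f x \<partial>PiM {..<n} (\<lambda>_. density lborel (\<lambda>z. ennreal (normal_density 0 \<sigma> z))))"
proof -
  have rv: "random_variable borel (X i)" if "i \<in> {..<n}" for i
    using ind that by (auto simp: indep_vars_def)
  have "distr M borel (X i) = density lborel (\<lambda>z. ennreal (normal_density 0 \<sigma> z))" if "i \<in> {..<n}" for i
  proof -
    have "distr M borel (X i) = distr M lborel (X i)" by (intro distr_cong) auto
    then show ?thesis using X[of i] that by (simp add: distributed_def)
  qed
  then have "PiM {..<n} (\<lambda>i. distr M borel (X i)) = PiM {..<n} (\<lambda>_. density lborel (\<lambda>z. ennreal (normal_density 0 \<sigma> z)))"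
    by (intro PiM_cong) auto
  moreover have "distr M (PiM {..<n} (\<lambda>_. borel)) (\<lambda>\<omega>. \<lambda>i\<in>{..<n}. X i \<omega>) = PiM {..<n} (\<lambda>i. distr M borel (X i))"
    using indep_vars_iff_distr_eq_PiM'[where I = "{..<n}" and M' = "\<lambda>_. borel" and X = X] n rv ind by auto
  moreover have "(\<integral>\<^sup>+\<omega>. f (\<lambda>i\<in>{..<n}. X i \<omega>) \<partial>M) =
      (\<integral>\<^sup>+x. f x \<partial>distr M (PiM {..<n} (\<lambda>_. borel)) (\<lambda>\<omega>. \<lambda>i\<in>{..<n}. X i \<omega>))"
    by (subst nn_integral_distr) (auto intro!: measurable_restrict rv)
  ultimately show ?thesis by simp
qed

text \<open>Cameron-Martin: shifting the increments by \<open>c\<close> costs, up to a constant, the density \<open>exp (c s / \<sigma>\<^sup>2)\<close>, where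
  \<open>s\<close> is the endpoint of the walk; its mean over the symmetric pair \<open>x\<close>, \<open>-x\<close> is at least one.\<close>

lemma (in prob_space) tube_shift:
  fixes X :: "nat \<Rightarrow> 'a \<Rightarrow> real"
  assumes ind: "indep_vars (\<lambda>_. borel) X {..<n}" and n: "0 < n" and \<sigma>: "0 < \<sigma>"
    and X: "\<And>i. i < n \<Longrightarrow> distributed M lborel (X i) (\<lambda>z. ennreal (normal_density 0 \<sigma> z))"
  shows "exp (- (real n * c\<^sup>2 / (2 * \<sigma>\<^sup>2))) * prob {\<omega> \<in> space M. \<forall>k\<le>n. \<bar>\<Sum>i<k. X i \<omega>\<bar> \<le> m}
    \<le> prob {\<omega> \<in> space M. \<forall>k\<le>n. \<bar>(\<Sum>i<k. X i \<omega>) + real k * c\<bar> \<le> m}"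
proof -
  let ?N = "density lborel (\<lambda>z. ennreal (normal_density 0 \<sigma> z))"
  let ?P = "PiM {..<n} (\<lambda>_. ?N)"
  let ?B = "PiM {..<n} (\<lambda>_. borel :: real measure)"
  interpret N: prob_space ?N by (rule prob_space_normal_density[OF \<sigma>])
  define K where "K = exp (- (real n * c\<^sup>2 / (2 * \<sigma>\<^sup>2)))"
  define \<theta> where "\<theta> = c / \<sigma>\<^sup>2"
  define f :: "(nat \<Rightarrow> real) \<Rightarrow> ennreal" where "f x = indicator {x. \<forall>k\<le>n. \<bar>\<Sum>i<k. x i\<bar> \<le> m} x" for x
  have sm: "(\<lambda>x. \<Sum>i<k. x i) \<in> borel_measurable ?B" if "k \<le> n" for k
    using that by (intro borel_measurable_sum measurable_component_singleton) auto
  have f[measurable]: "f \<in> borel_measurable ?B"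
  proof -
    have "{x \<in> space ?B. \<forall>k\<in>{..n}. \<bar>\<Sum>i<k. x i\<bar> \<le> m} \<in> sets ?B"
    proof (intro sets.sets_Collect_finite_All')
      fix k assume "k \<in> {..n}"
      then have [measurable]: "(\<lambda>x. \<Sum>i<k. x i) \<in> borel_measurable ?B" by (intro sm) simp
      show "{x \<in> space ?B. \<bar>\<Sum>i<k. x i\<bar> \<le> m} \<in> sets ?B" by measurable
    qed auto
    then have "indicator {x \<in> space ?B. \<forall>k\<in>{..n}. \<bar>\<Sum>i<k. x i\<bar> \<le> m} \<in> borel_measurable ?B" by simp
    then show ?thesis
      by (rule measurable_cong[THEN iffD1, rotated]) (auto simp: f_def indicator_def)
  qed
  have S[measurable]: "(\<lambda>x. \<Sum>i<n. x i) \<in> borel_measurable ?B" by (rule sm) simp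
  have setsP[measurable_cong]: "sets ?P = sets ?B" by (intro sets_PiM_cong) auto
  define \<rho> :: "real \<Rightarrow> ennreal" where "\<rho> x = ennreal (exp (\<theta> * x - c\<^sup>2 / (2 * \<sigma>\<^sup>2)))" for x
  have shift: "(\<integral>\<^sup>+x. g (x + c) \<partial>?N) = (\<integral>\<^sup>+x. g x * \<rho> x \<partial>?N)"
    if [measurable]: "g \<in> borel_measurable borel" for g
  proof -
    have "normal_density 0 \<sigma> (x - c) = normal_density 0 \<sigma> x * exp (\<theta> * x - c\<^sup>2 / (2 * \<sigma>\<^sup>2))" for x
      using \<sigma> by (simp add: normal_density_def \<theta>_def exp_add[symmetric] field_simps power2_eq_square)
    then have d: "ennreal (normal_density 0 \<sigma> (x - c)) = ennreal (normal_density 0 \<sigma> x) * \<rho> x" for x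
      using \<sigma> by (simp add: \<rho>_def ennreal_mult)
    have "(\<integral>\<^sup>+x. g (x + c) \<partial>?N) = (\<integral>\<^sup>+x. ennreal (normal_density 0 \<sigma> x) * g (x + c) \<partial>lborel)"
      by (simp add: nn_integral_density)
    also have "\<dots> = (\<integral>\<^sup>+x. ennreal (normal_density 0 \<sigma> (x - c)) * g x \<partial>lborel)"
      using nn_integral_real_affine[of "\<lambda>x. ennreal (normal_density 0 \<sigma> (x - c)) * g x" 1 c]
      by (simp add: add.commute)
    also have "\<dots> = (\<integral>\<^sup>+x. g x * \<rho> x \<partial>?N)"
      by (simp add: nn_integral_density d \<rho>_def mult_ac)
    finally show ?thesis .
  qed
  have refl: "(\<integral>\<^sup>+x. g (- x) \<partial>?N) = (\<integral>\<^sup>+x. g x * 1 \<partial>?N)"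
    if [measurable]: "g \<in> borel_measurable borel" for g
  proof -
    have "normal_density 0 \<sigma> (-x) = normal_density 0 \<sigma> x" for x by (simp add: normal_density_def)
    then show ?thesis
      using nn_integral_real_affine[of "\<lambda>x. ennreal (normal_density 0 \<sigma> x) * g x" "-1" 0]
      by (simp add: nn_integral_density)
  qed
  \<comment> \<open>The one-step densities multiply to a function of the endpoint alone;
    \<open>K\<close> collects the quadratic terms.\<close>
  have prod\<rho>: "(\<Prod>i<n. \<rho> (x i)) = ennreal (K * exp (\<theta> * (\<Sum>i<n. x i)))" for x
    by (simp add: \<rho>_def prod_ennreal exp_sum[symmetric] K_def exp_add[symmetric] sum_subtractf sum_distrib_left)
  have sf: "sigma_finite_measure ?N" by unfold_locales
  have f_shift[measurable]: "(\<lambda>x. f (\<lambda>i\<in>{..<n}. x i + c)) \<in> borel_measurable ?B"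
    by (rule measurable_compose[OF _ f]) (auto intro!: measurable_restrict)
  have K: "0 < K" by (simp add: K_def)
  let ?A0 = "{\<omega> \<in> space M. \<forall>k\<le>n. \<bar>\<Sum>i<k. X i \<omega>\<bar> \<le> m}"
  let ?A1 = "{\<omega> \<in> space M. \<forall>k\<le>n. \<bar>(\<Sum>i<k. X i \<omega>) + real k * c\<bar> \<le> m}"
  have rv: "random_variable borel (X i)" if "i < n" for i
    using ind that by (auto simp: indep_vars_def)
  have fX: "(\<lambda>\<omega>. f (\<lambda>i\<in>{..<n}. X i \<omega>)) \<in> borel_measurable M"
    by (rule measurable_compose[OF _ f]) (auto intro!: measurable_restrict rv)
  have fXc: "(\<lambda>\<omega>. f (\<lambda>i\<in>{..<n}. (\<lambda>i\<in>{..<n}. X i \<omega>) i + c)) \<in> borel_measurable M"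
    by (rule measurable_compose[OF _ f_shift], rule measurable_restrict) (auto intro: rv)
  have sum0: "(\<Sum>i<k. (\<lambda>i\<in>{..<n}. x i) i) = (\<Sum>i<k. x i)" if "k \<le> n" for k and x :: "nat \<Rightarrow> real"
    using that by (intro sum.cong) auto
  have f0: "f (\<lambda>i\<in>{..<n}. X i \<omega>) = indicator ?A0 \<omega>" if "\<omega> \<in> space M" for \<omega>
    using that by (auto simp: f_def indicator_def sum0)
  have sum1: "(\<Sum>i<k. (\<lambda>i\<in>{..<n}. (\<lambda>i\<in>{..<n}. x i) i + c) i) = (\<Sum>i<k. x i) + real k * c" if "k \<le> n" for k and x :: "nat \<Rightarrow> real"
  proof -
    have "(\<Sum>i<k. (\<lambda>i\<in>{..<n}. (\<lambda>i\<in>{..<n}. x i) i + c) i) = (\<Sum>i<k. x i + c)"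
      using that by (intro sum.cong) auto
    then show ?thesis by (simp add: sum.distrib)
  qed
  have f1: "f (\<lambda>i\<in>{..<n}. (\<lambda>i\<in>{..<n}. X i \<omega>) i + c) = indicator ?A1 \<omega>" if "\<omega> \<in> space M" for \<omega>
  proof -
    have "(\<forall>k\<le>n. \<bar>\<Sum>i<k. (\<lambda>i\<in>{..<n}. (\<lambda>i\<in>{..<n}. X i \<omega>) i + c) i\<bar> \<le> m) \<longleftrightarrow>
        (\<forall>k\<le>n. \<bar>(\<Sum>i<k. X i \<omega>) + real k * c\<bar> \<le> m)"
      by (rule all_cong) (simp only: sum1)
    then show ?thesis using that by (simp only: f_def indicator_def mem_Collect_eq simp_thms)
  qed
  have sets0: "?A0 \<in> sets M"
  proof -
    have "(indicator ?A0 :: 'a \<Rightarrow> ennreal) \<in> borel_measurable M"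
      using fX by (rule measurable_cong[THEN iffD1, rotated]) (rule f0)
    then have "indicator ?A0 -` {1 :: ennreal} \<inter> space M \<in> sets M" by (rule measurable_sets) simp
    also have "indicator ?A0 -` {1 :: ennreal} \<inter> space M = ?A0" by (auto simp: indicator_def)
    finally show ?thesis .
  qed
  have sets1: "?A1 \<in> sets M"
  proof -
    have "(indicator ?A1 :: 'a \<Rightarrow> ennreal) \<in> borel_measurable M"
      using fXc by (rule measurable_cong[THEN iffD1, rotated]) (rule f1)
    then have "indicator ?A1 -` {1 :: ennreal} \<inter> space M \<in> sets M" by (rule measurable_sets) simp
    also have "indicator ?A1 -` {1 :: ennreal} \<inter> space M = ?A1" by (auto simp: indicator_def)
    finally show ?thesis .
  qed
  have e0: "emeasure M ?A0 = (\<integral>\<^sup>+x. f x \<partial>?P)"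
  proof -
    have "emeasure M ?A0 = (\<integral>\<^sup>+\<omega>. f (\<lambda>i\<in>{..<n}. X i \<omega>) \<partial>M)"
      unfolding nn_integral_indicator[OF sets0, symmetric] by (rule nn_integral_cong) (rule f0[symmetric])
    then show ?thesis using nn_integral_indep_normal[OF ind n X f] by simp
  qed
  define h where "h x = f x * ennreal (K * exp (\<theta> * (\<Sum>i<n. x i)))" for x
  have h[measurable]: "h \<in> borel_measurable ?B" unfolding h_def by measurable
  have e1: "emeasure M ?A1 = (\<integral>\<^sup>+x. h x \<partial>?P)"
  proof -
    have "emeasure M ?A1 = (\<integral>\<^sup>+\<omega>. f (\<lambda>i\<in>{..<n}. (\<lambda>i\<in>{..<n}. X i \<omega>) i + c) \<partial>M)"
      unfolding nn_integral_indicator[OF sets1, symmetric] by (rule nn_integral_cong) (rule f1[symmetric])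
    also have "\<dots> = (\<integral>\<^sup>+x. f (\<lambda>i\<in>{..<n}. x i + c) \<partial>?P)"
      by (rule nn_integral_indep_normal[OF ind n X f_shift])
    also have "\<dots> = (\<integral>\<^sup>+x. f x * (\<Prod>i<n. \<rho> (x i)) \<partial>?P)"
      by (rule nn_integral_PiM_transform[OF sf _ _ _ shift _ f]) (auto simp: \<rho>_def)
    finally show ?thesis by (simp add: prod\<rho> h_def)
  qed
  \<comment> \<open>Sign symmetry of the centred Gaussian. The tube indicator is even, so adding
    \<open>h\<close> and its mirror image leaves \<open>f\<close> times
    \<open>K * (exp s + exp (-s)) \<ge> 2 * K\<close>.\<close>
  have e2: "(\<integral>\<^sup>+x. h x \<partial>?P) = (\<integral>\<^sup>+x. h (\<lambda>i\<in>{..<n}. - x i) \<partial>?P)"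
  proof -
    have "(\<integral>\<^sup>+x. h (\<lambda>i\<in>{..<n}. - x i) \<partial>?P) = (\<integral>\<^sup>+x. h x * (\<Prod>i<n. (\<lambda>_. 1) (x i)) \<partial>?P)"
      by (rule nn_integral_PiM_transform[OF sf _ _ _ refl _ h]) auto
    then show ?thesis by (simp only: prod.neutral_const mult_1_right)
  qed
  have hneg: "h (\<lambda>i\<in>{..<n}. - x i) = f x * ennreal (K * exp (- \<theta> * (\<Sum>i<n. x i)))" for x
  proof -
    have "(\<Sum>i<k. (\<lambda>i\<in>{..<n}. - x i) i) = - (\<Sum>i<k. x i)" if "k \<le> n" for k
      using sum0[OF that, of "\<lambda>i. - x i"] by (simp add: sum_negf)
    then show ?thesis by (auto simp: h_def f_def indicator_def)
  qed
  have "ennreal K * emeasure M ?A0 + ennreal K * emeasure M ?A0 = (\<integral>\<^sup>+x. f x * ennreal K + f x * ennreal K \<partial>?P)"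
  proof -
    have [measurable]: "f \<in> borel_measurable ?P" by measurable
    show ?thesis unfolding e0 by (simp add: nn_integral_add nn_integral_multc mult.commute[of "ennreal K"])
  qed
  also have "\<dots> \<le> (\<integral>\<^sup>+x. h x + h (\<lambda>i\<in>{..<n}. - x i) \<partial>?P)"
  proof (intro nn_integral_mono)
    fix x
    define s where "s = \<theta> * (\<Sum>i<n. x i)"
    have "2 \<le> exp s + exp (-s)"
      using exp_ge_add_one_self[of s] exp_ge_add_one_self[of "-s"] by linarith
    then have "K * 2 \<le> K * (exp s + exp (-s))" using K by (intro mult_left_mono) auto
    then have "ennreal (K + K) \<le> ennreal (K * exp s + K * exp (-s))"
      by (intro ennreal_leI) (simp add: distrib_left)
    then have "f x * (ennreal K + ennreal K) \<le> f x * (ennreal (K * exp s) + ennreal (K * exp (-s)))"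
      using K by (intro mult_left_mono) (simp_all add: ennreal_plus[symmetric] del: ennreal_plus)
    then show "f x * ennreal K + f x * ennreal K \<le> h x + h (\<lambda>i\<in>{..<n}. - x i)"
      unfolding hneg by (simp add: h_def s_def distrib_left)
  qed
  also have "\<dots> = (\<integral>\<^sup>+x. h x \<partial>?P) + (\<integral>\<^sup>+x. h (\<lambda>i\<in>{..<n}. - x i) \<partial>?P)"
    unfolding hneg by (intro nn_integral_add) (auto simp: hneg)
  also have "\<dots> = emeasure M ?A1 + emeasure M ?A1" unfolding e1 e2[symmetric] ..
  finally have "ennreal (K * prob ?A0 + K * prob ?A0) \<le> ennreal (prob ?A1 + prob ?A1)"
    using K by (simp add: emeasure_eq_measure ennreal_mult[symmetric] ennreal_plus[symmetric] del: ennreal_plus)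
  then show ?thesis using K by (simp add: K_def[symmetric])
qed

text \<open>Optional stopping for the exponential martingale; truncation at level \<open>y + \<epsilon>\<close> handles the overshoot.\<close>

lemma (in prob_space) walk_exit_below:
  fixes X :: "nat \<Rightarrow> 'a \<Rightarrow> real"
  assumes ind: "indep_vars (\<lambda>_. borel) X {..<n}"
    and mgf: "\<And>i. i < n \<Longrightarrow> (\<integral>\<^sup>+\<omega>. ennreal (exp (\<beta> * X i \<omega>)) \<partial>M) = 1"
    and tail: "\<And>i. i < n \<Longrightarrow> (\<integral>\<^sup>+\<omega>. ennreal (exp (\<beta> * X i \<omega>) * indicator {\<epsilon><..} (X i \<omega>)) \<partial>M) \<le> ennreal \<eta>"
    and \<beta>: "0 < \<beta>" and \<epsilon>: "0 < \<epsilon>" and \<eta>: "0 \<le> \<eta>" and c: "c < z" "z < y"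
  shows "prob {\<omega> \<in> space M. \<exists>k\<le>n. z + (\<Sum>i<k. X i \<omega>) \<le> c \<and> (\<forall>j\<le>k. z + (\<Sum>i<j. X i \<omega>) < y)}
      * (exp (\<beta> * (y + \<epsilon>)) - exp (\<beta> * c))
    \<le> exp (\<beta> * (y + \<epsilon>)) - exp (\<beta> * z) + real n * (exp (\<beta> * y) * \<eta>)"
proof -
  define Z where "Z k \<omega> = z + (\<Sum>i<k. X i \<omega>)" for k \<omega>
  define Y where "Y = exp (\<beta> * (y + \<epsilon>))"
  define al where "al k \<omega> \<longleftrightarrow> (\<forall>j\<le>k. c < Z j \<omega> \<and> Z j \<omega> < y)" for k \<omega>
  \<comment> \<open>\<open>U\<close> is \<open>Y - exp (\<beta> * Z)\<close> stopped when the walk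
    leaves the open interval from \<open>c\<close> to \<open>y\<close>, and cut off at 0 when it
    lands beyond \<open>y + \<epsilon>\<close>; \<open>al k\<close> says that no exit has happened
    up to and including step \<open>k\<close>.\<close>
  define U where "U = rec_nat (\<lambda>\<omega>. Y - exp (\<beta> * z))
     (\<lambda>k u \<omega>. if al k \<omega> then max 0 (Y - exp (\<beta> * Z (Suc k) \<omega>)) else u \<omega>)"
  have U_0: "U 0 = (\<lambda>\<omega>. Y - exp (\<beta> * z))"
    and U_Suc: "U (Suc k) = (\<lambda>\<omega>. if al k \<omega> then max 0 (Y - exp (\<beta> * Z (Suc k) \<omega>)) else U k \<omega>)" for k
    unfolding U_def by simp_all
  have Yy: "exp (\<beta> * y) \<le> Y" using \<beta> \<epsilon> by (simp add: Y_def)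
  have U_nonneg: "0 \<le> U k \<omega>" for k \<omega>
  proof (induction k)
    case 0
    have "exp (\<beta> * z) \<le> exp (\<beta> * y)" using \<beta> c by simp
    then show ?case unfolding U_0 using Yy by linarith
  qed (simp add: U_Suc)
  have U_al: "U k \<omega> = Y - exp (\<beta> * Z k \<omega>)" if "al k \<omega>" for k \<omega>
  proof (cases k)
    case 0 then show ?thesis by (simp add: U_0 Z_def)
  next
    case (Suc j)
    have "al j \<omega>" using that Suc by (simp add: al_def)
    moreover have "exp (\<beta> * Z k \<omega>) \<le> exp (\<beta> * y)" using that \<beta> by (auto simp: al_def)
    then have "exp (\<beta> * Z k \<omega>) \<le> Y" using Yy by linarith
    ultimately show ?thesis using Suc by (simp add: U_Suc)
  qed
  have X: "random_variable borel (X i)" if "i < n" for i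
    using ind that by (auto simp: indep_vars_def)
  have meas_Z: "Z k \<in> borel_measurable (past M borel X m)" if "k \<le> m" "m \<le> n" for k m
    unfolding Z_def using that by (intro borel_measurable_add borel_measurable_sum measurable_past X) auto
  have meas_Z': "Z k \<in> borel_measurable M" if "k \<le> n" for k
    unfolding Z_def using that by (intro borel_measurable_add borel_measurable_sum X) auto
  have meas_al: "Measurable.pred N (al k)" if "\<And>j. j \<le> k \<Longrightarrow> Z j \<in> borel_measurable N" for k N
  proof -
    have "Measurable.pred N (\<lambda>\<omega>. \<forall>j\<in>{..k}. c < Z j \<omega> \<and> Z j \<omega> < y)"
    proof (intro pred_intros_finite)
      fix j assume "j \<in> {..k}"
      then have [measurable]: "Z j \<in> borel_measurable N" by (intro that) simp
      show "Measurable.pred N (\<lambda>\<omega>. c < Z j \<omega> \<and> Z j \<omega> < y)" by measurable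
    qed simp
    moreover have "al k = (\<lambda>\<omega>. \<forall>j\<in>{..k}. c < Z j \<omega> \<and> Z j \<omega> < y)" by (auto simp: al_def fun_eq_iff)
    ultimately show ?thesis by (simp only:)
  qed
  have meas_U: "U k \<in> borel_measurable M" if "k \<le> n" for k
    using that
  proof (induction k)
    case (Suc k)
    then have [measurable]: "U k \<in> borel_measurable M" "Z (Suc k) \<in> borel_measurable M" "Measurable.pred M (al k)"
      by (auto intro!: meas_Z' meas_al)
    show ?case unfolding U_Suc by measurable
  qed (simp add: U_0)
  have step: "(\<integral>\<^sup>+\<omega>. ennreal (U (Suc k) \<omega>) \<partial>M) \<le> (\<integral>\<^sup>+\<omega>. ennreal (U k \<omega>) \<partial>M) + ennreal (exp (\<beta> * y) * \<eta>)"
    if k: "k < n" for k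
  proof -
    have [measurable]: "U k \<in> borel_measurable M" "U (Suc k) \<in> borel_measurable M" "Z k \<in> borel_measurable M"
      "Measurable.pred M (al k)" "X k \<in> borel_measurable M"
      using k by (auto intro!: meas_Z' meas_al meas_U X)
    have [measurable]: "Z k \<in> borel_measurable (past M borel X k)" "Measurable.pred (past M borel X k) (al k)"
      using k by (auto intro!: meas_Z meas_al)
    define p where "p \<omega> = ennreal (if al k \<omega> then exp (\<beta> * Z k \<omega>) else 0)" for \<omega>
    have p_past: "p \<in> borel_measurable (past M borel X k)" unfolding p_def by measurable
    have [measurable]: "p \<in> borel_measurable M" unfolding p_def by measurable
    define r where "r \<omega> = exp (\<beta> * X k \<omega>) * indicator {\<epsilon><..} (X k \<omega>)" for \<omega>
    have [measurable]: "r \<in> borel_measurable M" unfolding r_def by measurable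
    have r: "0 \<le> r \<omega>" for \<omega> by (simp add: r_def)
    \<comment> \<open>Written without subtraction so that it can be integrated in
      \<open>ennreal\<close>. Truncation matters only when the walk lands beyond
      \<open>y + \<epsilon>\<close>; the jump then exceeds \<epsilon> and its cost is at most
      \<open>exp (\<beta> * y) * r \<omega>\<close>.\<close>
    have pw: "U (Suc k) \<omega> + (if al k \<omega> then exp (\<beta> * Z k \<omega>) else 0) * exp (\<beta> * X k \<omega>)
        \<le> U k \<omega> + (if al k \<omega> then exp (\<beta> * Z k \<omega>) else 0) + exp (\<beta> * y) * r \<omega>" for \<omega>
    proof (cases "al k \<omega>")
      case False
      then show ?thesis using r by (simp add: U_Suc)
    next
      case True
      have Zs: "Z (Suc k) \<omega> = Z k \<omega> + X k \<omega>" by (simp add: Z_def)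
      have e: "exp (\<beta> * Z k \<omega>) * exp (\<beta> * X k \<omega>) = exp (\<beta> * Z (Suc k) \<omega>)"
        by (simp add: Zs exp_add[symmetric] distrib_left)
      show ?thesis
      proof (cases "exp (\<beta> * Z (Suc k) \<omega>) \<le> Y")
        case le: True
        then show ?thesis using True U_al[OF True] e r by (simp add: U_Suc)
      next
        case gt: False
        then have "y + \<epsilon> < Z (Suc k) \<omega>" using \<beta> by (simp add: Y_def)
        moreover have "Z k \<omega> < y" using True by (simp add: al_def)
        ultimately have "\<epsilon> < X k \<omega>" using Zs by simp
        then have "r \<omega> = exp (\<beta> * X k \<omega>)" by (simp add: r_def)
        moreover have "exp (\<beta> * Z k \<omega>) * exp (\<beta> * X k \<omega>) \<le> exp (\<beta> * y) * exp (\<beta> * X k \<omega>)"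
          using \<open>Z k \<omega> < y\<close> \<beta> by (intro mult_right_mono) auto
        ultimately have "exp (\<beta> * Z k \<omega>) * exp (\<beta> * X k \<omega>) \<le> exp (\<beta> * y) * r \<omega>" by simp
        moreover have "U (Suc k) \<omega> = 0" using True gt by (simp add: U_Suc)
        moreover have "0 \<le> Y" by (simp add: Y_def)
        ultimately show ?thesis unfolding if_P[OF True] U_al[OF True] by linarith
      qed
    qed
    have "(\<integral>\<^sup>+\<omega>. ennreal (U (Suc k) \<omega>) \<partial>M) + (\<integral>\<^sup>+\<omega>. p \<omega> * ennreal (exp (\<beta> * X k \<omega>)) \<partial>M) =
        (\<integral>\<^sup>+\<omega>. ennreal (U (Suc k) \<omega>) + p \<omega> * ennreal (exp (\<beta> * X k \<omega>)) \<partial>M)"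
      by (intro nn_integral_add[symmetric]) auto
    also have "\<dots> \<le> (\<integral>\<^sup>+\<omega>. ennreal (U k \<omega>) + p \<omega> + ennreal (exp (\<beta> * y)) * ennreal (r \<omega>) \<partial>M)"
    proof (intro nn_integral_mono)
      fix \<omega>
      show "ennreal (U (Suc k) \<omega>) + p \<omega> * ennreal (exp (\<beta> * X k \<omega>))
        \<le> ennreal (U k \<omega>) + p \<omega> + ennreal (exp (\<beta> * y)) * ennreal (r \<omega>)"
        using ennreal_leI[OF pw[of \<omega>]] U_nonneg[of k \<omega>] U_nonneg[of "Suc k" \<omega>] r[of \<omega>]
        by (auto simp: p_def ennreal_plus ennreal_mult split: if_splits)
    qed
    also have "\<dots> = (\<integral>\<^sup>+\<omega>. ennreal (U k \<omega>) \<partial>M) + (\<integral>\<^sup>+\<omega>. p \<omega> \<partial>M) + ennreal (exp (\<beta> * y)) * (\<integral>\<^sup>+\<omega>. ennreal (r \<omega>) \<partial>M)"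
      by (simp add: nn_integral_add nn_integral_cmult)
    also have "\<dots> \<le> (\<integral>\<^sup>+\<omega>. ennreal (U k \<omega>) \<partial>M) + (\<integral>\<^sup>+\<omega>. p \<omega> \<partial>M) + ennreal (exp (\<beta> * y)) * ennreal \<eta>"
      unfolding r_def using tail[OF k] by (intro add_left_mono mult_left_mono) auto
    also have "(\<integral>\<^sup>+\<omega>. p \<omega> * ennreal (exp (\<beta> * X k \<omega>)) \<partial>M) = (\<integral>\<^sup>+\<omega>. p \<omega> \<partial>M)"
      using nn_integral_past_mult[OF ind k p_past, of "\<lambda>x. ennreal (exp (\<beta> * x))"] mgf[OF k] by simp
    finally have *: "(\<integral>\<^sup>+\<omega>. p \<omega> \<partial>M) + (\<integral>\<^sup>+\<omega>. ennreal (U (Suc k) \<omega>) \<partial>M) \<le>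
      (\<integral>\<^sup>+\<omega>. p \<omega> \<partial>M) + ((\<integral>\<^sup>+\<omega>. ennreal (U k \<omega>) \<partial>M) + ennreal (exp (\<beta> * y) * \<eta>))"
      using \<eta> by (simp add: ennreal_mult add_ac)
    \<comment> \<open>Cancelling the integral of \<open>p\<close> requires that it be finite: while
      alive the walk lies below \<open>y\<close>.\<close>
    have "(\<integral>\<^sup>+\<omega>. p \<omega> \<partial>M) \<le> (\<integral>\<^sup>+\<omega>. ennreal (exp (\<beta> * y)) \<partial>M)"
      using \<beta> by (intro nn_integral_mono) (auto simp: p_def al_def intro!: ennreal_leI)
    also have "\<dots> < \<infinity>" by (simp add: emeasure_space_1)
    finally have "(\<integral>\<^sup>+\<omega>. p \<omega> \<partial>M) \<noteq> \<infinity>" by simp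
    with * show ?thesis by (simp add: ennreal_add_left_cancel_le)
  qed
  have tot: "(\<integral>\<^sup>+\<omega>. ennreal (U k \<omega>) \<partial>M) \<le> ennreal (Y - exp (\<beta> * z) + real k * (exp (\<beta> * y) * \<eta>))" if "k \<le> n" for k
    using that
  proof (induction k)
    case 0 then show ?case by (simp add: U_0 emeasure_space_1)
  next
    case (Suc k)
    have "(\<integral>\<^sup>+\<omega>. ennreal (U (Suc k) \<omega>) \<partial>M) \<le> ennreal (Y - exp (\<beta> * z) + real k * (exp (\<beta> * y) * \<eta>)) + ennreal (exp (\<beta> * y) * \<eta>)"
      using Suc step[of k] by (auto intro: order_trans add_right_mono)
    also have "\<dots> = ennreal (Y - exp (\<beta> * z) + real (Suc k) * (exp (\<beta> * y) * \<eta>))"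
      using U_nonneg[of 0] \<eta>
      by (subst ennreal_plus[symmetric]) (auto simp: U_0 algebra_simps intro!: add_increasing2)
    finally show ?case .
  qed
  let ?D = "{\<omega> \<in> space M. \<exists>k\<le>n. Z k \<omega> \<le> c \<and> (\<forall>j\<le>k. Z j \<omega> < y)}"
  have U_down: "Y - exp (\<beta> * c) \<le> U n \<omega>" if "\<omega> \<in> ?D" for \<omega>
  proof -
    from that obtain k where k: "k \<le> n" "Z k \<omega> \<le> c" "\<And>j. j \<le> k \<Longrightarrow> Z j \<omega> < y" by auto
    \<comment> \<open>First passage to \<open>c\<close> or below. It is not 0 because the walk
      starts at \<open>z > c\<close>, so the walk is alive at step \<open>m - 1\<close> and
      \<open>U\<close> is updated for the last time at \<open>m\<close>.\<close>
    define m where "m = (LEAST j. Z j \<omega> \<le> c)"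
    have m: "Z m \<omega> \<le> c" unfolding m_def by (rule LeastI[of _ k]) fact
    have mk: "m \<le> k" unfolding m_def by (rule Least_le) fact
    have before: "c < Z j \<omega>" if "j < m" for j using not_less_Least[of j "\<lambda>j. Z j \<omega> \<le> c"] that by (auto simp: m_def)
    have "m \<noteq> 0"
    proof
      assume "m = 0"
      then show False using m c by (simp add: Z_def)
    qed
    then obtain l where l: "m = Suc l" by (cases m) auto
    have "al l \<omega>" unfolding al_def using before k(3) mk l by auto
    moreover have "exp (\<beta> * Z m \<omega>) \<le> exp (\<beta> * c)" using m \<beta> by simp
    ultimately have "Y - exp (\<beta> * c) \<le> U m \<omega>" unfolding l U_Suc by (auto intro: max.coboundedI2)
    moreover have "U (m + i) \<omega> = U m \<omega>" for i
    proof (induction i)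
      case (Suc i)
      have "\<not> al (m + i) \<omega>" using m by (auto simp: al_def intro!: exI[of _ m])
      then show ?case using Suc by (simp add: U_Suc)
    qed simp
    from this[of "n - m"] have "U n \<omega> = U m \<omega>" using mk k by simp
    ultimately show ?thesis by simp
  qed
  have D: "?D \<in> sets M"
  proof -
    have "?D = (\<Union>k\<in>{..n}. {\<omega> \<in> space M. Z k \<omega> \<le> c} \<inter> (\<Inter>j\<in>{..k}. {\<omega> \<in> space M. Z j \<omega> < y}))"
      by auto
    moreover have "{\<omega> \<in> space M. Z k \<omega> \<le> c} \<in> sets M" "{\<omega> \<in> space M. Z k \<omega> < y} \<in> sets M" if "k \<le> n" for k
      using meas_Z'[OF that] by measurable
    ultimately show ?thesis
      by (auto intro!: sets.finite_UN sets.Int sets.finite_INT)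
  qed
  have Yc: "0 \<le> Y - exp (\<beta> * c)"
  proof -
    have "exp (\<beta> * c) \<le> exp (\<beta> * y)" using \<beta> c by simp
    then show ?thesis using Yy by linarith
  qed
  have "ennreal (Y - exp (\<beta> * c)) * emeasure M ?D = (\<integral>\<^sup>+\<omega>. ennreal (Y - exp (\<beta> * c)) * indicator ?D \<omega> \<partial>M)"
    by (rule nn_integral_cmult_indicator[OF D, symmetric])
  also have "\<dots> \<le> (\<integral>\<^sup>+\<omega>. ennreal (U n \<omega>) \<partial>M)"
    using U_down by (intro nn_integral_mono) (auto simp: indicator_def intro!: ennreal_leI)
  also have "\<dots> \<le> ennreal (Y - exp (\<beta> * z) + real n * (exp (\<beta> * y) * \<eta>))" by (rule tot) simp
  finally have "ennreal ((Y - exp (\<beta> * c)) * prob ?D) \<le> ennreal (Y - exp (\<beta> * z) + real n * (exp (\<beta> * y) * \<eta>))"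
    using Yc by (simp add: emeasure_eq_measure ennreal_mult)
  moreover have "0 \<le> Y - exp (\<beta> * z) + real n * (exp (\<beta> * y) * \<eta>)"
    using U_nonneg[of 0] \<eta> by (auto simp: U_0)
  ultimately have "(Y - exp (\<beta> * c)) * prob ?D \<le> Y - exp (\<beta> * z) + real n * (exp (\<beta> * y) * \<eta>)"
    by (simp add: ennreal_le_iff)
  then show ?thesis by (simp add: Y_def Z_def mult.commute)
qed

section \<open>Brownian motion\<close>

text \<open>Needed for time reversal, which lists the increments in the opposite order.\<close>

lemma (in prob_space) indep_vars_reindex:
  assumes ind: "indep_vars (\<lambda>_. N) X I" and \<pi>: "inj_on \<pi> J" "\<pi> ` J \<subseteq> I"
  shows "indep_vars (\<lambda>_. N) (\<lambda>j. X (\<pi> j)) J"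
  unfolding indep_vars_def2
proof
  show "\<forall>j\<in>J. random_variable N (X (\<pi> j))" using ind \<pi> by (auto simp: indep_vars_def2)
  let ?F = "\<lambda>i. {X i -` A \<inter> space M |A. A \<in> sets N}"
  have F: "indep_sets ?F I" using ind by (simp add: indep_vars_def2)
  show "indep_sets (\<lambda>j. ?F (\<pi> j)) J"
  proof (rule indep_setsI)
    fix j assume "j \<in> J"
    then show "?F (\<pi> j) \<subseteq> events" using F \<pi> unfolding indep_sets_def by auto
  next
    fix A K assume K: "K \<noteq> {}" "K \<subseteq> J" "finite K" "\<forall>j\<in>K. A j \<in> ?F (\<pi> j)"
    have inj: "inj_on \<pi> K" using \<pi> K by (meson inj_on_subset)
    define A' where "A' i = A (the_inv_into K \<pi> i)" for i
    have A': "A' (\<pi> j) = A j" if "j \<in> K" for j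
      using that inj by (simp add: A'_def the_inv_into_f_f)
    have "prob (\<Inter>i\<in>\<pi> ` K. A' i) = (\<Prod>i\<in>\<pi> ` K. prob (A' i))"
    proof (rule indep_setsD[OF F])
      show "\<pi> ` K \<subseteq> I" using K \<pi> by blast
    qed (use K A' in auto)
    then show "prob (\<Inter>j\<in>K. A j) = (\<Prod>j\<in>K. prob (A j))"
      using inj A' by (simp add: prod.reindex)
  qed
qed

text \<open>Fatou: moment bounds that are uniform over the grids survive in continuous time.\<close>

lemma nn_integral_lim_le:
  assumes "\<And>n. u n \<in> borel_measurable M" "\<And>\<omega>. \<omega> \<in> space M \<Longrightarrow> (\<lambda>n. u n \<omega>) \<longlonglongrightarrow> v \<omega>"
    and "\<And>n. (\<integral>\<^sup>+\<omega>. ennreal (u n \<omega>) \<partial>M) \<le> C"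
  shows "(\<integral>\<^sup>+\<omega>. ennreal (v \<omega>) \<partial>M) \<le> C"
proof -
  have "(\<integral>\<^sup>+\<omega>. ennreal (v \<omega>) \<partial>M) = (\<integral>\<^sup>+\<omega>. liminf (\<lambda>n. ennreal (u n \<omega>)) \<partial>M)"
  proof (rule nn_integral_cong)
    fix \<omega> assume "\<omega> \<in> space M"
    then have "(\<lambda>n. ennreal (u n \<omega>)) \<longlonglongrightarrow> ennreal (v \<omega>)" using assms(2) by (intro tendsto_ennrealI)
    then show "ennreal (v \<omega>) = liminf (\<lambda>n. ennreal (u n \<omega>))"
      by (simp add: lim_imp_Liminf)
  qed
  also have "\<dots> \<le> liminf (\<lambda>n. \<integral>\<^sup>+\<omega>. ennreal (u n \<omega>) \<partial>M)"
    using assms(1) by (intro nn_integral_liminf) auto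
  also have "\<dots> \<le> C"
    using assms(3) by (intro Liminf_le) (auto)
  finally show ?thesis .
qed

lemma run_sup_reflect: "run_sup (\<lambda>t. f (a + b - t)) a b = run_sup f a b"
proof -
  have "(\<lambda>t. a + b - t) ` {a..b} = {a..b}"
    by (auto simp: image_iff intro: bexI[of _ "a + b - _"])
  then have "f ` {a..b} = (\<lambda>t. f (a + b - t)) ` {a..b}" by (metis image_image)
  then show ?thesis by (simp add: run_sup_def)
qed

text \<open>Processes with the increments of \<open>\<surd>2\<close> times a Brownian motion on dyadic subdivisions.\<close>

locale gaussian_process = prob_space +
  fixes f :: "real \<Rightarrow> 'a \<Rightarrow> real" and a b :: real
  assumes ab: "a < b"
    and meas: "t \<in> {a..b} \<Longrightarrow> f t \<in> borel_measurable M"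
    and cont: "\<omega> \<in> space M \<Longrightarrow> continuous_on {a..b} (\<lambda>t. f t \<omega>)"
    and indep: "indep_vars (\<lambda>_. borel) (\<lambda>i \<omega>. f (grid a b n (Suc i)) \<omega> - f (grid a b n i) \<omega>) {..<2 ^ n}"
    and normal: "i < 2 ^ n \<Longrightarrow> distributed M lborel (\<lambda>\<omega>. f (grid a b n (Suc i)) \<omega> - f (grid a b n i) \<omega>)
        (\<lambda>z. ennreal (normal_density 0 (sqrt (2 * ((b - a) / 2 ^ n))) z))"
begin

lemma mesh_pos: "0 < (b - a) / 2 ^ n"
  using ab by simp

lemma sum_increments: "(\<Sum>i<k. f (grid a b n (Suc i)) \<omega> - f (grid a b n i) \<omega>) = f (grid a b n k) \<omega> - f a \<omega>"
  using sum_lessThan_telescope[of "\<lambda>i. f (grid a b n i) \<omega>" k] by simp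

lemma increment_mgf:
  assumes "i < 2 ^ n"
  shows "(\<integral>\<^sup>+\<omega>. ennreal (exp (c * (f (grid a b n (Suc i)) \<omega> - f (grid a b n i) \<omega>))) \<partial>M)
    = ennreal (exp (c\<^sup>2 * ((b - a) / 2 ^ n)))"
proof -
  define \<delta> where "\<delta> = (b - a) / 2 ^ n"
  have "0 < \<delta>" using mesh_pos[of n] by (simp add: \<delta>_def)
  then show ?thesis
    using nn_integral_exp_normal[OF normal[OF assms, folded \<delta>_def], of c] by (simp add: \<delta>_def[symmetric])
qed

lemma drifted_increment_mgf:
  assumes "i < 2 ^ n"
  shows "(\<integral>\<^sup>+\<omega>. ennreal (exp (c * (f (grid a b n (Suc i)) \<omega> - f (grid a b n i) \<omega> - d * ((b - a) / 2 ^ n)))) \<partial>M)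
    = ennreal (exp ((c\<^sup>2 - c * d) * ((b - a) / 2 ^ n)))"
proof -
  have m: "random_variable borel (\<lambda>\<omega>. f (grid a b n (Suc i)) \<omega> - f (grid a b n i) \<omega>)"
    using indep assms by (auto simp: indep_vars_def)
  have "(\<integral>\<^sup>+\<omega>. ennreal (exp (c * (f (grid a b n (Suc i)) \<omega> - f (grid a b n i) \<omega> - d * ((b - a) / 2 ^ n)))) \<partial>M) =
    (\<integral>\<^sup>+\<omega>. ennreal (exp (- (c * (d * ((b - a) / 2 ^ n))))) *
       ennreal (exp (c * (f (grid a b n (Suc i)) \<omega> - f (grid a b n i) \<omega>))) \<partial>M)"
    by (intro nn_integral_cong) (simp add: ennreal_mult[symmetric] exp_add[symmetric] algebra_simps)
  also have "\<dots> = ennreal (exp (- (c * (d * ((b - a) / 2 ^ n))))) * ennreal (exp (c\<^sup>2 * ((b - a) / 2 ^ n)))"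
    using m by (simp add: nn_integral_cmult increment_mgf[OF assms])
  also have "\<dots> = ennreal (exp ((c\<^sup>2 - c * d) * ((b - a) / 2 ^ n)))"
    by (simp add: ennreal_mult[symmetric] exp_add[symmetric] left_diff_distrib mult.assoc diff_divide_distrib)
  finally show ?thesis .
qed

lemma drifted_indep: "indep_vars (\<lambda>_. borel)
    (\<lambda>i \<omega>. f (grid a b n (Suc i)) \<omega> - f (grid a b n i) \<omega> - d * ((b - a) / 2 ^ n)) {..<2 ^ n}"
  using indep_vars_compose2[OF indep, where Y = "\<lambda>_ x. x - d * ((b - a) / 2 ^ n)" and N = "\<lambda>_. borel"] by simp

lemma sum_drifted_increments:
  "(\<Sum>i<k. f (grid a b n (Suc i)) \<omega> - f (grid a b n i) \<omega> - d * ((b - a) / 2 ^ n))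
    = f (grid a b n k) \<omega> - f a \<omega> - d * (grid a b n k - a)"
  using sum_increments[where n = n and k = k and \<omega> = \<omega>] by (simp add: sum_subtractf grid_def)

text \<open>The increments have variance twice the time step, so slope \<open>c\<close> makes
  \<open>exp (c * X)\<close> of mean exactly 1 and the bound for walks holds on every grid with the
  same constant. The value \<open>c / (c - \<kappa>)\<close> is the moment of an exponential
  variable of rate \<open>c\<close>, the law of this supremum over an infinite horizon.\<close>

lemma exp_sup_le:
  assumes \<kappa>: "0 < \<kappa>" "\<kappa> < c"
  shows "(\<integral>\<^sup>+\<omega>. ennreal (exp (\<kappa> * run_sup (\<lambda>t. f t \<omega> - f a \<omega> - c * (t - a)) a b)) \<partial>M) \<le> ennreal (c / (c - \<kappa>))"
proof (rule nn_integral_lim_le)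
  let ?g = "\<lambda>\<omega> t. f t \<omega> - f a \<omega> - c * (t - a)"
  have g_meas: "(\<lambda>\<omega>. ?g \<omega> t) \<in> borel_measurable M" if "t \<in> {a..b}" for t
    using meas[OF that] meas[of a] ab by auto
  show "(\<lambda>\<omega>. exp (\<kappa> * grid_sup (?g \<omega>) a b n)) \<in> borel_measurable M" for n
  proof -
    have "(\<lambda>\<omega>. grid_sup (?g \<omega>) a b n) \<in> borel_measurable M"
      unfolding grid_sup_def
      by (intro borel_measurable_Max g_meas) (use grid_in[of a b] ab in auto)
    then show ?thesis by measurable
  qed
  show "(\<lambda>n. exp (\<kappa> * grid_sup (?g \<omega>) a b n)) \<longlonglongrightarrow> exp (\<kappa> * run_sup (?g \<omega>) a b)" if "\<omega> \<in> space M" for \<omega>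
    using ab that by (intro tendsto_intros grid_sup_tendsto continuous_intros cont) auto
  show "(\<integral>\<^sup>+\<omega>. ennreal (exp (\<kappa> * grid_sup (?g \<omega>) a b n)) \<partial>M) \<le> ennreal (c / (c - \<kappa>))" for n
  proof -
    have eq: "grid_sup (?g \<omega>) a b n =
      Max ((\<lambda>k. \<Sum>i<k. f (grid a b n (Suc i)) \<omega> - f (grid a b n i) \<omega> - c * ((b - a) / 2 ^ n)) ` {..2 ^ n})" for \<omega>
      unfolding grid_sup_def sum_drifted_increments ..
    show ?thesis unfolding eq
    proof (rule nn_integral_exp_max_le[OF drifted_indep _ \<kappa>])
      fix i :: nat assume i: "i < 2 ^ n"
      show "(\<integral>\<^sup>+\<omega>. ennreal (exp (c * (f (grid a b n (Suc i)) \<omega> - f (grid a b n i) \<omega> - c * ((b - a) / 2 ^ n)))) \<partial>M) \<le> 1"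
        unfolding drifted_increment_mgf[OF i] by (simp add: power2_eq_square)
    qed
  qed
qed

lemma neg: "gaussian_process M (\<lambda>t \<omega>. - f t \<omega>) a b"
proof
  show "indep_vars (\<lambda>_. borel) (\<lambda>i \<omega>. - f (grid a b n (Suc i)) \<omega> - - f (grid a b n i) \<omega>) {..<2 ^ n}" for n
    using indep_vars_compose2[OF indep[of n], where Y = "\<lambda>_ x. - x" and N = "\<lambda>_. borel"] by simp
  show "distributed M lborel (\<lambda>\<omega>. - f (grid a b n (Suc i)) \<omega> - - f (grid a b n i) \<omega>)
      (\<lambda>z. ennreal (normal_density 0 (sqrt (2 * ((b - a) / 2 ^ n))) z))" if "i < 2 ^ n" for i n
  proof -
    define \<delta> where "\<delta> = (b - a) / 2 ^ n"
    have "0 < \<delta>" using mesh_pos[of n] by (simp add: \<delta>_def)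
    then show ?thesis
      using normal_density_affine[OF normal[OF that, folded \<delta>_def], of "-1" 0] by (simp add: \<delta>_def[symmetric])
  qed
qed (use ab meas cont in \<open>auto intro!: continuous_intros\<close>)

text \<open>The reversed increments are the negated original ones in opposite order. The locale
  speaks only about increments and does not fix the starting value, so the reversed process
  qualifies as well.\<close>

lemma reverse: "gaussian_process M (\<lambda>t. f (a + b - t)) a b"
proof -
  interpret n: gaussian_process M "\<lambda>t \<omega>. - f t \<omega>" a b by (rule neg)
  have g: "a + b - grid a b n i = grid a b n (2 ^ n - i)" if "i \<le> 2 ^ n" for i n
    using that by (simp add: grid_def of_nat_diff field_simps)
  have inc: "f (a + b - grid a b n (Suc i)) \<omega> - f (a + b - grid a b n i) \<omega> =
      - f (grid a b n (Suc (2 ^ n - Suc i))) \<omega> - - f (grid a b n (2 ^ n - Suc i)) \<omega>" if "i < 2 ^ n" for i n \<omega>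
    using that by (simp add: g Suc_diff_Suc)
  show ?thesis
  proof
    show "a < b" by (rule ab)
    show "f (a + b - t) \<in> borel_measurable M" if "t \<in> {a..b}" for t
      using that by (intro meas) auto
    show "continuous_on {a..b} (\<lambda>t. f (a + b - t) \<omega>)" if "\<omega> \<in> space M" for \<omega>
      by (rule continuous_on_compose2[OF cont[OF that]]) (auto intro!: continuous_intros)
    have "indep_vars (\<lambda>_. borel) (\<lambda>i \<omega>. - f (grid a b n (Suc (2 ^ n - Suc i))) \<omega> - - f (grid a b n (2 ^ n - Suc i)) \<omega>) {..<2 ^ n}" for n
      by (rule indep_vars_reindex[OF n.indep, of "\<lambda>i. 2 ^ n - Suc i"]) (auto simp: inj_on_def)
    then show "indep_vars (\<lambda>_. borel) (\<lambda>i \<omega>. f (a + b - grid a b n (Suc i)) \<omega> - f (a + b - grid a b n i) \<omega>) {..<2 ^ n}" for n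
      by (rule indep_vars_cong[THEN iffD1, rotated -1]) (auto simp: inc)
    show "distributed M lborel (\<lambda>\<omega>. f (a + b - grid a b n (Suc i)) \<omega> - f (a + b - grid a b n i) \<omega>)
      (\<lambda>z. ennreal (normal_density 0 (sqrt (2 * ((b - a) / 2 ^ n))) z))" if "i < 2 ^ n" for i n
      unfolding inc[OF that] by (rule n.normal) (use that in auto)
  qed
qed

text \<open>The tube events decrease along dyadic levels and, by continuity, intersect in the tube
  over all times, so a lower bound uniform in \<open>n\<close> passes to the limit. The
  Cameron-Martin cost has 4 in the denominator because the variance is twice the time.\<close>

lemma tube_lower_bound:
  assumes "\<And>n. p \<le> prob {\<omega> \<in> space M. \<forall>k\<le>2 ^ n. \<bar>f (grid a b n k) \<omega> - f a \<omega>\<bar> \<le> m}"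
  shows "exp (- (s\<^sup>2 * (b - a) / 4)) * p \<le> prob {\<omega> \<in> space M. \<forall>t\<in>{a..b}. \<bar>f t \<omega> - f a \<omega> + s * (t - a)\<bar> \<le> m}"
proof -
  define A where "A n = {\<omega> \<in> space M. \<forall>k\<le>2 ^ n. \<bar>f (grid a b n k) \<omega> - f a \<omega> + s * (grid a b n k - a)\<bar> \<le> m}" for n
  have lb: "exp (- (s\<^sup>2 * (b - a) / 4)) * p \<le> prob (A n)" for n
  proof -
    define \<delta> where "\<delta> = (b - a) / 2 ^ n"
    have \<delta>: "0 < \<delta>" using ab by (simp add: \<delta>_def)
    have e: "s\<^sup>2 * (b - a) / 4 = real (2 ^ n) * (s * \<delta>)\<^sup>2 / (2 * (sqrt (2 * \<delta>))\<^sup>2)"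
      using \<delta> ab by (simp add: power2_eq_square) (simp add: \<delta>_def)
    have "exp (- (s\<^sup>2 * (b - a) / 4)) * p \<le> exp (- (s\<^sup>2 * (b - a) / 4)) * prob {\<omega> \<in> space M. \<forall>k\<le>2 ^ n. \<bar>f (grid a b n k) \<omega> - f a \<omega>\<bar> \<le> m}"
      using assms by (intro mult_left_mono) auto
    also have "exp (- (s\<^sup>2 * (b - a) / 4)) * prob {\<omega> \<in> space M. \<forall>k\<le>2 ^ n. \<bar>f (grid a b n k) \<omega> - f a \<omega>\<bar> \<le> m}
      \<le> prob {\<omega> \<in> space M. \<forall>k\<le>2 ^ n. \<bar>f (grid a b n k) \<omega> - f a \<omega> + real k * (s * \<delta>)\<bar> \<le> m}"
    proof -
      have "exp (- (real (2 ^ n) * (s * \<delta>)\<^sup>2 / (2 * (sqrt (2 * \<delta>))\<^sup>2))) *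
          prob {\<omega> \<in> space M. \<forall>k\<le>2 ^ n. \<bar>\<Sum>i<k. f (grid a b n (Suc i)) \<omega> - f (grid a b n i) \<omega>\<bar> \<le> m}
        \<le> prob {\<omega> \<in> space M. \<forall>k\<le>2 ^ n. \<bar>(\<Sum>i<k. f (grid a b n (Suc i)) \<omega> - f (grid a b n i) \<omega>) + real k * (s * \<delta>)\<bar> \<le> m}"
        by (rule tube_shift[OF indep]) (use \<delta> in \<open>auto intro: normal[where n = n, folded \<delta>_def]\<close>)
      then show ?thesis unfolding sum_increments e .
    qed
    also have "\<dots> = prob (A n)"
      by (simp add: A_def grid_def \<delta>_def mult_ac)
    finally show ?thesis .
  qed
  have A_sets: "A n \<in> sets M" for n
  proof -
    have "A n = (\<Inter>k\<in>{..2 ^ n}. {\<omega> \<in> space M. \<bar>f (grid a b n k) \<omega> - f a \<omega> + s * (grid a b n k - a)\<bar> \<le> m})"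
      by (auto simp: A_def)
    moreover have "{\<omega> \<in> space M. \<bar>f t \<omega> - f a \<omega> + s * (t - a)\<bar> \<le> m} \<in> sets M" if "t \<in> {a..b}" for t
    proof -
      have [measurable]: "f t \<in> borel_measurable M" "f a \<in> borel_measurable M" using that ab by (auto intro!: meas)
      show ?thesis by measurable
    qed
    ultimately show ?thesis using grid_in[of a b] ab by (auto intro!: sets.finite_INT)
  qed
  have dec: "decseq A"
    unfolding decseq_Suc_iff
  proof (intro allI subsetI)
    fix n \<omega> assume "\<omega> \<in> A (Suc n)"
    then have \<omega>: "\<omega> \<in> space M"
      and H: "\<And>k. k \<le> 2 ^ Suc n \<Longrightarrow> \<bar>f (grid a b (Suc n) k) \<omega> - f a \<omega> + s * (grid a b (Suc n) k - a)\<bar> \<le> m"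
      by (auto simp: A_def)
    have "\<bar>f (grid a b n k) \<omega> - f a \<omega> + s * (grid a b n k - a)\<bar> \<le> m" if "k \<le> 2 ^ n" for k
      using H[of "2 * k"] that by (simp add: grid_refine)
    then show "\<omega> \<in> A n" using \<omega> by (simp add: A_def)
  qed
  have "(\<lambda>n. prob (A n)) \<longlonglongrightarrow> prob (\<Inter>n. A n)"
    using A_sets dec by (intro finite_Lim_measure_decseq) auto
  then have "exp (- (s\<^sup>2 * (b - a) / 4)) * p \<le> prob (\<Inter>n. A n)"
    by (rule LIMSEQ_le_const) (use lb in auto)
  also have "(\<Inter>n. A n) = {\<omega> \<in> space M. \<forall>t\<in>{a..b}. \<bar>f t \<omega> - f a \<omega> + s * (t - a)\<bar> \<le> m}"
  proof (intro set_eqI iffI)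
    fix \<omega> assume "\<omega> \<in> {\<omega> \<in> space M. \<forall>t\<in>{a..b}. \<bar>f t \<omega> - f a \<omega> + s * (t - a)\<bar> \<le> m}"
    then show "\<omega> \<in> (\<Inter>n. A n)" using grid_in[of a b] ab by (auto simp: A_def)
  next
    fix \<omega> assume \<omega>: "\<omega> \<in> (\<Inter>n. A n)"
    then have sp: "\<omega> \<in> space M" by (auto simp: A_def)
    have "\<bar>f t \<omega> - f a \<omega> + s * (t - a)\<bar> \<le> m" if t: "t \<in> {a..b}" for t
    proof -
      obtain i where i: "\<And>n. i n \<le> 2 ^ n" "\<And>n. grid a b n (i n) \<le> t" "(\<lambda>n. grid a b n (i n)) \<longlonglongrightarrow> t"
        using grid_dense[OF less_imp_le[OF ab] t] by blast
      have "(\<lambda>n. f (grid a b n (i n)) \<omega>) \<longlonglongrightarrow> f t \<omega>"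
        by (rule continuous_on_tendsto_compose[OF cont[OF sp] i(3) t]) (use grid_in[of a b] ab i in auto)
      then have "(\<lambda>n. \<bar>f (grid a b n (i n)) \<omega> - f a \<omega> + s * (grid a b n (i n) - a)\<bar>) \<longlonglongrightarrow> \<bar>f t \<omega> - f a \<omega> + s * (t - a)\<bar>"
        using i by (intro tendsto_intros) auto
      then show ?thesis
        by (rule LIMSEQ_le_const2) (use \<omega> i in \<open>auto simp: A_def\<close>)
    qed
    then show "\<omega> \<in> {\<omega> \<in> space M. \<forall>t\<in>{a..b}. \<bar>f t \<omega> - f a \<omega> + s * (t - a)\<bar> \<le> m}" using sp by auto
  qed
  finally show ?thesis .
qed

end

locale brownian =
  fixes M :: "'a measure" and W :: "real \<Rightarrow> 'a \<Rightarrow> real"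
  assumes BM: "std_BM M W"
begin

sublocale prob_space M using BM by (simp add: std_BM_def)

definition w :: "real \<Rightarrow> 'a \<Rightarrow> real" where "w t \<omega> = sqrt 2 * W t \<omega>"

lemma W_meas [measurable]: "W t \<in> borel_measurable M"
  using BM by (simp add: std_BM_def)

lemma w_meas [measurable]: "w t \<in> borel_measurable M"
  unfolding w_def[abs_def] by measurable

lemma w_cont: "\<omega> \<in> space M \<Longrightarrow> continuous_on {0..} (\<lambda>t. w t \<omega>)"
  using BM by (auto simp: std_BM_def w_def intro!: continuous_intros)

lemma w_0: "\<omega> \<in> space M \<Longrightarrow> w 0 \<omega> = 0"
  using BM by (auto simp: std_BM_def w_def)

lemma w_increment:
  assumes "0 \<le> s" "s < t"
  shows "distributed M lborel (\<lambda>\<omega>. w t \<omega> - w s \<omega>) (\<lambda>z. ennreal (normal_density 0 (sqrt (2 * (t - s))) z))"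
proof -
  have "distributed M lborel (\<lambda>\<omega>. W t \<omega> - W s \<omega>) (\<lambda>z. ennreal (normal_density 0 (sqrt (t - s)) z))"
    using BM assms by (auto simp: std_BM_def)
  from normal_density_affine[OF this, of "sqrt 2" 0] assms show ?thesis
    unfolding w_def real_sqrt_mult by (simp add: right_diff_distrib)
qed

lemma w_indep:
  assumes "0 \<le> ts 0" "\<And>i. i < n \<Longrightarrow> ts i < ts (Suc i)"
  shows "indep_vars (\<lambda>_. borel) (\<lambda>i \<omega>. w (ts (Suc i)) \<omega> - w (ts i) \<omega>) {..<n}"
proof -
  have "indep_vars (\<lambda>_. borel) (\<lambda>i \<omega>. W (ts (Suc i)) \<omega> - W (ts i) \<omega>) {..<n}"
    using BM assms by (simp add: std_BM_def)
  from indep_vars_compose2[OF this, where Y = "\<lambda>_ x. sqrt 2 * x" and N = "\<lambda>_. borel"] show ?thesis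
    by (simp add: w_def right_diff_distrib)
qed

lemma gaussian_process_w:
  assumes "0 \<le> a" "a < b"
  shows "gaussian_process M w a b"
proof
  show "indep_vars (\<lambda>_. borel) (\<lambda>i \<omega>. w (grid a b n (Suc i)) \<omega> - w (grid a b n i) \<omega>) {..<2 ^ n}" for n
    using assms by (intro w_indep) (auto simp: grid_Suc)
  show "distributed M lborel (\<lambda>\<omega>. w (grid a b n (Suc i)) \<omega> - w (grid a b n i) \<omega>)
      (\<lambda>z. ennreal (normal_density 0 (sqrt (2 * ((b - a) / 2 ^ n))) z))" for i n
    using w_increment[of "grid a b n i" "grid a b n (Suc i)"] assms grid_ge[of a b n i]
    by (simp add: grid_Suc)
  show "continuous_on {a..b} (\<lambda>t. w t \<omega>)" if "\<omega> \<in> space M" for \<omega>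
    using assms by (intro continuous_on_subset[OF w_cont[OF that]]) auto
qed (use assms in auto)

end

text \<open>The distance of the path \<open>p u + c * u\<close> at time \<open>t\<close> from its
  running maximum, that is, this path reflected at its maximum.\<close>

definition drawdown :: "real \<Rightarrow> real \<Rightarrow> real \<Rightarrow> (real \<Rightarrow> real) \<Rightarrow> real" where
  "drawdown c a t p = run_sup (\<lambda>u. p u - p t - c * (t - u)) a t"

definition drop_sup :: "real \<Rightarrow> real \<Rightarrow> real \<Rightarrow> (real \<Rightarrow> real) \<Rightarrow> real" where
  "drop_sup c a e p = run_sup (\<lambda>u. p a - p u - c * (u - a)) a e"

definition rise_sup :: "real \<Rightarrow> real \<Rightarrow> (real \<Rightarrow> real) \<Rightarrow> real" where
  "rise_sup a e p = run_sup (\<lambda>u. p u - p a) a e"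

definition drawdown_integral :: "real \<Rightarrow> real \<Rightarrow> real \<Rightarrow> (real \<Rightarrow> real) \<Rightarrow> real" where
  "drawdown_integral c a e p = integral {a..e} (\<lambda>t. drawdown c a t p)"

lemma run_sup_add_const:
  assumes "continuous_on {a..b} f" "a \<le> b"
  shows "run_sup (\<lambda>t. f t + c) a b = run_sup f a b + c"
proof (rule antisym)
  show "run_sup (\<lambda>t. f t + c) a b \<le> run_sup f a b + c"
    using assms by (intro run_sup_le add_right_mono run_sup_ge) auto
  obtain t where "t \<in> {a..b}" "run_sup f a b = f t" using run_sup_attained[OF assms] by blast
  moreover have "continuous_on {a..b} (\<lambda>t. f t + c)" using assms by (intro continuous_intros)
  ultimately show "run_sup f a b + c \<le> run_sup (\<lambda>t. f t + c) a b"
    using run_sup_ge[of a b "\<lambda>t. f t + c" t] by auto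
qed

text \<open>Separates \<open>t\<close> from the function under the supremum, after which continuity
  in \<open>t\<close> is visible.\<close>

lemma drawdown_alt:
  assumes "continuous_on {a..t} p" "a \<le> t"
  shows "drawdown c a t p = run_sup (\<lambda>u. p u + c * u) a t - p t - c * t"
proof -
  have "continuous_on {a..t} (\<lambda>u. p u + c * u)" using assms by (intro continuous_intros)
  from run_sup_add_const[OF this assms(2), of "- p t - c * t"] show ?thesis
    by (simp add: drawdown_def algebra_simps)
qed

lemma continuous_on_drawdown:
  assumes "continuous_on {a..e} p"
  shows "continuous_on {a..e} (\<lambda>t. drawdown c a t p)"
proof -
  have "continuous_on {a..e} (\<lambda>t. run_sup (\<lambda>u. p u + c * u) a t - p t - c * t)"
    using assms by (intro continuous_intros continuous_on_run_sup) auto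
  then show ?thesis
    by (rule continuous_on_eq) (auto intro!: drawdown_alt[symmetric] continuous_on_subset[OF assms])
qed

lemma drawdown_nonneg:
  assumes "continuous_on {a..t} p" "a \<le> t"
  shows "0 \<le> drawdown c a t p"
proof -
  have "continuous_on {a..t} (\<lambda>u. p u - p t - c * (t - u))" using assms by (intro continuous_intros)
  from run_sup_ge[OF this, of t] assms(2) show ?thesis by (simp add: drawdown_def)
qed

lemma drop_sup_nonneg:
  assumes "continuous_on {a..t} p" "a \<le> t"
  shows "0 \<le> drop_sup c a t p"
proof -
  have "continuous_on {a..t} (\<lambda>u. p a - p u - c * (u - a))" using assms by (intro continuous_intros)
  from run_sup_ge[OF this, of a] assms(2) show ?thesis by (simp add: drop_sup_def)
qed

lemma rise_sup_nonneg:
  assumes "continuous_on {a..t} p" "a \<le> t"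
  shows "0 \<le> rise_sup a t p"
proof -
  have "continuous_on {a..t} (\<lambda>u. p u - p a)" using assms by (intro continuous_intros)
  from run_sup_ge[OF this, of a] assms(2) show ?thesis by (simp add: rise_sup_def)
qed

lemma drawdown_integral_nonneg: "continuous_on {a..t} p \<Longrightarrow> 0 \<le> drawdown_integral c a t p"
  unfolding drawdown_integral_def
  by (intro integral_nonneg integrable_continuous_real continuous_on_drawdown drawdown_nonneg)
    (auto intro: continuous_on_subset)

lemma inverse_one_minus_le_exp:
  fixes x :: real assumes "0 \<le> x" "x \<le> 1/2"
  shows "1 / (1 - x) \<le> exp (2 * x)"
proof -
  have "1 \<le> (1 - x) * (1 + 2 * x)" using assms mult_left_mono[of x "1/2" x] by (simp add: algebra_simps)
  also have "\<dots> \<le> (1 - x) * exp (2 * x)"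
    using assms exp_ge_add_one_self[of "2 * x"] by (intro mult_left_mono) auto
  finally show ?thesis using assms by (simp add: field_simps)
qed

context gaussian_process
begin

lemma sup_meas:
  "(\<lambda>\<omega>. run_sup (\<lambda>t. f t \<omega> - f a \<omega> - c * (t - a)) a b) \<in> borel_measurable M"
  using ab meas[of a] meas
  by (intro borel_measurable_run_sup continuous_intros cont borel_measurable_diff) auto

text \<open>An artificial slope \<open>c\<close> costs at most \<open>c * (b - a)\<close> and makes
  the supremum exponentially integrable. With \<open>c\<close> proportional to \<mu> the exponent
  stays quadratic with a coefficient proportional to the length of the interval, which is the source
  of Gaussian tails.\<close>

lemma exp_driftless_sup_le:
  assumes \<mu>: "0 < \<mu>" and short: "b - a \<le> 1/2"
  shows "(\<integral>\<^sup>+\<omega>. ennreal (exp (\<mu> * run_sup (\<lambda>t. f t \<omega> - f a \<omega>) a b)) \<partial>M)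
    \<le> ennreal (exp (2 * (b - a) * \<mu>\<^sup>2 + 2 * \<mu>))"
proof -
  \<comment> \<open>The factor 2 keeps \<open>\<mu> / c\<close> at most 1/2. The floor at 1 makes
    the remaining loss linear in \<mu>, so the final exponent vanishes with \<mu>; a constant term
    would accumulate from block to block in \<open>exp_dom_le\<close>.\<close>
  define c where "c = 2 * max \<mu> 1"
  have c: "\<mu> < c" "0 < c" "\<mu> / c \<le> 1/2" "2 * \<mu> \<le> \<mu> * c" "\<mu> * c \<le> 2 * \<mu>\<^sup>2 + 2 * \<mu>"
    using \<mu> by (auto simp: c_def max_def power2_eq_square)
  have "ennreal (exp (\<mu> * run_sup (\<lambda>t. f t \<omega> - f a \<omega>) a b)) \<le>
      ennreal (exp (\<mu> * c * (b - a))) * ennreal (exp (\<mu> * run_sup (\<lambda>t. f t \<omega> - f a \<omega> - c * (t - a)) a b))"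
    if \<omega>: "\<omega> \<in> space M" for \<omega>
  proof -
    have "run_sup (\<lambda>t. f t \<omega> - f a \<omega>) a b \<le> c * (b - a) + run_sup (\<lambda>t. f t \<omega> - f a \<omega> - c * (t - a)) a b"
    proof (rule run_sup_le)
      fix t assume t: "t \<in> {a..b}"
      have "f t \<omega> - f a \<omega> - c * (t - a) \<le> run_sup (\<lambda>t. f t \<omega> - f a \<omega> - c * (t - a)) a b"
        using \<omega> t by (intro run_sup_ge continuous_intros cont)
      moreover have "c * (t - a) \<le> c * (b - a)" using t c by (intro mult_left_mono) auto
      ultimately show "f t \<omega> - f a \<omega> \<le> c * (b - a) + run_sup (\<lambda>t. f t \<omega> - f a \<omega> - c * (t - a)) a b" by simp
    qed (use ab in simp)
    then have "\<mu> * run_sup (\<lambda>t. f t \<omega> - f a \<omega>) a b \<le> \<mu> * (c * (b - a) + run_sup (\<lambda>t. f t \<omega> - f a \<omega> - c * (t - a)) a b)"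
      using \<mu> by (intro mult_left_mono) auto
    then show ?thesis
      by (simp add: ennreal_mult[symmetric] exp_add[symmetric] distrib_left mult.assoc del: ennreal_le_iff)
        (intro ennreal_leI, simp)
  qed
  then have "(\<integral>\<^sup>+\<omega>. ennreal (exp (\<mu> * run_sup (\<lambda>t. f t \<omega> - f a \<omega>) a b)) \<partial>M) \<le>
     (\<integral>\<^sup>+\<omega>. ennreal (exp (\<mu> * c * (b - a))) * ennreal (exp (\<mu> * run_sup (\<lambda>t. f t \<omega> - f a \<omega> - c * (t - a)) a b)) \<partial>M)"
    by (intro nn_integral_mono)
  also have "\<dots> = ennreal (exp (\<mu> * c * (b - a))) * (\<integral>\<^sup>+\<omega>. ennreal (exp (\<mu> * run_sup (\<lambda>t. f t \<omega> - f a \<omega> - c * (t - a)) a b)) \<partial>M)"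
    using sup_meas by (intro nn_integral_cmult) measurable
  also have "\<dots> \<le> ennreal (exp (\<mu> * c * (b - a))) * ennreal (c / (c - \<mu>))"
    using \<mu> c by (intro mult_left_mono exp_sup_le) auto
  also have "\<dots> \<le> ennreal (exp (\<mu> * c * (b - a))) * ennreal (exp (2 * (\<mu> / c)))"
  proof (intro mult_left_mono ennreal_leI)
    have "c / (c - \<mu>) = 1 / (1 - \<mu> / c)" using c \<mu> by (simp add: field_simps)
    also have "\<dots> \<le> exp (2 * (\<mu> / c))" using c \<mu> by (intro inverse_one_minus_le_exp) auto
    finally show "c / (c - \<mu>) \<le> exp (2 * (\<mu> / c))" .
  qed auto
  also have "\<dots> = ennreal (exp (\<mu> * c * (b - a) + 2 * (\<mu> / c)))"
    by (simp add: ennreal_mult[symmetric] exp_add)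
  also have "\<dots> \<le> ennreal (exp (2 * (b - a) * \<mu>\<^sup>2 + 2 * \<mu>))"
  proof (intro ennreal_leI)
    have "\<mu> * c * (b - a) \<le> (2 * \<mu>\<^sup>2 + 2 * \<mu>) * (b - a)" using c ab by (intro mult_right_mono) auto
    moreover have "2 * \<mu> * (b - a) \<le> 2 * \<mu> * (1/2)" using short \<mu> by (intro mult_left_mono) auto
    moreover have "2 * (\<mu> / c) \<le> \<mu>"
      using \<mu> by (simp add: c_def max_def)
    ultimately show "exp (\<mu> * c * (b - a) + 2 * (\<mu> / c)) \<le> exp (2 * (b - a) * \<mu>\<^sup>2 + 2 * \<mu>)"
      by (simp add: algebra_simps)
  qed
  finally show ?thesis .
qed

end

context brownian
begin

lemma w_cont_Icc: "\<omega> \<in> space M \<Longrightarrow> 0 \<le> a \<Longrightarrow> continuous_on {a..b} (\<lambda>t. w t \<omega>)"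
  by (rule continuous_on_subset[OF w_cont]) auto

lemma exp_drop_sup_le:
  assumes "0 \<le> a" "a < e" "0 < \<kappa>" "\<kappa> < c"
  shows "(\<integral>\<^sup>+\<omega>. ennreal (exp (\<kappa> * drop_sup c a e (\<lambda>t. w t \<omega>))) \<partial>M) \<le> ennreal (c / (c - \<kappa>))"
proof -
  interpret g: gaussian_process M w a e using assms by (intro gaussian_process_w)
  interpret n: gaussian_process M "\<lambda>t \<omega>. - w t \<omega>" a e by (rule g.neg)
  show ?thesis using n.exp_sup_le[OF assms(3,4)] by (simp add: drop_sup_def)
qed

text \<open>Viewed backwards from \<open>e\<close>, the drawdown is the drifted supremum of the
  reversed path.\<close>

lemma exp_drawdown_le:
  assumes "0 \<le> a" "a < e" "0 < \<kappa>" "\<kappa> < c"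
  shows "(\<integral>\<^sup>+\<omega>. ennreal (exp (\<kappa> * drawdown c a e (\<lambda>t. w t \<omega>))) \<partial>M) \<le> ennreal (c / (c - \<kappa>))"
proof -
  interpret g: gaussian_process M w a e using assms by (intro gaussian_process_w)
  interpret n: gaussian_process M "\<lambda>t. w (a + e - t)" a e by (rule g.reverse)
  have "drawdown c a e (\<lambda>t. w t \<omega>) = run_sup (\<lambda>t. w (a + e - t) \<omega> - w (a + e - a) \<omega> - c * (t - a)) a e" for \<omega>
    unfolding drawdown_def by (subst run_sup_reflect[symmetric]) (simp add: algebra_simps)
  then show ?thesis using n.exp_sup_le[OF assms(3,4)] by simp
qed

lemma exp_rise_le:
  assumes "0 \<le> a" "a < e" "e - a \<le> 1/2" "0 < \<mu>"
  shows "(\<integral>\<^sup>+\<omega>. ennreal (exp (\<mu> * rise_sup a e (\<lambda>t. w t \<omega>))) \<partial>M) \<le> ennreal (exp (2 * (e - a) * \<mu>\<^sup>2 + 2 * \<mu>))"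
proof -
  interpret g: gaussian_process M w a e using assms by (intro gaussian_process_w)
  show ?thesis using g.exp_driftless_sup_le[OF assms(4,3)] by (simp add: rise_sup_def)
qed

lemma exp_drop_le:
  assumes "0 \<le> a" "a < e" "e - a \<le> 1/2" "0 < \<mu>"
  shows "(\<integral>\<^sup>+\<omega>. ennreal (exp (\<mu> * drop_sup 0 a e (\<lambda>t. w t \<omega>))) \<partial>M) \<le> ennreal (exp (2 * (e - a) * \<mu>\<^sup>2 + 2 * \<mu>))"
proof -
  interpret g: gaussian_process M w a e using assms by (intro gaussian_process_w)
  interpret n: gaussian_process M "\<lambda>t \<omega>. - w t \<omega>" a e by (rule g.neg)
  show ?thesis using n.exp_driftless_sup_le[OF assms(4,3)] by (simp add: drop_sup_def)
qed

lemma exp_driftless_drawdown_le: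
  assumes "0 \<le> a" "a < e" "e - a \<le> 1/2" "0 < \<mu>"
  shows "(\<integral>\<^sup>+\<omega>. ennreal (exp (\<mu> * drawdown 0 a e (\<lambda>t. w t \<omega>))) \<partial>M) \<le> ennreal (exp (2 * (e - a) * \<mu>\<^sup>2 + 2 * \<mu>))"
proof -
  interpret g: gaussian_process M w a e using assms by (intro gaussian_process_w)
  interpret n: gaussian_process M "\<lambda>t. w (a + e - t)" a e by (rule g.reverse)
  have "drawdown 0 a e (\<lambda>t. w t \<omega>) = run_sup (\<lambda>t. w (a + e - t) \<omega> - w (a + e - a) \<omega>) a e" for \<omega>
    unfolding drawdown_def by (subst run_sup_reflect[symmetric]) (simp add: algebra_simps)
  then show ?thesis using n.exp_driftless_sup_le[OF assms(4,3)] by simp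
qed

text \<open>Only increments from \<open>a\<close> are assumed measurable, so the statement covers
  both \<open>M\<close> and the algebra of a single block, which is generated by increments.\<close>

lemma drawdown_borel:
  assumes N: "space N = space M" "\<And>t. t \<in> {a..e} \<Longrightarrow> (\<lambda>\<omega>. w t \<omega> - w a \<omega>) \<in> borel_measurable N"
    and t: "0 \<le> a" "t \<in> {a..e}"
  shows "(\<lambda>\<omega>. drawdown c a t (\<lambda>t. w t \<omega>)) \<in> borel_measurable N"
  unfolding drawdown_def
proof (rule borel_measurable_run_sup)
  fix u assume u: "u \<in> {a..t}"
  have "(\<lambda>\<omega>. (w u \<omega> - w a \<omega>) - (w t \<omega> - w a \<omega>) - c * (t - u)) \<in> borel_measurable N"
    using u t by (intro borel_measurable_diff N borel_measurable_const) auto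
  then show "(\<lambda>\<omega>. w u \<omega> - w t \<omega> - c * (t - u)) \<in> borel_measurable N" by simp
qed (use N t in \<open>auto intro!: continuous_intros w_cont_Icc\<close>)

lemma drop_sup_borel:
  assumes N: "space N = space M" "\<And>t. t \<in> {a..e} \<Longrightarrow> (\<lambda>\<omega>. w t \<omega> - w a \<omega>) \<in> borel_measurable N"
    and t: "0 \<le> a" "a \<le> e"
  shows "(\<lambda>\<omega>. drop_sup c a e (\<lambda>t. w t \<omega>)) \<in> borel_measurable N"
  unfolding drop_sup_def
proof (rule borel_measurable_run_sup)
  fix u assume u: "u \<in> {a..e}"
  have "(\<lambda>\<omega>. - (w u \<omega> - w a \<omega>) - c * (u - a)) \<in> borel_measurable N"
    using u by (intro borel_measurable_diff borel_measurable_uminus N borel_measurable_const) auto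
  then show "(\<lambda>\<omega>. w a \<omega> - w u \<omega> - c * (u - a)) \<in> borel_measurable N" by simp
qed (use N t in \<open>auto intro!: continuous_intros w_cont_Icc\<close>)

lemma rise_sup_borel:
  assumes N: "space N = space M" "\<And>t. t \<in> {a..e} \<Longrightarrow> (\<lambda>\<omega>. w t \<omega> - w a \<omega>) \<in> borel_measurable N"
    and t: "0 \<le> a" "a \<le> e"
  shows "(\<lambda>\<omega>. rise_sup a e (\<lambda>t. w t \<omega>)) \<in> borel_measurable N"
  unfolding rise_sup_def
  by (rule borel_measurable_run_sup) (use N t in \<open>auto intro!: continuous_intros w_cont_Icc\<close>)

lemma drawdown_integral_borel:
  assumes N: "space N = space M" "\<And>t. t \<in> {a..e} \<Longrightarrow> (\<lambda>\<omega>. w t \<omega> - w a \<omega>) \<in> borel_measurable N"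
    and t: "0 \<le> a" "a \<le> e"
  shows "(\<lambda>\<omega>. drawdown_integral c a e (\<lambda>t. w t \<omega>)) \<in> borel_measurable N"
  unfolding drawdown_integral_def
  by (intro borel_measurable_integral_cont drawdown_borel[OF N] continuous_on_drawdown w_cont_Icc)
    (use N t in auto)

text \<open>Jensen's inequality, applied to Riemann sums so that no joint measurability is needed.\<close>

lemma exp_drawdown_integral_le:
  assumes a: "0 \<le> a" "a < e" "e - a \<le> 1" and \<kappa>: "0 < \<kappa>" "\<kappa> < c"
  shows "(\<integral>\<^sup>+\<omega>. ennreal (exp (\<kappa> * drawdown_integral c a e (\<lambda>t. w t \<omega>))) \<partial>M) \<le> ennreal (c / (c - \<kappa>))"
proof (rule nn_integral_lim_le)
  let ?R = "\<lambda>t \<omega>. drawdown c a t (\<lambda>t. w t \<omega>)"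
  let ?s = "\<lambda>n \<omega>. \<Sum>i<2 ^ n. ?R (grid a e n i) \<omega> * ((e - a) / 2 ^ n)"
  have R_meas: "?R t \<in> borel_measurable M" if "t \<in> {a..e}" for t
    using that a by (intro drawdown_borel[of M a e]) auto
  have R_meas': "?R (grid a e n i) \<in> borel_measurable M" if "i < 2 ^ n" for n i
    using that a by (intro R_meas grid_in) auto
  show "(\<lambda>\<omega>. exp (\<kappa> * ?s n \<omega>)) \<in> borel_measurable M" for n
    using R_meas' by (intro borel_measurable_exp borel_measurable_times borel_measurable_sum borel_measurable_const
      measurable_compose[OF _ borel_measurable_exp]) auto
  show "(\<lambda>n. exp (\<kappa> * ?s n \<omega>)) \<longlonglongrightarrow> exp (\<kappa> * drawdown_integral c a e (\<lambda>t. w t \<omega>))" if "\<omega> \<in> space M" for \<omega>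
    unfolding drawdown_integral_def
    using a that by (intro tendsto_intros riemann_sum_tendsto continuous_on_drawdown w_cont_Icc) auto
  show "(\<integral>\<^sup>+\<omega>. ennreal (exp (\<kappa> * ?s n \<omega>)) \<partial>M) \<le> ennreal (c / (c - \<kappa>))" for n
  proof -
    have pw: "exp (\<kappa> * ?s n \<omega>) \<le> (\<Sum>i<2 ^ n. (1 / 2 ^ n) * exp (\<kappa> * ?R (grid a e n i) \<omega>))" if \<omega>: "\<omega> \<in> space M" for \<omega>
    proof -
      have "\<kappa> * ?s n \<omega> = (e - a) * (\<Sum>i<2 ^ n. (1 / 2 ^ n) * (\<kappa> * ?R (grid a e n i) \<omega>))"
        by (simp add: sum_distrib_left field_simps)
      also have "\<dots> \<le> 1 * (\<Sum>i<2 ^ n. (1 / 2 ^ n) * (\<kappa> * ?R (grid a e n i) \<omega>))"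
        using a \<kappa> \<omega> by (intro mult_right_mono sum_nonneg mult_nonneg_nonneg drawdown_nonneg w_cont_Icc grid_ge) auto
      finally have "exp (\<kappa> * ?s n \<omega>) \<le> exp (\<Sum>i<2 ^ n. (1 / 2 ^ n) *\<^sub>R (\<kappa> * ?R (grid a e n i) \<omega>))" by simp
      also have "\<dots> \<le> (\<Sum>i<2 ^ n. (1 / 2 ^ n) * exp (\<kappa> * ?R (grid a e n i) \<omega>))"
        by (rule convex_on_sum[OF _ _ exp_convex]) (auto simp: lessThan_empty_iff)
      finally show ?thesis .
    qed
    have "(\<integral>\<^sup>+\<omega>. ennreal (exp (\<kappa> * ?s n \<omega>)) \<partial>M) \<le> (\<integral>\<^sup>+\<omega>. ennreal (\<Sum>i<2 ^ n. (1 / 2 ^ n) * exp (\<kappa> * ?R (grid a e n i) \<omega>)) \<partial>M)"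
      by (intro nn_integral_mono ennreal_leI pw)
    also have "\<dots> = (\<integral>\<^sup>+\<omega>. (\<Sum>i<2 ^ n. ennreal (1 / 2 ^ n) * ennreal (exp (\<kappa> * ?R (grid a e n i) \<omega>))) \<partial>M)"
      by (intro nn_integral_cong) (simp add: sum_ennreal[symmetric] ennreal_mult[symmetric] del: sum_ennreal)
    also have "\<dots> = (\<Sum>i<2 ^ n. \<integral>\<^sup>+\<omega>. ennreal (1 / 2 ^ n) * ennreal (exp (\<kappa> * ?R (grid a e n i) \<omega>)) \<partial>M)"
      using R_meas' by (intro nn_integral_sum) auto
    also have "\<dots> \<le> (\<Sum>i<(2::nat) ^ n. ennreal (1 / 2 ^ n) * ennreal (c / (c - \<kappa>)))"
    proof (rule sum_mono)
      fix i :: nat assume i: "i \<in> {..<2 ^ n}"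
      have "(\<integral>\<^sup>+\<omega>. ennreal (exp (\<kappa> * ?R (grid a e n i) \<omega>)) \<partial>M) \<le> ennreal (c / (c - \<kappa>))"
      \<comment> \<open>The first grid point is \<open>a\<close>, where the interval degenerates and
        \<open>exp_drawdown_le\<close> does not apply; there the drawdown is 0.\<close>
      proof (cases "i = 0")
        case True
        have "?R a \<omega> = 0" for \<omega> by (simp add: drawdown_def run_sup_def)
        moreover have "1 \<le> c / (c - \<kappa>)" using \<kappa> by (simp add: field_simps)
        ultimately show ?thesis using True by (simp add: emeasure_space_1)
      next
        case False
        then show ?thesis using a \<kappa> by (intro exp_drawdown_le) (auto simp: grid_def)
      qed
      then show "(\<integral>\<^sup>+\<omega>. ennreal (1 / 2 ^ n) * ennreal (exp (\<kappa> * ?R (grid a e n i) \<omega>)) \<partial>M) \<le> ennreal (1 / 2 ^ n) * ennreal (c / (c - \<kappa>))"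
        using R_meas'[of i n] i by (subst nn_integral_cmult) (auto intro!: mult_left_mono)
    qed
    also have "\<dots> = ennreal (c / (c - \<kappa>))"
      using \<kappa> by (simp add: ennreal_mult[symmetric] ennreal_of_nat_eq_real_of_nat)
    finally show ?thesis .
  qed
qed

end

section \<open>Independence of the blocks\<close>

text \<open>The length 1/16 is dictated by the tail of \<open>D\<close>. A moment bound with
  exponent \<open>A * \<mu>\<^sup>2\<close> yields a tail of Gaussian rate
  \<open>1 / (4 * A)\<close>, and rate 1/8 requires \<open>A < 2\<close>; these blocks lead to
  \<open>A = 8/5\<close> in \<open>dom_osc_tail\<close>.\<close>

definition blk :: "nat \<Rightarrow> real" where
  "blk j = real j / 16"

lemma blk_nonneg [simp]: "0 \<le> blk j" and blk_Suc: "blk (Suc j) = blk j + 1 / 16"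
  and blk_0 [simp]: "blk 0 = 0" and blk_less [simp]: "blk j < blk (Suc j)" and blk_le [simp]: "blk j \<le> blk (Suc j)"
  by (auto simp: blk_def field_simps)

lemma blk_mono: "i \<le> j \<Longrightarrow> blk i \<le> blk j"
  by (simp add: blk_def)

lemma grid_blk: "grid (blk j) (blk (Suc j)) n i = real (j * 2 ^ n + i) * (1 / (16 * 2 ^ n))"
  by (simp add: grid_def blk_def field_simps)

context brownian
begin

definition blk_incr :: "nat \<Rightarrow> nat \<Rightarrow> 'a \<Rightarrow> nat \<Rightarrow> real" where
  "blk_incr j n \<omega> = (\<lambda>i\<in>{..<2 ^ n}. w (grid (blk j) (blk (Suc j)) n (Suc i)) \<omega> - w (grid (blk j) (blk (Suc j)) n i) \<omega>)"

definition blk_sets :: "nat \<Rightarrow> nat \<Rightarrow> 'a set set" where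
  "blk_sets j n = {blk_incr j n -` A \<inter> space M | A. A \<in> sets (PiM {..<2 ^ n} (\<lambda>_. borel))}"

text \<open>The sigma-algebra of the increments of \<open>w\<close> inside block \<open>j\<close>,
  generated by an increasing family of dyadic levels.\<close>

definition blk_alg :: "nat \<Rightarrow> 'a measure" where
  "blk_alg j = sigma (space M) (\<Union>n. blk_sets j n)"

lemma blk_incr_meas: "blk_incr j n \<in> measurable M (PiM {..<2 ^ n} (\<lambda>_. borel))"
  unfolding blk_incr_def by (intro measurable_restrict) measurable

lemma blk_sets_events: "blk_sets j n \<subseteq> sets M"
  using measurable_sets[OF blk_incr_meas] by (auto simp: blk_sets_def)

lemma space_blk_alg [simp]: "space (blk_alg j) = space M"
  by (simp add: blk_alg_def space_measure_of_conv)

lemma sets_blk_alg: "sets (blk_alg j) = sigma_sets (space M) (\<Union>n. blk_sets j n)"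
  unfolding blk_alg_def using blk_sets_events sets.sets_into_space by (subst sets_measure_of) blast+

lemma sets_blk_alg_subset: "sets (blk_alg j) \<subseteq> sets M"
  unfolding sets_blk_alg using blk_sets_events by (intro sets.sigma_sets_subset) auto

lemma measurable_blk_alg: "f \<in> measurable (blk_alg j) N \<Longrightarrow> f \<in> measurable M N"
  using sets_blk_alg_subset by (auto simp: measurable_def)

text \<open>At a fixed level the increments of all blocks form one family over a single uniform grid
  of mesh \<open>1 / (16 * 2 ^ n)\<close>; grouping it by disjoint index ranges preserves
  independence.\<close>

lemma indep_blk_level: "indep_sets (\<lambda>j. blk_sets j n) {..<K}"
proof -
  define ts where "ts i = real i * (1 / (16 * 2 ^ n))" for i
  let ?X = "\<lambda>i \<omega>. w (ts (Suc i)) \<omega> - w (ts i) \<omega>"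
  let ?I = "\<lambda>j. {j * 2 ^ n..<Suc j * 2 ^ n}"
  have "indep_vars (\<lambda>_. borel) ?X {..<K * 2 ^ n}"
    by (rule w_indep) (auto simp: ts_def field_simps)
  then have "indep_vars (\<lambda>j. PiM (?I j) (\<lambda>_. borel)) (\<lambda>j \<omega>. \<lambda>i\<in>?I j. ?X i \<omega>) {..<K}"
  proof (rule indep_vars_restrict)
    fix j assume "j \<in> {..<K}"
    then have "Suc j * 2 ^ n \<le> K * 2 ^ n" by (intro mult_right_mono) auto
    then show "?I j \<subseteq> {..<K * 2 ^ n}" by auto
  next
    show "disjoint_family_on ?I {..<K}"
      unfolding disjoint_family_on_def
    proof (intro ballI impI)
      fix i j :: nat assume "i \<noteq> j"
      then consider "Suc i \<le> j" | "Suc j \<le> i" by linarith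
      then show "?I i \<inter> ?I j = {}"
      proof cases
        case 1
        then have "Suc i * 2 ^ n \<le> j * 2 ^ n" by (rule mult_right_mono) simp
        then show ?thesis by auto
      next
        case 2
        then have "Suc j * 2 ^ n \<le> i * 2 ^ n" by (rule mult_right_mono) simp
        then show ?thesis by auto
      qed
    qed
  qed
  then have "indep_vars (\<lambda>j. PiM {..<2 ^ n} (\<lambda>_. borel)) (\<lambda>j \<omega>. (\<lambda>x. \<lambda>i\<in>{..<2 ^ n}. x (j * 2 ^ n + i)) (\<lambda>i\<in>?I j. ?X i \<omega>)) {..<K}"
  proof (rule indep_vars_compose2)
    fix j assume "j \<in> {..<K}"
    show "(\<lambda>x. \<lambda>i\<in>{..<2 ^ n}. x (j * 2 ^ n + i)) \<in> measurable (PiM (?I j) (\<lambda>_. borel)) (PiM {..<2 ^ n} (\<lambda>_. borel))"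
      by (rule measurable_restrict, rule measurable_component_singleton) auto
  qed
  moreover have "(\<lambda>x. \<lambda>i\<in>{..<2 ^ n}. x (j * 2 ^ n + i)) (\<lambda>i\<in>?I j. ?X i \<omega>) = blk_incr j n \<omega>" for j \<omega>
    unfolding blk_incr_def grid_blk by (auto simp: fun_eq_iff ts_def restrict_def)
  ultimately have "indep_vars (\<lambda>j. PiM {..<2 ^ n} (\<lambda>_. borel)) (\<lambda>j. blk_incr j n) {..<K}"
    by simp
  then show ?thesis unfolding indep_vars_def2 blk_sets_def by simp
qed

text \<open>A coarse increment is the sum of two finer ones. Levels therefore increase, which makes
  their union closed under intersections.\<close>

lemma blk_sets_Suc: "blk_sets j n \<subseteq> blk_sets j (Suc n)"
proof
  fix E assume "E \<in> blk_sets j n"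
  then obtain A where A: "A \<in> sets (PiM {..<2 ^ n} (\<lambda>_. borel))" "E = blk_incr j n -` A \<inter> space M"
    by (auto simp: blk_sets_def)
  define T where "T x = (\<lambda>i\<in>{..<2 ^ n}. x (2 * i) + x (2 * i + 1))" for x :: "nat \<Rightarrow> real"
  have "blk_incr j n \<omega> = T (blk_incr j (Suc n) \<omega>)" for \<omega>
  proof
    fix i
    have "grid (blk j) (blk (Suc j)) (Suc n) (2 * Suc i) = grid (blk j) (blk (Suc j)) n (Suc i)"
      by (rule grid_refine)
    moreover have "grid (blk j) (blk (Suc j)) (Suc n) (2 * i) = grid (blk j) (blk (Suc j)) n i"
      by (rule grid_refine)
    ultimately show "blk_incr j n \<omega> i = T (blk_incr j (Suc n) \<omega>) i"
      by (auto simp: blk_incr_def T_def)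
  qed
  then have "E = blk_incr j (Suc n) -` (T -` A \<inter> space (PiM {..<2 ^ Suc n} (\<lambda>_. borel))) \<inter> space M"
    using A measurable_space[OF blk_incr_meas[where j = j and n = "Suc n"]] by auto
  moreover have "T \<in> measurable (PiM {..<2 ^ Suc n} (\<lambda>_. borel)) (PiM {..<2 ^ n} (\<lambda>_. borel))"
    unfolding T_def
    by (intro measurable_restrict borel_measurable_add measurable_component_singleton) auto
  ultimately show "E \<in> blk_sets j (Suc n)"
    unfolding blk_sets_def using measurable_sets[OF _ A(1)] by blast
qed

lemma blk_sets_mono: "n \<le> m \<Longrightarrow> blk_sets j n \<subseteq> blk_sets j m"
  by (rule lift_Suc_mono_le[of "blk_sets j"]) (auto intro: blk_sets_Suc[THEN subsetD])

lemma Int_stable_blk: "Int_stable (\<Union>n. blk_sets j n)"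
proof (rule Int_stableI)
  fix E F assume "E \<in> (\<Union>n. blk_sets j n)" "F \<in> (\<Union>n. blk_sets j n)"
  then obtain n m where "E \<in> blk_sets j n" "F \<in> blk_sets j m" by auto
  then have "E \<in> blk_sets j (max n m)" "F \<in> blk_sets j (max n m)"
    using blk_sets_mono[of n "max n m" j] blk_sets_mono[of m "max n m" j] by auto
  then obtain A B where "A \<in> sets (PiM {..<2 ^ max n m} (\<lambda>_. borel))" "E = blk_incr j (max n m) -` A \<inter> space M"
    "B \<in> sets (PiM {..<2 ^ max n m} (\<lambda>_. borel))" "F = blk_incr j (max n m) -` B \<inter> space M"
    by (auto simp: blk_sets_def)
  then have "E \<inter> F = blk_incr j (max n m) -` (A \<inter> B) \<inter> space M"
    "A \<inter> B \<in> sets (PiM {..<2 ^ max n m} (\<lambda>_. borel))" by auto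
  then show "E \<inter> F \<in> (\<Union>n. blk_sets j n)" unfolding blk_sets_def by blast
qed

text \<open>Finitely many events live at finitely many levels, hence at a common one, where
  independence is known. Closure under intersections then carries it to the generated
  algebras.\<close>

lemma indep_blk_alg: "indep_sets (\<lambda>j. sets (blk_alg j)) UNIV"
  unfolding sets_blk_alg
proof (rule indep_sets_sigma)
  show "indep_sets (\<lambda>j. \<Union>n. blk_sets j n) UNIV"
  proof (rule indep_setsI)
    fix A :: "nat \<Rightarrow> 'a set" and J assume J: "J \<noteq> {}" "finite J" "\<forall>j\<in>J. A j \<in> (\<Union>n. blk_sets j n)"
    then have "\<forall>j\<in>J. \<exists>n. A j \<in> blk_sets j n" by auto
    then obtain N where N: "\<And>j. j \<in> J \<Longrightarrow> A j \<in> blk_sets j (N j)" by metis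
    have *: "A j \<in> blk_sets j (Max (N ` J))" if "j \<in> J" for j
      using N[OF that] blk_sets_mono[of "N j" "Max (N ` J)" j] J that by auto
    show "prob (\<Inter>j\<in>J. A j) = (\<Prod>j\<in>J. prob (A j))"
    proof (rule indep_setsD[OF indep_blk_level])
      show "J \<subseteq> {..<Suc (Max J)}" using J Max_ge[of J] by (auto simp: less_Suc_eq_le)
      show "\<forall>j\<in>J. A j \<in> blk_sets j (Max (N ` J))" using * by auto
    qed fact+
  qed (use blk_sets_events in auto)
qed (rule Int_stable_blk)

lemma indep_vars_blk:
  assumes "\<And>j. X j \<in> measurable (blk_alg j) (N j)"
  shows "indep_vars N X UNIV"
  unfolding indep_vars_def2
proof (intro conjI ballI)
  show "random_variable (N j) (X j)" for j by (rule measurable_blk_alg[OF assms])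
  show "indep_sets (\<lambda>j. {X j -` A \<inter> space M |A. A \<in> sets (N j)}) UNIV"
    by (rule indep_sets_mono_sets[OF indep_blk_alg]) (use measurable_sets[OF assms] in auto)
qed

text \<open>At dyadic times the value is a finite sum of block increments; other times are limits of
  dyadic ones by path continuity.\<close>

lemma w_blk_meas:
  assumes t: "t \<in> {blk j..blk (Suc j)}"
  shows "(\<lambda>\<omega>. w t \<omega> - w (blk j) \<omega>) \<in> borel_measurable (blk_alg j)"
proof -
  interpret g: gaussian_process M w "blk j" "blk (Suc j)" by (rule gaussian_process_w) auto
  have incr: "blk_incr j n \<in> measurable (blk_alg j) (PiM {..<2 ^ n} (\<lambda>_. borel))" for n
  proof (rule measurableI)
    fix A :: "(nat \<Rightarrow> real) set" assume "A \<in> sets (PiM {..<2 ^ n} (\<lambda>_. borel))"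
    then have "blk_incr j n -` A \<inter> space M \<in> (\<Union>n. blk_sets j n)" by (auto simp: blk_sets_def)
    then show "blk_incr j n -` A \<inter> space (blk_alg j) \<in> sets (blk_alg j)"
      unfolding sets_blk_alg by auto
  qed (use measurable_space[OF blk_incr_meas] in auto)
  have dy: "(\<lambda>\<omega>. w (grid (blk j) (blk (Suc j)) n k) \<omega> - w (blk j) \<omega>) \<in> borel_measurable (blk_alg j)" if "k \<le> 2 ^ n" for n k
  proof -
    have "(\<lambda>\<omega>. \<Sum>i<k. blk_incr j n \<omega> i) \<in> borel_measurable (blk_alg j)"
      using that by (intro borel_measurable_sum measurable_compose[OF incr measurable_component_singleton]) auto
    moreover have "(\<Sum>i<k. blk_incr j n \<omega> i) = w (grid (blk j) (blk (Suc j)) n k) \<omega> - w (blk j) \<omega>" for \<omega>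
    proof -
      have "(\<Sum>i<k. blk_incr j n \<omega> i) =
        (\<Sum>i<k. w (grid (blk j) (blk (Suc j)) n (Suc i)) \<omega> - w (grid (blk j) (blk (Suc j)) n i) \<omega>)"
        using that by (intro sum.cong) (auto simp: blk_incr_def)
      then show ?thesis by (simp add: g.sum_increments)
    qed
    ultimately show ?thesis by simp
  qed
  obtain i where i: "\<And>n. i n \<le> 2 ^ n" "\<And>n. grid (blk j) (blk (Suc j)) n (i n) \<le> t" "(\<lambda>n. grid (blk j) (blk (Suc j)) n (i n)) \<longlonglongrightarrow> t"
    using grid_dense[OF blk_le t] by blast
  show ?thesis
  proof (rule borel_measurable_LIMSEQ_real)
    show "(\<lambda>\<omega>. w (grid (blk j) (blk (Suc j)) n (i n)) \<omega> - w (blk j) \<omega>) \<in> borel_measurable (blk_alg j)" for n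
      by (rule dy) (rule i)
    show "(\<lambda>n. w (grid (blk j) (blk (Suc j)) n (i n)) \<omega> - w (blk j) \<omega>) \<longlonglongrightarrow> w t \<omega> - w (blk j) \<omega>"
      if "\<omega> \<in> space (blk_alg j)" for \<omega>
    proof (intro tendsto_intros)
      show "(\<lambda>n. w (grid (blk j) (blk (Suc j)) n (i n)) \<omega>) \<longlonglongrightarrow> w t \<omega>"
        by (rule continuous_on_tendsto_compose[OF w_cont_Icc i(3) t])
          (use that grid_in[OF blk_le i(1), of j] in auto)
    qed
  qed
qed

lemma blk_drawdown_meas: "(\<lambda>\<omega>. drawdown c (blk j) (blk (Suc j)) (\<lambda>t. w t \<omega>)) \<in> borel_measurable (blk_alg j)"
  by (intro drawdown_borel[of _ _ "blk (Suc j)"] w_blk_meas) auto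

lemma blk_drop_meas: "(\<lambda>\<omega>. drop_sup c (blk j) (blk (Suc j)) (\<lambda>t. w t \<omega>)) \<in> borel_measurable (blk_alg j)"
  by (intro drop_sup_borel w_blk_meas) auto

lemma blk_rise_meas: "(\<lambda>\<omega>. rise_sup (blk j) (blk (Suc j)) (\<lambda>t. w t \<omega>)) \<in> borel_measurable (blk_alg j)"
  by (intro rise_sup_borel w_blk_meas) auto

lemma blk_drawdown_integral_meas: "(\<lambda>\<omega>. drawdown_integral c (blk j) (blk (Suc j)) (\<lambda>t. w t \<omega>)) \<in> borel_measurable (blk_alg j)"
  by (intro drawdown_integral_borel w_blk_meas) auto

end

section \<open>Exponential moments\<close>

lemma (in prob_space) chernoff:
  assumes X[measurable]: "X \<in> borel_measurable M" and \<theta>: "0 \<le> \<theta>"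
    and C: "(\<integral>\<^sup>+\<omega>. ennreal (exp (\<theta> * X \<omega>)) \<partial>M) \<le> ennreal C" "0 \<le> C"
  shows "prob {\<omega> \<in> space M. x \<le> X \<omega>} \<le> exp (- \<theta> * x) * C"
proof -
  have "emeasure M {\<omega> \<in> space M. x \<le> X \<omega>} = (\<integral>\<^sup>+\<omega>. indicator {\<omega> \<in> space M. x \<le> X \<omega>} \<omega> \<partial>M)"
    by (rule nn_integral_indicator[symmetric]) measurable
  also have "\<dots> \<le> (\<integral>\<^sup>+\<omega>. ennreal (exp (- \<theta> * x)) * ennreal (exp (\<theta> * X \<omega>)) \<partial>M)"
  proof (rule nn_integral_mono)
    fix \<omega>
    have "1 \<le> exp (- \<theta> * x) * exp (\<theta> * X \<omega>)" if "x \<le> X \<omega>"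
      using mult_left_mono[OF that \<theta>] by (simp add: exp_add[symmetric])
    then show "indicator {\<omega> \<in> space M. x \<le> X \<omega>} \<omega> \<le> ennreal (exp (- \<theta> * x)) * ennreal (exp (\<theta> * X \<omega>))"
      by (auto simp: indicator_def ennreal_mult[symmetric] simp del: mult_minus_left)
  qed
  also have "\<dots> = ennreal (exp (- \<theta> * x)) * (\<integral>\<^sup>+\<omega>. ennreal (exp (\<theta> * X \<omega>)) \<partial>M)"
    by (rule nn_integral_cmult) measurable
  also have "\<dots> \<le> ennreal (exp (- \<theta> * x)) * ennreal C" by (intro mult_left_mono C) auto
  finally show ?thesis using C by (simp add: emeasure_eq_measure ennreal_mult[symmetric])
qed

lemma prod_mono_ennreal:
  fixes f g :: "'i \<Rightarrow> ennreal"
  assumes "\<And>i. i \<in> A \<Longrightarrow> f i \<le> g i"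
  shows "prod f A \<le> prod g A"
  using assms by (induction A rule: infinite_finite_induct) (auto intro!: mult_mono)

text \<open>Separates three dependent terms at the price of tripled exponents.\<close>

lemma exp_sum3_le:
  fixes x y z :: real
  shows "exp (x + y + z) \<le> (exp (3 * x) + exp (3 * y) + exp (3 * z)) / 3"
proof -
  have "exp (\<Sum>i\<in>{0,1,2::nat}. (1/3) *\<^sub>R (3 * (if i = 0 then x else if i = 1 then y else z)))
    \<le> (\<Sum>i\<in>{0,1,2::nat}. (1/3) * exp (3 * (if i = 0 then x else if i = 1 then y else z)))"
    by (rule convex_on_sum[OF _ _ exp_convex]) auto
  then show ?thesis by (simp add: add_ac)
qed

section \<open>Growth of the queue over a block\<close>

context brownian
begin

text \<open>The first entry of the maximum is the case of a block without zeros of \<open>D\<close>.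
  In the second, the integrated drawdown bounds the integral of \<open>D\<close> between its first
  and last zero, while drop and drawdown replace \<open>w\<close> at these random zeros by its
  values at the block ends.\<close>

definition growth :: "real \<Rightarrow> real \<Rightarrow> nat \<Rightarrow> 'a \<Rightarrow> real" where
  "growth B \<beta> j \<omega> = max (- (B / 16))
     (w (blk (Suc j)) \<omega> - w (blk j) \<omega> - \<beta> / 16
      + (drawdown_integral (B - \<beta>) (blk j) (blk (Suc j)) (\<lambda>t. w t \<omega>)
         + drop_sup (B - \<beta>) (blk j) (blk (Suc j)) (\<lambda>t. w t \<omega>)
         + drawdown (B - \<beta>) (blk j) (blk (Suc j)) (\<lambda>t. w t \<omega>)))"

text \<open>Bounds the queue at an arbitrary time inside the block, hence suprema in place of the
  net increment. It is used once per path, for the block in which the level is reached.\<close>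

definition max_growth :: "real \<Rightarrow> real \<Rightarrow> nat \<Rightarrow> 'a \<Rightarrow> real" where
  "max_growth B \<beta> j \<omega> = rise_sup (blk j) (blk (Suc j)) (\<lambda>t. w t \<omega>)
     + drop_sup 0 (blk j) (blk (Suc j)) (\<lambda>t. w t \<omega>)
     + drawdown_integral (B - \<beta>) (blk j) (blk (Suc j)) (\<lambda>t. w t \<omega>)"

lemma growth_meas: "growth B \<beta> j \<in> borel_measurable (blk_alg j)"
  unfolding growth_def
  by (intro borel_measurable_max borel_measurable_add borel_measurable_diff[OF w_blk_meas] borel_measurable_const
      blk_drawdown_meas blk_drop_meas blk_drawdown_integral_meas) auto

lemma max_growth_meas: "max_growth B \<beta> j \<in> borel_measurable (blk_alg j)"
  unfolding max_growth_def
  by (intro borel_measurable_add blk_rise_meas blk_drop_meas blk_drawdown_integral_meas)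

lemma blk_increment_mgf:
  "(\<integral>\<^sup>+\<omega>. ennreal (exp (c * (w (blk (Suc j)) \<omega> - w (blk j) \<omega>))) \<partial>M) = ennreal (exp (c\<^sup>2 / 16))"
  using nn_integral_exp_normal[OF w_increment[of "blk j" "blk (Suc j)"], of c] by (simp add: blk_Suc)

text \<open>The increment and the errors come from the same block and are dependent. Young's
  inequality doubles the exponents and convexity over three errors triples them, whence
  \<open>6 * \<theta>\<close>. The last factor is close to 1 when \<open>B\<close> is large compared
  with \<beta> and \<theta>, so the negative drift survives.\<close>

lemma exp_growth_le:
  assumes \<theta>: "0 < \<theta>" "6 * \<theta> < B - \<beta>"
  shows "(\<integral>\<^sup>+\<omega>. ennreal (exp (\<theta> * growth B \<beta> j \<omega>)) \<partial>M) \<le>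
    ennreal (exp (- (\<theta> * B / 16)) + exp (- (\<theta> * \<beta> / 16) + \<theta>\<^sup>2 / 8) * ((1 + (B - \<beta>) / (B - \<beta> - 6 * \<theta>)) / 2))"
proof -
  let ?a = "blk j" and ?e = "blk (Suc j)" and ?b = "B - \<beta>"
  define \<Delta> where "\<Delta> \<omega> = w ?e \<omega> - w ?a \<omega>" for \<omega>
  define A where "A \<omega> = drawdown_integral ?b ?a ?e (\<lambda>t. w t \<omega>)" for \<omega>
  define E where "E \<omega> = drop_sup ?b ?a ?e (\<lambda>t. w t \<omega>)" for \<omega>
  define E' where "E' \<omega> = drawdown ?b ?a ?e (\<lambda>t. w t \<omega>)" for \<omega>
  define C where "C = ?b / (?b - 6 * \<theta>)"
  define K where "K = exp (- (\<theta> * \<beta> / 16) + \<theta>\<^sup>2 / 8)"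
  have [measurable]: "\<Delta> \<in> borel_measurable M" "A \<in> borel_measurable M" "E \<in> borel_measurable M" "E' \<in> borel_measurable M"
    unfolding \<Delta>_def A_def E_def E'_def
    by (auto intro!: measurable_blk_alg[OF blk_drawdown_integral_meas] measurable_blk_alg[OF blk_drop_meas]
        measurable_blk_alg[OF blk_drawdown_meas])
  have pos: "0 \<le> C" "0 \<le> K" using \<theta> by (auto simp: C_def K_def)
  have IA: "(\<integral>\<^sup>+\<omega>. ennreal (exp (6 * \<theta> * A \<omega>)) \<partial>M) \<le> ennreal C"
    unfolding A_def C_def using \<theta> by (intro exp_drawdown_integral_le) (auto simp: blk_Suc)
  have IE: "(\<integral>\<^sup>+\<omega>. ennreal (exp (6 * \<theta> * E \<omega>)) \<partial>M) \<le> ennreal C"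
    unfolding E_def C_def using \<theta> by (intro exp_drop_sup_le) auto
  have IE': "(\<integral>\<^sup>+\<omega>. ennreal (exp (6 * \<theta> * E' \<omega>)) \<partial>M) \<le> ennreal C"
    unfolding E'_def C_def using \<theta> by (intro exp_drawdown_le) auto
  define r where "r \<omega> = exp (2 * \<theta> * \<Delta> \<omega>) * (exp (- (\<theta>\<^sup>2 / 4)) / 2)" for \<omega>
  have Ir: "(\<integral>\<^sup>+\<omega>. ennreal (r \<omega>) \<partial>M) = ennreal (1/2)"
  proof -
    have "(\<integral>\<^sup>+\<omega>. ennreal (r \<omega>) \<partial>M) = (\<integral>\<^sup>+\<omega>. ennreal (exp (2 * \<theta> * \<Delta> \<omega>)) * ennreal (exp (- (\<theta>\<^sup>2 / 4)) / 2) \<partial>M)"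
      unfolding r_def by (intro nn_integral_cong ennreal_mult) auto
    also have "\<dots> = ennreal (exp ((2 * \<theta>)\<^sup>2 / 16)) * ennreal (exp (- (\<theta>\<^sup>2 / 4)) / 2)"
      by (subst nn_integral_multc) (auto simp: \<Delta>_def blk_increment_mgf[of "2 * \<theta>", simplified])
    also have "\<dots> = ennreal (1/2)"
      by (simp add: ennreal_mult[symmetric] exp_add[symmetric] power_mult_distrib)
    finally show ?thesis .
  qed
  define s where "s \<omega> = (exp (6 * \<theta> * A \<omega>) + exp (6 * \<theta> * E \<omega>) + exp (6 * \<theta> * E' \<omega>)) / 6" for \<omega>
  have Is: "(\<integral>\<^sup>+\<omega>. ennreal (s \<omega>) \<partial>M) \<le> ennreal (C / 2)"
  proof -
    have "(\<integral>\<^sup>+\<omega>. ennreal (s \<omega>) \<partial>M) = (\<integral>\<^sup>+\<omega>. ennreal (1/6) * (ennreal (exp (6 * \<theta> * A \<omega>)) + ennreal (exp (6 * \<theta> * E \<omega>)) + ennreal (exp (6 * \<theta> * E' \<omega>))) \<partial>M)"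
      by (intro nn_integral_cong) (simp add: s_def ennreal_mult[symmetric] ennreal_plus[symmetric] del: ennreal_plus)
    also have "\<dots> = ennreal (1/6) * ((\<integral>\<^sup>+\<omega>. ennreal (exp (6 * \<theta> * A \<omega>)) \<partial>M) + (\<integral>\<^sup>+\<omega>. ennreal (exp (6 * \<theta> * E \<omega>)) \<partial>M) + (\<integral>\<^sup>+\<omega>. ennreal (exp (6 * \<theta> * E' \<omega>)) \<partial>M))"
      by (simp add: nn_integral_cmult nn_integral_add)
    also have "\<dots> \<le> ennreal (1/6) * (ennreal C + ennreal C + ennreal C)"
      by (intro mult_left_mono add_mono IA IE IE') auto
    also have "\<dots> = ennreal (C / 2)"
      using pos by (simp add: ennreal_mult[symmetric] ennreal_plus[symmetric] del: ennreal_plus)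
    finally show ?thesis .
  qed
  have pw: "exp (\<theta> * growth B \<beta> j \<omega>) \<le> exp (- (\<theta> * B / 16)) + K * (r \<omega> + s \<omega>)" for \<omega>
  proof -
    define v where "v = \<Delta> \<omega> - \<beta> / 16 + (A \<omega> + E \<omega> + E' \<omega>)"
    have g: "growth B \<beta> j \<omega> = max (- (B / 16)) v"
      by (simp add: growth_def v_def \<Delta>_def A_def E_def E'_def)
    \<comment> \<open>Normalised so that \<open>x\<^sup>2\<close> has mean 1.\<close>
    define x where "x = exp (\<theta> * \<Delta> \<omega> - \<theta>\<^sup>2 / 8)"
    define y where "y = exp (\<theta> * (A \<omega> + E \<omega> + E' \<omega>))"
    have "x * y \<le> (x\<^sup>2 + y\<^sup>2) / 2"
      using sum_squares_bound[of x y] by simp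
    moreover have "x\<^sup>2 = 2 * r \<omega>"
      by (simp add: x_def r_def power2_eq_square exp_add[symmetric] algebra_simps)
    moreover have "y\<^sup>2 \<le> 2 * s \<omega>"
      using exp_sum3_le[of "2 * \<theta> * A \<omega>" "2 * \<theta> * E \<omega>" "2 * \<theta> * E' \<omega>"]
      by (simp add: y_def s_def power2_eq_square exp_add[symmetric] algebra_simps)
    ultimately have "K * (x * y) \<le> K * (r \<omega> + s \<omega>)" using pos by (intro mult_left_mono) auto
    moreover have "exp (\<theta> * v) = K * (x * y)"
      by (simp add: K_def x_def y_def v_def exp_add[symmetric] algebra_simps)
    ultimately have "exp (\<theta> * v) \<le> K * (r \<omega> + s \<omega>)" by simp
    moreover have "0 \<le> K * (r \<omega> + s \<omega>)" using pos by (simp add: r_def s_def)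
    ultimately show ?thesis unfolding g
      by (cases "- (B / 16) \<le> v") (auto simp: max_def add_increasing add_increasing2)
  qed
  have [measurable]: "r \<in> borel_measurable M" "s \<in> borel_measurable M"
    unfolding r_def s_def by measurable
  have rs: "0 \<le> r \<omega>" "0 \<le> s \<omega>" for \<omega> by (auto simp: r_def s_def)
  have "(\<integral>\<^sup>+\<omega>. ennreal (exp (\<theta> * growth B \<beta> j \<omega>)) \<partial>M) \<le>
      (\<integral>\<^sup>+\<omega>. ennreal (exp (- (\<theta> * B / 16))) + ennreal K * (ennreal (r \<omega>) + ennreal (s \<omega>)) \<partial>M)"
    using pw pos rs by (intro nn_integral_mono)
      (simp add: ennreal_mult[symmetric] ennreal_plus[symmetric] ennreal_leI del: ennreal_plus)
  also have "\<dots> = ennreal (exp (- (\<theta> * B / 16))) + ennreal K * ((\<integral>\<^sup>+\<omega>. ennreal (r \<omega>) \<partial>M) + (\<integral>\<^sup>+\<omega>. ennreal (s \<omega>) \<partial>M))"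
    by (simp add: nn_integral_add nn_integral_cmult emeasure_space_1)
  also have "\<dots> \<le> ennreal (exp (- (\<theta> * B / 16))) + ennreal K * (ennreal (1/2) + ennreal (C / 2))"
    unfolding Ir by (intro add_left_mono mult_left_mono Is) auto
  also have "ennreal (1/2) + ennreal (C / 2) = ennreal ((1 + C) / 2)"
    using pos by (subst ennreal_plus[symmetric]) (auto simp: add_divide_distrib)
  also have "ennreal (exp (- (\<theta> * B / 16))) + ennreal K * ennreal ((1 + C) / 2) = ennreal (exp (- (\<theta> * B / 16)) + K * ((1 + C) / 2))"
    using pos by (simp add: ennreal_mult[symmetric] ennreal_plus[symmetric] del: ennreal_plus)
  finally show ?thesis by (simp add: K_def C_def)
qed

lemma exp_max_growth_le:
  assumes \<theta>: "0 < \<theta>" "6 * \<theta> < B - \<beta>"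
  shows "(\<integral>\<^sup>+\<omega>. ennreal (exp (\<theta> * max_growth B \<beta> j \<omega>)) \<partial>M) \<le> ennreal (2 * exp (2 * \<theta>\<^sup>2 + 6 * \<theta>))"
proof -
  let ?a = "blk j" and ?e = "blk (Suc j)" and ?b = "B - \<beta>"
  define A where "A \<omega> = drawdown_integral ?b ?a ?e (\<lambda>t. w t \<omega>)" for \<omega>
  define E where "E \<omega> = drop_sup 0 ?a ?e (\<lambda>t. w t \<omega>)" for \<omega>
  define E' where "E' \<omega> = rise_sup ?a ?e (\<lambda>t. w t \<omega>)" for \<omega>
  define C where "C = 2 * exp (2 * \<theta>\<^sup>2 + 6 * \<theta>)"
  have [measurable]: "A \<in> borel_measurable M" "E \<in> borel_measurable M" "E' \<in> borel_measurable M"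
    unfolding A_def E_def E'_def
    by (auto intro!: measurable_blk_alg[OF blk_drawdown_integral_meas] measurable_blk_alg[OF blk_drop_meas]
        measurable_blk_alg[OF blk_rise_meas])
  have e1: "exp (2 * (?e - ?a) * (3 * \<theta>)\<^sup>2 + 2 * (3 * \<theta>)) \<le> C"
  proof -
    have "exp (2 * (?e - ?a) * (3 * \<theta>)\<^sup>2 + 2 * (3 * \<theta>)) \<le> exp (2 * \<theta>\<^sup>2 + 6 * \<theta>)"
      by (simp add: blk_Suc power_mult_distrib)
    also have "\<dots> \<le> C" by (simp add: C_def)
    finally show ?thesis .
  qed
  have IA: "(\<integral>\<^sup>+\<omega>. ennreal (exp (3 * \<theta> * A \<omega>)) \<partial>M) \<le> ennreal C"
  proof -
    have "(\<integral>\<^sup>+\<omega>. ennreal (exp (3 * \<theta> * A \<omega>)) \<partial>M) \<le> ennreal (?b / (?b - 3 * \<theta>))"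
      unfolding A_def using \<theta> by (intro exp_drawdown_integral_le) (auto simp: blk_Suc)
    also have "\<dots> \<le> ennreal C"
    proof (intro ennreal_leI)
      have "?b / (?b - 3 * \<theta>) \<le> 2" using \<theta> by (simp add: field_simps)
      also have "\<dots> \<le> C" using \<theta> by (simp add: C_def)
      finally show "?b / (?b - 3 * \<theta>) \<le> C" .
    qed
    finally show ?thesis .
  qed
  have IE: "(\<integral>\<^sup>+\<omega>. ennreal (exp (3 * \<theta> * E \<omega>)) \<partial>M) \<le> ennreal C"
    unfolding E_def using \<theta> by (intro order_trans[OF exp_drop_le ennreal_leI[OF e1]]) (auto simp: blk_Suc)
  have IE': "(\<integral>\<^sup>+\<omega>. ennreal (exp (3 * \<theta> * E' \<omega>)) \<partial>M) \<le> ennreal C"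
    unfolding E'_def using \<theta> by (intro order_trans[OF exp_rise_le ennreal_leI[OF e1]]) (auto simp: blk_Suc)
  have "(\<integral>\<^sup>+\<omega>. ennreal (exp (\<theta> * max_growth B \<beta> j \<omega>)) \<partial>M) \<le>
      (\<integral>\<^sup>+\<omega>. ennreal (1/3) * (ennreal (exp (3 * \<theta> * A \<omega>)) + ennreal (exp (3 * \<theta> * E \<omega>)) + ennreal (exp (3 * \<theta> * E' \<omega>))) \<partial>M)"
  proof (intro nn_integral_mono)
    fix \<omega>
    have "exp (\<theta> * max_growth B \<beta> j \<omega>) \<le> (exp (3 * \<theta> * A \<omega>) + exp (3 * \<theta> * E \<omega>) + exp (3 * \<theta> * E' \<omega>)) / 3"
      using exp_sum3_le[of "\<theta> * A \<omega>" "\<theta> * E \<omega>" "\<theta> * E' \<omega>"]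
      by (simp add: max_growth_def A_def E_def E'_def algebra_simps)
    then show "ennreal (exp (\<theta> * max_growth B \<beta> j \<omega>)) \<le>
        ennreal (1/3) * (ennreal (exp (3 * \<theta> * A \<omega>)) + ennreal (exp (3 * \<theta> * E \<omega>)) + ennreal (exp (3 * \<theta> * E' \<omega>)))"
      by (simp add: ennreal_mult[symmetric] ennreal_plus[symmetric] ennreal_leI del: ennreal_plus)
  qed
  also have "\<dots> = ennreal (1/3) * ((\<integral>\<^sup>+\<omega>. ennreal (exp (3 * \<theta> * A \<omega>)) \<partial>M) + (\<integral>\<^sup>+\<omega>. ennreal (exp (3 * \<theta> * E \<omega>)) \<partial>M) + (\<integral>\<^sup>+\<omega>. ennreal (exp (3 * \<theta> * E' \<omega>)) \<partial>M))"
    by (simp add: nn_integral_cmult nn_integral_add)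
  also have "\<dots> \<le> ennreal (1/3) * (ennreal C + ennreal C + ennreal C)"
    by (intro mult_left_mono add_mono IA IE IE') auto
  also have "\<dots> = ennreal C"
    by (simp add: C_def ennreal_mult[symmetric] ennreal_plus[symmetric] del: ennreal_plus)
  finally show ?thesis by (simp add: C_def)
qed

lemma exp_sum_growth_le:
  assumes \<rho>: "\<And>j. (\<integral>\<^sup>+\<omega>. ennreal (exp (\<theta> * growth B \<beta> j \<omega>)) \<partial>M) \<le> ennreal \<rho>" "0 \<le> \<rho>"
  shows "(\<integral>\<^sup>+\<omega>. ennreal (exp (\<theta> * (\<Sum>j<k. growth B \<beta> j \<omega>))) \<partial>M) \<le> ennreal (\<rho> ^ k)"
proof -
  have ind: "indep_vars (\<lambda>_. borel) (\<lambda>j \<omega>. ennreal (exp (\<theta> * growth B \<beta> j \<omega>))) {..<k}"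
    by (rule indep_vars_subset[OF indep_vars_blk]) (use growth_meas in measurable)
  have "(\<integral>\<^sup>+\<omega>. ennreal (exp (\<theta> * (\<Sum>j<k. growth B \<beta> j \<omega>))) \<partial>M) = (\<integral>\<^sup>+\<omega>. (\<Prod>j<k. ennreal (exp (\<theta> * growth B \<beta> j \<omega>))) \<partial>M)"
    by (simp add: prod_ennreal exp_sum[symmetric] sum_distrib_left)
  also have "\<dots> = (\<Prod>j<k. \<integral>\<^sup>+\<omega>. ennreal (exp (\<theta> * growth B \<beta> j \<omega>)) \<partial>M)"
    by (rule indep_vars_nn_integral[OF _ ind]) auto
  also have "\<dots> \<le> (\<Prod>j<k. ennreal \<rho>)" by (intro prod_mono_ennreal \<rho>)
  also have "\<dots> = ennreal (\<rho> ^ k)" using \<rho> by (simp add: ennreal_power)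
  finally show ?thesis .
qed

lemma exp_sum_growth_max_le:
  assumes \<rho>: "\<And>j. (\<integral>\<^sup>+\<omega>. ennreal (exp (\<theta> * growth B \<beta> j \<omega>)) \<partial>M) \<le> ennreal \<rho>" "0 \<le> \<rho>"
    and C: "(\<integral>\<^sup>+\<omega>. ennreal (exp (\<theta> * max_growth B \<beta> k \<omega>)) \<partial>M) \<le> ennreal C" "0 \<le> C"
  shows "(\<integral>\<^sup>+\<omega>. ennreal (exp (\<theta> * ((\<Sum>j<k. growth B \<beta> j \<omega>) + max_growth B \<beta> k \<omega>))) \<partial>M) \<le> ennreal (\<rho> ^ k * C)"
proof -
  define X where "X j \<omega> = ennreal (exp (\<theta> * (if j < k then growth B \<beta> j \<omega> else max_growth B \<beta> j \<omega>)))" for j \<omega>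
  have "X j \<in> borel_measurable (blk_alg j)" for j
    unfolding X_def using growth_meas[of B \<beta> j] max_growth_meas[of B \<beta> j] by (cases "j < k") auto
  then have ind: "indep_vars (\<lambda>_. borel) X {..<Suc k}"
    by (intro indep_vars_subset[OF indep_vars_blk]) auto
  have "(\<integral>\<^sup>+\<omega>. ennreal (exp (\<theta> * ((\<Sum>j<k. growth B \<beta> j \<omega>) + max_growth B \<beta> k \<omega>))) \<partial>M) = (\<integral>\<^sup>+\<omega>. (\<Prod>j<Suc k. X j \<omega>) \<partial>M)"
  proof (intro nn_integral_cong)
    fix \<omega>
    have "(\<Prod>j<k. X j \<omega>) = (\<Prod>j<k. ennreal (exp (\<theta> * growth B \<beta> j \<omega>)))"
      by (intro prod.cong) (auto simp: X_def)
    then show "ennreal (exp (\<theta> * ((\<Sum>j<k. growth B \<beta> j \<omega>) + max_growth B \<beta> k \<omega>))) = (\<Prod>j<Suc k. X j \<omega>)"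
      by (simp add: X_def prod_ennreal exp_sum[symmetric] ennreal_mult[symmetric] exp_add distrib_left sum_distrib_left)
  qed
  also have "\<dots> = (\<Prod>j<Suc k. \<integral>\<^sup>+\<omega>. X j \<omega> \<partial>M)"
    by (rule indep_vars_nn_integral[OF _ ind]) auto
  also have "\<dots> = (\<Prod>j<k. \<integral>\<^sup>+\<omega>. X j \<omega> \<partial>M) * (\<integral>\<^sup>+\<omega>. X k \<omega> \<partial>M)" by simp
  also have "\<dots> \<le> (\<Prod>j<k. ennreal \<rho>) * ennreal C"
    by (intro mult_mono prod_mono_ennreal) (auto simp: X_def intro: \<rho> C)
  also have "\<dots> = ennreal (\<rho> ^ k * C)" using \<rho> C by (simp add: ennreal_power ennreal_mult)
  finally show ?thesis .
qed

lemma Q_block_growth: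
  assumes \<omega>: "\<omega> \<in> space M" and path: "reflected_path (\<lambda>t. w t \<omega>) D Q L \<beta> y0"
    and B: "\<And>s. blk j \<le> s \<Longrightarrow> s \<le> blk (Suc j) \<Longrightarrow> B \<le> Q s"
  shows "Q (blk (Suc j)) \<le> Q (blk j) + growth B \<beta> j \<omega>"
proof -
  interpret reflected_path "\<lambda>t. w t \<omega>" D Q L \<beta> y0 by fact
  let ?a = "blk j" and ?e = "blk (Suc j)" and ?b = "B - \<beta>" and ?p = "\<lambda>t. w t \<omega>"
  have c: "continuous_on {?a..t} ?p" for t using \<omega> by (intro w_cont_Icc) auto
  show ?thesis
  proof (cases "\<exists>z\<in>{?a..?e}. D z = 0")
    case False
    then have "Q ?e \<le> Q ?a - B * (?e - ?a)" by (intro Q_le_no_zero B) auto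
    then show ?thesis by (simp add: growth_def blk_Suc)
  next
    case True
    then obtain z where z: "z \<in> {?a..?e}" "D z = 0" by blast
    have "\<exists>\<sigma> g. ?a \<le> \<sigma> \<and> \<sigma> \<le> g \<and> g \<le> ?e \<and>
      Q ?e - Q ?a \<le> ?p g - ?p \<sigma> - \<beta> * (g - \<sigma>) - B * (?e - g) - B * (\<sigma> - ?a) + integral {?a..?e} (\<lambda>t. drawdown ?b ?a t ?p)"
    proof (rule Q_growth[OF _ _ z B])
      fix t u assume "?a \<le> u" "u \<le> t" "t \<le> ?e"
      then show "?p u - ?p t - ?b * (t - u) \<le> drawdown ?b ?a t ?p"
        unfolding drawdown_def by (intro run_sup_ge continuous_intros c) auto
    qed (use continuous_on_drawdown[OF c] in auto)
    then obtain \<sigma> g where sg: "?a \<le> \<sigma>" "\<sigma> \<le> g" "g \<le> ?e"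
      "Q ?e - Q ?a \<le> ?p g - ?p \<sigma> - \<beta> * (g - \<sigma>) - B * (?e - g) - B * (\<sigma> - ?a) + drawdown_integral ?b ?a ?e ?p"
      by (auto simp: drawdown_integral_def)
    \<comment> \<open>On the stretches before \<sigma> and after \<open>g\<close> the decay at rate
      \<open>B\<close> also supplies the drift \<beta> missing from the sum, so the displacement of
      \<open>w\<close> there is measured against slope \<open>B - \<beta>\<close>.\<close>
    have 1: "?p g - ?p ?e - ?b * (?e - g) \<le> drawdown ?b ?a ?e ?p"
      unfolding drawdown_def using sg by (intro run_sup_ge continuous_intros c) auto
    have 2: "?p ?a - ?p \<sigma> - ?b * (\<sigma> - ?a) \<le> drop_sup ?b ?a ?e ?p"
      unfolding drop_sup_def using sg by (intro run_sup_ge[of ?a ?e "\<lambda>u. ?p ?a - ?p u - ?b * (u - ?a)"] continuous_intros c) auto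
    have "Q ?e - Q ?a \<le> ?p ?e - ?p ?a - \<beta> / 16 + (drawdown_integral ?b ?a ?e ?p + drop_sup ?b ?a ?e ?p + drawdown ?b ?a ?e ?p)"
      using sg(4) 1 2 by (simp add: blk_Suc algebra_simps diff_divide_distrib)
    then show ?thesis by (simp add: growth_def)
  qed
qed

lemma Q_block_max_growth:
  assumes \<omega>: "\<omega> \<in> space M" and path: "reflected_path (\<lambda>t. w t \<omega>) D Q L \<beta> y0"
    and \<tau>: "blk j \<le> \<tau>" "\<tau> \<le> blk (Suc j)" and B0: "0 \<le> B"
    and B: "\<And>s. blk j \<le> s \<Longrightarrow> s \<le> \<tau> \<Longrightarrow> B \<le> Q s"
  shows "Q \<tau> \<le> Q (blk j) + max_growth B \<beta> j \<omega>"
proof -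
  interpret reflected_path "\<lambda>t. w t \<omega>" D Q L \<beta> y0 by fact
  let ?a = "blk j" and ?e = "blk (Suc j)" and ?b = "B - \<beta>" and ?p = "\<lambda>t. w t \<omega>"
  have c: "continuous_on {?a..t} ?p" for t using \<omega> by (intro w_cont_Icc) auto
  have nn: "0 \<le> max_growth B \<beta> j \<omega>"
    unfolding max_growth_def
    by (intro add_nonneg_nonneg rise_sup_nonneg drop_sup_nonneg drawdown_integral_nonneg c) auto
  show ?thesis
  proof (cases "\<exists>z\<in>{?a..\<tau>}. D z = 0")
    case False
    then have "Q \<tau> \<le> Q ?a - B * (\<tau> - ?a)" using \<tau> by (intro Q_le_no_zero B) auto
    moreover have "0 \<le> B * (\<tau> - ?a)" using B0 \<tau> by auto
    ultimately show ?thesis using nn by linarith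
  next
    case True
    then obtain z where z: "z \<in> {?a..\<tau>}" "D z = 0" by blast
    have "\<exists>\<sigma> g. ?a \<le> \<sigma> \<and> \<sigma> \<le> g \<and> g \<le> \<tau> \<and>
      Q \<tau> - Q ?a \<le> ?p g - ?p \<sigma> - \<beta> * (g - \<sigma>) - B * (\<tau> - g) - B * (\<sigma> - ?a) + integral {?a..\<tau>} (\<lambda>t. drawdown ?b ?a t ?p)"
    proof (rule Q_growth[OF _ _ z B])
      fix t u assume "?a \<le> u" "u \<le> t" "t \<le> \<tau>"
      then show "?p u - ?p t - ?b * (t - u) \<le> drawdown ?b ?a t ?p"
        unfolding drawdown_def by (intro run_sup_ge continuous_intros c) auto
    qed (use continuous_on_drawdown[OF c] \<tau> in auto)
    then obtain \<sigma> g where sg: "?a \<le> \<sigma>" "\<sigma> \<le> g" "g \<le> \<tau>"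
      "Q \<tau> - Q ?a \<le> ?p g - ?p \<sigma> - \<beta> * (g - \<sigma>) - B * (\<tau> - g) - B * (\<sigma> - ?a) + integral {?a..\<tau>} (\<lambda>t. drawdown ?b ?a t ?p)"
      by auto
    have 1: "?p g - ?p ?a \<le> rise_sup ?a ?e ?p"
      unfolding rise_sup_def using sg \<tau> by (intro run_sup_ge[of ?a ?e "\<lambda>u. ?p u - ?p ?a"] continuous_intros c) auto
    have 2: "?p ?a - ?p \<sigma> - 0 * (\<sigma> - ?a) \<le> drop_sup 0 ?a ?e ?p"
      unfolding drop_sup_def using sg \<tau> by (intro run_sup_ge[of ?a ?e "\<lambda>u. ?p ?a - ?p u - 0 * (u - ?a)"] continuous_intros c) auto
    have 3: "integral {?a..\<tau>} (\<lambda>t. drawdown ?b ?a t ?p) \<le> drawdown_integral ?b ?a ?e ?p"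
      unfolding drawdown_integral_def using \<tau>
      by (intro integral_subset_le integrable_continuous_real continuous_on_drawdown c) (auto intro!: drawdown_nonneg c)
    have 4: "0 \<le> \<beta> * (g - \<sigma>)" "0 \<le> B * (\<tau> - g)" "0 \<le> B * (\<sigma> - ?a)"
      using sg beta_pos B0 by auto
    show ?thesis unfolding max_growth_def using sg(4) 1 2 3 4 by linarith
  qed
qed

lemma Q_blocks_growth:
  assumes \<omega>: "\<omega> \<in> space M" and path: "reflected_path (\<lambda>t. w t \<omega>) D Q L \<beta> y0"
    and B: "\<And>s. 0 \<le> s \<Longrightarrow> s \<le> blk n \<Longrightarrow> B \<le> Q s"
  shows "Q (blk n) \<le> y0 + (\<Sum>j<n. growth B \<beta> j \<omega>)"
  using B
proof (induction n)
  case 0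
  then show ?case using reflected_path.Q_0[OF path] by simp
next
  case (Suc n)
  have "Q (blk n) \<le> y0 + (\<Sum>j<n. growth B \<beta> j \<omega>)"
  proof (rule Suc.IH)
    fix s assume "0 \<le> s" "s \<le> blk n"
    then show "B \<le> Q s" by (intro Suc.prems order_trans[OF _ blk_le[of n]])
  qed
  moreover have "Q (blk (Suc n)) \<le> Q (blk n) + growth B \<beta> n \<omega>"
    by (intro Q_block_growth[OF \<omega> path] Suc.prems) (auto intro: order_trans[OF blk_nonneg])
  ultimately show ?case by simp
qed

end

section \<open>Moments of the dominating sequence and the trials for the return\<close>

lemma normal_tail_pos:
  assumes "0 < \<sigma>"
  shows "0 < measure (density lborel (\<lambda>z. ennreal (normal_density 0 \<sigma> z))) {c<..}"
proof -
  interpret prob_space "density lborel (\<lambda>z. ennreal (normal_density 0 \<sigma> z))"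
    by (rule prob_space_normal_density[OF assms])
  have "emeasure (density lborel (\<lambda>z. ennreal (normal_density 0 \<sigma> z))) {c<..} \<noteq> 0"
  proof
    assume "emeasure (density lborel (\<lambda>z. ennreal (normal_density 0 \<sigma> z))) {c<..} = 0"
    then have "(\<integral>\<^sup>+z. ennreal (normal_density 0 \<sigma> z) * indicator {c<..} z \<partial>lborel) = 0"
      by (simp add: emeasure_density)
    then have "AE z in lborel. ennreal (normal_density 0 \<sigma> z) * indicator {c<..} z = 0"
      by (subst (asm) nn_integral_0_iff_AE) auto
    then have "AE z in lborel. z \<notin> {c<..}"
    proof eventually_elim
      case (elim z)
      then show ?case using normal_density_pos[OF assms, of 0 z] by (auto simp: indicator_def split: if_splits)
    qed
    then have "emeasure lborel {c<..} = 0"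
      by (subst (asm) AE_iff_measurable[where N = "{c<..}"]) auto
    moreover have "emeasure lborel {c<..<c+1} \<le> emeasure lborel {c<..}" by (intro emeasure_mono) auto
    ultimately show False by simp
  qed
  then show ?thesis by (simp add: emeasure_eq_measure zero_less_measure_iff)
qed

context brownian
begin

text \<open>Bundled into one vector per block so that a single notion of past serves
  \<open>dom\<close>, the steps and the oscillations.\<close>

definition blk_data :: "nat \<Rightarrow> 'a \<Rightarrow> real \<times> real \<times> real" where
  "blk_data j \<omega> = (w (blk (Suc j)) \<omega> - w (blk j) \<omega>,
     drawdown 0 (blk j) (blk (Suc j)) (\<lambda>t. w t \<omega>),
     rise_sup (blk j) (blk (Suc j)) (\<lambda>t. w t \<omega>) + drop_sup 0 (blk j) (blk (Suc j)) (\<lambda>t. w t \<omega>))"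

abbreviation "blk_step j \<omega> \<equiv> fst (blk_data j \<omega>)"
abbreviation "blk_dd j \<omega> \<equiv> fst (snd (blk_data j \<omega>))"
abbreviation "blk_osc j \<omega> \<equiv> snd (snd (blk_data j \<omega>))"

abbreviation data_alg :: "(real \<times> real \<times> real) measure" where
  "data_alg \<equiv> borel \<Otimes>\<^sub>M borel \<Otimes>\<^sub>M borel"

lemma blk_data_meas_blk: "blk_data j \<in> measurable (blk_alg j) data_alg"
  unfolding blk_data_def
  by (intro measurable_Pair borel_measurable_add w_blk_meas blk_drawdown_meas blk_rise_meas blk_drop_meas) auto

lemma blk_data_meas [measurable]: "blk_data j \<in> measurable M data_alg"
  by (rule measurable_blk_alg[OF blk_data_meas_blk])

lemma indep_blk_data: "indep_vars (\<lambda>_. data_alg) blk_data {..<n}"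
  by (rule indep_vars_subset[OF indep_vars_blk[OF blk_data_meas_blk]]) auto

lemma blk_data_past: "j < k \<Longrightarrow> blk_data j \<in> measurable (past M data_alg blk_data k) data_alg"
  by (rule measurable_past) auto

lemma nn_integral_blk_mult:
  assumes "P \<in> borel_measurable (past M data_alg blk_data k)" "g \<in> borel_measurable data_alg"
  shows "(\<integral>\<^sup>+\<omega>. P \<omega> * g (blk_data k \<omega>) \<partial>M) = (\<integral>\<^sup>+\<omega>. P \<omega> \<partial>M) * (\<integral>\<^sup>+\<omega>. g (blk_data k \<omega>) \<partial>M)"
  by (rule nn_integral_past_mult[OF indep_blk_data[of "Suc k"] _ assms]) simp

text \<open>A dominating sequence for \<open>-Q\<^sub>1\<close> at the block ends which depends on the Brownian motion only.\<close>

fun dom :: "real \<Rightarrow> nat \<Rightarrow> 'a \<Rightarrow> real" where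
  "dom \<beta> 0 \<omega> = 0"
| "dom \<beta> (Suc k) \<omega> = exp (- (1/16)) * dom \<beta> k \<omega> + \<beta> + blk_dd k \<omega>"

lemma dom_past: "k \<le> n \<Longrightarrow> dom \<beta> k \<in> borel_measurable (past M data_alg blk_data n)"
proof (induction k)
  case 0
  have "dom \<beta> 0 = (\<lambda>_. 0)" by (simp add: fun_eq_iff)
  then show ?case by simp
next
  case (Suc k)
  have [measurable]: "blk_data k \<in> measurable (past M data_alg blk_data n) data_alg" using Suc by (intro blk_data_past) auto
  have [measurable]: "dom \<beta> k \<in> borel_measurable (past M data_alg blk_data n)" using Suc by auto
  have "(\<lambda>\<omega>. exp (- (1/16)) * dom \<beta> k \<omega> + \<beta> + blk_dd k \<omega>) \<in> borel_measurable (past M data_alg blk_data n)" by measurable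
  then show ?case by simp
qed

lemma dom_meas [measurable]: "dom \<beta> k \<in> borel_measurable M"
proof (induction k)
  case 0
  have "dom \<beta> 0 = (\<lambda>_. 0)" by (simp add: fun_eq_iff)
  then show ?case by simp
next
  case (Suc k)
  note [measurable] = Suc
  have "(\<lambda>\<omega>. exp (- (1/16)) * dom \<beta> k \<omega> + \<beta> + blk_dd k \<omega>) \<in> borel_measurable M" by measurable
  then show ?case by simp
qed

lemma exp_blk_dd_le:
  assumes "0 < \<mu>"
  shows "(\<integral>\<^sup>+\<omega>. ennreal (exp (\<mu> * blk_dd j \<omega>)) \<partial>M) \<le> ennreal (exp (\<mu>\<^sup>2 / 8 + 2 * \<mu>))"
  using exp_driftless_drawdown_le[of "blk j" "blk (Suc j)" \<mu>] assms by (simp add: blk_data_def blk_Suc)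

text \<open>Rise and drop are dependent; Young's inequality separates them and doubles \<mu>, which
  gives four times the quadratic coefficient of either.\<close>

lemma exp_blk_osc_le:
  assumes "0 < \<mu>"
  shows "(\<integral>\<^sup>+\<omega>. ennreal (exp (\<mu> * blk_osc j \<omega>)) \<partial>M) \<le> ennreal (exp (\<mu>\<^sup>2 / 2 + 4 * \<mu>))"
proof -
  let ?a = "blk j" and ?e = "blk (Suc j)"
  define E where "E \<omega> = drop_sup 0 ?a ?e (\<lambda>t. w t \<omega>)" for \<omega>
  define E' where "E' \<omega> = rise_sup ?a ?e (\<lambda>t. w t \<omega>)" for \<omega>
  define C where "C = exp (\<mu>\<^sup>2 / 2 + 4 * \<mu>)"
  have [measurable]: "E \<in> borel_measurable M" "E' \<in> borel_measurable M"
    unfolding E_def E'_def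
    by (auto intro!: measurable_blk_alg[OF blk_drop_meas] measurable_blk_alg[OF blk_rise_meas])
  have IE: "(\<integral>\<^sup>+\<omega>. ennreal (exp (2 * \<mu> * E \<omega>)) \<partial>M) \<le> ennreal C"
    unfolding E_def C_def using exp_drop_le[of ?a ?e "2 * \<mu>"] assms by (simp add: blk_Suc power_mult_distrib)
  have IE': "(\<integral>\<^sup>+\<omega>. ennreal (exp (2 * \<mu> * E' \<omega>)) \<partial>M) \<le> ennreal C"
    unfolding E'_def C_def using exp_rise_le[of ?a ?e "2 * \<mu>"] assms by (simp add: blk_Suc power_mult_distrib)
  have "(\<integral>\<^sup>+\<omega>. ennreal (exp (\<mu> * blk_osc j \<omega>)) \<partial>M) \<le>
      (\<integral>\<^sup>+\<omega>. ennreal (1/2) * (ennreal (exp (2 * \<mu> * E \<omega>)) + ennreal (exp (2 * \<mu> * E' \<omega>))) \<partial>M)"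
  proof (intro nn_integral_mono)
    fix \<omega>
    have "exp (\<mu> * blk_osc j \<omega>) = exp (\<mu> * E' \<omega>) * exp (\<mu> * E \<omega>)"
      by (simp add: blk_data_def E_def E'_def exp_add[symmetric] distrib_left)
    also have "\<dots> \<le> ((exp (\<mu> * E' \<omega>))\<^sup>2 + (exp (\<mu> * E \<omega>))\<^sup>2) / 2"
      using sum_squares_bound[of "exp (\<mu> * E' \<omega>)" "exp (\<mu> * E \<omega>)"] by simp
    also have "\<dots> = 1/2 * (exp (2 * \<mu> * E \<omega>) + exp (2 * \<mu> * E' \<omega>))"
      by (simp add: power2_eq_square exp_add[symmetric] mult.assoc)
    finally have "ennreal (exp (\<mu> * blk_osc j \<omega>)) \<le> ennreal (1/2 * (exp (2 * \<mu> * E \<omega>) + exp (2 * \<mu> * E' \<omega>)))"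
      by (rule ennreal_leI)
    then show "ennreal (exp (\<mu> * blk_osc j \<omega>)) \<le> ennreal (1/2) * (ennreal (exp (2 * \<mu> * E \<omega>)) + ennreal (exp (2 * \<mu> * E' \<omega>)))"
      by (subst (asm) ennreal_mult) auto
  qed
  also have "\<dots> = ennreal (1/2) * ((\<integral>\<^sup>+\<omega>. ennreal (exp (2 * \<mu> * E \<omega>)) \<partial>M) + (\<integral>\<^sup>+\<omega>. ennreal (exp (2 * \<mu> * E' \<omega>)) \<partial>M))"
    by (subst nn_integral_cmult) (auto simp: nn_integral_add)
  also have "\<dots> \<le> ennreal (1/2) * (ennreal C + ennreal C)"
    by (intro mult_left_mono add_mono IE IE') auto
  also have "\<dots> = ennreal (1/2 * (C + C))"
    by (subst ennreal_mult, simp, simp add: C_def, subst ennreal_plus) (auto simp: C_def)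
  finally show ?thesis by (simp add: C_def)
qed

text \<open>The recursion replaces \<mu> by \<open>q * \<mu>\<close> with
  \<open>q = exp (- (1/16))\<close>, so the induction runs over all \<mu> at once. The coefficients
  are fixed points: \<open>q \<le> 16/17\<close> turns the linear input \<open>\<beta> + 2\<close>
  into \<open>17 * (\<beta> + 2)\<close>, and \<open>q\<^sup>2 \<le> 113/128\<close> turns 1/8 into
  16/15.\<close>

lemma exp_dom_le:
  assumes \<beta>: "0 < \<beta>" and \<mu>: "0 < \<mu>"
  shows "(\<integral>\<^sup>+\<omega>. ennreal (exp (\<mu> * dom \<beta> k \<omega>)) \<partial>M) \<le> ennreal (exp (17 * (\<beta> + 2) * \<mu> + 16/15 * \<mu>\<^sup>2))"
  using \<mu>
proof (induction k arbitrary: \<mu>)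
  case 0
  have "1 \<le> exp (17 * (\<beta> + 2) * \<mu> + 16/15 * \<mu>\<^sup>2)" using \<beta> 0 by simp
  then show ?case by (simp add: emeasure_space_1)
next
  case (Suc k)
  define q where "q = exp (- (1/16) :: real)"
  have q: "0 < q" "q \<le> 16/17" "q\<^sup>2 \<le> 113/128"
  proof -
    have "q = inverse (exp (1/16))" by (simp add: q_def exp_minus)
    also have "\<dots> \<le> inverse (1 + 1/16)"
      using exp_ge_add_one_self[of "1/16::real"] by (intro le_imp_inverse_le) auto
    finally show "q \<le> 16/17" by simp
    have "q\<^sup>2 = inverse (exp (1/8))" by (simp add: q_def power2_eq_square exp_minus[symmetric] exp_add[symmetric])
    also have "\<dots> \<le> inverse (1 + 1/8 + (1/8)\<^sup>2 / 2)"
      using exp_lower_Taylor_quadratic[of "1/8::real"] by (intro le_imp_inverse_le) (auto simp: power2_eq_square)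
    also have "\<dots> \<le> 113/128" by (simp add: power2_eq_square)
    finally show "q\<^sup>2 \<le> 113/128" .
  qed (simp add: q_def)
  have [measurable]: "(\<lambda>\<omega>. ennreal (exp (\<mu> * q * dom \<beta> k \<omega>))) \<in> borel_measurable (past M data_alg blk_data k)"
    using dom_past[of k k \<beta>] by measurable
  have "(\<integral>\<^sup>+\<omega>. ennreal (exp (\<mu> * dom \<beta> (Suc k) \<omega>)) \<partial>M) =
      (\<integral>\<^sup>+\<omega>. ennreal (exp (\<mu> * \<beta>)) * (ennreal (exp (\<mu> * q * dom \<beta> k \<omega>)) * ennreal (exp (\<mu> * blk_dd k \<omega>))) \<partial>M)"
    by (intro nn_integral_cong) (simp add: q_def ennreal_mult[symmetric] exp_add[symmetric] algebra_simps)
  also have "\<dots> = ennreal (exp (\<mu> * \<beta>)) * (\<integral>\<^sup>+\<omega>. ennreal (exp (\<mu> * q * dom \<beta> k \<omega>)) * ennreal (exp (\<mu> * blk_dd k \<omega>)) \<partial>M)"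
    by (rule nn_integral_cmult) measurable
  also have "(\<integral>\<^sup>+\<omega>. ennreal (exp (\<mu> * q * dom \<beta> k \<omega>)) * ennreal (exp (\<mu> * blk_dd k \<omega>)) \<partial>M) =
      (\<integral>\<^sup>+\<omega>. ennreal (exp (\<mu> * q * dom \<beta> k \<omega>)) \<partial>M) * (\<integral>\<^sup>+\<omega>. ennreal (exp (\<mu> * blk_dd k \<omega>)) \<partial>M)"
    by (rule nn_integral_blk_mult[of _ _ "\<lambda>x. ennreal (exp (\<mu> * fst (snd x)))"]) measurable
  also have "ennreal (exp (\<mu> * \<beta>)) * \<dots> \<le> ennreal (exp (\<mu> * \<beta>)) *
      (ennreal (exp (17 * (\<beta> + 2) * (\<mu> * q) + 16/15 * (\<mu> * q)\<^sup>2)) * ennreal (exp (\<mu>\<^sup>2 / 8 + 2 * \<mu>)))"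
    using Suc.prems q by (intro mult_left_mono mult_mono Suc.IH exp_blk_dd_le) auto
  also have "\<dots> = ennreal (exp (\<mu> * \<beta> + (17 * (\<beta> + 2) * (\<mu> * q) + 16/15 * (\<mu> * q)\<^sup>2) + (\<mu>\<^sup>2 / 8 + 2 * \<mu>)))"
    by (simp add: ennreal_mult[symmetric] exp_add)
  also have "\<dots> \<le> ennreal (exp (17 * (\<beta> + 2) * \<mu> + 16/15 * \<mu>\<^sup>2))"
  proof (intro ennreal_leI)
    have "(17 * (\<beta> + 2) * \<mu>) * q \<le> (17 * (\<beta> + 2) * \<mu>) * (16/17)" using q \<beta> Suc.prems by (intro mult_left_mono) auto
    moreover have "(16/15 * \<mu>\<^sup>2) * q\<^sup>2 \<le> (16/15 * \<mu>\<^sup>2) * (113/128)" using q by (intro mult_left_mono) auto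
    ultimately have "\<mu> * \<beta> + (17 * (\<beta> + 2) * (\<mu> * q) + 16/15 * (\<mu> * q)\<^sup>2) + (\<mu>\<^sup>2 / 8 + 2 * \<mu>) \<le> 17 * (\<beta> + 2) * \<mu> + 16/15 * \<mu>\<^sup>2"
      by (simp add: power_mult_distrib algebra_simps)
    then show "exp (\<mu> * \<beta> + (17 * (\<beta> + 2) * (\<mu> * q) + 16/15 * (\<mu> * q)\<^sup>2) + (\<mu>\<^sup>2 / 8 + 2 * \<mu>)) \<le> exp (17 * (\<beta> + 2) * \<mu> + 16/15 * \<mu>\<^sup>2)"
      by simp
  qed
  finally show ?case .
qed

text \<open>\<open>dom\<close> at the start of a block is independent of the oscillation inside it,
  so moments multiply. The quadratic coefficient is \<open>16/15 + 1/2\<close>, rounded up to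
  8/5.\<close>

lemma dom_osc_tail:
  assumes \<beta>: "0 < \<beta>" and \<mu>: "0 < \<mu>"
  shows "prob {\<omega> \<in> space M. x \<le> dom \<beta> k \<omega> + \<beta> + blk_osc k \<omega>} \<le> exp (- \<mu> * x) * exp (18 * (\<beta> + 3) * \<mu> + 8/5 * \<mu>\<^sup>2)"
proof (rule chernoff)
  have [measurable]: "(\<lambda>\<omega>. ennreal (exp (\<mu> * dom \<beta> k \<omega>))) \<in> borel_measurable (past M data_alg blk_data k)"
    using dom_past[of k k \<beta>] by measurable
  have "(\<integral>\<^sup>+\<omega>. ennreal (exp (\<mu> * (dom \<beta> k \<omega> + \<beta> + blk_osc k \<omega>))) \<partial>M) =
      (\<integral>\<^sup>+\<omega>. ennreal (exp (\<mu> * \<beta>)) * (ennreal (exp (\<mu> * dom \<beta> k \<omega>)) * ennreal (exp (\<mu> * blk_osc k \<omega>))) \<partial>M)"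
    by (intro nn_integral_cong) (simp add: ennreal_mult[symmetric] exp_add[symmetric] algebra_simps)
  also have "\<dots> = ennreal (exp (\<mu> * \<beta>)) * (\<integral>\<^sup>+\<omega>. ennreal (exp (\<mu> * dom \<beta> k \<omega>)) * ennreal (exp (\<mu> * blk_osc k \<omega>)) \<partial>M)"
    by (rule nn_integral_cmult) measurable
  also have "(\<integral>\<^sup>+\<omega>. ennreal (exp (\<mu> * dom \<beta> k \<omega>)) * ennreal (exp (\<mu> * blk_osc k \<omega>)) \<partial>M) =
      (\<integral>\<^sup>+\<omega>. ennreal (exp (\<mu> * dom \<beta> k \<omega>)) \<partial>M) * (\<integral>\<^sup>+\<omega>. ennreal (exp (\<mu> * blk_osc k \<omega>)) \<partial>M)"
    by (rule nn_integral_blk_mult[of _ _ "\<lambda>x. ennreal (exp (\<mu> * snd (snd x)))"]) measurable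
  also have "ennreal (exp (\<mu> * \<beta>)) * \<dots> \<le> ennreal (exp (\<mu> * \<beta>)) *
      (ennreal (exp (17 * (\<beta> + 2) * \<mu> + 16/15 * \<mu>\<^sup>2)) * ennreal (exp (\<mu>\<^sup>2 / 2 + 4 * \<mu>)))"
    using \<beta> \<mu> by (intro mult_left_mono mult_mono exp_dom_le exp_blk_osc_le) auto
  also have "\<dots> = ennreal (exp (\<mu> * \<beta> + (17 * (\<beta> + 2) * \<mu> + 16/15 * \<mu>\<^sup>2) + (\<mu>\<^sup>2 / 2 + 4 * \<mu>)))"
    by (simp add: ennreal_mult[symmetric] exp_add[symmetric] add_ac)
  also have "\<dots> \<le> ennreal (exp (18 * (\<beta> + 3) * \<mu> + 8/5 * \<mu>\<^sup>2))"
    using \<mu> by (intro ennreal_leI) (simp add: algebra_simps)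
  finally show "(\<integral>\<^sup>+\<omega>. ennreal (exp (\<mu> * (dom \<beta> k \<omega> + \<beta> + blk_osc k \<omega>))) \<partial>M) \<le> ennreal (exp (18 * (\<beta> + 3) * \<mu> + 8/5 * \<mu>\<^sup>2))" .
qed (use \<mu> in auto)

lemma D_le_dom:
  assumes \<omega>: "\<omega> \<in> space M" and path: "reflected_path (\<lambda>t. w t \<omega>) D Q L \<beta> y0"
  shows "D (blk k) \<le> dom \<beta> k \<omega>"
proof (induction k)
  case 0
  then show ?case using reflected_path.D_0[OF path] by simp
next
  case (Suc k)
  have "D (blk (Suc k)) \<le> exp (-(blk (Suc k) - blk k)) * D (blk k) + \<beta> + blk_dd k \<omega>"
  proof (rule reflected_path.D_mean_reversion[OF path])
    fix u assume "blk k \<le> u" "u \<le> blk (Suc k)"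
    then have "w u \<omega> - w (blk (Suc k)) \<omega> - 0 * (blk (Suc k) - u) \<le> drawdown 0 (blk k) (blk (Suc k)) (\<lambda>t. w t \<omega>)"
      unfolding drawdown_def using \<omega>
      by (intro run_sup_ge[of _ _ "\<lambda>u. w u \<omega> - w (blk (Suc k)) \<omega> - 0 * (blk (Suc k) - u)"] continuous_intros w_cont_Icc) auto
    then show "w u \<omega> - w (blk (Suc k)) \<omega> \<le> blk_dd k \<omega>" by (simp add: blk_data_def)
  qed auto
  also have "\<dots> \<le> exp (- (1/16)) * dom \<beta> k \<omega> + \<beta> + blk_dd k \<omega>"
    using Suc by (simp add: blk_Suc)
  finally show ?case by simp
qed

text \<open>Inside a block the contraction factor is given up, and rise plus drop bounds every
  difference \<open>w u - w t\<close>.\<close>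

lemma D_le_dom_osc:
  assumes \<omega>: "\<omega> \<in> space M" and path: "reflected_path (\<lambda>t. w t \<omega>) D Q L \<beta> y0"
    and t: "blk k \<le> t" "t \<le> blk (Suc k)"
  shows "D t \<le> dom \<beta> k \<omega> + \<beta> + blk_osc k \<omega>"
proof -
  have c: "continuous_on {blk k..b} (\<lambda>t. w t \<omega>)" for b using \<omega> by (intro w_cont_Icc) auto
  have "D t \<le> exp (-(t - blk k)) * D (blk k) + \<beta> + blk_osc k \<omega>"
  proof (rule reflected_path.D_mean_reversion[OF path])
    fix u assume u: "blk k \<le> u" "u \<le> t"
    have "w u \<omega> - w (blk k) \<omega> \<le> rise_sup (blk k) (blk (Suc k)) (\<lambda>t. w t \<omega>)"
      unfolding rise_sup_def using u t
      by (intro run_sup_ge[of _ _ "\<lambda>u. w u \<omega> - w (blk k) \<omega>"] continuous_intros c) auto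
    moreover have "w (blk k) \<omega> - w t \<omega> - 0 * (t - blk k) \<le> drop_sup 0 (blk k) (blk (Suc k)) (\<lambda>t. w t \<omega>)"
      unfolding drop_sup_def using t
      by (intro run_sup_ge[of _ _ "\<lambda>t. w (blk k) \<omega> - w t \<omega> - 0 * (t - blk k)"] continuous_intros c) auto
    ultimately show "w u \<omega> - w t \<omega> \<le> blk_osc k \<omega>" by (simp add: blk_data_def)
  qed (use t in auto)
  also have "exp (-(t - blk k)) * D (blk k) \<le> 1 * D (blk k)"
    using t reflected_path.D_nonneg[OF path, of "blk k"] by (intro mult_right_mono) auto
  finally show ?thesis using D_le_dom[OF \<omega> path, of k] by simp
qed

text \<open>Geometric trials: in each block the queue is pushed above its target unless the Brownian increment is small
  compared with \<open>dom\<close>; the Lyapunov function \<open>1 + \<epsilon> exp y\<close> of \<open>y = dom\<close> controls the blocks where \<open>dom\<close>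
  is large.\<close>

lemma all_blocks_fail:
  assumes \<beta>: "0 < \<beta>" and K: "K = exp (\<beta> + 3)" and y0: "y0 = 17 * ln (2 * K)"
    and p: "0 < p" "p \<le> 1" "\<And>k. prob {\<omega> \<in> space M. blk_step k \<omega> \<le> c + y0} \<le> 1 - p"
    and \<epsilon>: "\<epsilon> = p / (2 * K * exp y0)" and \<delta>: "\<delta> = min (p / 2) (\<epsilon> / (2 * (1 + \<epsilon>)))"
  shows "prob {\<omega> \<in> space M. \<forall>k\<in>{n..<n+m}. blk_step k \<omega> \<le> c + dom \<beta> k \<omega>}
    \<le> (1 - \<delta>) ^ m * (1 + \<epsilon> * exp (17 * (\<beta> + 2) + 16/15))"
proof -
  define q where "q = exp (- (1/16) :: real)"
  have q: "0 < q" "q \<le> 16/17"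
  proof -
    have "q = inverse (exp (1/16))" by (simp add: q_def exp_minus)
    also have "\<dots> \<le> inverse (1 + 1/16)"
      using exp_ge_add_one_self[of "1/16::real"] by (intro le_imp_inverse_le) auto
    finally show "q \<le> 16/17" by simp
  qed (simp add: q_def)
  have K1: "1 \<le> K" using \<beta> by (simp add: K)
  have y0_pos: "0 \<le> y0" using K1 by (simp add: y0)
  have \<epsilon>_pos: "0 < \<epsilon>" using p K1 by (simp add: \<epsilon>)
  have \<delta>_pos: "0 < \<delta>" "\<delta> < 1" using p \<epsilon>_pos by (auto simp: \<delta> min_def field_simps)
  define H where "H m \<omega> \<longleftrightarrow> (\<forall>k\<in>{n..<n+m}. blk_step k \<omega> \<le> c + dom \<beta> k \<omega>)" for m \<omega>
  define V where "V y = 1 + \<epsilon> * exp y" for y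
  have H_Suc: "H (Suc m) \<omega> \<longleftrightarrow> H m \<omega> \<and> blk_step (n + m) \<omega> \<le> c + dom \<beta> (n + m) \<omega>" for m \<omega>
    by (auto simp: H_def less_Suc_eq)
  have H_past[measurable]: "Measurable.pred (past M data_alg blk_data (n + m)) (H m)" for m
    unfolding H_def
  proof (intro pred_intros_finite)
    fix k assume "k \<in> {n..<n+m}"
    then have [measurable]: "blk_data k \<in> measurable (past M data_alg blk_data (n + m)) data_alg"
      "dom \<beta> k \<in> borel_measurable (past M data_alg blk_data (n + m))"
      by (auto intro!: blk_data_past dom_past)
    show "Measurable.pred (past M data_alg blk_data (n + m)) (\<lambda>\<omega>. blk_step k \<omega> \<le> c + dom \<beta> k \<omega>)" by measurable
  qed simp
  have H_meas[measurable]: "Measurable.pred M (H m)" for m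
    unfolding H_def by (intro pred_intros_finite) measurable
  \<comment> \<open>Above \<open>y0\<close> the contraction of \<open>dom\<close> alone lowers
    \<open>V\<close>, whatever the trial does: \<open>y0 = 17 * ln (2 * K)\<close> makes
    \<open>ln (2 * K) + 16/17 * y \<le> y\<close>. The second bound in \<delta> comes from
    here.\<close>
  have large: "1 + \<epsilon> * K * exp (q * y) \<le> (1 - \<delta>) * V y" if "y0 \<le> y" for y
  proof -
    have "ln (2 * K) + q * y \<le> y0 / 17 + 16/17 * y"
      using q that y0_pos by (intro add_mono mult_right_mono) (auto simp: y0)
    also have "\<dots> \<le> y" using that by simp
    finally have "exp (ln (2 * K) + q * y) \<le> exp y" by simp
    then have 1: "2 * K * exp (q * y) \<le> exp y" using K1 by (simp add: exp_add)
    have "1 * 1 \<le> exp y * 1" using that y0_pos by simp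
    then have "\<delta> * (1 + \<epsilon> * exp y) \<le> \<delta> * ((1 + \<epsilon>) * exp y)"
      using \<delta>_pos by (intro mult_left_mono) (auto simp: distrib_right)
    also have "\<dots> \<le> \<epsilon> / (2 * (1 + \<epsilon>)) * ((1 + \<epsilon>) * exp y)"
      using \<epsilon>_pos by (intro mult_right_mono) (auto simp: \<delta>)
    also have "\<dots> = \<epsilon> * exp y / 2" using \<epsilon>_pos by (simp add: field_simps)
    finally have "\<delta> * (1 + \<epsilon> * exp y) \<le> \<epsilon> * exp y / 2" .
    moreover have "\<epsilon> * K * exp (q * y) \<le> \<epsilon> * exp y / 2" using 1 \<epsilon>_pos by (simp add: mult.assoc)
    ultimately show ?thesis by (simp add: V_def algebra_simps)
  qed
  have EK: "(\<integral>\<^sup>+\<omega>. ennreal (exp (\<beta> + blk_dd k \<omega>)) \<partial>M) \<le> ennreal K" for k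
  proof -
    have "(\<integral>\<^sup>+\<omega>. ennreal (exp (\<beta> + blk_dd k \<omega>)) \<partial>M) = (\<integral>\<^sup>+\<omega>. ennreal (exp \<beta>) * ennreal (exp (1 * blk_dd k \<omega>)) \<partial>M)"
      by (intro nn_integral_cong) (simp add: ennreal_mult[symmetric] exp_add)
    also have "\<dots> = ennreal (exp \<beta>) * (\<integral>\<^sup>+\<omega>. ennreal (exp (1 * blk_dd k \<omega>)) \<partial>M)"
      by (rule nn_integral_cmult) measurable
    also have "\<dots> \<le> ennreal (exp \<beta>) * ennreal (exp (1\<^sup>2 / 8 + 2 * 1))"
      by (intro mult_left_mono exp_blk_dd_le) auto
    also have "\<dots> \<le> ennreal K" by (simp add: K ennreal_mult[symmetric] exp_add[symmetric])
    finally show ?thesis .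
  qed
  \<comment> \<open>Below \<open>y0\<close>, a failure forces the step under the fixed level
    \<open>c + y0\<close>, and the next \<open>V\<close> is at most \<open>G\<close>. The choice of
    \<epsilon> lets the exponential part cost \<open>p / 2\<close>, half the success probability,
    whence the first bound in \<delta>.\<close>
  define G where "G x = indicator {x. fst x \<le> c + y0} x + \<epsilon> * exp y0 * exp (\<beta> + fst (snd x))" for x :: "real \<times> real \<times> real"
  have G[measurable]: "G \<in> borel_measurable data_alg" unfolding G_def by measurable
  have EG: "(\<integral>\<^sup>+\<omega>. ennreal (G (blk_data k \<omega>)) \<partial>M) \<le> ennreal (1 - \<delta>)" for k
  proof -
    have "(\<integral>\<^sup>+\<omega>. ennreal (G (blk_data k \<omega>)) \<partial>M) =
        (\<integral>\<^sup>+\<omega>. indicator {\<omega> \<in> space M. blk_step k \<omega> \<le> c + y0} \<omega> + ennreal (\<epsilon> * exp y0) * ennreal (exp (\<beta> + blk_dd k \<omega>)) \<partial>M)"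
      using \<epsilon>_pos by (intro nn_integral_cong) (auto simp: G_def indicator_def ennreal_plus ennreal_mult)
    also have "\<dots> = emeasure M {\<omega> \<in> space M. blk_step k \<omega> \<le> c + y0} + ennreal (\<epsilon> * exp y0) * (\<integral>\<^sup>+\<omega>. ennreal (exp (\<beta> + blk_dd k \<omega>)) \<partial>M)"
      by (subst nn_integral_add) (auto simp: nn_integral_cmult)
    also have "\<dots> \<le> ennreal (1 - p) + ennreal (\<epsilon> * exp y0) * ennreal K"
      using p(3)[of k] by (intro add_mono mult_left_mono EK) (auto simp: emeasure_eq_measure intro!: ennreal_leI)
    also have "\<dots> = ennreal (1 - p + p / 2)"
      using p K1 by (simp add: ennreal_mult[symmetric] ennreal_plus[symmetric] \<epsilon> del: ennreal_plus)
    also have "\<dots> \<le> ennreal (1 - \<delta>)"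
    proof (intro ennreal_leI)
      have "\<delta> \<le> p / 2" unfolding \<delta> by (rule min.cobounded1)
      then show "1 - p + p / 2 \<le> 1 - \<delta>" by simp
    qed
    finally show ?thesis .
  qed
  \<comment> \<open>The trials start at block \<open>n\<close> because the first \<open>n\<close>
    blocks are reserved for the descent to \<open>B\<close>; the initial value of \<open>V\<close>
    is controlled uniformly in \<open>n\<close> by \<open>exp_dom_le\<close>.\<close>
  have main: "(\<integral>\<^sup>+\<omega>. ennreal (if H m \<omega> then V (dom \<beta> (n + m) \<omega>) else 0) \<partial>M) \<le> ennreal ((1 - \<delta>) ^ m) * (\<integral>\<^sup>+\<omega>. ennreal (V (dom \<beta> n \<omega>)) \<partial>M)" for m
  proof (induction m)
    case 0
    show ?case by (simp add: H_def)
  next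
    case (Suc m)
    let ?k = "n + m"
    \<comment> \<open>Factors that depend on earlier blocks only: \<open>P1\<close> for small
      \<open>dom\<close>, and for large \<open>dom\<close> the constant part \<open>P2\<close> and
      the exponential part \<open>P3\<close> of the next \<open>V\<close>.\<close>
    define P1 where "P1 \<omega> = ennreal (if H m \<omega> \<and> dom \<beta> ?k \<omega> < y0 then 1 else 0)" for \<omega>
    define P2 where "P2 \<omega> = ennreal (if H m \<omega> \<and> y0 \<le> dom \<beta> ?k \<omega> then 1 else 0)" for \<omega>
    define P3 where "P3 \<omega> = ennreal (if H m \<omega> \<and> y0 \<le> dom \<beta> ?k \<omega> then \<epsilon> * exp (q * dom \<beta> ?k \<omega>) else 0)" for \<omega>
    have dp[measurable]: "dom \<beta> ?k \<in> borel_measurable (past M data_alg blk_data ?k)" by (rule dom_past) simp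
    have Pp: "P1 \<in> borel_measurable (past M data_alg blk_data ?k)" "P3 \<in> borel_measurable (past M data_alg blk_data ?k)"
      unfolding P1_def P3_def by measurable
    have [measurable]: "P1 \<in> borel_measurable M" "P2 \<in> borel_measurable M" "P3 \<in> borel_measurable M"
      unfolding P1_def P2_def P3_def by measurable
    have pw: "ennreal (if H (Suc m) \<omega> then V (dom \<beta> (n + Suc m) \<omega>) else 0) \<le>
        P1 \<omega> * ennreal (G (blk_data ?k \<omega>)) + (P2 \<omega> + P3 \<omega> * ennreal (exp (\<beta> + blk_dd ?k \<omega>)))" for \<omega>
    proof (cases "H (Suc m) \<omega>")
      case True
      then have h: "H m \<omega>" "blk_step ?k \<omega> \<le> c + dom \<beta> ?k \<omega>" by (auto simp: H_Suc)
      have dS: "V (dom \<beta> (n + Suc m) \<omega>) = 1 + \<epsilon> * exp (q * dom \<beta> ?k \<omega>) * exp (\<beta> + blk_dd ?k \<omega>)"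
        by (simp add: V_def q_def exp_add[symmetric] add_ac mult.assoc)
      show ?thesis
      proof (cases "dom \<beta> ?k \<omega> < y0")
        case small: True
        have "q * dom \<beta> ?k \<omega> \<le> y0"
        proof -
          have "q * dom \<beta> ?k \<omega> \<le> q * y0" using small q by (intro mult_left_mono) auto
          also have "\<dots> \<le> 1 * y0" using q y0_pos by (intro mult_right_mono) auto
          finally show ?thesis by simp
        qed
        then have "\<epsilon> * exp (q * dom \<beta> ?k \<omega>) * exp (\<beta> + blk_dd ?k \<omega>) \<le> \<epsilon> * exp y0 * exp (\<beta> + blk_dd ?k \<omega>)"
          using \<epsilon>_pos by (intro mult_right_mono mult_left_mono) auto
        then have "V (dom \<beta> (n + Suc m) \<omega>) \<le> G (blk_data ?k \<omega>)"
          using h small unfolding dS G_def by (auto simp: indicator_def)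
        then show ?thesis using h small True by (simp add: P1_def P2_def P3_def ennreal_leI)
      next
        case False
        then show ?thesis using h True dS \<epsilon>_pos by (simp add: P1_def P2_def P3_def ennreal_mult ennreal_plus)
      qed
    qed simp
    have "(\<integral>\<^sup>+\<omega>. ennreal (if H (Suc m) \<omega> then V (dom \<beta> (n + Suc m) \<omega>) else 0) \<partial>M) \<le>
      (\<integral>\<^sup>+\<omega>. P1 \<omega> * ennreal (G (blk_data ?k \<omega>)) + (P2 \<omega> + P3 \<omega> * ennreal (exp (\<beta> + blk_dd ?k \<omega>))) \<partial>M)"
      by (intro nn_integral_mono pw)
    also have "\<dots> = (\<integral>\<^sup>+\<omega>. P1 \<omega> * ennreal (G (blk_data ?k \<omega>)) \<partial>M) + ((\<integral>\<^sup>+\<omega>. P2 \<omega> \<partial>M) + (\<integral>\<^sup>+\<omega>. P3 \<omega> * ennreal (exp (\<beta> + blk_dd ?k \<omega>)) \<partial>M))"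
      by (simp add: nn_integral_add)
    also have "(\<integral>\<^sup>+\<omega>. P1 \<omega> * ennreal (G (blk_data ?k \<omega>)) \<partial>M) = (\<integral>\<^sup>+\<omega>. P1 \<omega> \<partial>M) * (\<integral>\<^sup>+\<omega>. ennreal (G (blk_data ?k \<omega>)) \<partial>M)"
      by (rule nn_integral_blk_mult[OF Pp(1)]) measurable
    also have "(\<integral>\<^sup>+\<omega>. P3 \<omega> * ennreal (exp (\<beta> + blk_dd ?k \<omega>)) \<partial>M) = (\<integral>\<^sup>+\<omega>. P3 \<omega> \<partial>M) * (\<integral>\<^sup>+\<omega>. ennreal (exp (\<beta> + blk_dd ?k \<omega>)) \<partial>M)"
      by (rule nn_integral_blk_mult[OF Pp(2), of "\<lambda>x. ennreal (exp (\<beta> + fst (snd x)))"]) measurable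
    also have "(\<integral>\<^sup>+\<omega>. P1 \<omega> \<partial>M) * (\<integral>\<^sup>+\<omega>. ennreal (G (blk_data ?k \<omega>)) \<partial>M) + ((\<integral>\<^sup>+\<omega>. P2 \<omega> \<partial>M) + (\<integral>\<^sup>+\<omega>. P3 \<omega> \<partial>M) * (\<integral>\<^sup>+\<omega>. ennreal (exp (\<beta> + blk_dd ?k \<omega>)) \<partial>M))
      \<le> (\<integral>\<^sup>+\<omega>. P1 \<omega> \<partial>M) * ennreal (1 - \<delta>) + ((\<integral>\<^sup>+\<omega>. P2 \<omega> \<partial>M) + (\<integral>\<^sup>+\<omega>. P3 \<omega> \<partial>M) * ennreal K)"
      by (intro add_mono mult_left_mono EG EK order_refl) auto
    also have "\<dots> = (\<integral>\<^sup>+\<omega>. P1 \<omega> * ennreal (1 - \<delta>) + (P2 \<omega> + P3 \<omega> * ennreal K) \<partial>M)"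
      by (simp add: nn_integral_add nn_integral_multc)
    also have "\<dots> \<le> (\<integral>\<^sup>+\<omega>. ennreal (1 - \<delta>) * ennreal (if H m \<omega> then V (dom \<beta> ?k \<omega>) else 0) \<partial>M)"
    proof (intro nn_integral_mono)
      fix \<omega>
      show "P1 \<omega> * ennreal (1 - \<delta>) + (P2 \<omega> + P3 \<omega> * ennreal K) \<le> ennreal (1 - \<delta>) * ennreal (if H m \<omega> then V (dom \<beta> ?k \<omega>) else 0)"
      proof (cases "H m \<omega>")
        case True
        show ?thesis
        proof (cases "dom \<beta> ?k \<omega> < y0")
          case small: True
          have "1 \<le> V (dom \<beta> ?k \<omega>)" using \<epsilon>_pos by (simp add: V_def)
          then have "(1 - \<delta>) * 1 \<le> (1 - \<delta>) * V (dom \<beta> ?k \<omega>)" using \<delta>_pos by (intro mult_left_mono) auto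
          then have "ennreal (1 - \<delta>) \<le> ennreal ((1 - \<delta>) * V (dom \<beta> ?k \<omega>))" by (intro ennreal_leI) simp
          also have "\<dots> = ennreal (1 - \<delta>) * ennreal (V (dom \<beta> ?k \<omega>))"
            using \<delta>_pos \<open>1 \<le> V (dom \<beta> ?k \<omega>)\<close> by (intro ennreal_mult) auto
          finally show ?thesis using True small by (simp add: P1_def P2_def P3_def)
        next
          case False
          have "ennreal (1 + \<epsilon> * K * exp (q * dom \<beta> ?k \<omega>)) \<le> ennreal ((1 - \<delta>) * V (dom \<beta> ?k \<omega>))"
            using False by (intro ennreal_leI large) auto
          moreover have "ennreal (1 + \<epsilon> * K * exp (q * dom \<beta> ?k \<omega>)) = 1 + ennreal (\<epsilon> * exp (q * dom \<beta> ?k \<omega>)) * ennreal K"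
            using \<epsilon>_pos K1 by (simp add: ennreal_plus ennreal_mult[symmetric] mult_ac)
          moreover have "ennreal ((1 - \<delta>) * V (dom \<beta> ?k \<omega>)) = ennreal (1 - \<delta>) * ennreal (V (dom \<beta> ?k \<omega>))"
            using \<delta>_pos \<epsilon>_pos by (intro ennreal_mult) (auto simp: V_def)
          ultimately show ?thesis using True False by (simp add: P1_def P2_def P3_def)
        qed
      qed (simp add: P1_def P2_def P3_def)
    qed
    also have "\<dots> = ennreal (1 - \<delta>) * (\<integral>\<^sup>+\<omega>. ennreal (if H m \<omega> then V (dom \<beta> ?k \<omega>) else 0) \<partial>M)"
      unfolding V_def by (rule nn_integral_cmult) measurable
    also have "\<dots> \<le> ennreal (1 - \<delta>) * (ennreal ((1 - \<delta>) ^ m) * (\<integral>\<^sup>+\<omega>. ennreal (V (dom \<beta> n \<omega>)) \<partial>M))"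
      by (intro mult_left_mono Suc.IH) auto
    also have "\<dots> = ennreal ((1 - \<delta>) ^ Suc m) * (\<integral>\<^sup>+\<omega>. ennreal (V (dom \<beta> n \<omega>)) \<partial>M)"
      using \<delta>_pos by (simp add: ennreal_mult mult.assoc)
    finally show ?case .
  qed
  have EV: "(\<integral>\<^sup>+\<omega>. ennreal (V (dom \<beta> n \<omega>)) \<partial>M) \<le> ennreal (1 + \<epsilon> * exp (17 * (\<beta> + 2) + 16/15))"
  proof -
    have "(\<integral>\<^sup>+\<omega>. ennreal (V (dom \<beta> n \<omega>)) \<partial>M) = (\<integral>\<^sup>+\<omega>. 1 + ennreal \<epsilon> * ennreal (exp (1 * dom \<beta> n \<omega>)) \<partial>M)"
      using \<epsilon>_pos by (intro nn_integral_cong) (simp add: V_def ennreal_plus ennreal_mult)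
    also have "\<dots> = 1 + ennreal \<epsilon> * (\<integral>\<^sup>+\<omega>. ennreal (exp (1 * dom \<beta> n \<omega>)) \<partial>M)"
      by (simp add: nn_integral_add nn_integral_cmult emeasure_space_1)
    also have "\<dots> \<le> 1 + ennreal \<epsilon> * ennreal (exp (17 * (\<beta> + 2) * 1 + 16/15 * 1\<^sup>2))"
      using \<beta> by (intro add_left_mono mult_left_mono exp_dom_le) auto
    also have "\<dots> = ennreal (1 + \<epsilon> * exp (17 * (\<beta> + 2) + 16/15))"
      using \<epsilon>_pos by (simp add: ennreal_plus ennreal_mult)
    finally show ?thesis .
  qed
  have "emeasure M {\<omega> \<in> space M. H m \<omega>} = (\<integral>\<^sup>+\<omega>. indicator {\<omega> \<in> space M. H m \<omega>} \<omega> \<partial>M)"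
    by (rule nn_integral_indicator[symmetric]) measurable
  also have "\<dots> \<le> (\<integral>\<^sup>+\<omega>. ennreal (if H m \<omega> then V (dom \<beta> (n + m) \<omega>) else 0) \<partial>M)"
    using \<epsilon>_pos by (intro nn_integral_mono) (auto simp: indicator_def V_def)
  also have "\<dots> \<le> ennreal ((1 - \<delta>) ^ m) * ennreal (1 + \<epsilon> * exp (17 * (\<beta> + 2) + 16/15))"
    by (rule order_trans[OF main mult_left_mono[OF EV]]) simp
  also have "\<dots> = ennreal ((1 - \<delta>) ^ m * (1 + \<epsilon> * exp (17 * (\<beta> + 2) + 16/15)))"
    using \<delta>_pos \<epsilon>_pos by (intro ennreal_mult[symmetric]) auto
  finally have "ennreal (prob {\<omega> \<in> space M. H m \<omega>}) \<le> ennreal ((1 - \<delta>) ^ m * (1 + \<epsilon> * exp (17 * (\<beta> + 2) + 16/15)))"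
    by (simp only: emeasure_eq_measure)
  then show ?thesis using \<delta>_pos \<epsilon>_pos by (subst (asm) ennreal_le_iff) (auto simp: H_def)
qed

lemma blk_step_prob:
  "prob {\<omega> \<in> space M. blk_step k \<omega> \<le> c} = 1 - measure (density lborel (\<lambda>z. ennreal (normal_density 0 (sqrt (1/8)) z))) {c<..}"
proof -
  have d: "distributed M lborel (blk_step k) (\<lambda>z. ennreal (normal_density 0 (sqrt (1/8)) z))"
    using w_increment[of "blk k" "blk (Suc k)"] by (simp add: blk_data_def blk_Suc)
  interpret N: prob_space "density lborel (\<lambda>z. ennreal (normal_density 0 (sqrt (1/8)) z))"
    by (rule prob_space_normal_density) simp
  have "measure (density lborel (\<lambda>z. ennreal (normal_density 0 (sqrt (1/8)) z))) {c<..} = prob (blk_step k -` {c<..} \<inter> space M)"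
    using d by (simp add: distributed_distr_eq_density[symmetric] measure_distr distributed_measurable)
  also have "\<dots> = prob (space M - {\<omega> \<in> space M. blk_step k \<omega> \<le> c})"
    by (intro arg_cong[where f = prob]) auto
  also have "\<dots> = 1 - prob {\<omega> \<in> space M. blk_step k \<omega> \<le> c}"
    by (rule prob_compl) measurable
  finally show ?thesis by simp
qed

end

text \<open>Fixes the order of quantifiers: the constants are chosen before the probability space,
  as the final statement requires. This works because the success probability is a tail of one fixed
  Gaussian law.\<close>

lemma all_blocks_fail_exponential:
  assumes \<beta>: "0 < \<beta>"
  shows "\<exists>C r. 0 < C \<and> 0 < r \<and> r < 1 \<and> (\<forall>(M :: 'a measure) W n. std_BM M W \<longrightarrow>
    measure M {\<omega> \<in> space M. \<forall>k\<in>{n..<n+n}. brownian.blk_step W k \<omega> \<le> c + brownian.dom W \<beta> k \<omega>} \<le> C * r ^ n)"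
proof -
  define K where "K = exp (\<beta> + 3)"
  define y0 where "y0 = 17 * ln (2 * K)"
  define N where "N = density lborel (\<lambda>z. ennreal (normal_density 0 (sqrt (1/8)) z))"
  define p where "p = measure N {c + y0<..}"
  interpret N: prob_space N unfolding N_def by (rule prob_space_normal_density) simp
  have p: "0 < p" "p \<le> 1"
    using normal_tail_pos[of "sqrt (1/8)"] N.prob_le_1 by (auto simp: p_def N_def)
  define \<epsilon> where "\<epsilon> = p / (2 * K * exp y0)"
  define \<delta> where "\<delta> = min (p / 2) (\<epsilon> / (2 * (1 + \<epsilon>)))"
  have \<epsilon>: "0 < \<epsilon>" using p by (simp add: \<epsilon>_def K_def)
  have \<delta>: "0 < \<delta>" "\<delta> < 1" using p \<epsilon> by (auto simp: \<delta>_def min_def field_simps)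
  show ?thesis
  proof (intro exI conjI allI impI)
    show "0 < 1 + \<epsilon> * exp (17 * (\<beta> + 2) + 16/15)" using \<epsilon> by (simp add: add_pos_pos)
    show "0 < 1 - \<delta>" "1 - \<delta> < 1" using \<delta> by auto
    fix M :: "'a measure" and W n assume "std_BM M W"
    then interpret brownian M W by unfold_locales
    have "prob {\<omega> \<in> space M. \<forall>k\<in>{n..<n+n}. blk_step k \<omega> \<le> c + dom \<beta> k \<omega>} \<le> (1 - \<delta>) ^ n * (1 + \<epsilon> * exp (17 * (\<beta> + 2) + 16/15))"
      by (rule all_blocks_fail[OF \<beta> K_def y0_def p _ \<epsilon>_def \<delta>_def]) (simp add: blk_step_prob p_def N_def)
    then show "prob {\<omega> \<in> space M. \<forall>k\<in>{n..<n+n}. blk_step k \<omega> \<le> c + dom \<beta> k \<omega>} \<le> (1 + \<epsilon> * exp (17 * (\<beta> + 2) + 16/15)) * (1 - \<delta>) ^ n"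
      by (simp add: mult.commute)
  qed
qed

section \<open>Measurability of the solution\<close>

lemma continuous_on_atLeastI:
  fixes f :: "real \<Rightarrow> real"
  assumes "\<And>b. 0 \<le> b \<Longrightarrow> continuous_on {0..b} f"
  shows "continuous_on {0..} f"
proof -
  have "continuous (at t within {0..}) f" if "0 \<le> t" for t
  proof -
    have "continuous (at t within {0..t+1}) f"
      using assms[of "t + 1"] that by (auto simp: continuous_on_eq_continuous_within)
    moreover have "at t within {0..t+1} = at t within {0..}"
      by (rule at_within_nhd[of _ "{..<t+1}"]) auto
    ultimately show ?thesis by simp
  qed
  then show ?thesis by (auto simp: continuous_on_eq_continuous_within)
qed

lemma continuous_on_run_sup_atLeast:
  assumes "continuous_on {0..} f"
  shows "continuous_on {0..} (run_sup f 0)"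
  by (intro continuous_on_atLeastI continuous_on_run_sup continuous_on_subset[OF assms]) auto

text \<open>The supremum is 1-Lipschitz in the uniform norm; the Picard contraction rests on
  this.\<close>

lemma run_sup_diff_le:
  assumes f: "continuous_on {a..b} f" and g: "continuous_on {a..b} g" and ab: "a \<le> b"
    and d: "\<And>t. t \<in> {a..b} \<Longrightarrow> \<bar>f t - g t\<bar> \<le> c"
  shows "\<bar>run_sup f a b - run_sup g a b\<bar> \<le> c"
proof -
  have "run_sup f a b \<le> run_sup g a b + c"
  proof (rule run_sup_le[OF ab])
    fix t assume t: "t \<in> {a..b}"
    then show "f t \<le> run_sup g a b + c" using d[OF t] run_sup_ge[OF g t] by linarith
  qed
  moreover have "run_sup g a b \<le> run_sup f a b + c"
  proof (rule run_sup_le[OF ab])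
    fix t assume t: "t \<in> {a..b}"
    then show "g t \<le> run_sup f a b + c" using d[OF t] run_sup_ge[OF f t] by linarith
  qed
  ultimately show ?thesis by linarith
qed

text \<open>Picard iteration for the pair \<open>(\<integral>(D + Q), \<integral>Q)\<close>, where \<open>X\<close> is the driving path with drift; the
  reflection term is the running supremum of \<open>X + \<integral>(D + Q)\<close>.\<close>

primrec picard :: "real \<Rightarrow> (real \<Rightarrow> real) \<Rightarrow> nat \<Rightarrow> (real \<Rightarrow> real) \<times> (real \<Rightarrow> real)" where
  "picard y0 X 0 = (\<lambda>_. 0, \<lambda>_. 0)"
| "picard y0 X (Suc n) =
    (\<lambda>t. integral {0..t} (\<lambda>s. 2 * run_sup (\<lambda>r. X r + fst (picard y0 X n) r) 0 s - X s
        - fst (picard y0 X n) s + y0 - snd (picard y0 X n) s),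
     \<lambda>t. integral {0..t} (\<lambda>s. y0 + run_sup (\<lambda>r. X r + fst (picard y0 X n) r) 0 s - snd (picard y0 X n) s))"

lemma picard_cont:
  assumes X: "continuous_on {0..} X"
  shows "continuous_on {0..} (fst (picard y0 X n)) \<and> continuous_on {0..} (snd (picard y0 X n))"
proof (induction n)
  case (Suc n)
  then have c: "continuous_on {0..} (fst (picard y0 X n))" "continuous_on {0..} (snd (picard y0 X n))" by auto
  have r: "continuous_on {0..} (run_sup (\<lambda>r. X r + fst (picard y0 X n) r) 0)"
    by (intro continuous_on_run_sup_atLeast continuous_intros X c)
  show ?case
    unfolding picard.simps fst_conv snd_conv
    by (intro conjI continuous_on_integral_atLeast continuous_intros X c r)
qed simp

lemma picard_meas:
  assumes cont: "\<And>\<omega>. \<omega> \<in> space N \<Longrightarrow> continuous_on {0..} (\<lambda>t. X t \<omega>)"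
    and meas: "\<And>t. 0 \<le> t \<Longrightarrow> X t \<in> borel_measurable N"
    and t: "0 \<le> t"
  shows "(\<lambda>\<omega>. fst (picard y0 (\<lambda>t. X t \<omega>) n) t) \<in> borel_measurable N \<and>
    (\<lambda>\<omega>. snd (picard y0 (\<lambda>t. X t \<omega>) n) t) \<in> borel_measurable N"
  using t
proof (induction n arbitrary: t)
  case (Suc n)
  have m: "(\<lambda>\<omega>. fst (picard y0 (\<lambda>t. X t \<omega>) n) t) \<in> borel_measurable N"
    "(\<lambda>\<omega>. snd (picard y0 (\<lambda>t. X t \<omega>) n) t) \<in> borel_measurable N" if "0 \<le> t" for t
    using Suc.IH[OF that] by auto
  have c: "continuous_on {0..} (fst (picard y0 (\<lambda>t. X t \<omega>) n))" "continuous_on {0..} (snd (picard y0 (\<lambda>t. X t \<omega>) n))"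
    if "\<omega> \<in> space N" for \<omega>
    using picard_cont[OF cont[OF that]] by auto
  have sub: "continuous_on {0..b} f" if "continuous_on {0..} f" for b and f :: "real \<Rightarrow> real"
    using that by (rule continuous_on_subset) auto
  have r: "continuous_on {0..} (run_sup (\<lambda>r. X r \<omega> + fst (picard y0 (\<lambda>t. X t \<omega>) n) r) 0)" if "\<omega> \<in> space N" for \<omega>
    by (intro continuous_on_run_sup_atLeast continuous_intros cont c that)
  have rm: "(\<lambda>\<omega>. run_sup (\<lambda>r. X r \<omega> + fst (picard y0 (\<lambda>t. X t \<omega>) n) r) 0 s) \<in> borel_measurable N" if "0 \<le> s" for s
    using that by (intro borel_measurable_run_sup borel_measurable_add meas m sub continuous_intros cont c) auto
  show ?case
    unfolding picard.simps fst_conv snd_conv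
    using Suc.prems
    by (intro conjI borel_measurable_integral_cont borel_measurable_add borel_measurable_diff
        borel_measurable_times borel_measurable_const meas m rm sub continuous_intros cont c r) auto
qed simp

context reflected_path
begin

text \<open>Skorokhod's formula for reflection at 0. Up to the last zero of \<open>D\<close> the
  supremum catches up with \<open>L\<close>, since there \<open>D = 0\<close>; afterwards
  \<open>L\<close> is constant.\<close>

lemma L_eq_run_sup:
  assumes "0 \<le> t"
  shows "L t = run_sup (\<lambda>s. w s - \<beta> * s + integral {0..s} (\<lambda>s. D s + Q s)) 0 t"
proof (rule antisym)
  let ?f = "\<lambda>s. w s - \<beta> * s + integral {0..s} (\<lambda>s. D s + Q s)"
  have cont: "continuous_on {0..t} ?f"
    by (intro continuous_intros continuous_on_subset[OF w_cont] continuous_on_subset[OF continuous_on_integral_atLeast[OF DQ_cont]]) auto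
  obtain g where g: "0 \<le> g" "g \<le> t" "D g = 0" "\<And>s. g < s \<Longrightarrow> s \<le> t \<Longrightarrow> 0 < D s"
    using last_zero[of 0 0 t] D_0 assms by auto
  have "L t = L g" using g by (intro L_flat) auto
  also have "\<dots> = ?f g" using D_eq[of g] g by simp
  also have "\<dots> \<le> run_sup ?f 0 t" using g by (intro run_sup_ge[OF cont]) auto
  finally show "L t \<le> run_sup ?f 0 t" .
  show "run_sup ?f 0 t \<le> L t"
  proof (rule run_sup_le[OF assms])
    fix s assume s: "s \<in> {0..t}"
    have "?f s \<le> L s" using D_eq[of s] D_nonneg[of s] s by simp
    also have "\<dots> \<le> L t" using s by (intro mono_onD[OF L_mono]) auto
    finally show "?f s \<le> L t" .
  qed
qed

text \<open>The weight \<open>exp (12 * s)\<close> makes the iteration contract on any horizon. Each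
  component has an integrand error of at most three times the old error, integration against the
  weight divides by 12, and the two components add up to the factor 1/2. \<open>K\<close> bounds the
  exact solution, as the iteration starts at 0.\<close>

lemma picard_error:
  assumes T: "0 \<le> T"
  obtains K where "0 \<le> K" "\<And>n s. s \<in> {0..T} \<Longrightarrow>
      \<bar>integral {0..s} (\<lambda>s. D s + Q s) - fst (picard y0 (\<lambda>t. w t - \<beta> * t) n) s\<bar>
      + \<bar>integral {0..s} Q - snd (picard y0 (\<lambda>t. w t - \<beta> * t) n) s\<bar> \<le> K * (1/2) ^ n * exp (12 * s)"
proof -
  let ?X = "\<lambda>t. w t - \<beta> * t"
  define v where "v s = integral {0..s} (\<lambda>s. D s + Q s)" for s
  define J where "J s = integral {0..s} Q" for s
  define vn where "vn n = fst (picard y0 ?X n)" for n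
  define Jn where "Jn n = snd (picard y0 ?X n)" for n
  have X: "continuous_on {0..} ?X" by (intro continuous_intros w_cont)
  have vc: "continuous_on {0..} v" unfolding v_def by (intro continuous_on_integral_atLeast DQ_cont)
  have Jc: "continuous_on {0..} J" unfolding J_def by (intro continuous_on_integral_atLeast Q_cont)
  have vnc: "continuous_on {0..} (vn n)" and Jnc: "continuous_on {0..} (Jn n)" for n
    using picard_cont[OF X] by (auto simp: vn_def Jn_def)
  have sub: "continuous_on {0..b} f" if "continuous_on {0..} f" for b and f :: "real \<Rightarrow> real"
    using that by (rule continuous_on_subset) auto
  have "continuous_on {0..T} (\<lambda>s. \<bar>v s\<bar> + \<bar>J s\<bar>)" by (intro continuous_intros sub vc Jc)
  then obtain t0 where "t0 \<in> {0..T}" and t0: "\<And>s. s \<in> {0..T} \<Longrightarrow> \<bar>v s\<bar> + \<bar>J s\<bar> \<le> \<bar>v t0\<bar> + \<bar>J t0\<bar>"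
    using continuous_attains_sup[of "{0..T}" "\<lambda>s. \<bar>v s\<bar> + \<bar>J s\<bar>"] T by auto
  define K where "K = \<bar>v t0\<bar> + \<bar>J t0\<bar>"
  have K: "0 \<le> K" by (simp add: K_def)
  have "\<bar>v s - vn n s\<bar> + \<bar>J s - Jn n s\<bar> \<le> K * (1/2) ^ n * exp (12 * s)" if "s \<in> {0..T}" for n s
    using that
  proof (induction n arbitrary: s)
    case 0
    have "K * 1 \<le> K * exp (12 * s)" using K 0 by (intro mult_left_mono) auto
    then show ?case using t0[OF 0] by (simp add: vn_def Jn_def K_def)
  next
    case (Suc n)
    define e where "e r = K * (1/2) ^ n * exp (12 * r)" for r
    let ?Ln = "run_sup (\<lambda>r. ?X r + vn n r) 0"
    have Lnc: "continuous_on {0..} ?Ln" by (intro continuous_on_run_sup_atLeast continuous_intros X[simplified] vnc w_cont)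
    have s: "0 \<le> s" using Suc.prems by simp
    have Ldiff: "\<bar>L r - ?Ln r\<bar> \<le> e r" if r: "r \<in> {0..s}" for r
    proof -
      have "\<bar>run_sup (\<lambda>s. ?X s + v s) 0 r - ?Ln r\<bar> \<le> e r"
      proof (rule run_sup_diff_le)
        fix u assume u: "u \<in> {0..r}"
        have "\<bar>v u - vn n u\<bar> + \<bar>J u - Jn n u\<bar> \<le> e u"
          unfolding e_def using u r Suc.prems by (intro Suc.IH) auto
        moreover have "e u \<le> e r" unfolding e_def using u K by (intro mult_left_mono) auto
        ultimately show "\<bar>?X u + v u - (?X u + vn n u)\<bar> \<le> e r" by simp
      qed (use r in \<open>auto intro!: continuous_intros sub vc vnc w_cont\<close>)
      then show ?thesis using L_eq_run_sup[of r] r by (simp add: v_def)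
    qed
    have int: "f integrable_on {0..s}" if "continuous_on {0..} f" for f :: "real \<Rightarrow> real"
      using that by (intro continuous_on_atLeast_integrable) auto
    \<comment> \<open>Adding the equations for \<open>D\<close> and \<open>Q\<close> expresses
      \<open>D + Q\<close> through \<open>L\<close> and the two integrals; this is the map iterated
      in \<open>picard\<close>.\<close>
    have v_eq: "v s = integral {0..s} (\<lambda>r. 2 * L r - ?X r - v r + y0 - J r)"
      unfolding v_def[of s]
      by (rule integral_cong) (use D_eq Q_eq in \<open>auto simp: v_def J_def\<close>)
    have J_eq: "J s = integral {0..s} (\<lambda>r. y0 + L r - J r)"
      unfolding J_def[of s]
      by (rule integral_cong) (use Q_eq in \<open>auto simp: J_def\<close>)
    have vnS: "vn (Suc n) s = integral {0..s} (\<lambda>r. 2 * ?Ln r - ?X r - vn n r + y0 - Jn n r)"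
      and JnS: "Jn (Suc n) s = integral {0..s} (\<lambda>r. y0 + ?Ln r - Jn n r)"
      by (simp_all add: vn_def Jn_def)
    have ec: "continuous_on {0..} e" unfolding e_def by (intro continuous_intros)
    have pw: "\<bar>v r - vn n r\<bar> + \<bar>J r - Jn n r\<bar> \<le> e r" if "r \<in> {0..s}" for r
      unfolding e_def using that Suc.prems by (intro Suc.IH) auto
    have b1: "\<bar>v s - vn (Suc n) s\<bar> \<le> integral {0..s} (\<lambda>r. 3 * e r)"
    proof -
      have eq: "v s - vn (Suc n) s = integral {0..s} (\<lambda>r. (2 * L r - ?X r - v r + y0 - J r) - (2 * ?Ln r - ?X r - vn n r + y0 - Jn n r))"
        unfolding v_eq vnS
        by (intro Henstock_Kurzweil_Integration.integral_diff[symmetric] int continuous_intros L_cont vc Jc w_cont Lnc vnc Jnc)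
      have "norm (integral {0..s} (\<lambda>r. (2 * L r - ?X r - v r + y0 - J r) - (2 * ?Ln r - ?X r - vn n r + y0 - Jn n r))) \<le> integral {0..s} (\<lambda>r. 3 * e r)"
      proof (rule integral_norm_bound_integral)
        fix r assume r: "r \<in> {0..s}"
        show "norm ((2 * L r - ?X r - v r + y0 - J r) - (2 * ?Ln r - ?X r - vn n r + y0 - Jn n r)) \<le> 3 * e r"
          using Ldiff[OF r] pw[OF r] by (simp add: abs_le_iff) linarith
      qed (intro int continuous_intros L_cont vc Jc w_cont Lnc vnc Jnc ec)+
      then show ?thesis unfolding eq by simp
    qed
    have b2: "\<bar>J s - Jn (Suc n) s\<bar> \<le> integral {0..s} (\<lambda>r. 3 * e r)"
    proof -
      have eq: "J s - Jn (Suc n) s = integral {0..s} (\<lambda>r. (y0 + L r - J r) - (y0 + ?Ln r - Jn n r))"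
        unfolding J_eq JnS
        by (intro Henstock_Kurzweil_Integration.integral_diff[symmetric] int continuous_intros L_cont vc Jc w_cont Lnc vnc Jnc)
      have "norm (integral {0..s} (\<lambda>r. (y0 + L r - J r) - (y0 + ?Ln r - Jn n r))) \<le> integral {0..s} (\<lambda>r. 3 * e r)"
      proof (rule integral_norm_bound_integral)
        fix r assume r: "r \<in> {0..s}"
        show "norm ((y0 + L r - J r) - (y0 + ?Ln r - Jn n r)) \<le> 3 * e r"
          using Ldiff[OF r] pw[OF r] by (simp add: abs_le_iff) linarith
      qed (intro int continuous_intros L_cont vc Jc w_cont Lnc vnc Jnc ec)+
      then show ?thesis unfolding eq by simp
    qed
    have "((\<lambda>r. 3 * e r) has_integral (e s / 4 - e 0 / 4)) {0..s}"
    proof (rule fundamental_theorem_of_calculus[OF s])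
      fix r
      have "((\<lambda>r. e r / 4) has_real_derivative 3 * e r) (at r within {0..s})"
        unfolding e_def by (auto intro!: derivative_eq_intros)
      then show "((\<lambda>r. e r / 4) has_vector_derivative 3 * e r) (at r within {0..s})"
        by (simp add: has_real_derivative_iff_has_vector_derivative)
    qed
    then have "integral {0..s} (\<lambda>r. 3 * e r) = e s / 4 - e 0 / 4" by (rule integral_unique)
    moreover have "0 \<le> e 0" using K by (simp add: e_def)
    ultimately have "\<bar>v s - vn (Suc n) s\<bar> + \<bar>J s - Jn (Suc n) s\<bar> \<le> e s / 2" using b1 b2 by linarith
    then show ?case by (simp add: e_def)
  qed
  then show ?thesis using K by (intro that[of K]) (auto simp: v_def J_def vn_def Jn_def)
qed

lemma picard_limit:
  assumes t: "0 \<le> t"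
  shows "(\<lambda>n. y0 + run_sup (\<lambda>r. w r - \<beta> * r + fst (picard y0 (\<lambda>t. w t - \<beta> * t) n) r) 0 t
      - snd (picard y0 (\<lambda>t. w t - \<beta> * t) n) t) \<longlonglongrightarrow> Q t"
    and "(\<lambda>n. run_sup (\<lambda>r. w r - \<beta> * r + fst (picard y0 (\<lambda>t. w t - \<beta> * t) n) r) 0 t
      - (w t - \<beta> * t) - fst (picard y0 (\<lambda>t. w t - \<beta> * t) n) t) \<longlonglongrightarrow> D t"
proof -
  let ?X = "\<lambda>t. w t - \<beta> * t"
  define v where "v s = integral {0..s} (\<lambda>s. D s + Q s)" for s
  define J where "J s = integral {0..s} Q" for s
  define vn where "vn n = fst (picard y0 ?X n)" for n
  define Jn where "Jn n = snd (picard y0 ?X n)" for n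
  obtain K where K: "0 \<le> K" "\<And>n s. s \<in> {0..t} \<Longrightarrow>
      \<bar>v s - vn n s\<bar> + \<bar>J s - Jn n s\<bar> \<le> K * (1/2) ^ n * exp (12 * s)"
    using picard_error[OF t] unfolding v_def J_def vn_def Jn_def by blast
  have X: "continuous_on {0..} ?X" by (intro continuous_intros w_cont)
  have vc: "continuous_on {0..t} v" unfolding v_def by (rule continuous_on_subset[OF continuous_on_integral_atLeast[OF DQ_cont]]) auto
  have vnc: "continuous_on {0..t} (vn n)" for n
    using continuous_on_subset[of "{0..}" "vn n" "{0..t}"] picard_cont[OF X] by (auto simp: vn_def)
  have Xc: "continuous_on {0..t} ?X" by (rule continuous_on_subset[OF X]) auto
  have 0: "(\<lambda>n. K * (1/2) ^ n * exp (12 * t)) \<longlonglongrightarrow> 0"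
    by (intro tendsto_mult_left_zero tendsto_mult_right_zero LIMSEQ_power_zero) auto
  have e1: "\<bar>vn n t - v t\<bar> \<le> K * (1/2) ^ n * exp (12 * t)" "\<bar>Jn n t - J t\<bar> \<le> K * (1/2) ^ n * exp (12 * t)" for n
    using K(2)[of t n] t by auto
  have "(\<lambda>n. vn n t - v t) \<longlonglongrightarrow> 0"
    by (rule Lim_null_comparison[OF _ 0]) (use e1 in auto)
  then have lv: "(\<lambda>n. vn n t) \<longlonglongrightarrow> v t" by (simp add: LIM_zero_iff)
  have "(\<lambda>n. Jn n t - J t) \<longlonglongrightarrow> 0"
    by (rule Lim_null_comparison[OF _ 0]) (use e1 in auto)
  then have lJ: "(\<lambda>n. Jn n t) \<longlonglongrightarrow> J t" by (simp add: LIM_zero_iff)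
  have "\<bar>run_sup (\<lambda>r. ?X r + vn n r) 0 t - run_sup (\<lambda>r. ?X r + v r) 0 t\<bar> \<le> K * (1/2) ^ n * exp (12 * t)" for n
  proof (rule run_sup_diff_le)
    show "continuous_on {0..t} (\<lambda>r. ?X r + vn n r)" by (intro continuous_on_add Xc vnc)
    show "continuous_on {0..t} (\<lambda>r. ?X r + v r)" by (intro continuous_on_add Xc vc)
    show "0 \<le> t" by (rule t)
    fix s assume s: "s \<in> {0..t}"
    have "\<bar>v s - vn n s\<bar> + \<bar>J s - Jn n s\<bar> \<le> K * (1/2) ^ n * exp (12 * s)" by (rule K(2)[OF s])
    also have "\<dots> \<le> K * (1/2) ^ n * exp (12 * t)" using s K(1) by (intro mult_left_mono) auto
    finally show "\<bar>?X s + vn n s - (?X s + v s)\<bar> \<le> K * (1/2) ^ n * exp (12 * t)" by (simp add: abs_minus_commute)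
  qed
  then have "(\<lambda>n. run_sup (\<lambda>r. ?X r + vn n r) 0 t - run_sup (\<lambda>r. ?X r + v r) 0 t) \<longlonglongrightarrow> 0"
    by (intro Lim_null_comparison[OF _ 0] always_eventually) auto
  then have lL: "(\<lambda>n. run_sup (\<lambda>r. ?X r + vn n r) 0 t) \<longlonglongrightarrow> L t"
    using L_eq_run_sup[OF t] by (simp add: LIM_zero_iff v_def)
  have "(\<lambda>n. y0 + run_sup (\<lambda>r. ?X r + vn n r) 0 t - Jn n t) \<longlonglongrightarrow> y0 + L t - J t"
    by (intro tendsto_intros lL lJ)
  then show "(\<lambda>n. y0 + run_sup (\<lambda>r. w r - \<beta> * r + fst (picard y0 (\<lambda>t. w t - \<beta> * t) n) r) 0 t
      - snd (picard y0 (\<lambda>t. w t - \<beta> * t) n) t) \<longlonglongrightarrow> Q t"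
    using Q_eq[OF t] by (simp add: vn_def Jn_def J_def)
  have "(\<lambda>n. run_sup (\<lambda>r. ?X r + vn n r) 0 t - ?X t - vn n t) \<longlonglongrightarrow> L t - ?X t - v t"
    by (intro tendsto_intros lL lv)
  moreover have "L t - ?X t - v t = D t" using D_eq[OF t] by (simp add: v_def)
  ultimately show "(\<lambda>n. run_sup (\<lambda>r. w r - \<beta> * r + fst (picard y0 (\<lambda>t. w t - \<beta> * t) n) r) 0 t
      - (w t - \<beta> * t) - fst (picard y0 (\<lambda>t. w t - \<beta> * t) n) t) \<longlonglongrightarrow> D t"
    by (simp add: vn_def)
qed

end

section \<open>The stopping times\<close>

lemma Inf_ereal_less_iff: "Inf {ereal t | t. P t} < ereal T \<longleftrightarrow> (\<exists>t. P t \<and> t < T)"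
proof
  assume "\<exists>t. P t \<and> t < T"
  then obtain t where "P t" "t < T" by blast
  then show "Inf {ereal t | t. P t} < ereal T"
    unfolding Inf_less_iff by (intro bexI[of _ "ereal t"]) auto
qed (auto simp: Inf_less_iff)

text \<open>Strict upper bounds reduce the nested infima to the existence of two times, avoiding
  questions of attainment and of infinite values. All later arguments about the cycle go through
  this form.\<close>

lemma Xi0_less_iff:
  "Xi0 q B < ereal T \<longleftrightarrow> (\<exists>s t. 0 \<le> s \<and> s < t \<and> t < T \<and> q s = B \<and> q t = 2 * B)"
  unfolding Xi0_def hit_def Inf_ereal_less_iff by blast

lemma Icc_cont: "continuous_on {0..} f \<Longrightarrow> 0 \<le> a \<Longrightarrow> continuous_on {a..b} f" for f :: "real \<Rightarrow> real"
  by (rule continuous_on_subset) auto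

text \<open>A path that starts at \<open>2 * B\<close> and gets down to \<open>B\<close> or below,
  then up to \<open>2 * B\<close> or above, passes both levels in this order. A rational time
  separates the passages, so the event is a countable combination of events about running
  suprema.\<close>

lemma Xi0_less_iff_rat:
  assumes q: "continuous_on {0..} q" "q 0 = 2 * B" and B: "0 < B"
  shows "Xi0 q B < ereal T \<longleftrightarrow> (\<exists>r\<in>\<rat>. \<exists>r'\<in>\<rat>. 0 \<le> r \<and> r \<le> r' \<and> r' < T \<and>
    - B \<le> run_sup (\<lambda>t. - q t) 0 r \<and> 2 * B \<le> run_sup q r r')"
proof
  assume "Xi0 q B < ereal T"
  then obtain s t where st: "0 \<le> s" "s < t" "t < T" "q s = B" "q t = 2 * B" by (auto simp: Xi0_less_iff)
  obtain r where r: "r \<in> \<rat>" "s < r" "r < t" using Rats_dense_in_real[OF st(2)] by blast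
  obtain r' where r': "r' \<in> \<rat>" "t < r'" "r' < T" using Rats_dense_in_real[OF st(3)] by blast
  have "- q s \<le> run_sup (\<lambda>t. - q t) 0 r"
    using st r by (intro run_sup_ge[of 0 r "\<lambda>t. - q t"] continuous_intros Icc_cont[OF q(1)]) auto
  moreover have "q t \<le> run_sup q r r'"
    using st r r' by (intro run_sup_ge Icc_cont[OF q(1)]) auto
  ultimately show "\<exists>r\<in>\<rat>. \<exists>r'\<in>\<rat>. 0 \<le> r \<and> r \<le> r' \<and> r' < T \<and>
    - B \<le> run_sup (\<lambda>t. - q t) 0 r \<and> 2 * B \<le> run_sup q r r'"
    using st r r' by (intro bexI[of _ r] bexI[of _ r']) auto
next
  assume "\<exists>r\<in>\<rat>. \<exists>r'\<in>\<rat>. 0 \<le> r \<and> r \<le> r' \<and> r' < T \<and>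
    - B \<le> run_sup (\<lambda>t. - q t) 0 r \<and> 2 * B \<le> run_sup q r r'"
  then obtain r r' where r: "0 \<le> r" "r \<le> r'" "r' < T" "- B \<le> run_sup (\<lambda>t. - q t) 0 r" "2 * B \<le> run_sup q r r'"
    by blast
  have "continuous_on {0..r} (\<lambda>t. - q t)" by (intro continuous_intros Icc_cont[OF q(1)]) auto
  from run_sup_attained[OF this r(1)] obtain s where s: "s \<in> {0..r}" "q s \<le> B" using r(4) by force
  obtain u where u: "u \<in> {r..r'}" "2 * B \<le> q u"
    using run_sup_attained[OF Icc_cont[OF q(1) r(1)] r(2)] r(5) by metis
  have "\<exists>x\<ge>0. x \<le> s \<and> q x = B"
    using s q B by (intro IVT2') (auto intro: Icc_cont[OF q(1)])
  then obtain s' where s': "0 \<le> s'" "s' \<le> s" "q s' = B" by blast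
  have "\<exists>x\<ge>s'. x \<le> u \<and> q x = 2 * B"
    using s s' u B by (intro IVT') (auto intro!: Icc_cont[OF q(1)])
  then obtain t where "s' \<le> t" "t \<le> u" "q t = 2 * B" by blast
  moreover have "t \<noteq> s'" using calculation s' B by auto
  ultimately show "Xi0 q B < ereal T"
    unfolding Xi0_less_iff using s' u r by (intro exI[of _ s'] exI[of _ t]) auto
qed

lemma below_of_no_hit:
  assumes q: "continuous_on {0..} q" "q 0 < y" and hit: "ereal T < hit q y" and t: "0 \<le> t" "t \<le> T"
  shows "q t < y"
proof (rule ccontr)
  assume "\<not> q t < y"
  then have "\<exists>x\<ge>0. x \<le> t \<and> q x = y" using q t by (intro IVT') (auto intro!: Icc_cont)
  then obtain x where x: "0 \<le> x" "x \<le> t" "q x = y" by blast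
  then have "hit q y \<le> ereal x" unfolding hit_def by (intro Inf_lower) auto
  also have "\<dots> \<le> ereal T" using x t by simp
  finally show False using hit by simp
qed

lemma hit_ge_of_below:
  assumes "\<And>t. 0 \<le> t \<Longrightarrow> t \<le> T \<Longrightarrow> q t < y"
  shows "ereal T \<le> hit q y"
  unfolding hit_def
proof (rule Inf_greatest)
  fix x assume "x \<in> {ereal t |t. 0 \<le> t \<and> q t = y}"
  then obtain t where t: "x = ereal t" "0 \<le> t" "q t = y" by auto
  then have "\<not> t \<le> T" using assms[of t] by auto
  then show "ereal T \<le> x" using t by simp
qed

lemma Xi0_less_hit_iff:
  assumes q: "continuous_on {0..} q" "q 0 = 2 * B" and B: "0 < B" and y: "2 * B < y"
  shows "Xi0 q B < hit q y \<longleftrightarrow> (\<exists>T\<in>\<rat>. 0 < T \<and> Xi0 q B < ereal T \<and> run_sup q 0 T < y)"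
proof
  assume *: "Xi0 q B < hit q y"
  obtain z1 where z1: "Xi0 q B < ereal z1" "ereal z1 < hit q y" using ereal_dense2[OF *] by blast
  \<comment> \<open>A second real number turns the extended-real gap into a real interval in which a
    rational can be found.\<close>
  obtain z2 where z2: "ereal z1 < ereal z2" "ereal z2 < hit q y" using ereal_dense2[OF z1(2)] by blast
  then have "z1 < z2" by simp
  then obtain T where T: "T \<in> \<rat>" "z1 < T" "T < z2" using Rats_dense_in_real by blast
  have "ereal z1 < ereal T" "ereal T < ereal z2" using T by auto
  then have XT: "Xi0 q B < ereal T" "ereal T < hit q y" 
    using less_trans[OF z1(1)] less_trans[OF _ z2(2)] by blast+
  have "0 < T" using XT(1) by (auto simp: Xi0_less_iff)
  moreover obtain t where "t \<in> {0..T}" "run_sup q 0 T = q t"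
    using run_sup_attained[OF Icc_cont[OF q(1)], of 0 T] \<open>0 < T\<close> by auto
  then have "run_sup q 0 T < y" using below_of_no_hit[OF q(1) _ XT(2), of t] q y by auto
  ultimately show "\<exists>T\<in>\<rat>. 0 < T \<and> Xi0 q B < ereal T \<and> run_sup q 0 T < y" using T XT by blast
next
  assume "\<exists>T\<in>\<rat>. 0 < T \<and> Xi0 q B < ereal T \<and> run_sup q 0 T < y"
  then obtain T where T: "Xi0 q B < ereal T" "run_sup q 0 T < y" by blast
  have "ereal T \<le> hit q y"
    by (rule hit_ge_of_below) (use T run_sup_ge[OF Icc_cont[OF q(1)], of 0 _ T] in force)
  then show "Xi0 q B < hit q y" using T by (auto intro: less_le_trans)
qed

locale reflected_sys = brownian M W for M :: "'a measure" and W +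
  fixes \<beta> B :: real and Q1 Q2 L :: "real \<Rightarrow> 'a \<Rightarrow> real"
  assumes sys: "reflected_system M W \<beta> 0 (2 * B) Q1 Q2 L" and \<beta>: "0 < \<beta>" and B: "0 < B"
begin

lemma path:
  assumes \<omega>: "\<omega> \<in> space M"
  shows "reflected_path (\<lambda>t. w t \<omega>) (\<lambda>t. - Q1 t \<omega>) (\<lambda>t. Q2 t \<omega>) (\<lambda>t. L t \<omega>) \<beta> (2 * B)"
proof -
  have c1: "continuous_on {0..} (\<lambda>t. Q1 t \<omega>)" and c2: "continuous_on {0..} (\<lambda>t. Q2 t \<omega>)"
    and L0: "L 0 \<omega> = 0" and Lm: "mono_on {0..} (\<lambda>t. L t \<omega>)" and neg: "\<And>t. 0 \<le> t \<Longrightarrow> Q1 t \<omega> \<le> 0"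
    and e1: "\<And>t. 0 \<le> t \<Longrightarrow> Q1 t \<omega> = 0 + sqrt 2 * W t \<omega> - \<beta> * t + integral {0..t} (\<lambda>s. - Q1 s \<omega> + Q2 s \<omega>) - L t \<omega>"
    and e2: "\<And>t. 0 \<le> t \<Longrightarrow> Q2 t \<omega> = 2 * B + L t \<omega> - integral {0..t} (\<lambda>s. Q2 s \<omega>)"
    and null: "(\<integral>\<^sup>+ t. indicator {t. 0 \<le> t \<and> Q1 t \<omega> < 0} t \<partial>interval_measure (\<lambda>t. L (max t 0) \<omega>)) = 0"
    using sys \<omega> unfolding reflected_system_def by blast+
  let ?F = "\<lambda>t. L (max t 0) \<omega>"
  have Lc: "continuous_on {0..} (\<lambda>t. L t \<omega>)"
  proof -
    have "continuous_on {0..} (\<lambda>t. Q2 t \<omega> - 2 * B + integral {0..t} (\<lambda>s. Q2 s \<omega>))"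
      by (intro continuous_intros c2 continuous_on_integral_atLeast)
    then show ?thesis by (rule continuous_on_eq) (use e2 in auto)
  qed
  \<comment> \<open>Freezing \<open>L\<close> at its value at 0 for negative times gives a
    continuous nondecreasing function on the whole line, so \<open>interval_measure\<close> has its
    usual meaning.\<close>
  have Fc: "continuous_on UNIV ?F"
    by (rule continuous_on_compose2[OF Lc]) (auto intro!: continuous_intros)
  have Fm: "?F x \<le> ?F y" if "x \<le> y" for x y
    using that by (intro mono_onD[OF Lm]) auto
  have flat: "L b \<omega> = L a \<omega>" if ab: "0 \<le> a" "a \<le> b" and pos: "\<And>t. a < t \<Longrightarrow> t \<le> b \<Longrightarrow> 0 < - Q1 t \<omega>" for a b
  proof -
    \<comment> \<open>The interval \<open>{a<..b}\<close> lies inside the set where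
      \<open>Q1\<close> is negative, hence is null for the Stieltjes measure.\<close>
    have "emeasure (interval_measure ?F) {a<..b} = ?F b - ?F a"
      by (rule emeasure_interval_measure_Ioc)
        (use ab Fm Fc in \<open>auto simp: continuous_on_eq_continuous_within intro: continuous_within_subset\<close>)
    moreover have "emeasure (interval_measure ?F) {a<..b} \<le> 0"
    proof -
      have "emeasure (interval_measure ?F) {a<..b} = (\<integral>\<^sup>+ t. indicator {a<..b} t \<partial>interval_measure ?F)"
        by (rule nn_integral_indicator[symmetric]) simp
      also have "\<dots> \<le> (\<integral>\<^sup>+ t. indicator {t. 0 \<le> t \<and> Q1 t \<omega> < 0} t \<partial>interval_measure ?F)"
        using ab pos by (intro nn_integral_mono) (auto simp: indicator_def)
      finally show ?thesis using null by simp
    qed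
    ultimately have "?F b - ?F a \<le> 0" using Fm[of a b] ab by (simp add: ennreal_eq_0_iff)
    moreover have "max a 0 = a" "max b 0 = b" using ab by auto
    ultimately show ?thesis using Fm[of a b] ab by simp
  qed
  show ?thesis
  proof
    show "- Q1 t \<omega> = - w t \<omega> + \<beta> * t - integral {0..t} (\<lambda>s. - Q1 s \<omega> + Q2 s \<omega>) + L t \<omega>" if "0 \<le> t" for t
      using e1[OF that] by (simp add: w_def)
    show "L b \<omega> = L a \<omega>" if "0 \<le> a" "a \<le> b" "\<And>t. a < t \<Longrightarrow> t \<le> b \<Longrightarrow> 0 < - Q1 t \<omega>" for a b
      by (rule flat) (use that in auto)
  qed (use c1 c2 L0 Lm neg e2 \<omega> w_cont w_0 \<beta> B in \<open>auto intro!: continuous_intros\<close>)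
qed

lemma Q2_cont: "\<omega> \<in> space M \<Longrightarrow> continuous_on {0..} (\<lambda>t. Q2 t \<omega>)"
  using reflected_path.Q_cont[OF path] .

lemma Q1_cont: "\<omega> \<in> space M \<Longrightarrow> continuous_on {0..} (\<lambda>t. Q1 t \<omega>)"
  using continuous_on_minus[OF reflected_path.D_cont[OF path]] by simp

lemma Q2_0: "\<omega> \<in> space M \<Longrightarrow> Q2 0 \<omega> = 2 * B"
  using reflected_path.Q_0[OF path] .

lemma Q1_0: "\<omega> \<in> space M \<Longrightarrow> Q1 0 \<omega> = 0"
  using reflected_path.D_0[OF path] by simp

lemma Q_meas:
  assumes t: "0 \<le> t"
  shows "Q2 t \<in> borel_measurable M" "Q1 t \<in> borel_measurable M"
proof -
  let ?X = "\<lambda>t \<omega>. w t \<omega> - \<beta> * t"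
  let ?p = "\<lambda>n \<omega>. picard (2 * B) (\<lambda>t. w t \<omega> - \<beta> * t) n"
  have Xc: "continuous_on {0..} (\<lambda>t. ?X t \<omega>)" if "\<omega> \<in> space M" for \<omega>
    using that by (intro continuous_intros w_cont)
  have pm: "(\<lambda>\<omega>. fst (?p n \<omega>) s) \<in> borel_measurable M" "(\<lambda>\<omega>. snd (?p n \<omega>) s) \<in> borel_measurable M" if "0 \<le> s" for n s
    using picard_meas[of M ?X s "2 * B" n] Xc that by auto
  have rm: "(\<lambda>\<omega>. run_sup (\<lambda>r. w r \<omega> - \<beta> * r + fst (?p n \<omega>) r) 0 t) \<in> borel_measurable M" for n
    using t picard_cont[OF Xc]
    by (intro borel_measurable_run_sup borel_measurable_add borel_measurable_diff pm continuous_on_add Icc_cont[OF Xc])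
      (auto intro: Icc_cont)
  show "Q2 t \<in> borel_measurable M"
    by (rule borel_measurable_LIMSEQ_real[OF reflected_path.picard_limit(1)[OF path t]])
      (auto intro!: borel_measurable_diff borel_measurable_add rm pm t)
  have "(\<lambda>\<omega>. - Q1 t \<omega>) \<in> borel_measurable M"
    by (rule borel_measurable_LIMSEQ_real[OF reflected_path.picard_limit(2)[OF path t]])
      (auto intro!: borel_measurable_diff borel_measurable_add rm pm t)
  then show "Q1 t \<in> borel_measurable M" by (simp only: borel_measurable_uminus_eq)
qed

lemma Q2_sup_meas: "0 \<le> a \<Longrightarrow> a \<le> b \<Longrightarrow> (\<lambda>\<omega>. run_sup (\<lambda>t. Q2 t \<omega>) a b) \<in> borel_measurable M"
  by (intro borel_measurable_run_sup Q_meas Icc_cont[OF Q2_cont]) auto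

lemma Q2_inf_meas: "0 \<le> a \<Longrightarrow> a \<le> b \<Longrightarrow> (\<lambda>\<omega>. run_sup (\<lambda>t. - Q2 t \<omega>) a b) \<in> borel_measurable M"
  by (intro borel_measurable_run_sup borel_measurable_uminus Q_meas continuous_intros Icc_cont[OF Q2_cont]) auto

abbreviation "\<Xi> \<omega> \<equiv> Xi0 (\<lambda>t. Q2 t \<omega>) B"

lemma Xi_less_sets: "{\<omega> \<in> space M. \<Xi> \<omega> < ereal T} \<in> sets M"
proof -
  let ?S = "{(r, r'). r \<in> \<rat> \<and> r' \<in> \<rat> \<and> 0 \<le> r \<and> r \<le> r' \<and> r' < T}"
  have eq: "{\<omega> \<in> space M. \<Xi> \<omega> < ereal T} = (\<Union>(r, r')\<in>?S.
      {\<omega> \<in> space M. - B \<le> run_sup (\<lambda>t. - Q2 t \<omega>) 0 r} \<inter> {\<omega> \<in> space M. 2 * B \<le> run_sup (\<lambda>t. Q2 t \<omega>) r r'})"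
    using Xi0_less_iff_rat[OF Q2_cont Q2_0 B] by fastforce
  have "countable ?S"
    by (rule countable_subset[of _ "\<rat> \<times> \<rat>"]) (auto intro: countable_rat)
  then show ?thesis unfolding eq
  proof (rule sets.countable_UN'')
    fix x assume "x \<in> ?S"
    then obtain r r' where x: "x = (r, r')" "0 \<le> r" "r \<le> r'" by auto
    have [measurable]: "(\<lambda>\<omega>. run_sup (\<lambda>t. - Q2 t \<omega>) 0 r) \<in> borel_measurable M" "(\<lambda>\<omega>. run_sup (\<lambda>t. Q2 t \<omega>) r r') \<in> borel_measurable M"
      using x by (auto intro!: Q2_sup_meas Q2_inf_meas)
    show "(case x of (r, r') \<Rightarrow> {\<omega> \<in> space M. - B \<le> run_sup (\<lambda>t. - Q2 t \<omega>) 0 r} \<inter> {\<omega> \<in> space M. 2 * B \<le> run_sup (\<lambda>t. Q2 t \<omega>) r r'}) \<in> sets M"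
      unfolding x(1) prod.case by measurable
  qed
qed

text \<open>The cycle ends, with level \<open>y\<close> still unreached, by time \<open>N\<close>.
  The rational witness keeps the union countable; for \<open>y > 2 * B\<close> these events increase
  in \<open>N\<close> to the complement of reaching \<open>y\<close> within the cycle.\<close>

definition miss :: "real \<Rightarrow> real \<Rightarrow> 'a set" where
  "miss y N = (\<Union>T\<in>{T\<in>\<rat>. 0 < T \<and> T \<le> N}. {\<omega> \<in> space M. \<Xi> \<omega> < ereal T} \<inter> {\<omega> \<in> space M. run_sup (\<lambda>t. Q2 t \<omega>) 0 T < y})"

lemma miss_sets: "miss y N \<in> sets M"
  unfolding miss_def
proof (rule sets.countable_UN'')
  show "countable {T\<in>\<rat>. 0 < T \<and> T \<le> N}" by (rule countable_subset[of _ \<rat>]) (auto intro: countable_rat)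
  fix T assume "T \<in> {T\<in>\<rat>. 0 < T \<and> T \<le> N}"
  then have [measurable]: "(\<lambda>\<omega>. run_sup (\<lambda>t. Q2 t \<omega>) 0 T) \<in> borel_measurable M" by (intro Q2_sup_meas) auto
  show "{\<omega> \<in> space M. \<Xi> \<omega> < ereal T} \<inter> {\<omega> \<in> space M. run_sup (\<lambda>t. Q2 t \<omega>) 0 T < y} \<in> sets M"
    by (intro sets.Int Xi_less_sets) measurable
qed

lemma hit_compl:
  assumes y: "2 * B < y"
  shows "space M - {\<omega> \<in> space M. hit (\<lambda>t. Q2 t \<omega>) y \<le> \<Xi> \<omega>} = (\<Union>N. miss y (real N))"
proof (intro set_eqI iffI)
  fix \<omega> assume "\<omega> \<in> space M - {\<omega> \<in> space M. hit (\<lambda>t. Q2 t \<omega>) y \<le> \<Xi> \<omega>}"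
  then have \<omega>: "\<omega> \<in> space M" "\<Xi> \<omega> < hit (\<lambda>t. Q2 t \<omega>) y" by auto
  from Xi0_less_hit_iff[OF Q2_cont[OF \<omega>(1)] Q2_0[OF \<omega>(1)] B y, THEN iffD1, OF \<omega>(2)]
  obtain T where T: "T \<in> \<rat>" "0 < T" "\<Xi> \<omega> < ereal T" "run_sup (\<lambda>t. Q2 t \<omega>) 0 T < y" by blast
  obtain N :: nat where "T \<le> real N" using real_arch_simple by blast
  then show "\<omega> \<in> (\<Union>N. miss y (real N))" using T \<omega> by (auto simp: miss_def)
next
  fix \<omega> assume "\<omega> \<in> (\<Union>N. miss y (real N))"
  then obtain T where T: "T \<in> \<rat>" "0 < T" "\<Xi> \<omega> < ereal T" "run_sup (\<lambda>t. Q2 t \<omega>) 0 T < y" and \<omega>: "\<omega> \<in> space M"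
    by (auto simp: miss_def)
  then have "\<Xi> \<omega> < hit (\<lambda>t. Q2 t \<omega>) y"
    using Xi0_less_hit_iff[OF Q2_cont[OF \<omega>] Q2_0[OF \<omega>] B y] by blast
  then show "\<omega> \<in> space M - {\<omega> \<in> space M. hit (\<lambda>t. Q2 t \<omega>) y \<le> \<Xi> \<omega>}" using \<omega> by auto
qed

text \<open>A time at which \<open>Q1 < - x\<close> is positive, since \<open>Q1\<close> starts at
  0, and can be moved slightly back to a rational by continuity. Moving back also preserves that the
  cycle has not ended.\<close>

lemma inf_event:
  assumes x: "0 \<le> x"
  shows "{\<omega> \<in> space M. (INF t \<in> {t. 0 \<le> t \<and> ereal t \<le> \<Xi> \<omega>}. ereal (Q1 t \<omega>)) < ereal (- x)} =
    (\<Union>T\<in>{T\<in>\<rat>. 0 \<le> T}. (space M - {\<omega> \<in> space M. \<Xi> \<omega> < ereal T}) \<inter> {\<omega> \<in> space M. Q1 T \<omega> < - x})"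
proof (intro set_eqI iffI)
  fix \<omega> assume "\<omega> \<in> {\<omega> \<in> space M. (INF t \<in> {t. 0 \<le> t \<and> ereal t \<le> \<Xi> \<omega>}. ereal (Q1 t \<omega>)) < ereal (- x)}"
  then obtain t where \<omega>: "\<omega> \<in> space M" and t: "0 \<le> t" "ereal t \<le> \<Xi> \<omega>" "Q1 t \<omega> < - x" by (auto simp: INF_less_iff)
  have "t \<noteq> 0" using t Q1_0[OF \<omega>] x by auto
  then have t0: "0 < t" using t by simp
  have "continuous (at t within {0..}) (\<lambda>t. Q1 t \<omega>)"
    using Q1_cont[OF \<omega>] t by (auto simp: continuous_on_eq_continuous_within)
  then obtain d where d: "0 < d" "\<And>s. 0 \<le> s \<Longrightarrow> dist s t < d \<Longrightarrow> dist (Q1 s \<omega>) (Q1 t \<omega>) < - x - Q1 t \<omega>"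
    using t(3) unfolding continuous_within_eps_delta by (metis atLeast_iff diff_gt_0_iff_gt)
  have "max 0 (t - d) < t" using t0 d by auto
  then obtain T where T: "T \<in> \<rat>" "max 0 (t - d) < T" "T < t" using Rats_dense_in_real by blast
  have "dist (Q1 T \<omega>) (Q1 t \<omega>) < - x - Q1 t \<omega>" using T by (intro d(2)) (auto simp: dist_real_def)
  then have "Q1 T \<omega> < - x" by (auto simp: dist_real_def)
  moreover have "\<not> \<Xi> \<omega> < ereal T"
  proof
    assume "\<Xi> \<omega> < ereal T"
    also have "ereal T < ereal t" using T by simp
    finally show False using t(2) by simp
  qed
  ultimately show "\<omega> \<in> (\<Union>T\<in>{T\<in>\<rat>. 0 \<le> T}. (space M - {\<omega> \<in> space M. \<Xi> \<omega> < ereal T}) \<inter> {\<omega> \<in> space M. Q1 T \<omega> < - x})"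
    using T \<omega> by (intro UN_I[of T]) auto
next
  fix \<omega> assume "\<omega> \<in> (\<Union>T\<in>{T\<in>\<rat>. 0 \<le> T}. (space M - {\<omega> \<in> space M. \<Xi> \<omega> < ereal T}) \<inter> {\<omega> \<in> space M. Q1 T \<omega> < - x})"
  then obtain T where "0 \<le> T" "\<not> \<Xi> \<omega> < ereal T" "\<omega> \<in> space M" "Q1 T \<omega> < - x" by auto
  then show "\<omega> \<in> {\<omega> \<in> space M. (INF t \<in> {t. 0 \<le> t \<and> ereal t \<le> \<Xi> \<omega>}. ereal (Q1 t \<omega>)) < ereal (- x)}"
    by (auto simp: INF_less_iff not_less intro!: exI[of _ T])
qed

lemma inf_event_sets:
  assumes x: "0 \<le> x"
  shows "{\<omega> \<in> space M. (INF t \<in> {t. 0 \<le> t \<and> ereal t \<le> \<Xi> \<omega>}. ereal (Q1 t \<omega>)) < ereal (- x)} \<in> sets M"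
  unfolding inf_event[OF x]
proof (rule sets.countable_UN'')
  show "countable {T\<in>\<rat>. 0 \<le> T}" by (rule countable_subset[of _ \<rat>]) (auto intro: countable_rat)
  fix T assume "T \<in> {T\<in>\<rat>. (0::real) \<le> T}"
  then have [measurable]: "Q1 T \<in> borel_measurable M" by (intro Q_meas) auto
  have "{\<omega> \<in> space M. Q1 T \<omega> < - x} \<in> sets M" by measurable
  then show "(space M - {\<omega> \<in> space M. \<Xi> \<omega> < ereal T}) \<inter> {\<omega> \<in> space M. Q1 T \<omega> < - x} \<in> sets M"
    by (intro sets.Int sets.compl_sets Xi_less_sets)
qed

end

section \<open>Lower bounds\<close>

text \<open>Exponential Markov bound: on the indicator the integrand gains at least
  \<open>exp (\<mu> * (X - \<epsilon>))\<close>, and the tilted moment is explicit.\<close>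

lemma (in gaussian_process) increment_overshoot:
  assumes i: "i < 2 ^ n" and \<mu>: "0 \<le> \<mu>"
  shows "(\<integral>\<^sup>+\<omega>. ennreal (exp (c * (f (grid a b n (Suc i)) \<omega> - f (grid a b n i) \<omega> - c * ((b - a) / 2 ^ n)))
      * indicator {\<epsilon><..} (f (grid a b n (Suc i)) \<omega> - f (grid a b n i) \<omega> - c * ((b - a) / 2 ^ n))) \<partial>M)
    \<le> ennreal (exp (- \<mu> * \<epsilon> + (c + \<mu>) * \<mu> * ((b - a) / 2 ^ n)))"
proof -
  define X where "X \<omega> = f (grid a b n (Suc i)) \<omega> - f (grid a b n i) \<omega> - c * ((b - a) / 2 ^ n)" for \<omega>
  have [measurable]: "X \<in> borel_measurable M"
    using drifted_indep[of n c] i by (auto simp: indep_vars_def X_def[abs_def])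
  have "(\<integral>\<^sup>+\<omega>. ennreal (exp (c * X \<omega>) * indicator {\<epsilon><..} (X \<omega>)) \<partial>M) \<le>
      (\<integral>\<^sup>+\<omega>. ennreal (exp (- \<mu> * \<epsilon>)) * ennreal (exp ((c + \<mu>) * X \<omega>)) \<partial>M)"
  proof (intro nn_integral_mono)
    fix \<omega>
    have "exp (c * X \<omega>) * indicator {\<epsilon><..} (X \<omega>) \<le> exp (- \<mu> * \<epsilon> + (c + \<mu>) * X \<omega>)"
    proof (cases "\<epsilon> < X \<omega>")
      case True
      then have "\<mu> * \<epsilon> \<le> \<mu> * X \<omega>" using \<mu> by (intro mult_left_mono) auto
      then show ?thesis using True by (simp add: algebra_simps)
    qed simp
    then show "ennreal (exp (c * X \<omega>) * indicator {\<epsilon><..} (X \<omega>)) \<le> ennreal (exp (- \<mu> * \<epsilon>)) * ennreal (exp ((c + \<mu>) * X \<omega>))"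
      by (subst ennreal_mult[symmetric]) (auto simp: exp_add[symmetric] intro!: ennreal_leI)
  qed
  also have "\<dots> = ennreal (exp (- \<mu> * \<epsilon>)) * (\<integral>\<^sup>+\<omega>. ennreal (exp ((c + \<mu>) * X \<omega>)) \<partial>M)"
    by (rule nn_integral_cmult) measurable
  also have "(\<integral>\<^sup>+\<omega>. ennreal (exp ((c + \<mu>) * X \<omega>)) \<partial>M) = ennreal (exp (((c + \<mu>)\<^sup>2 - (c + \<mu>) * c) * ((b - a) / 2 ^ n)))"
    unfolding X_def by (rule drifted_increment_mgf[OF i])
  also have "(c + \<mu>)\<^sup>2 - (c + \<mu>) * c = (c + \<mu>) * \<mu>" by (simp add: power2_eq_square algebra_simps)
  also have "ennreal (exp (- \<mu> * \<epsilon>)) * ennreal (exp ((c + \<mu>) * \<mu> * ((b - a) / 2 ^ n))) = ennreal (exp (- \<mu> * \<epsilon> + (c + \<mu>) * \<mu> * ((b - a) / 2 ^ n)))"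
    by (simp add: ennreal_mult[symmetric] exp_add[symmetric])
  finally show ?thesis by (simp add: X_def)
qed

text \<open>The total overshoot of \<open>2 ^ n\<close> steps when each is tilted by
  \<open>sqrt (2 ^ n)\<close>: the exponential beats the number of steps.\<close>

lemma overshoot_tendsto_0:
  fixes \<epsilon> C :: real assumes \<epsilon>: "0 < \<epsilon>"
  shows "(\<lambda>n. real (2 ^ n) * exp (- sqrt (2 ^ n) * \<epsilon> + C)) \<longlonglongrightarrow> 0"
proof -
  have top: "filterlim (\<lambda>n. sqrt (2 ^ n) * \<epsilon>) at_top sequentially"
    using \<epsilon> by real_asymp
  have "((\<lambda>x::real. x ^ 2 / exp x) \<longlongrightarrow> 0) at_top" by (rule tendsto_power_div_exp_0)
  from filterlim_compose[OF this top]
  have "(\<lambda>n. (sqrt (2 ^ n) * \<epsilon>) ^ 2 / exp (sqrt (2 ^ n) * \<epsilon>)) \<longlonglongrightarrow> 0" .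
  then have "(\<lambda>n. exp C / \<epsilon>\<^sup>2 * ((sqrt (2 ^ n) * \<epsilon>) ^ 2 / exp (sqrt (2 ^ n) * \<epsilon>))) \<longlonglongrightarrow> 0"
    by (rule tendsto_mult_right_zero)
  moreover have "exp C / \<epsilon>\<^sup>2 * ((sqrt (2 ^ n) * \<epsilon>) ^ 2 / exp (sqrt (2 ^ n) * \<epsilon>)) = real (2 ^ n) * exp (- sqrt (2 ^ n) * \<epsilon> + C)" for n
  proof -
    have "exp (- sqrt (2 ^ n) * \<epsilon> + C) = exp C / exp (sqrt (2 ^ n) * \<epsilon>)"
      by (simp add: exp_diff[symmetric])
    moreover have "(sqrt (2 ^ n) * \<epsilon>) ^ 2 = 2 ^ n * \<epsilon>\<^sup>2"
      unfolding power_mult_distrib by simp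
    ultimately show ?thesis using \<epsilon> by simp
  qed
  ultimately show ?thesis by simp
qed

context reflected_sys
begin

text \<open>On this event the Brownian motion with drift \<open>2 B + w(t) - \<beta> t\<close>, which lies below the queue, hits \<open>B\<close>
  without having reached \<open>y\<close>.\<close>

lemma miss_bound:
  assumes y: "2 * B < y" and \<epsilon>: "0 < \<epsilon>" "\<epsilon> < B" and N: "0 < N"
  shows "prob (miss y N) \<le> (exp (\<beta> * (y + \<epsilon>)) - exp (\<beta> * (2 * B))) / (exp (\<beta> * (y + \<epsilon>)) - exp (\<beta> * (B + \<epsilon>)))"
proof -
  interpret g: gaussian_process M w 0 N using N by (intro gaussian_process_w) auto
  define \<eta> where "\<eta> n = exp (- sqrt (2 ^ n) * \<epsilon> + N * (\<beta> + 1))" for n :: nat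
  define Z where "Z t \<omega> = 2 * B + (w t \<omega> - w 0 \<omega> - \<beta> * (t - 0))" for t \<omega>
  define Dn where "Dn n = {\<omega> \<in> space M. \<exists>k\<le>2 ^ n. Z (grid 0 N n k) \<omega> \<le> B + \<epsilon> \<and> (\<forall>j\<le>k. Z (grid 0 N n j) \<omega> < y)}" for n
  define G where "G = exp (\<beta> * (y + \<epsilon>)) - exp (\<beta> * (B + \<epsilon>))"
  have G: "0 < G" unfolding G_def using \<beta> y B by simp
  have bound: "prob (Dn n) \<le> (exp (\<beta> * (y + \<epsilon>)) - exp (\<beta> * (2 * B)) + exp (\<beta> * y) * (real (2 ^ n) * \<eta> n)) / G" for n
  proof -
    \<comment> \<open>Tilt for the overshoot bound: \<open>s * s\<close> times the mesh
      \<open>N / 2 ^ n\<close> equals \<open>N\<close>, so the penalty stays bounded in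
      \<open>n\<close>.\<close>
    define s where "s = sqrt (2 ^ n :: real)"
    have s: "1 \<le> s" "s * s = 2 ^ n" by (auto simp: s_def)
    have "prob {\<omega> \<in> space M. \<exists>k\<le>2 ^ n.
          2 * B + (\<Sum>i<k. w (grid 0 N n (Suc i)) \<omega> - w (grid 0 N n i) \<omega> - \<beta> * ((N - 0) / 2 ^ n)) \<le> B + \<epsilon> \<and>
          (\<forall>j\<le>k. 2 * B + (\<Sum>i<j. w (grid 0 N n (Suc i)) \<omega> - w (grid 0 N n i) \<omega> - \<beta> * ((N - 0) / 2 ^ n)) < y)}
        * (exp (\<beta> * (y + \<epsilon>)) - exp (\<beta> * (B + \<epsilon>)))
      \<le> exp (\<beta> * (y + \<epsilon>)) - exp (\<beta> * (2 * B)) + real (2 ^ n) * (exp (\<beta> * y) * \<eta> n)"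
    proof (rule walk_exit_below[OF g.drifted_indep])
      fix i :: nat assume i: "i < 2 ^ n"
      show "(\<integral>\<^sup>+\<omega>. ennreal (exp (\<beta> * (w (grid 0 N n (Suc i)) \<omega> - w (grid 0 N n i) \<omega> - \<beta> * ((N - 0) / 2 ^ n)))) \<partial>M) = 1"
        unfolding g.drifted_increment_mgf[OF i] by (simp add: power2_eq_square)
      have "(\<beta> + s) * s * (N / 2 ^ n) \<le> N * (\<beta> + 1)"
      proof -
        have "(\<beta> + s) * s \<le> (\<beta> + 1) * (s * s)"
        proof -
          have "\<beta> * s * 1 \<le> \<beta> * s * s" using s \<beta> by (intro mult_left_mono) auto
          then show ?thesis by (simp add: algebra_simps)
        qed
        then have "(\<beta> + s) * s * (N / 2 ^ n) \<le> (\<beta> + 1) * (s * s) * (N / 2 ^ n)" using N by (intro mult_right_mono) auto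
        then show ?thesis unfolding s(2) by (simp add: mult.commute)
      qed
      then have "exp (- s * \<epsilon> + (\<beta> + s) * s * ((N - 0) / 2 ^ n)) \<le> \<eta> n" by (simp add: \<eta>_def s_def)
      then show "(\<integral>\<^sup>+\<omega>. ennreal (exp (\<beta> * (w (grid 0 N n (Suc i)) \<omega> - w (grid 0 N n i) \<omega> - \<beta> * ((N - 0) / 2 ^ n)))
          * indicator {\<epsilon><..} (w (grid 0 N n (Suc i)) \<omega> - w (grid 0 N n i) \<omega> - \<beta> * ((N - 0) / 2 ^ n))) \<partial>M) \<le> ennreal (\<eta> n)"
        using s by (intro order_trans[OF g.increment_overshoot[OF i, of s] ennreal_leI]) auto
    qed (use \<beta> \<epsilon> y in \<open>auto simp: \<eta>_def\<close>)
    then show ?thesis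
      unfolding g.sum_drifted_increments using G by (simp add: Dn_def Z_def G_def field_simps)
  qed
  have Dn_sets: "Dn n \<in> sets M" for n
  proof -
    have [measurable]: "Z t \<in> borel_measurable M" for t unfolding Z_def by measurable
    have "Dn n = (\<Union>k\<in>{..2 ^ n}. {\<omega> \<in> space M. Z (grid 0 N n k) \<omega> \<le> B + \<epsilon>} \<inter> (\<Inter>j\<in>{..k}. {\<omega> \<in> space M. Z (grid 0 N n j) \<omega> < y}))"
      by (auto simp: Dn_def)
    then show ?thesis by (auto intro!: sets.finite_UN sets.Int sets.finite_INT)
  qed
  \<comment> \<open>A path is caught by the discretised event only from a level on that depends on
    the path, hence the increasing sets \<open>A m\<close>. Grid times merely approach the hitting
    time of \<open>B\<close>, which is why the walk is tested against
    \<open>B + \<epsilon>\<close>.\<close>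
  define A where "A m = miss y N \<inter> (\<Inter>n\<in>{m..}. Dn n)" for m
  have A_sets: "A m \<in> sets M" for m
    unfolding A_def using miss_sets Dn_sets by (intro sets.Int sets.countable_INT') auto
  have "incseq A" unfolding A_def incseq_def by fastforce
  then have lim: "(\<lambda>m. prob (A m)) \<longlonglongrightarrow> prob (\<Union>m. A m)"
    using A_sets by (intro finite_Lim_measure_incseq) auto
  have cover: "miss y N \<subseteq> (\<Union>m. A m)"
  proof
    fix \<omega> assume m: "\<omega> \<in> miss y N"
    then obtain T where T: "0 < T" "T \<le> N" "\<Xi> \<omega> < ereal T" "run_sup (\<lambda>t. Q2 t \<omega>) 0 T < y" and \<omega>: "\<omega> \<in> space M"
      by (auto simp: miss_def)
    obtain s t where st: "0 \<le> s" "s < t" "t < T" "Q2 s \<omega> = B" using T(3) by (auto simp: Xi0_less_iff)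
    have ZQ: "Z u \<omega> \<le> Q2 u \<omega>" if "0 \<le> u" for u
      using reflected_path.Q_ge_drift[OF path[OF \<omega>] that] w_0[OF \<omega>] by (simp add: Z_def)
    have Zy: "Z u \<omega> < y" if "0 \<le> u" "u \<le> s" for u
    proof -
      have "Q2 u \<omega> \<le> run_sup (\<lambda>t. Q2 t \<omega>) 0 T" using that st by (intro run_sup_ge Icc_cont[OF Q2_cont[OF \<omega>]]) auto
      then show ?thesis using ZQ[OF that(1)] T by simp
    qed
    have sN: "s \<in> {0..N}" using st T by auto
    obtain i where i: "\<And>n. i n \<le> 2 ^ n" "\<And>n. grid 0 N n (i n) \<le> s" "(\<lambda>n. grid 0 N n (i n)) \<longlonglongrightarrow> s"
      using grid_dense[OF less_imp_le[OF N] sN] by blast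
    have "(\<lambda>n. w (grid 0 N n (i n)) \<omega>) \<longlonglongrightarrow> w s \<omega>"
      by (rule continuous_on_tendsto_compose[OF w_cont[OF \<omega>] i(3)]) (use st N in \<open>auto intro!: always_eventually grid_ge\<close>)
    then have "(\<lambda>n. Z (grid 0 N n (i n)) \<omega>) \<longlonglongrightarrow> Z s \<omega>"
      unfolding Z_def by (intro tendsto_intros i(3))
    moreover have "Z s \<omega> < B + \<epsilon>" using ZQ[of s] st \<epsilon> by simp
    ultimately have "eventually (\<lambda>n. Z (grid 0 N n (i n)) \<omega> < B + \<epsilon>) sequentially" by (rule order_tendstoD)
    then obtain m where mm: "\<And>n. m \<le> n \<Longrightarrow> Z (grid 0 N n (i n)) \<omega> < B + \<epsilon>" by (auto simp: eventually_sequentially)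
    have "\<omega> \<in> Dn n" if "m \<le> n" for n
    proof -
      have "Z (grid 0 N n j) \<omega> < y" if "j \<le> i n" for j
        using grid_mono[of 0 N j "i n" n] i(2)[of n] that N by (intro Zy grid_ge) auto
      then show ?thesis unfolding Dn_def using i(1)[of n] mm[OF that] \<omega> by (auto intro!: exI[of _ "i n"])
    qed
    then show "\<omega> \<in> (\<Union>m. A m)" using m by (auto simp: A_def)
  qed
  have "prob (\<Union>m. A m) \<le> (exp (\<beta> * (y + \<epsilon>)) - exp (\<beta> * (2 * B)) + exp (\<beta> * y) * 0) / G"
  proof (rule LIMSEQ_le[OF lim])
    show "(\<lambda>n. (exp (\<beta> * (y + \<epsilon>)) - exp (\<beta> * (2 * B)) + exp (\<beta> * y) * (real (2 ^ n) * \<eta> n)) / G) \<longlonglongrightarrow>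
      (exp (\<beta> * (y + \<epsilon>)) - exp (\<beta> * (2 * B)) + exp (\<beta> * y) * 0) / G"
      unfolding \<eta>_def using G \<epsilon> by (intro tendsto_intros overshoot_tendsto_0) auto
    show "\<exists>n0. \<forall>n\<ge>n0. prob (A n) \<le> (exp (\<beta> * (y + \<epsilon>)) - exp (\<beta> * (2 * B)) + exp (\<beta> * y) * (real (2 ^ n) * \<eta> n)) / G"
    proof (intro exI allI impI)
      fix n
      have "prob (A n) \<le> prob (Dn n)" using Dn_sets by (intro finite_measure_mono) (auto simp: A_def)
      then show "prob (A n) \<le> (exp (\<beta> * (y + \<epsilon>)) - exp (\<beta> * (2 * B)) + exp (\<beta> * y) * (real (2 ^ n) * \<eta> n)) / G"
        using bound[of n] by simp
    qed
  qed
  moreover have "prob (miss y N) \<le> prob (\<Union>m. A m)"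
    using cover A_sets by (intro finite_measure_mono) auto
  ultimately show ?thesis by (simp add: G_def)
qed

text \<open>Gambler's ruin with scale function \<open>exp (\<beta> * z)\<close>: \<kappa> is the
  probability that \<open>2 B + w(t) - \<beta> t\<close> leaves through \<open>B\<close> rather than
  \<open>y\<close>. The limits are taken in \<epsilon> and then in the horizon; the stated bound
  enlarges the denominator of \<open>1 - \<kappa>\<close> to
  \<open>exp (\<beta> * y)\<close>.\<close>

lemma hit_prob_ge:
  assumes y: "2 * B \<le> y"
  shows "(1 - exp (- \<beta> * B)) * exp (- \<beta> * (y - 2 * B)) \<le> prob {\<omega> \<in> space M. hit (\<lambda>t. Q2 t \<omega>) y \<le> \<Xi> \<omega>}"
proof (cases "y = 2 * B")
  case True
  have "hit (\<lambda>t. Q2 t \<omega>) y \<le> \<Xi> \<omega>" if "\<omega> \<in> space M" for \<omega>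
  proof -
    have "hit (\<lambda>t. Q2 t \<omega>) y \<le> ereal 0" unfolding hit_def using Q2_0[OF that] True by (intro Inf_lower) auto
    also have "\<dots> \<le> \<Xi> \<omega>"
    proof -
      have "\<not> \<Xi> \<omega> < ereal 0" unfolding Xi0_less_iff by auto
      then show ?thesis by simp
    qed
    finally show ?thesis .
  qed
  then have "{\<omega> \<in> space M. hit (\<lambda>t. Q2 t \<omega>) y \<le> \<Xi> \<omega>} = space M" by auto
  then show ?thesis using True by (simp add: prob_space)
next
  case False
  then have y: "2 * B < y" using y by simp
  let ?E = "{\<omega> \<in> space M. hit (\<lambda>t. Q2 t \<omega>) y \<le> \<Xi> \<omega>}"
  have mU: "(\<Union>N. miss y (real N)) \<in> sets M" using miss_sets by auto
  have Eq: "?E = space M - (\<Union>N. miss y (real N))" unfolding hit_compl[OF y, symmetric] by auto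
  have E: "?E \<in> sets M" unfolding Eq using mU by auto
  define \<kappa> where "\<kappa> = (exp (\<beta> * y) - exp (\<beta> * (2 * B))) / (exp (\<beta> * y) - exp (\<beta> * B))"
  have le: "prob (miss y (real N)) \<le> \<kappa>" if N: "0 < N" for N
  proof -
    \<comment> \<open>The summand 2 keeps \<open>u n\<close> strictly below \<open>B\<close> also
      for \<open>n = 0\<close>.\<close>
    define u where "u n = B / (real n + 2)" for n :: nat
    have u: "u \<longlonglongrightarrow> 0" unfolding u_def by real_asymp
    have "(\<lambda>n. (exp (\<beta> * (y + u n)) - exp (\<beta> * (2 * B))) / (exp (\<beta> * (y + u n)) - exp (\<beta> * (B + u n))))
      \<longlonglongrightarrow> (exp (\<beta> * (y + 0)) - exp (\<beta> * (2 * B))) / (exp (\<beta> * (y + 0)) - exp (\<beta> * (B + 0)))"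
      using \<beta> B y by (intro tendsto_intros u) auto
    moreover have "prob (miss y (real N)) \<le> (exp (\<beta> * (y + u n)) - exp (\<beta> * (2 * B))) / (exp (\<beta> * (y + u n)) - exp (\<beta> * (B + u n)))" for n
      using B N y by (intro miss_bound) (auto simp: u_def field_simps intro!: add_pos_nonneg)
    ultimately show ?thesis unfolding \<kappa>_def by (intro LIMSEQ_le_const) auto
  qed
  have inc: "incseq (\<lambda>N. miss y (real N))" unfolding incseq_def miss_def by fastforce
  have "(\<lambda>N. prob (miss y (real N))) \<longlonglongrightarrow> prob (\<Union>N. miss y (real N))"
    using miss_sets inc by (intro finite_Lim_measure_incseq) auto
  then have "prob (\<Union>N. miss y (real N)) \<le> \<kappa>"
    by (rule LIMSEQ_le_const2) (use le in \<open>auto intro!: exI[of _ 1]\<close>)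
  then have "1 - \<kappa> \<le> prob ?E" unfolding Eq using mU by (subst prob_compl) auto
  moreover have "(1 - exp (- \<beta> * B)) * exp (- \<beta> * (y - 2 * B)) \<le> 1 - \<kappa>"
  proof -
    have pos: "0 < exp (\<beta> * y) - exp (\<beta> * B)" "0 \<le> exp (\<beta> * (2 * B)) - exp (\<beta> * B)" using \<beta> B y by auto
    have "(1 - exp (- \<beta> * B)) * exp (- \<beta> * (y - 2 * B)) = (exp (\<beta> * (2 * B)) - exp (\<beta> * B)) / exp (\<beta> * y)"
      by (simp add: exp_minus exp_diff exp_add algebra_simps divide_simps)
        (simp add: exp_add[symmetric] algebra_simps)
    also have "\<dots> \<le> (exp (\<beta> * (2 * B)) - exp (\<beta> * B)) / (exp (\<beta> * y) - exp (\<beta> * B))"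
      using pos by (intro divide_left_mono) auto
    also have "\<dots> = 1 - \<kappa>"
    proof -
      have "\<kappa> + (exp (\<beta> * (2 * B)) - exp (\<beta> * B)) / (exp (\<beta> * y) - exp (\<beta> * B)) = 1"
        unfolding \<kappa>_def add_divide_distrib[symmetric] using \<beta> B y by auto
      then show ?thesis by linarith
    qed
    finally show ?thesis .
  qed
  ultimately show ?thesis by linarith
qed

text \<open>By Chernoff with exponent 1, rise and drop over the whole interval each reach 5 with
  probability at most \<open>exp (-5) * exp 3 \<le> 1/4\<close>. Suprema over all times make the
  bound uniform in the level of the grid.\<close>

lemma tube_prob: "1 / 2 \<le> prob {\<omega> \<in> space M. \<forall>k\<le>2 ^ n. \<bar>w (grid 0 (1/2) n k) \<omega> - w 0 \<omega>\<bar> \<le> 5}"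
proof -
  define R where "R \<omega> = rise_sup 0 (1/2) (\<lambda>t. w t \<omega>)" for \<omega>
  define S where "S \<omega> = drop_sup 0 0 (1/2) (\<lambda>t. w t \<omega>)" for \<omega>
  have [measurable]: "R \<in> borel_measurable M" "S \<in> borel_measurable M"
    unfolding R_def S_def by (auto intro!: rise_sup_borel drop_sup_borel)
  have e: "exp (-5::real) * exp 3 \<le> 1/4"
  proof -
    have "exp (-5::real) * exp 3 = inverse (exp 2)" by (simp add: exp_minus[symmetric] exp_add[symmetric])
    also have "\<dots> \<le> inverse 4" using exp_lower_Taylor_quadratic[of "2::real"] by (intro le_imp_inverse_le) auto
    finally show ?thesis by simp
  qed
  have 1: "prob {\<omega> \<in> space M. 5 \<le> R \<omega>} \<le> exp (- 1 * 5) * exp 3"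
  proof (rule chernoff)
    show "(\<integral>\<^sup>+\<omega>. ennreal (exp (1 * R \<omega>)) \<partial>M) \<le> ennreal (exp 3)"
      using exp_rise_le[of 0 "1/2" 1] by (simp add: R_def)
  qed auto
  have 2: "prob {\<omega> \<in> space M. 5 \<le> S \<omega>} \<le> exp (- 1 * 5) * exp 3"
  proof (rule chernoff)
    show "(\<integral>\<^sup>+\<omega>. ennreal (exp (1 * S \<omega>)) \<partial>M) \<le> ennreal (exp 3)"
      using exp_drop_le[of 0 "1/2" 1] by (simp add: S_def)
  qed auto
  let ?A = "{\<omega> \<in> space M. \<forall>k\<le>2 ^ n. \<bar>w (grid 0 (1/2) n k) \<omega> - w 0 \<omega>\<bar> \<le> 5}"
  have A: "?A \<in> sets M"
  proof -
    have "?A = (\<Inter>k\<in>{..2 ^ n}. {\<omega> \<in> space M. \<bar>w (grid 0 (1/2) n k) \<omega> - w 0 \<omega>\<bar> \<le> 5})" by auto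
    then show ?thesis by (auto intro!: sets.finite_INT)
  qed
  have sub: "space M - ?A \<subseteq> {\<omega> \<in> space M. 5 \<le> R \<omega>} \<union> {\<omega> \<in> space M. 5 \<le> S \<omega>}"
  proof
    fix \<omega> assume "\<omega> \<in> space M - ?A"
    then obtain k where \<omega>: "\<omega> \<in> space M" and k: "k \<le> 2 ^ n" "5 < \<bar>w (grid 0 (1/2) n k) \<omega> - w 0 \<omega>\<bar>" by auto
    have c: "continuous_on {0..1/2} (\<lambda>t. w t \<omega>)" using \<omega> by (intro w_cont_Icc) auto
    have "w (grid 0 (1/2) n k) \<omega> - w 0 \<omega> \<le> R \<omega>"
      unfolding R_def rise_sup_def using k
      by (intro run_sup_ge[of _ _ "\<lambda>u. w u \<omega> - w 0 \<omega>"] continuous_intros c grid_in) auto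
    moreover have "w 0 \<omega> - w (grid 0 (1/2) n k) \<omega> - 0 * (grid 0 (1/2) n k - 0) \<le> S \<omega>"
      unfolding S_def drop_sup_def using k
      by (intro run_sup_ge[of _ _ "\<lambda>u. w 0 \<omega> - w u \<omega> - 0 * (u - 0)"] continuous_intros c grid_in) auto
    ultimately show "\<omega> \<in> {\<omega> \<in> space M. 5 \<le> R \<omega>} \<union> {\<omega> \<in> space M. 5 \<le> S \<omega>}" using \<omega> k by auto
  qed
  have "1 - prob ?A = prob (space M - ?A)" using A by (subst prob_compl) auto
  also have "\<dots> \<le> prob ({\<omega> \<in> space M. 5 \<le> R \<omega>} \<union> {\<omega> \<in> space M. 5 \<le> S \<omega>})"
    by (rule finite_measure_mono[OF sub]) measurable
  also have "\<dots> \<le> prob {\<omega> \<in> space M. 5 \<le> R \<omega>} + prob {\<omega> \<in> space M. 5 \<le> S \<omega>}"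
    by (rule measure_Un_le) measurable
  also have "\<dots> \<le> 1/2" using 1 2 e by simp
  finally show ?thesis by simp
qed

text \<open>Time 1/2 balances two demands: it lies before \<open>ln 2\<close>, so the cycle is still
  running, and the slope needed to push \<open>D\<close> beyond \<open>x\<close> costs about
  \<open>0.87 * x\<^sup>2\<close>, less than the permitted \<open>x\<^sup>2\<close>.\<close>

lemma inf_prob_ge:
  assumes x: "0 \<le> x"
  shows "exp (- 10 * (6 * B + 36)\<^sup>2) / 2 * exp (- x\<^sup>2) \<le>
    prob {\<omega> \<in> space M. (INF t \<in> {t. 0 \<le> t \<and> ereal t \<le> \<Xi> \<omega>}. ereal (Q1 t \<omega>)) < ereal (- x)}"
proof -
  interpret g: gaussian_process M w 0 "1/2" by (intro gaussian_process_w) auto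
  \<comment> \<open>\<open>6 * B\<close> and \<open>7 * 5\<close> are the losses in
    \<open>D_ge_of_tube\<close> for a tube of radius 5, and 1 is added for strictness; 100/38 in
    \<open>s\<close> inverts its slope factor.\<close>
  define c where "c = 6 * B + 36"
  define s where "s = (x + c) * (100/38)"
  have c: "0 < c" using B by (simp add: c_def)
  have s: "0 \<le> s" using x c by (simp add: s_def)
  let ?T = "{\<omega> \<in> space M. \<forall>t\<in>{0..1/2}. \<bar>w t \<omega> - w 0 \<omega> + s * (t - 0)\<bar> \<le> 5}"
  have T: "exp (- (s\<^sup>2 * (1/2 - 0) / 4)) * (1/2) \<le> prob ?T"
    by (rule g.tube_lower_bound) (rule tube_prob)
  \<comment> \<open>The room between 0.87 and 1 pays for the cross term of
    \<open>(x + c)\<^sup>2\<close>, split as \<open>x\<^sup>2 / 10 + 10 * c\<^sup>2\<close>.\<close>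
  have s8: "s\<^sup>2 / 8 \<le> x\<^sup>2 + 10 * c\<^sup>2"
  proof -
    have "2 * x * c \<le> x\<^sup>2 / 10 + 10 * c\<^sup>2"
      using zero_le_power2[of "x / sqrt 10 - sqrt 10 * c"] by (simp add: power2_diff power_divide power_mult_distrib)
    then have "(x + c)\<^sup>2 \<le> 11/10 * x\<^sup>2 + 11 * c\<^sup>2" by (simp add: power2_sum)
    moreover have "s\<^sup>2 / 8 = (x + c)\<^sup>2 * (10000 / 11552)"
    proof -
      have "s\<^sup>2 = (x + c)\<^sup>2 * (100/38)\<^sup>2" unfolding s_def by (rule power_mult_distrib)
      then show ?thesis by (simp add: power_divide)
    qed
    ultimately have "s\<^sup>2 / 8 \<le> (11/10 * x\<^sup>2 + 11 * c\<^sup>2) * (10000 / 11552)" by simp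
    also have "\<dots> \<le> x\<^sup>2 + 10 * c\<^sup>2" by simp
    finally show ?thesis .
  qed
  have "exp (- (x\<^sup>2 + 10 * c\<^sup>2)) * (1/2) \<le> exp (- (s\<^sup>2 * (1/2 - 0) / 4)) * (1/2)"
    using s8 by (intro mult_right_mono) auto
  also note T
  also have "prob ?T \<le> prob {\<omega> \<in> space M. (INF t \<in> {t. 0 \<le> t \<and> ereal t \<le> \<Xi> \<omega>}. ereal (Q1 t \<omega>)) < ereal (- x)}"
  proof (rule finite_measure_mono[OF _ inf_event_sets[OF x]], rule subsetI)
    fix \<omega> assume "\<omega> \<in> ?T"
    then have \<omega>: "\<omega> \<in> space M" and T: "\<And>t. 0 \<le> t \<Longrightarrow> t \<le> 1/2 \<Longrightarrow> \<bar>w t \<omega> + s * t\<bar> \<le> 5"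
      using w_0 by auto
    have "38/100 * s - 3 * (2 * B) - 7 * 5 \<le> - Q1 (1/2) \<omega>"
      by (rule reflected_path.D_ge_of_tube[OF path[OF \<omega>] T s])
    then have Q: "Q1 (1/2) \<omega> < - x" by (simp add: s_def c_def field_simps)
    \<comment> \<open>The queue decays no faster than \<open>exp (- r)\<close>, too slowly to fall
      from \<open>2 * B\<close> to \<open>B\<close> before time 1/2.\<close>
    have "\<not> \<Xi> \<omega> < ereal (1/2)"
    proof
      assume "\<Xi> \<omega> < ereal (1/2)"
      then obtain r t where r: "0 \<le> r" "r < t" "t < 1/2" "Q2 r \<omega> = B" by (auto simp: Xi0_less_iff)
      have "2 * B * exp (- r) \<le> Q2 r \<omega>" by (rule reflected_path.Q_ge_exp[OF path[OF \<omega>] r(1)])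
      moreover have "1/2 < exp (- r)" using exp_ge_add_one_self[of "- r"] r by linarith
      then have "2 * B * (1/2) < 2 * B * exp (- r)" using B by (intro mult_strict_left_mono) auto
      ultimately show False using r by simp
    qed
    then have "1/2 \<in> {t. 0 \<le> t \<and> ereal t \<le> \<Xi> \<omega>}" by auto
    then show "\<omega> \<in> {\<omega> \<in> space M. (INF t \<in> {t. 0 \<le> t \<and> ereal t \<le> \<Xi> \<omega>}. ereal (Q1 t \<omega>)) < ereal (- x)}"
      using \<omega> Q by (auto simp: INF_less_iff intro!: exI[of _ "1/2"])
  qed
  finally have F: "exp (- (x\<^sup>2 + 10 * c\<^sup>2)) * (1/2) \<le>
    prob {\<omega> \<in> space M. (INF t \<in> {t. 0 \<le> t \<and> ereal t \<le> \<Xi> \<omega>}. ereal (Q1 t \<omega>)) < ereal (- x)}" .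
  have e: "exp (- (x\<^sup>2 + 10 * c\<^sup>2)) = exp (- 10 * c\<^sup>2) * exp (- x\<^sup>2)"
    unfolding exp_add[symmetric] by simp
  show ?thesis using F[unfolded e] unfolding c_def by simp
qed

end

section \<open>Upper bounds\<close>

text \<open>The bound of \<open>exp_growth_le\<close> at \<theta> = \<beta>/4, the value that
  minimises \<open>- \<theta> * \<beta> / 16 + \<theta>\<^sup>2 / 8\<close>.\<close>

definition rho :: "real \<Rightarrow> real \<Rightarrow> real" where
  "rho \<beta> B = exp (- (\<beta> / 4 * B / 16)) + exp (- (\<beta> / 4 * \<beta> / 16) + (\<beta> / 4)\<^sup>2 / 8)
     * ((1 + (B - \<beta>) / (B - \<beta> - 6 * (\<beta> / 4))) / 2)"

lemma l0_bounds:
  assumes "0 < \<beta>"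
  shows "0 < l0 \<beta>" "\<beta> \<le> l0 \<beta>" "1 \<le> \<beta> * l0 \<beta>" "\<beta>\<^sup>2 \<le> \<beta> * l0 \<beta>" "ln (1 / \<beta>) \<le> \<beta> * l0 \<beta>"
proof -
  show 1: "\<beta> \<le> l0 \<beta>" by (simp add: l0_def)
  then show "0 < l0 \<beta>" using assms by simp
  show "\<beta>\<^sup>2 \<le> \<beta> * l0 \<beta>" using 1 assms by (simp add: power2_eq_square)
  have "1 / \<beta> \<le> l0 \<beta>" by (simp add: l0_def)
  then have "\<beta> * (1 / \<beta>) \<le> \<beta> * l0 \<beta>" using assms by (intro mult_left_mono) auto
  then show "1 \<le> \<beta> * l0 \<beta>" using assms by simp
  have "ln (1 / \<beta>) / \<beta> \<le> l0 \<beta>" by (simp add: l0_def)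
  then have "\<beta> * (ln (1 / \<beta>) / \<beta>) \<le> \<beta> * l0 \<beta>" using assms by (intro mult_left_mono) auto
  then show "ln (1 / \<beta>) \<le> \<beta> * l0 \<beta>" using assms by simp
qed

text \<open>This is where the logarithm in \<open>l0\<close> is needed.\<close>

lemma exp_l0_le:
  assumes \<beta>: "0 < \<beta>" and k: "4 \<le> k"
  shows "exp (- (k * (\<beta> * l0 \<beta>))) \<le> exp (- (k / 2)) * min 1 (\<beta>\<^sup>2)"
proof (cases "1 \<le> \<beta>")
  case True
  have "k / 2 \<le> k * (\<beta> * l0 \<beta>)" using l0_bounds(3)[OF \<beta>] k mult_left_mono[of 1 "\<beta> * l0 \<beta>" k] by linarith
  then show ?thesis using True by (simp add: min_def power2_eq_square) (use True mult_mono[of 1 \<beta> 1 \<beta>] in auto)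
next
  case False
  then have l: "0 \<le> ln (1 / \<beta>)" using \<beta> by simp
  define X where "X = \<beta> * l0 \<beta>"
  \<comment> \<open>Half of the exponent produces \<open>exp (- (k / 2))\<close>; the other half
    yields a power of \<beta> of order at least 2.\<close>
  have "k / 2 * 1 + k / 2 * ln (1 / \<beta>) \<le> k / 2 * X + k / 2 * X"
    unfolding X_def using l0_bounds(3,5)[OF \<beta>] k by (intro add_mono mult_left_mono) auto
  moreover have "2 * ln (1 / \<beta>) \<le> k / 2 * ln (1 / \<beta>)" using l k by (intro mult_right_mono) auto
  ultimately have "exp (- (k * (\<beta> * l0 \<beta>))) \<le> exp (- (k / 2) + - (2 * ln (1 / \<beta>)))"
    unfolding X_def[symmetric] by (simp add: mult.commute)
  also have "\<dots> = exp (- (k / 2)) * \<beta>\<^sup>2"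
  proof -
    have "- (2 * ln (1 / \<beta>)) = ln \<beta> + ln \<beta>" using \<beta> by (simp add: ln_div)
    then have "exp (- (2 * ln (1 / \<beta>))) = exp (ln \<beta>) * exp (ln \<beta>)" by (simp only: exp_add)
    then have "exp (- (2 * ln (1 / \<beta>))) = \<beta>\<^sup>2" using \<beta> by (simp only: exp_ln power2_eq_square)
    then show ?thesis by (simp only: exp_add)
  qed
  also have "\<beta>\<^sup>2 = min 1 (\<beta>\<^sup>2)" using power_le_one[of \<beta> 2] False \<beta> by auto
  finally show ?thesis .
qed

lemma exp_minus_le:
  fixes u :: real assumes "0 \<le> u" "u \<le> 1"
  shows "exp (- u) \<le> 1 - u / 2"
proof -
  have "exp (- u) = inverse (exp u)" by (simp add: exp_minus)
  also have "\<dots> \<le> inverse (1 + u)" using assms exp_ge_add_one_self[of u] by (intro le_imp_inverse_le) auto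
  also have "\<dots> \<le> 1 - u / 2"
  proof -
    have "1 \<le> (1 - u / 2) * (1 + u)" using assms mult_left_mono[of u 1 u] by (simp add: algebra_simps)
    then show ?thesis using assms by (simp add: field_simps)
  qed
  finally show ?thesis .
qed

text \<open>The gap below 1 must be quantified, since its inverse enters the geometric sum. With
  \<open>u = min 1 (\<beta>\<^sup>2)\<close>, the drift together with the error factor gives at most
  \<open>1 - u / 400\<close>, and blocks without zeros add at most \<open>u / 2000\<close>; the two
  leave \<open>u / 500\<close>.\<close>

lemma rho_bounds:
  assumes \<beta>: "0 < \<beta>" and B: "B = 10000 * l0 \<beta>"
  shows "0 \<le> rho \<beta> B" "rho \<beta> B \<le> 1 - min 1 (\<beta>\<^sup>2) / 500" "6 * (\<beta> / 4) < B - \<beta>"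
proof -
  define u where "u = min 1 (\<beta>\<^sup>2)"
  have u: "0 < u" "u \<le> 1" "u \<le> \<beta>\<^sup>2" using \<beta> by (auto simp: u_def)
  have B1: "10000 * \<beta> \<le> B" using l0_bounds(2)[OF \<beta>] by (simp add: B)
  then show gap: "6 * (\<beta> / 4) < B - \<beta>" using \<beta> by simp
  have Bpos: "0 < B" using B1 \<beta> by simp
  show "0 \<le> rho \<beta> B" using gap \<beta> by (auto simp: rho_def intro!: add_nonneg_nonneg mult_nonneg_nonneg divide_nonneg_nonneg)
  have r1: "exp (- (\<beta> / 4 * B / 16)) \<le> u / 2000"
  proof -
    have "exp (- (\<beta> / 4 * B / 16)) = exp (- (10000 / 64 * (\<beta> * l0 \<beta>)))" by (simp add: B)
    also have "\<dots> \<le> exp (- (10000 / 64 / 2)) * u" unfolding u_def using \<beta> by (intro exp_l0_le) auto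
    also have "\<dots> \<le> 1 / 2000 * u"
    proof (intro mult_right_mono)
      have "exp (- (10000 / 64 / 2) :: real) = inverse (exp (10000 / 128))" by (simp add: exp_minus[symmetric])
      also have "\<dots> \<le> inverse 2000"
        using exp_lower_Taylor_quadratic[of "10000 / 128 :: real"]
        by (intro le_imp_inverse_le) (auto simp: power2_eq_square)
      finally show "exp (- (10000 / 64 / 2) :: real) \<le> 1 / 2000" by simp
    qed (use u in auto)
    finally show ?thesis by simp
  qed
  have ratio: "(1 + (B - \<beta>) / (B - \<beta> - 6 * (\<beta> / 4))) / 2 \<le> exp (\<beta>\<^sup>2 / 5000)"
  proof -
    have "\<beta> / (B - \<beta> - 6 * (\<beta> / 4)) \<le> \<beta>\<^sup>2 / 5000"
    proof -
      have "5000 \<le> \<beta> * (B / 2)" using l0_bounds(3)[OF \<beta>] by (simp add: B)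
      also have "\<dots> \<le> \<beta> * (B - \<beta> - 6 * (\<beta> / 4))" using B1 \<beta> by (intro mult_left_mono) auto
      finally have "\<beta> * 5000 \<le> \<beta> * (\<beta> * (B - \<beta> - 6 * (\<beta> / 4)))" using \<beta> by (intro mult_left_mono) auto
      then show ?thesis using gap by (simp add: field_simps power2_eq_square)
    qed
    moreover have "(B - \<beta>) / (B - \<beta> - 6 * (\<beta> / 4)) = 1 + 3 / 2 * (\<beta> / (B - \<beta> - 6 * (\<beta> / 4)))"
      using gap by (simp add: field_simps)
    moreover have "1 + \<beta>\<^sup>2 / 5000 \<le> exp (\<beta>\<^sup>2 / 5000)" by (rule exp_ge_add_one_self)
    moreover have "0 \<le> \<beta> / (B - \<beta> - 6 * (\<beta> / 4))" using gap \<beta> by simp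
    ultimately show ?thesis by argo
  qed
  have "exp (- (\<beta> / 4 * \<beta> / 16) + (\<beta> / 4)\<^sup>2 / 8) * ((1 + (B - \<beta>) / (B - \<beta> - 6 * (\<beta> / 4))) / 2)
      \<le> exp (- (\<beta> / 4 * \<beta> / 16) + (\<beta> / 4)\<^sup>2 / 8) * exp (\<beta>\<^sup>2 / 5000)"
    by (intro mult_left_mono ratio) auto
  also have "\<dots> \<le> exp (- (u / 200))"
    using u(1,3) by (simp add: exp_add[symmetric] power2_eq_square power_divide)
  also have "\<dots> \<le> 1 - u / 200 / 2" using u by (intro exp_minus_le) auto
  finally show "rho \<beta> B \<le> 1 - min 1 (\<beta>\<^sup>2) / 500"
    using r1 u unfolding rho_def u_def[symmetric] by linarith
qed

section \<open>Cycle length and hitting probabilities\<close>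

context reflected_sys
begin

lemma exists_B_of_less:
  assumes \<omega>: "\<omega> \<in> space M" and s: "0 \<le> s" "Q2 s \<omega> \<le> B"
  shows "\<exists>s'\<ge>0. s' \<le> s \<and> Q2 s' \<omega> = B"
  using s Q2_0[OF \<omega>] B by (intro IVT2') (auto intro!: Icc_cont[OF Q2_cont[OF \<omega>]])

text \<open>Either the queue stays above \<open>B\<close> during the first \<open>n\<close> blocks,
  and then the growth bounds cannot sum below \<open>- B\<close>; or it meets \<open>B\<close>, and
  then it may not exceed \<open>2 * B\<close> at the end of any of the next \<open>n\<close> blocks,
  so each increment of \<open>w\<close> is bounded through \<open>D\<close> at the start of its
  block.\<close>

lemma Xi_tail_subset:
  "{\<omega> \<in> space M. \<not> \<Xi> \<omega> < ereal (blk (n + n + 16))} \<subseteq>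
    {\<omega> \<in> space M. - B \<le> (\<Sum>j<n. growth B \<beta> j \<omega>)} \<union>
    {\<omega> \<in> space M. \<forall>k\<in>{n..<n+n}. blk_step k \<omega> \<le> (2 * B + \<beta> / 16) + dom \<beta> k \<omega>}"
proof
  fix \<omega> assume "\<omega> \<in> {\<omega> \<in> space M. \<not> \<Xi> \<omega> < ereal (blk (n + n + 16))}"
  then have \<omega>: "\<omega> \<in> space M" and X: "\<not> \<Xi> \<omega> < ereal (blk (n + n + 16))" by auto
  interpret p: reflected_path "\<lambda>t. w t \<omega>" "\<lambda>t. - Q1 t \<omega>" "\<lambda>t. Q2 t \<omega>" "\<lambda>t. L t \<omega>" \<beta> "2 * B" by (rule path[OF \<omega>])
  show "\<omega> \<in> {\<omega> \<in> space M. - B \<le> (\<Sum>j<n. growth B \<beta> j \<omega>)} \<union>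
    {\<omega> \<in> space M. \<forall>k\<in>{n..<n+n}. blk_step k \<omega> \<le> (2 * B + \<beta> / 16) + dom \<beta> k \<omega>}"
  proof (cases "\<exists>s\<ge>0. s \<le> blk n \<and> Q2 s \<omega> = B")
    case False
    have ge: "B \<le> Q2 s \<omega>" if s: "0 \<le> s" "s \<le> blk n" for s
    proof (rule ccontr)
      assume "\<not> B \<le> Q2 s \<omega>"
      then obtain s' where s': "0 \<le> s'" "s' \<le> s" "Q2 s' \<omega> = B" using exists_B_of_less[OF \<omega> s(1)] by auto
      have "s' \<le> blk n" using s' s by linarith
      then show False using False s' by blast
    qed
    then have "Q2 (blk n) \<omega> \<le> 2 * B + (\<Sum>j<n. growth B \<beta> j \<omega>)"
      by (intro Q_blocks_growth[OF \<omega> path[OF \<omega>]]) auto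
    moreover have "B \<le> Q2 (blk n) \<omega>" by (rule ge) auto
    ultimately show ?thesis using \<omega> by auto
  next
    case True
    then obtain s where s: "0 \<le> s" "s \<le> blk n" "Q2 s \<omega> = B" by blast
    have "blk_step k \<omega> \<le> (2 * B + \<beta> / 16) + dom \<beta> k \<omega>" if k: "k \<in> {n..<n+n}" for k
    proof -
      let ?a = "blk k" and ?e = "blk (Suc k)"
      have "blk n \<le> ?a" using k by (intro blk_mono) auto
      then have se: "s < ?e" using s(2) blk_less[of k] by linarith
      \<comment> \<open>The 16 spare blocks make this inequality strict, as
        \<open>Xi0_less_iff\<close> demands.\<close>
      have eT: "?e < blk (n + n + 16)" using k by (simp add: blk_def)
      have Qe: "Q2 ?e \<omega> \<le> 2 * B"
      proof (rule ccontr)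
        assume *: "\<not> Q2 ?e \<omega> \<le> 2 * B"
        have "\<exists>t\<ge>s. t \<le> ?e \<and> Q2 t \<omega> = 2 * B"
          using * s se B by (intro IVT') (auto intro!: Icc_cont[OF Q2_cont[OF \<omega>]])
        then obtain t where t: "s \<le> t" "t \<le> ?e" "Q2 t \<omega> = 2 * B" by blast
        have "s \<noteq> t" using t s B by auto
        then have "\<Xi> \<omega> < ereal (blk (n + n + 16))" unfolding Xi0_less_iff using s t eT by (intro exI[of _ s] exI[of _ t]) auto
        then show False using X by simp
      qed
      have "(Q2 ?e \<omega> - - Q1 ?e \<omega>) - (Q2 ?a \<omega> - - Q1 ?a \<omega>) = w ?e \<omega> - w ?a \<omega> - \<beta> * (?e - ?a) + integral {?a..?e} (\<lambda>t. - Q1 t \<omega>)"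
        by (rule p.S_diff) auto
      moreover have "0 \<le> integral {?a..?e} (\<lambda>t. - Q1 t \<omega>)" by (rule p.integral_D_nonneg) simp
      moreover have "0 \<le> - Q1 ?e \<omega>" "0 \<le> Q2 ?a \<omega>" using p.D_nonneg p.Q_nonneg by auto
      moreover have "- Q1 ?a \<omega> \<le> dom \<beta> k \<omega>" by (rule D_le_dom[OF \<omega> path[OF \<omega>]])
      moreover have "blk_step k \<omega> = w ?e \<omega> - w ?a \<omega>" by (simp add: blk_data_def)
      moreover have "\<beta> * (?e - ?a) = \<beta> / 16" by (simp add: blk_Suc)
      ultimately show ?thesis using Qe by linarith
    qed
    then show ?thesis using \<omega> by auto
  qed
qed

lemma growth_meas': "growth B \<beta> j \<in> borel_measurable M"
  by (rule measurable_blk_alg[OF growth_meas])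

lemma max_growth_meas': "max_growth B \<beta> j \<in> borel_measurable M"
  by (rule measurable_blk_alg[OF max_growth_meas])

lemma growth_rho:
  assumes "6 * (\<beta> / 4) < B - \<beta>"
  shows "(\<integral>\<^sup>+\<omega>. ennreal (exp (\<beta> / 4 * growth B \<beta> j \<omega>)) \<partial>M) \<le> ennreal (rho \<beta> B)"
  unfolding rho_def using \<beta> assms by (intro exp_growth_le) auto

lemma Xi_tail:
  assumes \<rho>: "6 * (\<beta> / 4) < B - \<beta>" "0 \<le> rho \<beta> B"
    and C: "prob {\<omega> \<in> space M. \<forall>k\<in>{n..<n+n}. blk_step k \<omega> \<le> (2 * B + \<beta> / 16) + dom \<beta> k \<omega>} \<le> C * r ^ n"
  shows "prob {\<omega> \<in> space M. \<not> \<Xi> \<omega> < ereal (blk (n + n + 16))} \<le> exp (\<beta> / 4 * B) * rho \<beta> B ^ n + C * r ^ n"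
proof -
  let ?S1 = "{\<omega> \<in> space M. - B \<le> (\<Sum>j<n. growth B \<beta> j \<omega>)}"
  let ?S2 = "{\<omega> \<in> space M. \<forall>k\<in>{n..<n+n}. blk_step k \<omega> \<le> (2 * B + \<beta> / 16) + dom \<beta> k \<omega>}"
  have gm: "(\<lambda>\<omega>. \<Sum>j<n. growth B \<beta> j \<omega>) \<in> borel_measurable M" by (intro borel_measurable_sum growth_meas')
  have s1: "?S1 \<in> sets M" using gm by measurable
  have "Measurable.pred M (\<lambda>\<omega>. \<forall>k\<in>{n..<n+n}. blk_step k \<omega> \<le> (2 * B + \<beta> / 16) + dom \<beta> k \<omega>)"
    by (intro pred_intros_finite) measurable
  then have s2: "?S2 \<in> sets M" by (simp add: pred_def)
  have "prob ?S1 \<le> exp (- (\<beta> / 4) * (- B)) * rho \<beta> B ^ n"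
  proof (rule chernoff[OF gm])
    show "(\<integral>\<^sup>+\<omega>. ennreal (exp (\<beta> / 4 * (\<Sum>j<n. growth B \<beta> j \<omega>))) \<partial>M) \<le> ennreal (rho \<beta> B ^ n)"
      using \<rho> by (intro exp_sum_growth_le growth_rho)
  qed (use \<beta> \<rho> in auto)
  moreover have "prob {\<omega> \<in> space M. \<not> \<Xi> \<omega> < ereal (blk (n + n + 16))} \<le> prob (?S1 \<union> ?S2)"
    by (rule finite_measure_mono[OF Xi_tail_subset]) (use s1 s2 in auto)
  moreover have "prob (?S1 \<union> ?S2) \<le> prob ?S1 + prob ?S2" by (rule measure_Un_le[OF s1 s2])
  ultimately show ?thesis using C by simp
qed

text \<open>At the first passage to \<open>y\<close> the cycle has not ended. Had the queue been
  below \<open>B\<close> earlier, it would have crossed \<open>B\<close> and then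
  \<open>2 * B\<close> on its way up and ended the cycle. So \<open>y\<close> is reached while the
  growth bounds are valid.\<close>

lemma hit_le_Xi_queue:
  assumes \<omega>: "\<omega> \<in> space M" and y: "2 * B < y"
    and h: "hit (\<lambda>t. Q2 t \<omega>) y \<le> \<Xi> \<omega>" "\<Xi> \<omega> < ereal T"
  shows "\<exists>\<tau>\<ge>0. \<tau> < T \<and> Q2 \<tau> \<omega> = y \<and> (\<forall>s. 0 \<le> s \<and> s \<le> \<tau> \<longrightarrow> B \<le> Q2 s \<omega>)"
proof -
  have "hit (\<lambda>t. Q2 t \<omega>) y < ereal T" using h by (rule le_less_trans)
  then obtain t where t: "0 \<le> t" "t < T" "Q2 t \<omega> = y" unfolding hit_def Inf_ereal_less_iff by blast
  let ?Z = "{s \<in> {0..t}. Q2 s \<omega> = y}"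
  have "closed ?Z"
    by (intro continuous_closed_preimage_constant Icc_cont[OF Q2_cont[OF \<omega>]]) auto
  then have "compact ?Z" by (auto simp: compact_eq_bounded_closed intro: bounded_subset[of "{0..t}"])
  moreover have "?Z \<noteq> {}" using t by auto
  ultimately obtain \<tau> where \<tau>: "\<tau> \<in> ?Z" "\<And>s. s \<in> ?Z \<Longrightarrow> \<tau> \<le> s"
    using compact_attains_inf[of ?Z] by blast
  have "ereal \<tau> \<le> hit (\<lambda>t. Q2 t \<omega>) y"
    unfolding hit_def
  proof (rule Inf_greatest)
    fix x assume "x \<in> {ereal t |t. 0 \<le> t \<and> Q2 t \<omega> = y}"
    then obtain s where s: "x = ereal s" "0 \<le> s" "Q2 s \<omega> = y" by auto
    show "ereal \<tau> \<le> x"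
    proof (cases "s \<le> t")
      case True then show ?thesis using \<tau>(2)[of s] s by auto
    next
      case False then show ?thesis using \<tau>(1) s by auto
    qed
  qed
  then have \<tau>X: "\<not> \<Xi> \<omega> < ereal \<tau>" using h(1) by (simp add: not_less)
  have "B \<le> Q2 s \<omega>" if s: "0 \<le> s" "s \<le> \<tau>" for s
  proof (rule ccontr)
    assume "\<not> B \<le> Q2 s \<omega>"
    then obtain s' where s': "0 \<le> s'" "s' \<le> s" "Q2 s' \<omega> = B" using exists_B_of_less[OF \<omega> s(1)] by force
    have "\<exists>u\<ge>s'. u \<le> \<tau> \<and> Q2 u \<omega> = 2 * B"
      using s s' \<tau> y B by (intro IVT') (auto intro!: Icc_cont[OF Q2_cont[OF \<omega>]])
    then obtain u where u: "s' \<le> u" "u \<le> \<tau>" "Q2 u \<omega> = 2 * B" by blast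
    have "u \<noteq> s'" "u \<noteq> \<tau>" using u s' B \<tau> y by auto
    then have "\<Xi> \<omega> < ereal \<tau>" unfolding Xi0_less_iff using s' u by (intro exI[of _ s'] exI[of _ u]) auto
    then show False using \<tau>X by simp
  qed
  moreover have "0 \<le> \<tau>" "\<tau> < T" "Q2 \<tau> \<omega> = y" using \<tau>(1) t(2) by auto
  ultimately show ?thesis by blast
qed

lemma blk_locate:
  assumes "0 \<le> t" "t < blk m"
  obtains k where "k < m" "blk k \<le> t" "t \<le> blk (Suc k)"
proof
  define k where "k = nat \<lfloor>16 * t\<rfloor>"
  have k: "real k \<le> 16 * t" "16 * t < real k + 1" unfolding k_def using assms by auto
  show "blk k \<le> t" "t \<le> blk (Suc k)" using k by (auto simp: blk_def)
  have "16 * t < real m" using assms by (simp add: blk_def)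
  then show "k < m" using k(1) by linarith
qed

text \<open>A union bound over the block in which \<open>y\<close> is first reached gives a
  geometric series in \<open>rho \<beta> B\<close>. The horizon is needed because
  \<open>hit \<le> \<Xi>\<close> also holds when both are infinite; letting it grow eliminates
  \<open>C\<close> and \<open>r\<close>, the constants of the return phase.\<close>

lemma hit_prob_le:
  assumes \<rho>: "6 * (\<beta> / 4) < B - \<beta>" "0 \<le> rho \<beta> B" "rho \<beta> B < 1"
    and y: "2 * B < y"
    and C: "\<And>n. prob {\<omega> \<in> space M. \<forall>k\<in>{n..<n+n}. blk_step k \<omega> \<le> (2 * B + \<beta> / 16) + dom \<beta> k \<omega>} \<le> C * r ^ n"
    and r: "0 \<le> r" "r < 1"
  shows "prob {\<omega> \<in> space M. hit (\<lambda>t. Q2 t \<omega>) y \<le> \<Xi> \<omega>}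
    \<le> exp (- (\<beta> / 4) * (y - 2 * B)) * (2 * exp (2 * (\<beta> / 4)\<^sup>2 + 6 * (\<beta> / 4))) / (1 - rho \<beta> B)"
proof -
  let ?E = "{\<omega> \<in> space M. hit (\<lambda>t. Q2 t \<omega>) y \<le> \<Xi> \<omega>}"
  define A where "A k = {\<omega> \<in> space M. y - 2 * B \<le> (\<Sum>j<k. growth B \<beta> j \<omega>) + max_growth B \<beta> k \<omega>}" for k
  define K where "K = exp (- (\<beta> / 4) * (y - 2 * B)) * (2 * exp (2 * (\<beta> / 4)\<^sup>2 + 6 * (\<beta> / 4)))"
  have am: "(\<lambda>\<omega>. (\<Sum>j<k. growth B \<beta> j \<omega>) + max_growth B \<beta> k \<omega>) \<in> borel_measurable M" for k
    by (intro borel_measurable_add borel_measurable_sum growth_meas' max_growth_meas')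
  have A_sets: "A k \<in> sets M" for k unfolding A_def using am[of k] by measurable
  have A_prob: "prob (A k) \<le> K * rho \<beta> B ^ k" for k
  proof -
    have "prob (A k) \<le> exp (- (\<beta> / 4) * (y - 2 * B)) * (rho \<beta> B ^ k * (2 * exp (2 * (\<beta> / 4)\<^sup>2 + 6 * (\<beta> / 4))))"
      unfolding A_def
    proof (rule chernoff[OF am])
      show "(\<integral>\<^sup>+\<omega>. ennreal (exp (\<beta> / 4 * ((\<Sum>j<k. growth B \<beta> j \<omega>) + max_growth B \<beta> k \<omega>))) \<partial>M)
        \<le> ennreal (rho \<beta> B ^ k * (2 * exp (2 * (\<beta> / 4)\<^sup>2 + 6 * (\<beta> / 4))))"
        using \<beta> \<rho> by (intro exp_sum_growth_max_le exp_max_growth_le growth_rho) auto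
    qed (use \<beta> \<rho> in auto)
    then show ?thesis by (simp add: K_def mult_ac)
  qed
  have Xs: "{\<omega> \<in> space M. \<not> \<Xi> \<omega> < ereal T} \<in> sets M" for T
    using sets.compl_sets[OF Xi_less_sets[of T]] by (simp add: set_diff_eq Collect_conj_eq[symmetric] cong: conj_cong)
  have sub: "?E \<subseteq> {\<omega> \<in> space M. \<not> \<Xi> \<omega> < ereal (blk (n + n + 16))} \<union> (\<Union>k<n + n + 16. A k)" for n
  proof
    fix \<omega> assume "\<omega> \<in> ?E"
    then have \<omega>: "\<omega> \<in> space M" and h: "hit (\<lambda>t. Q2 t \<omega>) y \<le> \<Xi> \<omega>" by auto
    show "\<omega> \<in> {\<omega> \<in> space M. \<not> \<Xi> \<omega> < ereal (blk (n + n + 16))} \<union> (\<Union>k<n + n + 16. A k)"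
    proof (cases "\<Xi> \<omega> < ereal (blk (n + n + 16))")
      case True
      obtain \<tau> where \<tau>: "0 \<le> \<tau>" "\<tau> < blk (n + n + 16)" "Q2 \<tau> \<omega> = y" "\<And>s. 0 \<le> s \<Longrightarrow> s \<le> \<tau> \<Longrightarrow> B \<le> Q2 s \<omega>"
        using hit_le_Xi_queue[OF \<omega> y h True] by blast
      obtain k where k: "k < n + n + 16" "blk k \<le> \<tau>" "\<tau> \<le> blk (Suc k)" using blk_locate[OF \<tau>(1,2)] by blast
      have "Q2 \<tau> \<omega> \<le> Q2 (blk k) \<omega> + max_growth B \<beta> k \<omega>"
        using k B by (intro Q_block_max_growth[OF \<omega> path[OF \<omega>]] \<tau>(4)) (auto intro: order_trans[OF blk_nonneg])
      moreover have "Q2 (blk k) \<omega> \<le> 2 * B + (\<Sum>j<k. growth B \<beta> j \<omega>)"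
        using k by (intro Q_blocks_growth[OF \<omega> path[OF \<omega>]] \<tau>(4)) auto
      ultimately have "\<omega> \<in> A k" using \<omega> \<tau>(3) by (simp add: A_def)
      then show ?thesis using k by auto
    qed (use \<omega> in auto)
  qed
  have fin: "prob ?E \<le> exp (\<beta> / 4 * B) * rho \<beta> B ^ n + C * r ^ n + K / (1 - rho \<beta> B)" for n
  proof -
    have "prob ?E \<le> prob ({\<omega> \<in> space M. \<not> \<Xi> \<omega> < ereal (blk (n + n + 16))} \<union> (\<Union>k<n + n + 16. A k))"
      by (rule finite_measure_mono[OF sub]) (use Xs A_sets in auto)
    also have "\<dots> \<le> prob {\<omega> \<in> space M. \<not> \<Xi> \<omega> < ereal (blk (n + n + 16))} + prob (\<Union>k<n + n + 16. A k)"
      by (rule measure_Un_le) (use Xs A_sets in auto)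
    also have "prob (\<Union>k<n + n + 16. A k) \<le> (\<Sum>k<n + n + 16. prob (A k))"
      by (rule measure_UNION_le) (use A_sets in auto)
    also have "\<dots> \<le> (\<Sum>k<n + n + 16. K * rho \<beta> B ^ k)" by (intro sum_mono A_prob)
    also have "\<dots> = K * (\<Sum>k<n + n + 16. rho \<beta> B ^ k)" by (simp add: sum_distrib_left)
    also have "\<dots> \<le> K * (1 / (1 - rho \<beta> B))"
    proof (intro mult_left_mono)
      have "(\<Sum>k<n + n + 16. rho \<beta> B ^ k) \<le> (\<Sum>k. rho \<beta> B ^ k)"
        using \<rho> by (intro sum_le_suminf summable_geometric) auto
      then show "(\<Sum>k<n + n + 16. rho \<beta> B ^ k) \<le> 1 / (1 - rho \<beta> B)"
        using \<rho> by (simp add: suminf_geometric)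
    qed (simp add: K_def)
    also have "prob {\<omega> \<in> space M. \<not> \<Xi> \<omega> < ereal (blk (n + n + 16))} \<le> exp (\<beta> / 4 * B) * rho \<beta> B ^ n + C * r ^ n"
      by (rule Xi_tail[OF \<rho>(1,2) C])
    finally show ?thesis by simp
  qed
  have "(\<lambda>n. exp (\<beta> / 4 * B) * rho \<beta> B ^ n + C * r ^ n + K / (1 - rho \<beta> B)) \<longlonglongrightarrow> exp (\<beta> / 4 * B) * 0 + C * 0 + K / (1 - rho \<beta> B)"
    using \<rho> r by (intro tendsto_intros LIMSEQ_power_zero) auto
  then have "prob ?E \<le> exp (\<beta> / 4 * B) * 0 + C * 0 + K / (1 - rho \<beta> B)"
    by (rule LIMSEQ_le_const) (use fin in auto)
  then show ?thesis by (simp add: K_def)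
qed

lemma hit_Q1_prob_le:
  assumes \<rho>: "6 * (\<beta> / 4) < B - \<beta>" "0 \<le> rho \<beta> B"
    and x: "0 < x"
    and C: "prob {\<omega> \<in> space M. \<forall>k\<in>{n..<n+n}. blk_step k \<omega> \<le> (2 * B + \<beta> / 16) + dom \<beta> k \<omega>} \<le> C * r ^ n"
  shows "measure M {\<omega> \<in> space M. hit (\<lambda>t. Q1 t \<omega>) (- x) \<le> \<Xi> \<omega>}
    \<le> exp (\<beta> / 4 * B) * rho \<beta> B ^ n + C * r ^ n + real (n + n + 16) * exp (- (3/20) * x\<^sup>2 + 9/2 * (\<beta> + 3) * x)"
proof (cases "{\<omega> \<in> space M. hit (\<lambda>t. Q1 t \<omega>) (- x) \<le> \<Xi> \<omega>} \<in> sets M")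
  \<comment> \<open>A nonmeasurable event has \<open>measure\<close> 0 by convention, so only
    nonnegativity of the right-hand side is at stake.\<close>
  case False
  have "0 \<le> exp (\<beta> / 4 * B) * rho \<beta> B ^ n + C * r ^ n"
    using order_trans[OF measure_nonneg C] \<rho> by simp
  then show ?thesis using False by (simp add: measure_notin_sets)
next
  case True
  let ?E = "{\<omega> \<in> space M. hit (\<lambda>t. Q1 t \<omega>) (- x) \<le> \<Xi> \<omega>}"
  define A where "A k = {\<omega> \<in> space M. x \<le> dom \<beta> k \<omega> + \<beta> + blk_osc k \<omega>}" for k
  have A_sets: "A k \<in> sets M" for k unfolding A_def by measurable
  have A_prob: "prob (A k) \<le> exp (- (3/20) * x\<^sup>2 + 9/2 * (\<beta> + 3) * x)" for k
  proof -
    \<comment> \<open>With \<mu> = x/4 the quadratic terms are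
      \<open>- 1/4 + (8/5) / 16 = - 3/20\<close>, better than the required -1/8.\<close>
    have "prob (A k) \<le> exp (- (x / 4) * x) * exp (18 * (\<beta> + 3) * (x / 4) + 8/5 * (x / 4)\<^sup>2)"
      unfolding A_def using \<beta> x by (intro dom_osc_tail) auto
    also have "\<dots> = exp (- (3/20) * x\<^sup>2 + 9/2 * (\<beta> + 3) * x)"
      by (simp add: exp_add[symmetric] power2_eq_square algebra_simps)
    finally show ?thesis .
  qed
  have Xs: "{\<omega> \<in> space M. \<not> \<Xi> \<omega> < ereal T} \<in> sets M" for T
    using sets.compl_sets[OF Xi_less_sets[of T]] by (simp add: set_diff_eq Collect_conj_eq[symmetric] cong: conj_cong)
  have sub: "?E \<subseteq> {\<omega> \<in> space M. \<not> \<Xi> \<omega> < ereal (blk (n + n + 16))} \<union> (\<Union>k<n + n + 16. A k)"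
  proof
    fix \<omega> assume "\<omega> \<in> ?E"
    then have \<omega>: "\<omega> \<in> space M" and h: "hit (\<lambda>t. Q1 t \<omega>) (- x) \<le> \<Xi> \<omega>" by auto
    show "\<omega> \<in> {\<omega> \<in> space M. \<not> \<Xi> \<omega> < ereal (blk (n + n + 16))} \<union> (\<Union>k<n + n + 16. A k)"
    proof (cases "\<Xi> \<omega> < ereal (blk (n + n + 16))")
      case True
      have "hit (\<lambda>t. Q1 t \<omega>) (- x) < ereal (blk (n + n + 16))" using h True by (rule le_less_trans)
      then obtain t where t: "0 \<le> t" "t < blk (n + n + 16)" "Q1 t \<omega> = - x" unfolding hit_def Inf_ereal_less_iff by blast
      obtain k where k: "k < n + n + 16" "blk k \<le> t" "t \<le> blk (Suc k)" using blk_locate[OF t(1,2)] by blast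
      have "- Q1 t \<omega> \<le> dom \<beta> k \<omega> + \<beta> + blk_osc k \<omega>" by (rule D_le_dom_osc[OF \<omega> path[OF \<omega>] k(2,3)])
      then have "\<omega> \<in> A k" using \<omega> t by (simp add: A_def)
      then show ?thesis using k by auto
    qed (use \<omega> in auto)
  qed
  have "prob ?E \<le> prob ({\<omega> \<in> space M. \<not> \<Xi> \<omega> < ereal (blk (n + n + 16))} \<union> (\<Union>k<n + n + 16. A k))"
    by (rule finite_measure_mono[OF sub]) (use Xs A_sets in auto)
  also have "\<dots> \<le> prob {\<omega> \<in> space M. \<not> \<Xi> \<omega> < ereal (blk (n + n + 16))} + prob (\<Union>k<n + n + 16. A k)"
    by (rule measure_Un_le) (use Xs A_sets in auto)
  also have "prob (\<Union>k<n + n + 16. A k) \<le> (\<Sum>k<n + n + 16. prob (A k))"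
    by (rule measure_UNION_le) (use A_sets in auto)
  also have "\<dots> \<le> (\<Sum>k<n + n + 16. exp (- (3/20) * x\<^sup>2 + 9/2 * (\<beta> + 3) * x))" by (intro sum_mono A_prob)
  also have "\<dots> = real (n + n + 16) * exp (- (3/20) * x\<^sup>2 + 9/2 * (\<beta> + 3) * x)" by simp
  also have "prob {\<omega> \<in> space M. \<not> \<Xi> \<omega> < ereal (blk (n + n + 16))} \<le> exp (\<beta> / 4 * B) * rho \<beta> B ^ n + C * r ^ n"
    by (rule Xi_tail[OF \<rho>(1,2) C])
  finally show ?thesis by simp
qed

end

section \<open>Arithmetic of the constants\<close>

lemma queue_constant_bound:
  assumes \<beta>: "0 < \<beta>" and B: "B = 10000 * l0 \<beta>" and y: "4 * B \<le> y"
  shows "exp (- (\<beta> / 4) * (y - 2 * B)) * (2 * exp (2 * (\<beta> / 4)\<^sup>2 + 6 * (\<beta> / 4))) / (1 - rho \<beta> B)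
    \<le> 1000 * exp (- (1/8) * \<beta> * (y - \<beta>) / 2)"
proof -
  define u where "u = min 1 (\<beta>\<^sup>2)"
  have u: "0 < u" using \<beta> by (simp add: u_def)
  have gap: "u / 500 \<le> 1 - rho \<beta> B" using rho_bounds(2)[OF \<beta> B] by (simp add: u_def)
  define l where "l = \<beta> * l0 \<beta>"
  have l: "1 \<le> l" "\<beta>\<^sup>2 \<le> l" using l0_bounds[OF \<beta>] by (auto simp: l_def)
  have \<beta>l: "\<beta> \<le> 2 * l"
  proof -
    have "2 * \<beta> \<le> 1 + \<beta>\<^sup>2" using zero_le_power2[of "\<beta> - 1"] by (simp add: power2_diff)
    then show ?thesis using l by linarith
  qed
  have "\<beta> * (4 * B) \<le> \<beta> * y" using y \<beta> by (intro mult_left_mono) auto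
  then have yl: "40000 * l \<le> \<beta> * y" by (simp add: B l_def mult_ac)
  have "exp (- (\<beta> / 4) * (y - 2 * B)) * (2 * exp (2 * (\<beta> / 4)\<^sup>2 + 6 * (\<beta> / 4))) / (1 - rho \<beta> B)
    \<le> exp (- (\<beta> / 4) * (y - 2 * B)) * (2 * exp (2 * (\<beta> / 4)\<^sup>2 + 6 * (\<beta> / 4))) / (u / 500)"
    using gap u by (intro divide_left_mono) auto
  also have "\<dots> = 1000 * exp (- (\<beta> / 4) * (y - 2 * B) + (2 * (\<beta> / 4)\<^sup>2 + 6 * (\<beta> / 4))) / u"
    by (simp only: exp_add) simp
  \<comment> \<open>As \<open>\<beta> * y \<ge> 40000 * l\<close>, the part
    \<open>3/16 * \<beta> * y\<close> of the exponent that the claim does not use covers the term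
    from \<open>2 * B\<close>, all terms in \<beta> and a surplus \<open>1000 * l\<close>. The
    surplus then absorbs \<open>1 / u\<close>, leaving constants free of \<beta>.\<close>
  also have "\<dots> \<le> 1000 * exp (- (1/8) * \<beta> * (y - \<beta>) / 2 - 1000 * l) / u"
  proof -
    have "\<beta> * B = 10000 * l" by (simp add: B l_def)
    then have "- (\<beta> / 4) * (y - 2 * B) + (2 * (\<beta> / 4)\<^sup>2 + 6 * (\<beta> / 4)) \<le> - (1/8) * \<beta> * (y - \<beta>) / 2 - 1000 * l"
      using yl l \<beta>l by (simp add: power2_eq_square algebra_simps diff_divide_distrib)
    then show ?thesis using u by (intro divide_right_mono mult_left_mono) auto
  qed
  also have "\<dots> = 1000 * exp (- (1/8) * \<beta> * (y - \<beta>) / 2) * (exp (- (1000 * l)) / u)"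
    by (simp only: exp_diff exp_minus divide_inverse mult.assoc)
  also have "\<dots> \<le> 1000 * exp (- (1/8) * \<beta> * (y - \<beta>) / 2) * 1"
  proof (intro mult_left_mono)
    have "exp (- (1000 * l)) \<le> exp (- (1000 / 2)) * u"
      unfolding l_def u_def using \<beta> by (intro exp_l0_le) auto
    also have "\<dots> \<le> 1 * u" using u by (intro mult_right_mono) auto
    finally show "exp (- (1000 * l)) / u \<le> 1" using u by simp
  qed auto
  finally show ?thesis by simp
qed

text \<open>Here \<open>n\<close> is of order \<open>x\<^sup>2\<close>: long enough for the geometric term, short enough for the polynomial factor.\<close>

lemma gaussian_balance:
  fixes c r A :: real
  assumes r: "0 < r" "r < 1" and A: "0 \<le> A" and c: "0 \<le> c"
  shows "\<exists>C>0. \<forall>x>0. \<exists>n. A * r ^ n + real (n + n + 16) * exp (- (3/20) * x\<^sup>2 + c * x) \<le> C * exp (- x\<^sup>2 / 8)"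
proof -
  \<comment> \<open>Chosen so that \<open>r ^ n\<close> is at most
    \<open>exp (- x\<^sup>2 / 8)\<close> as soon as \<open>n \<ge> K * x\<^sup>2\<close>.\<close>
  define K where "K = 1 / (8 * ln (1 / r))"
  have lr: "0 < ln (1 / r)" using r by simp
  have K: "0 < K" using lr by (simp add: K_def)
  define C where "C = A + (2 * K + 18) * 80 * exp (20 * c\<^sup>2)"
  have "0 < (2 * K + 18) * 80 * exp (20 * c\<^sup>2)" using K by simp
  then have C: "0 < C" using A by (simp add: C_def)
  have "\<exists>n. A * r ^ n + real (n + n + 16) * exp (- (3/20) * x\<^sup>2 + c * x) \<le> C * exp (- x\<^sup>2 / 8)" if x: "0 < x" for x
  proof -
    define n where "n = nat \<lceil>K * x\<^sup>2\<rceil>"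
    have n: "K * x\<^sup>2 \<le> real n" "real n \<le> K * x\<^sup>2 + 1"
      unfolding n_def using K by (auto intro: real_nat_ceiling_ge)
    have "r ^ n = exp (- (ln (1 / r) * real n))"
      using r exp_of_nat_mult[of n "ln r"] by (simp add: ln_div mult.commute)
    also have "\<dots> \<le> exp (- (ln (1 / r) * (K * x\<^sup>2)))"
      using n lr by simp
    also have "ln (1 / r) * (K * x\<^sup>2) = x\<^sup>2 / 8" using lr by (simp add: K_def)
    finally have 1: "A * r ^ n \<le> A * exp (- x\<^sup>2 / 8)" using A by (intro mult_left_mono) auto
    have "real (n + n + 16) \<le> 2 * K * x\<^sup>2 + 18" using n by simp
    also have "\<dots> \<le> (2 * K + 18) * (1 + x\<^sup>2)" using K by (simp add: algebra_simps)
    \<comment> \<open>The polynomial factor costs \<open>x\<^sup>2 / 80\<close> in the exponent and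
      the linear term \<open>c * x\<close> another \<open>x\<^sup>2 / 80\<close>;
      \<open>- 3/20 + 2/80\<close> is exactly -1/8.\<close>
    also have "1 + x\<^sup>2 \<le> 80 * (1 + x\<^sup>2 / 80)" by simp
    also have "1 + x\<^sup>2 / 80 \<le> exp (x\<^sup>2 / 80)" by (rule exp_ge_add_one_self)
    finally have "real (n + n + 16) \<le> (2 * K + 18) * (80 * exp (x\<^sup>2 / 80))" using K by simp
    then have "real (n + n + 16) * exp (- (3/20) * x\<^sup>2 + c * x) \<le> (2 * K + 18) * (80 * exp (x\<^sup>2 / 80)) * exp (- (3/20) * x\<^sup>2 + c * x)"
      by (intro mult_right_mono) auto
    also have "\<dots> = (2 * K + 18) * 80 * exp (x\<^sup>2 / 80 + (- (3/20) * x\<^sup>2 + c * x))"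
      by (simp only: exp_add mult.assoc)
    also have "\<dots> \<le> (2 * K + 18) * 80 * exp (20 * c\<^sup>2 + - x\<^sup>2 / 8)"
    proof -
      have "0 \<le> (x - 40 * c)\<^sup>2" by simp
      then have "80 * (c * x) \<le> x\<^sup>2 + 1600 * c\<^sup>2" by (simp add: power2_diff power_mult_distrib mult_ac)
      then have "x\<^sup>2 / 80 + (- (3/20) * x\<^sup>2 + c * x) \<le> 20 * c\<^sup>2 + - x\<^sup>2 / 8" by simp
      then show ?thesis using K by (intro mult_left_mono) auto
    qed
    also have "\<dots> = (2 * K + 18) * 80 * exp (20 * c\<^sup>2) * exp (- x\<^sup>2 / 8)" by (simp only: exp_add mult.assoc)
    finally show ?thesis using 1 by (intro exI[of _ n]) (simp add: C_def distrib_right)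
  qed
  then show ?thesis using C by blast
qed

text \<open>Expanding the square leaves the term \<open>\<beta> * x / 2\<close>, which is
  nonnegative; the remaining \<open>\<beta>\<^sup>2 / 2\<close> goes into the constant, which may
  depend on \<beta>.\<close>

lemma shift_gaussian:
  fixes x \<beta> :: real assumes "0 \<le> \<beta>" "0 \<le> x"
  shows "exp (- x\<^sup>2 / 8) \<le> exp (\<beta>\<^sup>2 / 2) * exp (- (x - 2 * \<beta>)\<^sup>2 / 8)"
proof -
  have "- x\<^sup>2 / 8 \<le> \<beta>\<^sup>2 / 2 + - (x - 2 * \<beta>)\<^sup>2 / 8"
    using mult_nonneg_nonneg[OF assms] by (simp add: power2_diff power_mult_distrib field_simps)
  then show ?thesis unfolding exp_add[symmetric] by simp
qed

theorem theorem3p4: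
  shows "\<exists>R0 > 0. \<exists>C1 > 0. \<exists>C2 > 0. \<forall>\<beta> > 0.
    (let B = R0 * l0 \<beta> in
      (\<forall>(M :: 'a measure) W Q1 Q2 L.
         std_BM M W \<and> reflected_system M W \<beta> 0 (2 * B) Q1 Q2 L \<longrightarrow>
           (\<forall>y \<ge> 4 * B.
              measure M {\<omega> \<in> space M. hit (\<lambda>t. Q2 t \<omega>) y \<le> Xi0 (\<lambda>t. Q2 t \<omega>) B}
                \<le> C1 * exp (- C2 * \<beta> * (y - \<beta>) / 2))
         \<and> (\<forall>y \<ge> 2 * B.
              measure M {\<omega> \<in> space M. hit (\<lambda>t. Q2 t \<omega>) y \<le> Xi0 (\<lambda>t. Q2 t \<omega>) B}
                \<ge> (1 - exp (- \<beta> * R0 * l0 \<beta>)) * exp (- \<beta> * (y - 2 * R0 * l0 \<beta>))))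
    \<and> (\<exists>Cs > 0. \<forall>(M :: 'a measure) W Q1 Q2 L.
         std_BM M W \<and> reflected_system M W \<beta> 0 (2 * B) Q1 Q2 L \<longrightarrow>
           (\<forall>x \<ge> 18 * B.
              measure M {\<omega> \<in> space M. hit (\<lambda>t. Q1 t \<omega>) (- x) \<le> Xi0 (\<lambda>t. Q2 t \<omega>) B}
                \<le> Cs * exp (- (x - 2 * \<beta>)\<^sup>2 / 8)))
    \<and> (\<exists>Css > 0. \<forall>(M :: 'a measure) W Q1 Q2 L.
         std_BM M W \<and> reflected_system M W \<beta> 0 (2 * B) Q1 Q2 L \<longrightarrow>
           (\<forall>x \<ge> \<beta>.
              measure M {\<omega> \<in> space M.
                 (INF t \<in> {t. 0 \<le> t \<and> ereal t \<le> Xi0 (\<lambda>t. Q2 t \<omega>) B}. ereal (Q1 t \<omega>))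
                   < ereal (- x)}
                \<ge> Css * exp (- x\<^sup>2))))"
\<comment> \<open>The witnesses are those of \<open>rho_bounds\<close> and
  \<open>queue_constant_bound\<close>: 10000 for the level, 1000 and 1/8 for the two constants of
  (i).\<close>
proof (rule exI[of _ 10000], intro conjI, simp, rule exI[of _ 1000], intro conjI, simp,
    rule exI[of _ "1/8"], intro conjI, simp, intro allI impI)
  fix \<beta> :: real assume \<beta>: "0 < \<beta>"
  define B where "B = 10000 * l0 \<beta>"
  have Bpos: "0 < B" using l0_bounds(1)[OF \<beta>] by (simp add: B_def)
  note rb = rho_bounds[OF \<beta> B_def]
  have rho1: "rho \<beta> B < 1" using rb(2) \<beta> by (smt (verit) divide_pos_pos min_less_iff_conj zero_less_power)
  obtain C r where C: "0 < C" "0 < r" "r < 1" and fail: "\<And>(M :: 'a measure) W n. std_BM M W \<Longrightarrow>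
    measure M {\<omega> \<in> space M. \<forall>k\<in>{n..<n+n}. brownian.blk_step W k \<omega> \<le> (2 * B + \<beta> / 16) + brownian.dom W \<beta> k \<omega>} \<le> C * r ^ n"
    using all_blocks_fail_exponential[OF \<beta>, where ?'a = 'a, of "2 * B + \<beta> / 16"] by blast
  \<comment> \<open>A common rate for the descent and the return, so that
    \<open>gaussian_balance\<close> can choose one \<open>n\<close> for both tails.\<close>
  define r' where "r' = max r (rho \<beta> B)"
  have r': "0 < r'" "r' < 1" "r \<le> r'" "rho \<beta> B \<le> r'" using C rho1 by (auto simp: r'_def)
  define A where "A = exp (\<beta> / 4 * B) + C"
  have A: "0 \<le> A" using C by (simp add: A_def)
  have c: "0 \<le> 9/2 * (\<beta> + 3)" using \<beta> by simp
  obtain Cg where Cg: "0 < Cg" and bal: "\<And>x. 0 < x \<Longrightarrow> \<exists>n. A * r' ^ n + real (n + n + 16) * exp (- (3/20) * x\<^sup>2 + 9/2 * (\<beta> + 3) * x) \<le> Cg * exp (- x\<^sup>2 / 8)"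
    using gaussian_balance[OF r'(1,2) A c] by blast
  have i_ii: "(\<forall>y \<ge> 4 * B.
        measure M {\<omega> \<in> space M. hit (\<lambda>t. Q2 t \<omega>) y \<le> Xi0 (\<lambda>t. Q2 t \<omega>) B} \<le> 1000 * exp (- (1/8) * \<beta> * (y - \<beta>) / 2))
      \<and> (\<forall>y \<ge> 2 * B.
        measure M {\<omega> \<in> space M. hit (\<lambda>t. Q2 t \<omega>) y \<le> Xi0 (\<lambda>t. Q2 t \<omega>) B}
          \<ge> (1 - exp (- \<beta> * 10000 * l0 \<beta>)) * exp (- \<beta> * (y - 2 * 10000 * l0 \<beta>)))"
    if "std_BM M W" "reflected_system M W \<beta> 0 (2 * B) Q1 Q2 L" for M :: "'a measure" and W Q1 Q2 L
  proof -
    interpret reflected_sys M W \<beta> B Q1 Q2 L using that \<beta> Bpos by unfold_locales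
    show ?thesis
    proof (intro conjI allI impI)
      fix y assume y: "4 * B \<le> y"
      then have "2 * B < y" using Bpos by simp
      from hit_prob_le[OF rb(3,1) rho1 this fail[OF that(1)] _ C(3)] C(2) queue_constant_bound[OF \<beta> B_def y]
      show "prob {\<omega> \<in> space M. hit (\<lambda>t. Q2 t \<omega>) y \<le> \<Xi> \<omega>} \<le> 1000 * exp (- (1/8) * \<beta> * (y - \<beta>) / 2)" by simp
    next
      fix y assume y: "2 * B \<le> y"
      show "(1 - exp (- \<beta> * 10000 * l0 \<beta>)) * exp (- \<beta> * (y - 2 * 10000 * l0 \<beta>)) \<le> prob {\<omega> \<in> space M. hit (\<lambda>t. Q2 t \<omega>) y \<le> \<Xi> \<omega>}"
        using hit_prob_ge[OF y] by (simp add: B_def mult.assoc)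
    qed
  qed
  have iii: "measure M {\<omega> \<in> space M. hit (\<lambda>t. Q1 t \<omega>) (- x) \<le> Xi0 (\<lambda>t. Q2 t \<omega>) B} \<le> Cg * exp (\<beta>\<^sup>2 / 2) * exp (- (x - 2 * \<beta>)\<^sup>2 / 8)"
    if "std_BM M W" "reflected_system M W \<beta> 0 (2 * B) Q1 Q2 L" "18 * B \<le> x" for M :: "'a measure" and W Q1 Q2 L x
  proof -
    interpret reflected_sys M W \<beta> B Q1 Q2 L using that \<beta> Bpos by unfold_locales
    have x: "0 < x" using that(3) Bpos by simp
    obtain n where n: "A * r' ^ n + real (n + n + 16) * exp (- (3/20) * x\<^sup>2 + 9/2 * (\<beta> + 3) * x) \<le> Cg * exp (- x\<^sup>2 / 8)"
      using bal[OF x] by blast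
    have "exp (\<beta> / 4 * B) * rho \<beta> B ^ n + C * r ^ n \<le> exp (\<beta> / 4 * B) * r' ^ n + C * r' ^ n"
      using r' C rb(1) by (intro add_mono mult_left_mono power_mono) auto
    also have "\<dots> = A * r' ^ n" by (simp add: A_def distrib_right)
    finally have "measure M {\<omega> \<in> space M. hit (\<lambda>t. Q1 t \<omega>) (- x) \<le> \<Xi> \<omega>} \<le> Cg * exp (- x\<^sup>2 / 8)"
      using hit_Q1_prob_le[OF rb(3,1) x fail[OF that(1), of n]] n by linarith
    also have "\<dots> \<le> Cg * (exp (\<beta>\<^sup>2 / 2) * exp (- (x - 2 * \<beta>)\<^sup>2 / 8))"
      using \<beta> x Cg by (intro mult_left_mono shift_gaussian) auto
    finally show ?thesis by (simp only: mult.assoc)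
  qed
  have iv: "exp (- 10 * (6 * B + 36)\<^sup>2) / 2 * exp (- x\<^sup>2) \<le> measure M {\<omega> \<in> space M.
       (INF t \<in> {t. 0 \<le> t \<and> ereal t \<le> Xi0 (\<lambda>t. Q2 t \<omega>) B}. ereal (Q1 t \<omega>)) < ereal (- x)}"
    if "std_BM M W" "reflected_system M W \<beta> 0 (2 * B) Q1 Q2 L" "\<beta> \<le> x" for M :: "'a measure" and W Q1 Q2 L x
  proof -
    interpret reflected_sys M W \<beta> B Q1 Q2 L using that \<beta> Bpos by unfold_locales
    show ?thesis using that(3) \<beta> by (intro inf_prob_ge) auto
  qed
  show "let B = 10000 * l0 \<beta> in
      (\<forall>(M :: 'a measure) W Q1 Q2 L.
         std_BM M W \<and> reflected_system M W \<beta> 0 (2 * B) Q1 Q2 L \<longrightarrow>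
           (\<forall>y \<ge> 4 * B.
              measure M {\<omega> \<in> space M. hit (\<lambda>t. Q2 t \<omega>) y \<le> Xi0 (\<lambda>t. Q2 t \<omega>) B}
                \<le> 1000 * exp (- (1/8) * \<beta> * (y - \<beta>) / 2))
         \<and> (\<forall>y \<ge> 2 * B.
              measure M {\<omega> \<in> space M. hit (\<lambda>t. Q2 t \<omega>) y \<le> Xi0 (\<lambda>t. Q2 t \<omega>) B}
                \<ge> (1 - exp (- \<beta> * 10000 * l0 \<beta>)) * exp (- \<beta> * (y - 2 * 10000 * l0 \<beta>))))
    \<and> (\<exists>Cs > 0. \<forall>(M :: 'a measure) W Q1 Q2 L.
         std_BM M W \<and> reflected_system M W \<beta> 0 (2 * B) Q1 Q2 L \<longrightarrow>
           (\<forall>x \<ge> 18 * B.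
              measure M {\<omega> \<in> space M. hit (\<lambda>t. Q1 t \<omega>) (- x) \<le> Xi0 (\<lambda>t. Q2 t \<omega>) B}
                \<le> Cs * exp (- (x - 2 * \<beta>)\<^sup>2 / 8)))
    \<and> (\<exists>Css > 0. \<forall>(M :: 'a measure) W Q1 Q2 L.
         std_BM M W \<and> reflected_system M W \<beta> 0 (2 * B) Q1 Q2 L \<longrightarrow>
           (\<forall>x \<ge> \<beta>.
              measure M {\<omega> \<in> space M.
                 (INF t \<in> {t. 0 \<le> t \<and> ereal t \<le> Xi0 (\<lambda>t. Q2 t \<omega>) B}. ereal (Q1 t \<omega>))
                   < ereal (- x)}
                \<ge> Css * exp (- x\<^sup>2)))"
    unfolding Let_def B_def[symmetric]
  proof (intro conjI[OF _ conjI])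
    show "\<exists>Cs>0. \<forall>(M :: 'a measure) W Q1 Q2 L.
         std_BM M W \<and> reflected_system M W \<beta> 0 (2 * B) Q1 Q2 L \<longrightarrow>
           (\<forall>x \<ge> 18 * B.
              measure M {\<omega> \<in> space M. hit (\<lambda>t. Q1 t \<omega>) (- x) \<le> Xi0 (\<lambda>t. Q2 t \<omega>) B}
                \<le> Cs * exp (- (x - 2 * \<beta>)\<^sup>2 / 8))"
      using Cg iii by (intro exI[of _ "Cg * exp (\<beta>\<^sup>2 / 2)"]) auto
    show "\<exists>Css > 0. \<forall>(M :: 'a measure) W Q1 Q2 L.
         std_BM M W \<and> reflected_system M W \<beta> 0 (2 * B) Q1 Q2 L \<longrightarrow>
           (\<forall>x \<ge> \<beta>.
              measure M {\<omega> \<in> space M.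
                 (INF t \<in> {t. 0 \<le> t \<and> ereal t \<le> Xi0 (\<lambda>t. Q2 t \<omega>) B}. ereal (Q1 t \<omega>))
                   < ereal (- x)}
                \<ge> Css * exp (- x\<^sup>2))"
      using iv by (intro exI[of _ "exp (- 10 * (6 * B + 36)\<^sup>2) / 2"]) auto
  qed (use i_ii in blast)
qed

end
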